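(* Let $K_1, K_2$ be fibered knots in closed, oriented $3$-manifolds $Y_1, Y_2$, with Seifert surfaces (fibers) $F_1, F_2$ and monodromies $\varphi_1, \varphi_2$. Let $W_i = S^1 \times E_{Y_i}(K_i)$ for $i=1,2$ (so each $\partial W_i$ is a $3$-torus), and let $f:\partial W_2 \to \partial W_1$ be a diffeomorphism. Then $X_f = W_1 \cup_f W_2$ fibers over the circle.
   Context: All manifolds and maps are smooth. For a knot $K$ in a closed, connected, oriented $3$-manifold $Y$, $E_Y(K) = Y \setminus \mathring{\nu}K$ denotes the exterior of $K$, where $\mathring{\nu}K$ is the interior of a closed tubular neighborhood of $K$. The knot $K$ is fibered if $E_Y(K)$ admits a smooth fibration over $S^1$ whose fiber is a Seifert surface $F$ for $K$ (a compact, connected, oriented surface with a single boundary component, a longitude of $K$ on $\partial E_Y(K)$); the monodromy is a diffeomorphism $\varphi$ of $F$ with $E_Y(K)$ the mapping torus of $\varphi$. A closed manifold "fibers over the circle" if it is the total space of a smooth fiber bundle over $S^1$. *)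

theory Defs
  imports "HOL-Analysis.Analysis"
begin

primrec Ck_on :: "nat \<Rightarrow> 'a::real_normed_vector set \<Rightarrow> ('a \<Rightarrow> 'b::real_normed_vector) \<Rightarrow> bool" where
  "Ck_on 0 U f \<longleftrightarrow> continuous_on U f"
| "Ck_on (Suc k) U f \<longleftrightarrow>
     (\<forall>x\<in>U. f differentiable (at x)) \<and> (\<forall>v. Ck_on k U (\<lambda>x. frechet_derivative f (at x) v))"

text \<open>Smoothness on an arbitrary subset of a vector space means that the function extends
  locally to a \<open>C\<^sup>\<infinity>\<close> function on an open set; this is the usual convention for half-spaces.\<close>

definition smooth_on :: "'a::real_normed_vector set \<Rightarrow> ('a \<Rightarrow> 'b::real_normed_vector) \<Rightarrow> bool" where
  "smooth_on S f \<longleftrightarrow>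
     (\<forall>x\<in>S. \<exists>U g. open U \<and> x \<in> U \<and> (\<forall>k. Ck_on k U g) \<and> (\<forall>y\<in>S \<inter> U. g y = f y))"


section \<open>Smooth manifolds with boundary\<close>

text \<open>A manifold consists of an abstract topological space and an atlas, not necessarily maximal.
  A chart is a pair of its domain and its coordinate map; the values of the coordinate map outside
  the domain are irrelevant. The dimension of the manifold is that of the model space \<open>'e\<close>.\<close>

record ('a, 'e) mfd =
  mtop :: "'a topology"
  atlas :: "('a set \<times> ('a \<Rightarrow> 'e)) set"

abbreviation pts :: "('a, 'e) mfd \<Rightarrow> 'a set" where
  "pts M \<equiv> topspace (mtop M)"

text \<open>For \<open>b = 0\<close> this is the whole space, so that one notion of chart covers interior and
  boundary charts.\<close>

definition half_space :: "'e::euclidean_space \<Rightarrow> 'e set" where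
  "half_space b = {x. 0 \<le> x \<bullet> b}"

definition chart_image :: "'e::euclidean_space set \<Rightarrow> bool" where
  "chart_image S \<longleftrightarrow> (\<exists>b. openin (top_of_set (half_space b)) S)"

definition smooth_mfd :: "('a, 'e::euclidean_space) mfd \<Rightarrow> bool" where
  "smooth_mfd M \<longleftrightarrow>
     Hausdorff_space (mtop M) \<and> second_countable (mtop M) \<and>
     (\<Union>(U, \<phi>)\<in>atlas M. U) = pts M \<and>
     (\<forall>(U, \<phi>)\<in>atlas M. openin (mtop M) U \<and> chart_image (\<phi> ` U) \<and>
        homeomorphic_map (subtopology (mtop M) U) (top_of_set (\<phi> ` U)) \<phi>) \<and>
     (\<forall>(U, \<phi>)\<in>atlas M. \<forall>(V, \<psi>)\<in>atlas M.
        smooth_on (\<phi> ` (U \<inter> V)) (\<psi> \<circ> inv_into U \<phi>))"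

text \<open>A point is on the boundary iff a chart sends it to the bounding hyperplane, i.e. iff it is not
  sent to an interior point of the image of the chart.\<close>

definition bd :: "('a, 'e::euclidean_space) mfd \<Rightarrow> 'a set" where
  "bd M = {x \<in> pts M. \<exists>(U, \<phi>)\<in>atlas M. x \<in> U \<and> \<phi> x \<notin> interior (\<phi> ` U)}"

definition closed_mfd :: "('a, 'e::euclidean_space) mfd \<Rightarrow> bool" where
  "closed_mfd M \<longleftrightarrow> smooth_mfd M \<and> compact_space (mtop M) \<and> bd M = {}"


section \<open>Smooth maps\<close>

text \<open>Smooth maps are defined on arbitrary subsets of manifolds, again in the sense of local smooth
  extension. On an embedded submanifold, e.g. on the boundary, this agrees with smoothness for
  the induced structure.\<close>

definition smooth_map_on ::
  "('a, 'e::euclidean_space) mfd \<Rightarrow> 'a set \<Rightarrow> ('b, 'd::euclidean_space) mfd \<Rightarrow> ('a \<Rightarrow> 'b) \<Rightarrow> bool" where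
  "smooth_map_on M A N f \<longleftrightarrow>
     A \<subseteq> pts M \<and> continuous_map (subtopology (mtop M) A) (mtop N) f \<and>
     (\<forall>(U, \<phi>)\<in>atlas M. \<forall>(V, \<psi>)\<in>atlas N.
        smooth_on (\<phi> ` {x \<in> A \<inter> U. f x \<in> V}) (\<psi> \<circ> f \<circ> inv_into U \<phi>))"

abbreviation smooth_map :: "('a, 'e::euclidean_space) mfd \<Rightarrow> ('b, 'd::euclidean_space) mfd \<Rightarrow> ('a \<Rightarrow> 'b) \<Rightarrow> bool" where
  "smooth_map M N f \<equiv> smooth_map_on M (pts M) N f"

definition diffeo_on ::
  "('a, 'e::euclidean_space) mfd \<Rightarrow> 'a set \<Rightarrow> ('b, 'd::euclidean_space) mfd \<Rightarrow> 'b set \<Rightarrow> ('a \<Rightarrow> 'b) \<Rightarrow> bool" where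
  "diffeo_on M A N B f \<longleftrightarrow>
     bij_betw f A B \<and> smooth_map_on M A N f \<and> smooth_map_on N B M (inv_into A f)"

definition smooth_embedding ::
  "('a, 'e::euclidean_space) mfd \<Rightarrow> ('b, 'd::euclidean_space) mfd \<Rightarrow> ('a \<Rightarrow> 'b) \<Rightarrow> bool" where
  "smooth_embedding M N f \<longleftrightarrow> diffeo_on M (pts M) N (f ` pts M) f"

definition local_diffeo ::
  "('a, 'e::euclidean_space) mfd \<Rightarrow> ('b, 'd::euclidean_space) mfd \<Rightarrow> ('a \<Rightarrow> 'b) \<Rightarrow> bool" where
  "local_diffeo M N f \<longleftrightarrow>
     (\<forall>x\<in>pts M. \<exists>U. openin (mtop M) U \<and> x \<in> U \<and> openin (mtop N) (f ` U) \<and>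
        diffeo_on M U N (f ` U) f)"


section \<open>Constructions\<close>

definition euclid :: "('e, 'e::euclidean_space) mfd" where
  "euclid = \<lparr>mtop = euclidean, atlas = {(UNIV, id)}\<rparr>"

text \<open>The product is a manifold with boundary only if one of the factors has empty boundary.\<close>

definition prod_mfd ::
  "('a, 'e::euclidean_space) mfd \<Rightarrow> ('b, 'd::euclidean_space) mfd \<Rightarrow> ('a \<times> 'b, 'e \<times> 'd) mfd" where
  "prod_mfd M N =
     \<lparr>mtop = prod_topology (mtop M) (mtop N),
      atlas = {(U \<times> V, map_prod \<phi> \<psi>) | U \<phi> V \<psi>. (U, \<phi>) \<in> atlas M \<and> (V, \<psi>) \<in> atlas N}\<rparr>"

text \<open>The subset \<open>S\<close> of \<open>M\<close> with the subspace topology and all charts, with values in the model space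
  \<open>'d\<close>, that are diffeomorphisms for the smooth structure inherited from \<open>M\<close>. The set \<open>S\<close> is a
  submanifold (with boundary) of dimension \<open>DIM('d)\<close> iff the result is a \<^const>\<open>smooth_mfd\<close>.\<close>

definition submfd :: "('a, 'e::euclidean_space) mfd \<Rightarrow> 'a set \<Rightarrow> ('a, 'd::euclidean_space) mfd" where
  "submfd M S =
     \<lparr>mtop = subtopology (mtop M) S,
      atlas = {(U, \<phi>). openin (subtopology (mtop M) S) U \<and> chart_image (\<phi> ` U) \<and>
                       diffeo_on M U (euclid :: ('d, 'd) mfd) (\<phi> ` U) \<phi>}\<rparr>"

definition circle :: "(complex, real) mfd" where
  "circle = submfd (euclid :: (complex, complex) mfd) (sphere 0 1)"

definition maximal_atlas :: "('a, 'e::euclidean_space) mfd \<Rightarrow> ('a set \<times> ('a \<Rightarrow> 'e)) set" where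
  "maximal_atlas M = atlas (submfd M (pts M) :: ('a, 'e) mfd)"

text \<open>An orientation is given by a covering set of charts whose transition maps have positive
  Jacobian determinant. The derivative is taken within the domain of the transition map, because
  the latter need not be open in the model space at boundary points.\<close>

definition orientation :: "('a, real^'n) mfd \<Rightarrow> ('a set \<times> ('a \<Rightarrow> real^'n)) set \<Rightarrow> bool" where
  "orientation M Or \<longleftrightarrow>
     Or \<subseteq> maximal_atlas M \<and> (\<Union>(U, \<phi>)\<in>Or. U) = pts M \<and>
     (\<forall>(U, \<phi>)\<in>Or. \<forall>(V, \<psi>)\<in>Or. \<forall>x\<in>U \<inter> V.
        \<exists>D. (\<psi> \<circ> inv_into U \<phi> has_derivative D) (at (\<phi> x) within \<phi> ` (U \<inter> V)) \<and>
            det (matrix D) > 0)"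

definition orientable :: "('a, real^'n) mfd \<Rightarrow> bool" where
  "orientable M \<longleftrightarrow> (\<exists>Or. orientation M Or)"

text \<open>\<open>X\<close> is \<open>M \<union>\<^sub>f N\<close> for \<open>f : \<partial>N \<rightarrow> \<partial>M\<close>: as a topological space it is the quotient of the disjoint
  union of \<open>M\<close> and \<open>N\<close> by \<open>y \<sim> f y\<close>, and its smooth structure restricts to the given ones on \<open>M\<close> and
  \<open>N\<close>. It is well known that such a structure exists and is unique up to diffeomorphism.\<close>

definition boundary_gluing ::
  "('a, 'e::euclidean_space) mfd \<Rightarrow> ('b, 'd::euclidean_space) mfd \<Rightarrow> ('b \<Rightarrow> 'a) \<Rightarrow>
   ('x, 'c::euclidean_space) mfd \<Rightarrow> ('a \<Rightarrow> 'x) \<Rightarrow> ('b \<Rightarrow> 'x) \<Rightarrow> bool" where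
  "boundary_gluing M N f X i j \<longleftrightarrow>
     smooth_mfd X \<and> bd X = {} \<and> smooth_embedding M X i \<and> smooth_embedding N X j \<and>
     pts X = i ` pts M \<union> j ` pts N \<and>
     (\<forall>x\<in>pts M. \<forall>y\<in>pts N. i x = j y \<longleftrightarrow> y \<in> bd N \<and> x = f y) \<and>
     (\<forall>U\<subseteq>pts X. openin (mtop X) U \<longleftrightarrow>
        openin (mtop M) {x \<in> pts M. i x \<in> U} \<and> openin (mtop N) {y \<in> pts N. j y \<in> U})"


section \<open>Fiber bundles\<close>

definition smooth_fiber_bundle ::
  "('a, 'e::euclidean_space) mfd \<Rightarrow> ('b, 'd::euclidean_space) mfd \<Rightarrow> ('f, 'c::euclidean_space) mfd \<Rightarrow>
   ('a \<Rightarrow> 'b) \<Rightarrow> bool" where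
  "smooth_fiber_bundle E B F p \<longleftrightarrow>
     smooth_mfd F \<and> smooth_map E B p \<and> p ` pts E = pts B \<and>
     (\<forall>b\<in>pts B. \<exists>U \<Psi>. openin (mtop B) U \<and> b \<in> U \<and>
        diffeo_on E {x \<in> pts E. p x \<in> U} (prod_mfd B F) (U \<times> pts F) \<Psi> \<and>
        (\<forall>x\<in>pts E. p x \<in> U \<longrightarrow> fst (\<Psi> x) = p x))"

text \<open>Since a fiber can be identified with a subset of the total space, it is no restriction to take
  its points from the type \<open>'a\<close>.\<close>

definition fibers_over_circle :: "('a, real^4) mfd \<Rightarrow> bool" where
  "fibers_over_circle X \<longleftrightarrow> (\<exists>p (F :: ('a, real^3) mfd). smooth_fiber_bundle X circle F p)"

text \<open>The mapping torus of \<open>\<phi>\<close> is the quotient of \<open>F \<times> \<real>\<close> by the \<open>\<int>\<close>-action generated by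
  \<open>(x, s + 1) \<mapsto> (\<phi> x, s)\<close>, with the smooth structure making the quotient map \<open>q\<close> a local
  diffeomorphism. Here \<open>E\<close> is identified with it in such a way that \<open>p\<close> becomes the projection to
  \<open>\<real>/\<int> = S\<^sup>1\<close> and \<open>F\<close>, a subset of \<open>E\<close>, is included as \<open>F \<times> {0}\<close>.\<close>

definition monodromy ::
  "('a, real^3) mfd \<Rightarrow> ('a \<Rightarrow> complex) \<Rightarrow> ('a, real^2) mfd \<Rightarrow> ('a \<Rightarrow> 'a) \<Rightarrow> bool" where
  "monodromy E p F \<phi> \<longleftrightarrow>
     diffeo_on F (pts F) F (pts F) \<phi> \<and>
     (\<exists>q. q ` (pts F \<times> UNIV) = pts E \<and>
        local_diffeo (prod_mfd F (euclid :: (real, real) mfd)) E q \<and>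
        (\<forall>x\<in>pts F. \<forall>y\<in>pts F. \<forall>s t. q (x, s) = q (y, t) \<longleftrightarrow>
           (\<exists>n. s = t + real n \<and> y = (\<phi> ^^ n) x \<or> t = s + real n \<and> x = (\<phi> ^^ n) y)) \<and>
        (\<forall>x\<in>pts F. q (x, 0) = x) \<and>
        (\<forall>x\<in>pts F. \<forall>s. p (q (x, s)) = cis (2 * pi * s)))"


section \<open>Knots\<close>

definition knot :: "('a, real^3) mfd \<Rightarrow> 'a set \<Rightarrow> bool" where
  "knot Y K \<longleftrightarrow> (\<exists>k. smooth_embedding circle Y k \<and> k ` sphere 0 1 = K)"

text \<open>In an oriented 3-manifold the normal disk bundle of a knot is trivial, so a closed tubular
  neighborhood is an embedded copy of \<open>S\<^sup>1 \<times> D\<^sup>2\<close>.\<close>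

definition closed_tubular_nbhd :: "('a, real^3) mfd \<Rightarrow> 'a set \<Rightarrow> 'a set \<Rightarrow> bool" where
  "closed_tubular_nbhd Y K N \<longleftrightarrow>
     (\<exists>t. diffeo_on (euclid :: (complex \<times> complex, complex \<times> complex) mfd)
            (sphere 0 1 \<times> cball 0 1) Y N t \<and>
          t ` (sphere 0 1 \<times> {0}) = K)"

definition exterior :: "('a, real^3) mfd \<Rightarrow> 'a set \<Rightarrow> ('a, real^3) mfd" where
  "exterior Y N = submfd Y (pts Y - mtop Y interior_of N)"

text \<open>A longitude is a simple closed curve on the boundary of the exterior that is homotopic to the
  knot, with one of its two directions, inside the tubular neighborhood.\<close>

definition longitude :: "('a, real^3) mfd \<Rightarrow> 'a set \<Rightarrow> 'a set \<Rightarrow> 'a set \<Rightarrow> bool" where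
  "longitude Y K N C \<longleftrightarrow>
     C \<subseteq> bd (exterior Y N) \<and>
     (\<exists>l k. smooth_embedding circle Y l \<and> l ` sphere 0 1 = C \<and>
            smooth_embedding circle Y k \<and> k ` sphere 0 1 = K \<and>
            homotopic_with (\<lambda>_. True) (mtop circle) (subtopology (mtop Y) N) l k)"

text \<open>Fixes the model space of the submanifold structure to be two-dimensional.\<close>

definition surface_in :: "('a, real^3) mfd \<Rightarrow> 'a set \<Rightarrow> ('a, real^2) mfd" where
  "surface_in E F = submfd E F"

definition seifert_surface :: "('a, real^3) mfd \<Rightarrow> 'a set \<Rightarrow> 'a set \<Rightarrow> 'a set \<Rightarrow> bool" where
  "seifert_surface Y K N F \<longleftrightarrow>
     F \<subseteq> pts (exterior Y N) \<and>
     (let S = surface_in (exterior Y N) F in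
        smooth_mfd S \<and> compact_space (mtop S) \<and> connected_space (mtop S) \<and> orientable S \<and>
        longitude Y K N (bd S))"

definition fibered_knot ::
  "('a, real^3) mfd \<Rightarrow> 'a set \<Rightarrow> 'a set \<Rightarrow> 'a set \<Rightarrow> ('a \<Rightarrow> 'a) \<Rightarrow> bool" where
  "fibered_knot Y K N F \<phi> \<longleftrightarrow>
     knot Y K \<and> closed_tubular_nbhd Y K N \<and> seifert_surface Y K N F \<and>
     (\<exists>p. smooth_fiber_bundle (exterior Y N) circle (surface_in (exterior Y N) F) p \<and>
          F = {x \<in> pts (exterior Y N). p x = 1} \<and>
          monodromy (exterior Y N) p (surface_in (exterior Y N) F) \<phi>)"

end

theory Submission
  imports Defs "HOL-Complex_Analysis.Complex_Analysis"
begin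

text \<open>On each piece \<open>W\<^sub>i = S\<^sup>1 \<times> E\<^sub>i\<close> the projection \<open>z\<^sub>i\<close> and the fibration \<open>p\<^sub>i\<close> of the knot exterior are
  circle-valued, and \<open>z\<^sub>i\<^sup>a p\<^sub>i\<^sup>b\<close> is a submersion, also on the boundary, unless \<open>a = b = 0\<close>. The boundary
  being a 3-torus, the four maps \<open>z\<^sub>1 \<circ> f\<close>, \<open>p\<^sub>1 \<circ> f\<close>, \<open>z\<^sub>2\<close>, \<open>p\<^sub>2\<close> on it are dependent in its first cohomology,
  which has rank 3. Hence some \<open>z\<^sub>1\<^sup>a p\<^sub>1\<^sup>b \<circ> f\<close> and \<open>z\<^sub>2\<^sup>c p\<^sub>2\<^sup>d\<close> agree up to a null-homotopic factor; neither
  exponent pair vanishes, since a submersion of a compact manifold to the circle is not null-homotopic.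
  Absorbing the factor in a collar gives a continuous map \<open>X \<rightarrow> S\<^sup>1\<close>, smooth away from the torus. After
  smoothing it there and multiplying it with \<open>cis\<close> of a large multiple of a step function across the
  torus it is a submersion, hence a fiber bundle by Ehresmann's theorem. For the latter, a lift of
  the rotation of the circle is composed of diffeomorphisms supported in single charts, so that
  no differential equation has to be solved.\<close>

section \<open>Smooth maps between open subsets of vector spaces\<close>

text \<open>The obstacle is the neighbourhood of the torus. The maps on the two sides are smooth
  only up to it, the factor between them is merely continuous, and smoothing the combined map
  destroys all control of its derivative there. The step function repairs this: its differential is
  a multiple of that of a function \<open>R\<close> cutting out the torus, so a large coefficient
  makes it dominate wherever the smoothing took place. Where the step levels off, however, its
  differential could cancel that of the old map. Hence the collar is chosen so thin that the old map
  still has nonzero derivative on the kernel of \<open>dR\<close>, a direction that the step does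
  not see; such directions exist because the curves witnessing the submersion property stay in the
  boundary when they start there. The gluing comes without a collar, so \<open>R\<close> is
  assembled from local half-space coordinates, and these come from the inverse function theorem
  applied to local extensions across the boundary.\<close>

lemma Ck_on_subset: "Ck_on k U f \<Longrightarrow> V \<subseteq> U \<Longrightarrow> Ck_on k V f"
  by (induction k arbitrary: f) (auto intro: continuous_on_subset)

lemma Ck_on_cong:
  assumes "open U" "\<And>x. x \<in> U \<Longrightarrow> f x = g x" "Ck_on k U f"
  shows "Ck_on k U g"
  using assms(2,3)
proof (induction k arbitrary: f g)
  case 0
  then show ?case by (simp cong: continuous_on_cong)
next
  case (Suc k)
  have d: "(g has_derivative frechet_derivative f (at x)) (at x)" if "x \<in> U" for x
  proof (rule has_derivative_transform_within_open[OF _ \<open>open U\<close> that])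
    show "(f has_derivative frechet_derivative f (at x)) (at x)"
      using Suc.prems that by (auto simp flip: frechet_derivative_works)
  qed (use Suc.prems in auto)
  then have e: "frechet_derivative g (at x) = frechet_derivative f (at x)" if "x \<in> U" for x
    using frechet_derivative_at that by metis
  show ?case
    using d e Suc.IH[of "\<lambda>x. frechet_derivative f (at x) v" "\<lambda>x. frechet_derivative g (at x) v" for v]
      Suc.prems by (auto simp: differentiable_def)
qed

text \<open>\<open>Ck_on\<close> is defined through the chosen \<open>frechet_derivative\<close>;
  this form accepts any family of derivatives given in closed form, which is what the inductions on
  the order of differentiability use.\<close>

lemma Ck_on_SucI:
  assumes "open U" "\<And>x. x \<in> U \<Longrightarrow> (f has_derivative f' x) (at x)" "\<And>v. Ck_on k U (\<lambda>x. f' x v)"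
  shows "Ck_on (Suc k) U f"
proof -
  have "f' x = frechet_derivative f (at x)" if "x \<in> U" for x
    using assms(2) that frechet_derivative_at by blast
  then have "Ck_on k U (\<lambda>x. frechet_derivative f (at x) v)" for v
    by (intro Ck_on_cong[OF assms(1) _ assms(3)[of v]]) auto
  then show ?thesis
    using assms(2) by (auto simp: differentiable_def)
qed

lemma Ck_on_SucD: "Ck_on (Suc k) U f \<Longrightarrow> Ck_on k U f"
proof (induction k arbitrary: f)
  case 0
  then show ?case
    using differentiable_imp_continuous_on[of f U] by (auto simp: differentiable_on_def
      intro: differentiable_at_withinI)
next
  case (Suc k)
  then show ?case by auto
qed

lemma Ck_on_le: "Ck_on m U f \<Longrightarrow> k \<le> m \<Longrightarrow> Ck_on k U f"
  using Ck_on_SucD by (induction m) (auto simp: le_Suc_eq simp del: Ck_on.simps)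

lemma Ck_on_has_derivative:
  "Ck_on (Suc k) U f \<Longrightarrow> x \<in> U \<Longrightarrow> (f has_derivative frechet_derivative f (at x)) (at x)"
  by (auto simp: frechet_derivative_works)

lemma Ck_on_local:
  assumes "\<And>x. x \<in> U \<Longrightarrow> \<exists>V. open V \<and> x \<in> V \<and> Ck_on k (U \<inter> V) f"
  shows "Ck_on k U f"
  using assms
proof (induction k arbitrary: f)
  case 0
  have "continuous (at x within U) f" if x: "x \<in> U" for x
  proof -
    have "\<exists>V. open V \<and> x \<in> V \<and> continuous_on (U \<inter> V) f" using 0[OF x] by simp
    then obtain V where V: "open V" "x \<in> V" "continuous_on (U \<inter> V) f" by blast
    then have "continuous (at x within (U \<inter> V)) f" using x
      by (simp add: continuous_on_eq_continuous_within)
    moreover have "at x within U = at x within (U \<inter> V)"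
      by (rule at_within_nhd[of _ V]) (use V in auto)
    ultimately show ?thesis by simp
  qed
  then show ?case by (simp add: continuous_on_eq_continuous_within)
next
  case (Suc k)
  have "Ck_on k U (\<lambda>x. frechet_derivative f (at x) v)" for v
  proof (rule Suc.IH)
    fix x assume "x \<in> U"
    then obtain V where "open V" "x \<in> V" "Ck_on (Suc k) (U \<inter> V) f" using Suc.prems by blast
    then show "\<exists>V. open V \<and> x \<in> V \<and> Ck_on k (U \<inter> V) (\<lambda>x. frechet_derivative f (at x) v)"
      unfolding Ck_on.simps by blast
  qed
  moreover have "f differentiable (at x)" if "x \<in> U" for x
  proof -
    obtain V where "open V" "x \<in> V" "Ck_on (Suc k) (U \<inter> V) f" using Suc.prems \<open>x \<in> U\<close> by blast
    then show ?thesis using \<open>x \<in> U\<close> unfolding Ck_on.simps by blast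
  qed
  ultimately show ?case unfolding Ck_on.simps by blast
qed

lemma Ck_on_const: "open U \<Longrightarrow> Ck_on k U (\<lambda>x. c)"
proof (induction k arbitrary: c)
  case (Suc k)
  show ?case by (rule Ck_on_SucI[where f'="\<lambda>_ _. 0"]) (use Suc in auto)
qed auto

lemma Ck_on_linear:
  assumes "bounded_linear f" "open U"
  shows "Ck_on k U f"
proof (cases k)
  case 0
  then show ?thesis using assms linear_continuous_on by auto
next
  case (Suc m)
  show ?thesis unfolding Suc
    by (rule Ck_on_SucI[where f'="\<lambda>_. f"])
       (use assms in \<open>auto intro: bounded_linear_imp_has_derivative Ck_on_const\<close>)
qed

lemma Ck_on_add:
  assumes "open U" "Ck_on k U f" "Ck_on k U g"
  shows "Ck_on k U (\<lambda>x. f x + g x)"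
  using assms(2,3)
proof (induction k arbitrary: f g)
  case (Suc k)
  show ?case
    by (rule Ck_on_SucI[OF \<open>open U\<close>,
          where f'="\<lambda>x v. frechet_derivative f (at x) v + frechet_derivative g (at x) v"])
       (use Suc in \<open>auto simp: frechet_derivative_works intro!: has_derivative_add\<close>)
qed (auto intro: continuous_intros)

lemma Ck_on_bilinear:
  assumes "bounded_bilinear h" "open U" "Ck_on k U f" "Ck_on k U g"
  shows "Ck_on k U (\<lambda>x. h (f x) (g x))"
  using assms(3,4)
proof (induction k arbitrary: f g)
  case 0
  then show ?case using assms(1) by (simp add: bounded_bilinear.continuous_on)
next
  case (Suc k)
  interpret h: bounded_bilinear h by fact
  show ?case
  proof (rule Ck_on_SucI[OF \<open>open U\<close>, where
        f'="\<lambda>x v. h (f x) (frechet_derivative g (at x) v) + h (frechet_derivative f (at x) v) (g x)"])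
    fix x assume "x \<in> U"
    then show "((\<lambda>x. h (f x) (g x)) has_derivative
        (\<lambda>v. h (f x) (frechet_derivative g (at x) v) + h (frechet_derivative f (at x) v) (g x))) (at x)"
      using Suc.prems by (intro h.FDERIV) (auto simp: frechet_derivative_works)
  next
    fix v
    show "Ck_on k U (\<lambda>x. h (f x) (frechet_derivative g (at x) v) + h (frechet_derivative f (at x) v) (g x))"
      using Suc.prems Ck_on_SucD[OF Suc.prems(1)] Ck_on_SucD[OF Suc.prems(2)]
      by (intro Ck_on_add Suc.IH \<open>open U\<close>) auto
  qed
qed

lemma Ck_on_sum:
  assumes "open U" "\<And>i. i \<in> I \<Longrightarrow> Ck_on k U (f i)"
  shows "Ck_on k U (\<lambda>x. \<Sum>i\<in>I. f i x)"
  using assms(2) by (induction I rule: infinite_finite_induct) (auto intro!: Ck_on_const Ck_on_add assms(1))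

lemma Ck_on_Pair:
  assumes "open U" "Ck_on k U f" "Ck_on k U g"
  shows "Ck_on k U (\<lambda>x. (f x, g x))"
  using assms(2,3)
proof (induction k arbitrary: f g)
  case (Suc k)
  show ?case
    by (rule Ck_on_SucI[OF \<open>open U\<close>,
          where f'="\<lambda>x v. (frechet_derivative f (at x) v, frechet_derivative g (at x) v)"])
       (use Suc in \<open>auto simp: frechet_derivative_works intro!: has_derivative_Pair\<close>)
qed (auto intro: continuous_intros)

lemma linear_eq_sum_Basis:
  assumes "linear f"
  shows "f (x::'a::euclidean_space) = (\<Sum>i\<in>Basis. (x \<bullet> i) *\<^sub>R f i)"
  by (metis (mono_tags, lifting) assms euclidean_representation linear_scale linear_sum sum.cong)

text \<open>The chain rule applies the derivative of \<open>g\<close> to a direction that varies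
  with \<open>x\<close>, whereas the induction hypothesis concerns fixed directions. Expanding the
  direction in the basis leaves coordinates times derivatives of \<open>g\<close> in basis
  directions, which are covered.\<close>

lemma Ck_on_compose:
  fixes f :: "'a::real_normed_vector \<Rightarrow> 'b::euclidean_space" and g :: "'b \<Rightarrow> 'c::real_normed_vector"
  assumes "open U" "open V" "Ck_on k U f" "Ck_on k V g" "f ` U \<subseteq> V"
  shows "Ck_on k U (\<lambda>x. g (f x))"
  using assms(3,4)
proof (induction k arbitrary: g)
  case 0
  then show ?case using assms(5) by (auto intro: continuous_on_compose2)
next
  case (Suc k)
  let ?f' = "\<lambda>x. frechet_derivative f (at x)" and ?g' = "\<lambda>x. frechet_derivative g (at x)"
  have df: "(f has_derivative ?f' x) (at x)" if "x \<in> U" for x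
    using Suc.prems that by (auto simp: frechet_derivative_works)
  have dg: "(g has_derivative ?g' (f x)) (at (f x))" if "x \<in> U" for x
    using Suc.prems that assms(5) by (auto simp: frechet_derivative_works)
  show ?case
  proof (rule Ck_on_SucI[OF \<open>open U\<close>, where f'="\<lambda>x v. ?g' (f x) (?f' x v)"])
    fix x assume "x \<in> U"
    then show "((\<lambda>x. g (f x)) has_derivative (\<lambda>v. ?g' (f x) (?f' x v))) (at x)"
      using has_derivative_compose[OF df dg] by simp
  next
    fix v
    have "Ck_on k U (\<lambda>x. \<Sum>i\<in>Basis. (?f' x v \<bullet> i) *\<^sub>R ?g' (f x) i)"
    proof (intro Ck_on_sum Ck_on_bilinear[OF bounded_bilinear_scaleR] \<open>open U\<close>)
      fix i :: 'b
      show "Ck_on k U (\<lambda>x. ?f' x v \<bullet> i)"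
        using Suc.prems by (intro Ck_on_bilinear[OF bounded_bilinear_inner] Ck_on_const \<open>open U\<close>) auto
      show "Ck_on k U (\<lambda>x. ?g' (f x) i)"
        using Suc.prems Ck_on_SucD[OF Suc.prems(1)] by (intro Suc.IH) auto
    qed
    then show "Ck_on k U (\<lambda>x. ?g' (f x) (?f' x v))"
      by (rule Ck_on_cong[OF \<open>open U\<close>, rotated])
         (metis dg has_derivative_linear linear_eq_sum_Basis)
  qed
qed

section \<open>Smooth functions on open sets\<close>

definition csmooth :: "'a::real_normed_vector set \<Rightarrow> ('a \<Rightarrow> 'b::real_normed_vector) \<Rightarrow> bool" where
  "csmooth U f \<longleftrightarrow> (\<forall>k. Ck_on k U f)"

lemma csmooth_subset: "csmooth U f \<Longrightarrow> V \<subseteq> U \<Longrightarrow> csmooth V f"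
  unfolding csmooth_def using Ck_on_subset by blast

lemma csmooth_cong: "open U \<Longrightarrow> (\<And>x. x \<in> U \<Longrightarrow> f x = g x) \<Longrightarrow> csmooth U f \<Longrightarrow> csmooth U g"
  unfolding csmooth_def using Ck_on_cong by blast

lemma csmooth_local:
  assumes "\<And>x. x \<in> U \<Longrightarrow> \<exists>V. open V \<and> x \<in> V \<and> csmooth (U \<inter> V) f"
  shows "csmooth U f"
  unfolding csmooth_def
proof (intro allI Ck_on_local)
  fix k x assume "x \<in> U"
  then obtain V where "open V" "x \<in> V" "csmooth (U \<inter> V) f" using assms by blast
  then show "\<exists>V. open V \<and> x \<in> V \<and> Ck_on k (U \<inter> V) f" by (auto simp: csmooth_def)
qed

lemma csmooth_const: "open U \<Longrightarrow> csmooth U (\<lambda>x. c)"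
  by (simp add: csmooth_def Ck_on_const)

lemma csmooth_linear: "bounded_linear f \<Longrightarrow> open U \<Longrightarrow> csmooth U f"
  by (simp add: csmooth_def Ck_on_linear)

lemma csmooth_ident: "open U \<Longrightarrow> csmooth U (\<lambda>x. x)"
  by (simp add: csmooth_linear)

lemma csmooth_add: "open U \<Longrightarrow> csmooth U f \<Longrightarrow> csmooth U g \<Longrightarrow> csmooth U (\<lambda>x. f x + g x)"
  by (simp add: csmooth_def Ck_on_add)

lemma csmooth_bilinear:
  "bounded_bilinear h \<Longrightarrow> open U \<Longrightarrow> csmooth U f \<Longrightarrow> csmooth U g \<Longrightarrow> csmooth U (\<lambda>x. h (f x) (g x))"
  by (simp add: csmooth_def Ck_on_bilinear)

lemma csmooth_mult:
  fixes f g :: "_ \<Rightarrow> 'b::real_normed_algebra"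
  shows "open U \<Longrightarrow> csmooth U f \<Longrightarrow> csmooth U g \<Longrightarrow> csmooth U (\<lambda>x. f x * g x)"
  by (rule csmooth_bilinear[OF bounded_bilinear_mult])

lemma csmooth_Pair: "open U \<Longrightarrow> csmooth U f \<Longrightarrow> csmooth U g \<Longrightarrow> csmooth U (\<lambda>x. (f x, g x))"
  by (simp add: csmooth_def Ck_on_Pair)

lemma csmooth_compose:
  fixes f :: "'a::real_normed_vector \<Rightarrow> 'b::euclidean_space" and g :: "'b \<Rightarrow> 'c::real_normed_vector"
  shows "open U \<Longrightarrow> open V \<Longrightarrow> csmooth U f \<Longrightarrow> csmooth V g \<Longrightarrow> f ` U \<subseteq> V \<Longrightarrow> csmooth U (\<lambda>x. g (f x))"
  using Ck_on_compose by (simp add: csmooth_def) blast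

lemma csmooth_linear_compose:
  fixes f :: "'a::real_normed_vector \<Rightarrow> 'b::euclidean_space"
  shows "bounded_linear h \<Longrightarrow> open U \<Longrightarrow> csmooth U f \<Longrightarrow> csmooth U (\<lambda>x. h (f x))"
  by (rule csmooth_compose[where V=UNIV]) (auto intro: csmooth_linear)

lemma csmooth_diff:
  fixes f g :: "'a::real_normed_vector \<Rightarrow> 'b::euclidean_space"
  shows "open U \<Longrightarrow> csmooth U f \<Longrightarrow> csmooth U g \<Longrightarrow> csmooth U (\<lambda>x. f x - g x)"
  using csmooth_add[of U f "\<lambda>x. - g x"] csmooth_linear_compose[of uminus U g]
  by (simp add: bounded_linear_minus[OF bounded_linear_ident])

lemma csmooth_has_derivative:
  "csmooth U f \<Longrightarrow> x \<in> U \<Longrightarrow> (f has_derivative frechet_derivative f (at x)) (at x)"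
  using Ck_on_has_derivative unfolding csmooth_def by blast

lemma csmooth_derivative: "csmooth U f \<Longrightarrow> csmooth U (\<lambda>x. frechet_derivative f (at x) v)"
  unfolding csmooth_def by (metis Ck_on.simps(2))

lemma csmooth_continuous: "csmooth U f \<Longrightarrow> continuous_on U f"
  unfolding csmooth_def by (metis Ck_on.simps(1))

text \<open>The derivative of a holomorphic function is again holomorphic, so the induction closes.
  Smoothness of \<open>cis\<close> and of the real functions \<open>exp\<close>,
  \<open>inverse\<close> and \<open>ln\<close> is derived from this, as they are composites of
  holomorphic maps with real-linear ones.\<close>

lemma csmooth_holomorphic:
  assumes "f holomorphic_on U" "open U"
  shows "csmooth U f"
proof -
  have "Ck_on k U f" for k
    using assms(1)
  proof (induction k arbitrary: f)
    case 0
    then show ?case by (simp add: holomorphic_on_imp_continuous_on)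
  next
    case (Suc k)
    show ?case
    proof (rule Ck_on_SucI[OF \<open>open U\<close>, where f'="\<lambda>x v. deriv f x * v"])
      show "(f has_derivative (\<lambda>v. deriv f x * v)) (at x)" if "x \<in> U" for x
        using holomorphic_derivI[OF Suc.prems \<open>open U\<close> that, of UNIV] by (simp add: has_field_derivative_def)
      show "Ck_on k U (\<lambda>x. deriv f x * v)" for v
        by (intro Suc.IH holomorphic_intros Suc.prems \<open>open U\<close>)
    qed
  qed
  then show ?thesis by (simp add: csmooth_def)
qed

lemma csmooth_holomorphic_compose:
  assumes "f holomorphic_on V" "open V" "open U" "csmooth U h" "h ` U \<subseteq> V"
  shows "csmooth U (\<lambda>x. f (h x))"
  by (rule csmooth_compose[OF assms(3,2,4) csmooth_holomorphic[OF assms(1,2)] assms(5)])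

lemma csmooth_of_real: "open U \<Longrightarrow> csmooth U (of_real :: real \<Rightarrow> complex)"
  by (rule csmooth_linear[OF bounded_linear_of_real])

lemma csmooth_cis: "csmooth UNIV cis"
proof -
  have "csmooth UNIV (\<lambda>t::real. (\<lambda>z. exp (\<i> * z)) (of_real t))"
    by (rule csmooth_holomorphic_compose[where V=UNIV])
       (auto intro!: csmooth_of_real holomorphic_intros)
  then show ?thesis by (simp add: cis_conv_exp[abs_def])
qed

lemma csmooth_exp_real: "csmooth UNIV (exp :: real \<Rightarrow> real)"
proof -
  have "csmooth UNIV (\<lambda>t::real. Re (exp (of_real t)))"
    by (rule csmooth_linear_compose[OF bounded_linear_Re open_UNIV],
        rule csmooth_holomorphic_compose[where V=UNIV])
       (auto intro!: csmooth_of_real holomorphic_intros)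
  then show ?thesis by (simp add: exp_of_real flip: of_real_exp)
qed

lemma csmooth_inverse_real: "csmooth {x. x \<noteq> 0} (inverse :: real \<Rightarrow> real)"
proof -
  have o: "open {x::real. x \<noteq> 0}" using open_Compl[of "{0::real}"] by (simp add: Compl_eq)
  have "csmooth {x::real. x \<noteq> 0} (\<lambda>t. Re (inverse (of_real t)))"
    by (rule csmooth_linear_compose[OF bounded_linear_Re o],
        rule csmooth_holomorphic_compose[where V="-{0}"])
       (auto intro!: csmooth_of_real holomorphic_intros o)
  then show ?thesis by (simp flip: of_real_inverse)
qed

lemma csmooth_ln: "csmooth {x. x > 0} (ln :: real \<Rightarrow> real)"
proof -
  have o: "open {x::real. x > 0}" by (rule open_Collect_less) (auto intro: continuous_intros)
  have "csmooth {x::real. x > 0} (\<lambda>t. Re (Ln (of_real t)))"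
    by (rule csmooth_linear_compose[OF bounded_linear_Re o],
        rule csmooth_holomorphic_compose[where V="-\<real>\<^sub>\<le>\<^sub>0"])
       (auto intro!: csmooth_of_real holomorphic_intros o)
  from csmooth_cong[OF o _ this] show ?thesis by (simp add: Ln_of_real)
qed

section \<open>A smooth bump function on the line\<close>

lemma poly_exp_decay: "((\<lambda>x::real. poly p x * exp (- x)) \<longlongrightarrow> 0) at_top"
proof -
  have "((\<lambda>x. \<Sum>i\<le>degree p. coeff p i * (x ^ i / exp x)) \<longlongrightarrow> (\<Sum>i\<le>degree p. coeff p i * 0)) at_top"
    by (intro tendsto_sum tendsto_mult tendsto_const tendsto_power_div_exp_0)
  then show ?thesis
    by (simp add: poly_altdef sum_distrib_right exp_minus divide_inverse mult.assoc)
qed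

text \<open>A family closed under differentiation that contains \<open>bump\<close> as the case
  \<open>p = 1\<close>. Treating all polynomials at once makes the induction on the order of
  differentiability possible.\<close>

definition flat :: "real poly \<Rightarrow> real \<Rightarrow> real" where
  "flat p t = (if t > 0 then poly p (1 / t) * exp (- (1 / t)) else 0)"

text \<open>With \<open>r = 1 / t\<close> the derivative of \<open>p(r) exp(-r)\<close> with respect
  to \<open>t\<close> is \<open>r\<^sup>2 (p(r) - p'(r)) exp(-r)\<close>, and
  \<open>[:0, 0, 1:]\<close> is the square of the indeterminate. At the origin exponential decay
  beats every power of \<open>r\<close>.\<close>

lemma flat_has_derivative:
  "(flat p has_real_derivative flat ([:0, 0, 1:] * (p - pderiv p)) t) (at t)"
proof -
  consider "t > 0" | "t < 0" | "t = 0" by linarith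
  then show ?thesis
  proof cases
    case 1
    let ?r = "inverse t"
    have i: "(inverse has_real_derivative - (?r * ?r)) (at t)"
      using DERIV_inverse[of t] 1 by (simp add: power2_eq_square)
    have "((\<lambda>t. poly p (inverse t) * exp (- inverse t)) has_real_derivative
        (poly (pderiv p) ?r * - (?r * ?r)) * exp (- ?r) + (exp (- ?r) * - (- (?r * ?r))) * poly p ?r) (at t)"
      by (rule DERIV_mult[OF DERIV_chain2[OF poly_DERIV i] DERIV_chain2[OF DERIV_exp DERIV_minus[OF i]]])
    moreover have "(poly (pderiv p) ?r * - (?r * ?r)) * exp (- ?r) + (exp (- ?r) * - (- (?r * ?r))) * poly p ?r
        = flat ([:0, 0, 1:] * (p - pderiv p)) t"
      using 1 by (simp add: flat_def divide_inverse algebra_simps)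
    ultimately have "((\<lambda>t. poly p (inverse t) * exp (- inverse t)) has_real_derivative
        flat ([:0, 0, 1:] * (p - pderiv p)) t) (at t)" by simp
    then show ?thesis
      by (rule has_field_derivative_transform_within_open[where S="{0<..}"])
         (use 1 in \<open>auto simp: flat_def divide_inverse\<close>)
  next
    case 2
    have "((\<lambda>t. 0) has_real_derivative flat ([:0, 0, 1:] * (p - pderiv p)) t) (at t)"
      using 2 by (simp add: flat_def)
    then show ?thesis
      by (rule has_field_derivative_transform_within_open[where S="{..<0}"])
         (use 2 in \<open>auto simp: flat_def\<close>)
  next
    case 3
    have "((\<lambda>h. flat p h / h) \<longlongrightarrow> 0) (at_right 0)"
    proof -
      \<comment> \<open>Dividing by \<open>t\<close> multiplies the polynomial in
        \<open>1 / t\<close> by the indeterminate, which is the effect of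
        \<open>pCons 0\<close>.\<close>
      have "((\<lambda>t. poly (pCons 0 p) (inverse t) * exp (- (inverse t))) \<longlongrightarrow> 0) (at_right (0::real))"
        by (rule filterlim_compose[OF poly_exp_decay filterlim_inverse_at_top_right])
      moreover have "\<forall>\<^sub>F t in at_right 0. poly (pCons 0 p) (inverse t) * exp (- (inverse t)) = flat p t / t"
        by (rule eventually_mono[OF eventually_at_right_less]) (simp add: flat_def divide_inverse)
      ultimately show ?thesis by (rule Lim_transform_eventually)
    qed
    moreover have "((\<lambda>h. flat p h / h) \<longlongrightarrow> 0) (at_left 0)"
    proof (rule Lim_transform_eventually[OF tendsto_const])
      show "\<forall>\<^sub>F h in at_left 0. 0 = flat p h / h"
        unfolding eventually_at_filter by (rule always_eventually) (simp add: flat_def)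
    qed
    ultimately have "((\<lambda>h. flat p h / h) \<longlongrightarrow> 0) (at 0)"
      by (rule filterlim_split_at[rotated])
    then show ?thesis using 3 by (simp add: DERIV_def flat_def)
  qed
qed

lemma csmooth_flat: "csmooth UNIV (flat p)"
proof -
  have "Ck_on k UNIV (flat p)" for k
  proof (induction k arbitrary: p)
    case 0
    then show ?case
      using flat_has_derivative by (auto intro!: continuous_at_imp_continuous_on DERIV_isCont)
  next
    case (Suc k)
    show ?case
    proof (rule Ck_on_SucI[OF open_UNIV, where f'="\<lambda>x v. flat ([:0, 0, 1:] * (p - pderiv p)) x * v"])
      show "(flat p has_derivative (*) (flat ([:0, 0, 1:] * (p - pderiv p)) x)) (at x)" for x
        using flat_has_derivative[of p x] unfolding has_field_derivative_def .
      show "Ck_on k UNIV (\<lambda>x. flat ([:0, 0, 1:] * (p - pderiv p)) x * v)" for v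
        by (intro Ck_on_bilinear[OF bounded_bilinear_mult] Ck_on_const open_UNIV Suc)
    qed
  qed
  then show ?thesis by (simp add: csmooth_def)
qed

definition bump :: "real \<Rightarrow> real" where "bump t = (if t > 0 then exp (- (1 / t)) else 0)"

lemma bump_eq_flat: "bump = flat 1"
  by (auto simp: bump_def flat_def)

lemma csmooth_bump: "csmooth UNIV bump"
  by (simp add: bump_eq_flat csmooth_flat)

lemma bump_nonneg: "bump t \<ge> 0" and bump_pos: "t > 0 \<Longrightarrow> bump t > 0" and bump_zero: "t \<le> 0 \<Longrightarrow> bump t = 0"
  by (auto simp: bump_def)

lemma bump_has_derivative:
  obtains b' where "\<And>t. (bump has_real_derivative b' t) (at t)" "\<And>t. t > 0 \<Longrightarrow> b' t > 0" "\<And>t. t \<le> 0 \<Longrightarrow> b' t = 0"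
proof
  show "(bump has_real_derivative flat ([:0, 0, 1:] * (1 - pderiv 1)) t) (at t)" for t
    unfolding bump_eq_flat by (rule flat_has_derivative)
  show "flat ([:0, 0, 1:] * (1 - pderiv 1)) t > 0" if "t > 0" for t
    using that by (auto simp: flat_def)
  show "flat ([:0, 0, 1:] * (1 - pderiv 1)) t = 0" if "t \<le> 0" for t
    using that by (simp add: flat_def)
qed

section \<open>The smooth inverse function theorem\<close>

text \<open>A product rule in which one factor need only be continuous, because the other one
  vanishes at the point. It serves to differentiate an expression containing the inverse of a linear
  map before that inverse is known to be differentiable.\<close>

lemma has_derivative_scaleR_vanish:
  fixes c :: "'a::real_normed_vector \<Rightarrow> 'b::real_normed_vector"
  assumes s: "(s has_derivative D) (at a)" "s a = 0" and c: "continuous (at a) c"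
  shows "((\<lambda>y. s y *\<^sub>R c y) has_derivative (\<lambda>h. D h *\<^sub>R c a)) (at a)"
proof -
  interpret D: bounded_linear D using s(1) by (rule has_derivative_bounded_linear)
  obtain K where K: "\<And>x. norm (D x) \<le> norm x * K" using D.bounded by blast
  have lim: "((\<lambda>y. norm (s y - s a - D (y - a)) / norm (y - a)) \<longlongrightarrow> 0) (at a)"
    using s(1) unfolding has_derivative_iff_norm by simp
  have c': "(c \<longlongrightarrow> c a) (at a)" using c by (simp add: continuous_at)
  have "((\<lambda>y. norm (s y *\<^sub>R c y - s a *\<^sub>R c a - D (y - a) *\<^sub>R c a) / norm (y - a)) \<longlongrightarrow> 0) (at a)"
  proof (rule Lim_null_comparison)
    show "((\<lambda>y. (norm (s y - s a - D (y - a)) / norm (y - a)) * norm (c y) + \<bar>K\<bar> * norm (c y - c a)) \<longlongrightarrow> 0) (at a)"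
      using tendsto_add[OF tendsto_mult[OF lim tendsto_norm[OF c']]
          tendsto_mult[OF tendsto_const[of "\<bar>K\<bar>"] tendsto_norm[OF tendsto_diff[OF c' tendsto_const[of "c a"]]]]]
      by simp
    show "\<forall>\<^sub>F y in at a. norm (norm (s y *\<^sub>R c y - s a *\<^sub>R c a - D (y - a) *\<^sub>R c a) / norm (y - a))
        \<le> norm (s y - s a - D (y - a)) / norm (y - a) * norm (c y) + \<bar>K\<bar> * norm (c y - c a)"
      unfolding eventually_at_filter
    proof (intro always_eventually allI impI)
      fix y assume "y \<noteq> a"
      then have n: "norm (y - a) > 0" by simp
      have "s y *\<^sub>R c y - D (y - a) *\<^sub>R c a = (s y - D (y - a)) *\<^sub>R c y + D (y - a) *\<^sub>R (c y - c a)"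
        by (simp add: algebra_simps)
      then have "norm (s y *\<^sub>R c y - D (y - a) *\<^sub>R c a)
          \<le> norm (s y - D (y - a)) * norm (c y) + norm (D (y - a)) * norm (c y - c a)"
        by (metis norm_scaleR norm_triangle_ineq real_norm_def)
      also have "norm (D (y - a)) * norm (c y - c a) \<le> (norm (y - a) * \<bar>K\<bar>) * norm (c y - c a)"
        by (rule mult_right_mono) (use K[of "y - a"] n in \<open>auto intro: order_trans[OF _ mult_left_mono]\<close>)
      finally have "norm (s y *\<^sub>R c y - D (y - a) *\<^sub>R c a)
          \<le> norm (s y - D (y - a)) * norm (c y) + norm (y - a) * \<bar>K\<bar> * norm (c y - c a)" by simp
      then have "norm (s y *\<^sub>R c y - D (y - a) *\<^sub>R c a) / norm (y - a)
          \<le> (norm (s y - D (y - a)) * norm (c y) + norm (y - a) * \<bar>K\<bar> * norm (c y - c a)) / norm (y - a)"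
        using n divide_right_mono less_imp_le by blast
      also have "\<dots> = norm (s y - D (y - a)) / norm (y - a) * norm (c y) + \<bar>K\<bar> * norm (c y - c a)"
        using n by (simp add: add_divide_distrib)
      finally show "norm (norm (s y *\<^sub>R c y - s a *\<^sub>R c a - D (y - a) *\<^sub>R c a) / norm (y - a))
        \<le> norm (s y - s a - D (y - a)) / norm (y - a) * norm (c y) + \<bar>K\<bar> * norm (c y - c a)"
        using s(2) by simp
    qed
  qed
  then show ?thesis
    unfolding has_derivative_iff_norm
    by (auto intro: bounded_linear_compose[OF bounded_linear_scaleR_left D.bounded_linear_axioms])
qed

text \<open>The identity \<open>N y v = u - N y (M y u - v)\<close> with \<open>u = N y0 v\<close>
  kept fixed shows that \<open>N\<close> is differentiable with derivative \<open>- N M' N\<close>.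
  In this formula \<open>N\<close> occurs undifferentiated, so each order of differentiability
  follows from the previous one.\<close>

lemma Ck_on_linear_inverse:
  fixes M :: "'c::euclidean_space \<Rightarrow> 'a::euclidean_space \<Rightarrow> 'b::euclidean_space" and N :: "'c \<Rightarrow> 'b \<Rightarrow> 'a"
  assumes "open T" and linM: "\<And>y. y \<in> T \<Longrightarrow> linear (M y)" and linN: "\<And>y. y \<in> T \<Longrightarrow> linear (N y)"
    and NM: "\<And>y z. y \<in> T \<Longrightarrow> N y (M y z) = z" and MN: "\<And>y w. y \<in> T \<Longrightarrow> M y (N y w) = w"
    and "\<And>v. Ck_on k T (\<lambda>y. M y v)"
  shows "Ck_on k T (\<lambda>y. N y v)"
  using assms(6)
proof (induction k arbitrary: v)
  case 0
  have "continuous (at y0) (\<lambda>y. N y v)" if y0: "y0 \<in> T" for y0 v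
  proof -
    have cM: "((\<lambda>y. M y u) \<longlongrightarrow> M y0 u) (at y0)" for u
      using 0[of u] y0 \<open>open T\<close> by (simp add: continuous_on_eq_continuous_at continuous_at)
    obtain B where B: "B > 0" "\<And>w. norm (N y0 w) \<le> B * norm w"
      using linear_bounded_pos[OF linN[OF y0]] by blast
    have "((\<lambda>y. \<Sum>i\<in>Basis. norm (M y i - M y0 i)) \<longlongrightarrow> (\<Sum>i\<in>(Basis::'a set). norm (M y0 i - M y0 i))) (at y0)"
      by (intro tendsto_sum tendsto_norm tendsto_diff cM tendsto_const)
    \<comment> \<open>With \<open>M y - M y0\<close> smaller than half of \<open>1 / B\<close>, the
      bound \<open>B\<close> on \<open>N y0\<close> turns into the bound \<open>2 * B\<close> on
      \<open>N y\<close>.\<close>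
    then have "\<forall>\<^sub>F y in at y0. (\<Sum>i\<in>Basis. norm (M y i - M y0 i)) < 1 / (2 * B)"
      by (rule order_tendstoD) (use B in auto)
    moreover have "\<forall>\<^sub>F y in at y0. y \<in> T" using y0 \<open>open T\<close> by (auto simp: eventually_at_topological)
    ultimately have ev: "\<forall>\<^sub>F y in at y0. norm (N y v - N y0 v) \<le> 2 * B * norm (M y (N y0 v) - M y0 (N y0 v))"
    proof eventually_elim
      fix y assume y: "(\<Sum>i\<in>Basis. norm (M y i - M y0 i)) < 1 / (2 * B)" "y \<in> T"
      interpret My: linear "M y" by (rule linM[OF y(2)])
      interpret M0: linear "M y0" by (rule linM[OF y0])
      interpret Ny: linear "N y" by (rule linN[OF y(2)])
      interpret N0: linear "N y0" by (rule linN[OF y0])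
      have d: "norm (M y z - M y0 z) \<le> norm z / (2 * B)" for z
      proof -
        have "M y z - M y0 z = (\<Sum>i\<in>Basis. (z \<bullet> i) *\<^sub>R (M y i - M y0 i))"
          by (simp add: linear_eq_sum_Basis[OF My.linear_axioms, of z] linear_eq_sum_Basis[OF M0.linear_axioms, of z]
              sum_subtractf scaleR_diff_right)
        also have "norm \<dots> \<le> (\<Sum>i\<in>Basis. norm z * norm (M y i - M y0 i))"
          by (intro order_trans[OF norm_sum] sum_mono) (simp add: Basis_le_norm mult_right_mono)
        also have "\<dots> \<le> norm z * (1 / (2 * B))"
          unfolding sum_distrib_left[symmetric] by (rule mult_left_mono) (use y in auto)
        finally show ?thesis by simp
      qed
      have bnd: "norm (N y w) \<le> 2 * B * norm w" for w
      proof -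
        have "N y w = N y0 (w - (M y (N y w) - M y0 (N y w)))"
          using MN[OF y(2)] NM[OF y0] by (simp add: N0.diff)
        then have "norm (N y w) \<le> B * norm (w - (M y (N y w) - M y0 (N y w)))" using B(2) by metis
        also have "\<dots> \<le> B * (norm w + norm (N y w) / (2 * B))"
          by (rule mult_left_mono[OF order_trans[OF norm_triangle_ineq4]]) (use d B in auto)
        finally show ?thesis using B by (simp add: algebra_simps)
      qed
      have "N y v - N y0 v = - N y (M y (N y0 v) - M y0 (N y0 v))"
        using MN[OF y0] NM[OF y(2)] by (simp add: Ny.diff)
      then show "norm (N y v - N y0 v) \<le> 2 * B * norm (M y (N y0 v) - M y0 (N y0 v))"
        using bnd by simp
    qed
    have "((\<lambda>y. N y v - N y0 v) \<longlongrightarrow> 0) (at y0)"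
      by (rule Lim_null_comparison[OF ev])
         (use tendsto_mult[OF tendsto_const[of "2*B"] tendsto_norm[OF tendsto_diff[OF cM[of "N y0 v"] tendsto_const[of "M y0 (N y0 v)"]]]] in simp)
    then show ?thesis by (simp add: continuous_at LIM_zero_iff)
  qed
  then show ?case using \<open>open T\<close> by (simp add: continuous_on_eq_continuous_at)
next
  case (Suc k)
  let ?DM = "\<lambda>u y w. frechet_derivative (\<lambda>y. M y u) (at y) w"
  have Mk: "Ck_on k T (\<lambda>y. M y u)" for u using Ck_on_SucD[OF Suc.prems] .
  have Nk: "Ck_on k T (\<lambda>y. N y u)" for u using Suc.IH Mk by blast
  have contN: "continuous (at y) (\<lambda>y. N y u)" if "y \<in> T" for u y
    using Ck_on_le[OF Nk, of 0] that \<open>open T\<close> by (simp add: continuous_on_eq_continuous_at)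
  have Nsum: "N y w = (\<Sum>i\<in>Basis. (w \<bullet> i) *\<^sub>R N y i)" if "y \<in> T" for y w
    by (rule linear_eq_sum_Basis[OF linN[OF that]])
  have Msum: "M y w = (\<Sum>i\<in>Basis. (w \<bullet> i) *\<^sub>R M y i)" if "y \<in> T" for y w
    by (rule linear_eq_sum_Basis[OF linM[OF that]])
  have dM: "((\<lambda>y. M y u) has_derivative ?DM u y) (at y)" if "y \<in> T" for u y
    using Suc.prems[of u] that by (simp add: frechet_derivative_works)
  show ?case
  proof (rule Ck_on_SucI[OF \<open>open T\<close>, where f'="\<lambda>y w. - N y (?DM (N y v) y w)"])
    fix y0 assume y0: "y0 \<in> T"
    \<comment> \<open>Freezing \<open>u\<close> makes \<open>M y u - v\<close> vanish at
      \<open>y0\<close>, so that its product with \<open>N y\<close>, so far only known to be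
      continuous at \<open>y0\<close> in this induction step, can be differentiated there.\<close>
    define u where "u = N y0 v"
    have "((\<lambda>y. ((M y u - v) \<bullet> i) *\<^sub>R N y i) has_derivative (\<lambda>h. (?DM u y0 h \<bullet> i) *\<^sub>R N y0 i)) (at y0)" for i
    proof (rule has_derivative_scaleR_vanish[OF _ _ contN[OF y0]])
      show "((\<lambda>y. (M y u - v) \<bullet> i) has_derivative (\<lambda>h. ?DM u y0 h \<bullet> i)) (at y0)"
        using dM[OF y0, of u] by (auto intro!: derivative_eq_intros)
      show "(M y0 u - v) \<bullet> i = 0" using MN[OF y0] by (simp add: u_def)
    qed
    then have "((\<lambda>y. u - (\<Sum>i\<in>Basis. ((M y u - v) \<bullet> i) *\<^sub>R N y i)) has_derivative
        (\<lambda>h. 0 - (\<Sum>i\<in>Basis. (?DM u y0 h \<bullet> i) *\<^sub>R N y0 i))) (at y0)"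
      by (intro has_derivative_diff has_derivative_sum has_derivative_const)
    moreover have "0 - (\<Sum>i\<in>Basis. (?DM u y0 h \<bullet> i) *\<^sub>R N y0 i) = - N y0 (?DM u y0 h)" for h
      using Nsum[OF y0, of "?DM u y0 h"] by simp
    ultimately have der: "((\<lambda>y. u - (\<Sum>i\<in>Basis. ((M y u - v) \<bullet> i) *\<^sub>R N y i)) has_derivative
        (\<lambda>h. - N y0 (?DM u y0 h))) (at y0)" by simp
    have "((\<lambda>y. N y v) has_derivative (\<lambda>h. - N y0 (?DM u y0 h))) (at y0)"
    proof (rule has_derivative_transform_within_open[OF der \<open>open T\<close> y0])
      fix y assume y: "y \<in> T"
      have "N y (M y u - v) = u - N y v" using linear_diff[OF linN[OF y]] NM[OF y] by simp
      then show "u - (\<Sum>i\<in>Basis. ((M y u - v) \<bullet> i) *\<^sub>R N y i) = N y v"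
        using Nsum[OF y, of "M y u - v"] by simp
    qed
    then show "((\<lambda>y. N y v) has_derivative (\<lambda>h. - N y0 (?DM (N y0 v) y0 h))) (at y0)"
      by (simp add: u_def)
  next
    fix w
    have DMsum: "?DM u y w = (\<Sum>j\<in>Basis. (u \<bullet> j) *\<^sub>R ?DM j y w)" if "y \<in> T" for u y
    proof -
      have "((\<lambda>y. \<Sum>j\<in>Basis. (u \<bullet> j) *\<^sub>R M y j) has_derivative
          (\<lambda>w. \<Sum>j\<in>Basis. (u \<bullet> j) *\<^sub>R ?DM j y w)) (at y)"
        by (rule has_derivative_sum, rule has_derivative_scaleR_right, rule dM[OF that])
      then have "((\<lambda>y. M y u) has_derivative (\<lambda>w. \<Sum>j\<in>Basis. (u \<bullet> j) *\<^sub>R ?DM j y w)) (at y)"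
        by (rule has_derivative_transform_within_open[OF _ \<open>open T\<close> that]) (simp only: Msum[of _ u])
      from has_derivative_unique[OF dM[OF that] this] show ?thesis by (rule fun_cong)
    qed
    have "Ck_on k T (\<lambda>y. \<Sum>i\<in>Basis. ((\<Sum>j\<in>Basis. (N y v \<bullet> j) *\<^sub>R ?DM j y w) \<bullet> i) *\<^sub>R N y i)"
      using Suc.prems
      by (intro Ck_on_sum Ck_on_bilinear[OF bounded_bilinear_scaleR] Ck_on_bilinear[OF bounded_bilinear_inner]
          Ck_on_const \<open>open T\<close> Nk) auto
    then have "Ck_on k T (\<lambda>y. N y (?DM (N y v) y w))"
    proof (rule Ck_on_cong[OF \<open>open T\<close>, rotated])
      fix y assume y: "y \<in> T"
      show "(\<Sum>i\<in>Basis. ((\<Sum>j\<in>Basis. (N y v \<bullet> j) *\<^sub>R ?DM j y w) \<bullet> i) *\<^sub>R N y i) = N y (?DM (N y v) y w)"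
        unfolding DMsum[OF y, of "N y v"] by (rule Nsum[OF y, symmetric])
    qed
    from Ck_on_bilinear[OF bounded_bilinear_scaleR \<open>open T\<close> Ck_on_const[OF \<open>open T\<close>, of k "-1::real"] this]
    show "Ck_on k T (\<lambda>y. - N y (?DM (N y v) y w))" by simp
  qed
qed

lemma linear_iso_DIM:
  assumes "DIM('a::euclidean_space) = DIM('b::euclidean_space)"
  obtains f :: "'a::euclidean_space \<Rightarrow> 'b::euclidean_space" and g
    where "linear f" "linear g" "\<And>x. g (f x) = x" "\<And>y. f (g y) = y"
  using isomorphisms_UNIV_UNIV[OF assms] by metis

text \<open>The isomorphism \<open>\<iota>\<close> turns \<open>f\<close> into a map of one space to
  itself, for which the inverse function theorem provides a differentiable local inverse
  \<open>g\<close>. Its derivative inverts that of the map at \<open>g y\<close>; if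
  \<open>g\<close> is of class k, then so is this inverse, hence \<open>g\<close> is of class k +
  1.\<close>

theorem csmooth_inverse_function:
  fixes f :: "'a::euclidean_space \<Rightarrow> 'b::euclidean_space"
  assumes dim: "DIM('a) = DIM('b)" and "open S" and f: "csmooth S f" and "x0 \<in> S"
    and inj: "inj (frechet_derivative f (at x0))"
  obtains U V g where "open U" "x0 \<in> U" "U \<subseteq> S" "open V" "homeomorphism U V f g" "csmooth V g"
proof -
  obtain \<iota> :: "'b \<Rightarrow> 'a" and \<kappa> where iso: "linear \<iota>" "linear \<kappa>" "\<And>x. \<kappa> (\<iota> x) = x" "\<And>y. \<iota> (\<kappa> y) = y"
    using linear_iso_DIM[OF dim[symmetric]] by metis
  have bl: "bounded_linear \<iota>" "bounded_linear \<kappa>" using iso by (simp_all add: linear_conv_bounded_linear)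
  let ?F = "\<lambda>x. \<iota> (f x)"
  define F' where "F' = (\<lambda>x. Blinfun (\<lambda>v. \<iota> (frechet_derivative f (at x) v)))"
  have blF: "bounded_linear (\<lambda>v. \<iota> (frechet_derivative f (at x) v))" if "x \<in> S" for x
    using bounded_linear_compose[OF bl(1) has_derivative_bounded_linear[OF csmooth_has_derivative[OF f that]]] .
  have F'_app: "blinfun_apply (F' x) v = \<iota> (frechet_derivative f (at x) v)" if "x \<in> S" for x v
    unfolding F'_def using bounded_linear_Blinfun_apply[OF blF[OF that]] by simp
  have dF: "(?F has_derivative blinfun_apply (F' x)) (at x)" if "x \<in> S" for x
    using bounded_linear.has_derivative[OF bl(1) csmooth_has_derivative[OF f that]]
    by (simp add: F'_app[OF that, abs_def])
  have cF: "csmooth S (\<lambda>x. blinfun_apply (F' x) v)" for v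
    by (rule csmooth_cong[OF \<open>open S\<close> _ csmooth_linear_compose[OF bl(1) \<open>open S\<close> csmooth_derivative[OF f, of v]]])
       (simp add: F'_app)
  have contF': "continuous_on S F'"
    by (rule continuous_on_blinfun_componentwise) (rule csmooth_continuous[OF cF])
  have "inj (blinfun_apply (F' x0))"
    using inj iso(3) F'_app[OF \<open>x0 \<in> S\<close>] by (metis injD injI)
  then obtain h where h: "linear h" "\<And>v. h (blinfun_apply (F' x0) v) = v"
    using linear_injective_left_inverse[OF bounded_linear.linear[OF blinfun.bounded_linear_right[of "F' x0"]]]
    by (metis comp_apply id_apply)
  have invF: "Blinfun h o\<^sub>L F' x0 = id_blinfun"
    by (rule blinfun_eqI) (use h in \<open>simp add: bounded_linear_Blinfun_apply linear_conv_bounded_linear\<close>)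
  have "\<exists>U V g g'. open U \<and> U \<subseteq> S \<and> x0 \<in> U \<and> open V \<and> homeomorphism U V ?F g \<and>
      (\<forall>y\<in>V. (g has_derivative g' y) (at y) \<and> g' y = inv (blinfun_apply (F' (g y)))
        \<and> bij (blinfun_apply (F' (g y))))" (is "\<exists>U V g g'. ?P U V g g'")
  proof (rule inverse_function_theorem[OF \<open>open S\<close> dF contF' \<open>x0 \<in> S\<close> invF])
    fix U V g g' assume *: "open U" "U \<subseteq> S" "x0 \<in> U" "open V" "homeomorphism U V ?F g"
      "\<And>y. y \<in> V \<Longrightarrow> (g has_derivative g' y) (at y)"
      "\<And>y. y \<in> V \<Longrightarrow> g' y = inv (blinfun_apply (F' (g y)))"
      "\<And>y. y \<in> V \<Longrightarrow> bij (blinfun_apply (F' (g y)))"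
    show "\<exists>U V g g'. ?P U V g g'"
      by (rule exI[of _ U], rule exI[of _ V], rule exI[of _ g], rule exI[of _ g'])
        (intro conjI ballI *)
  qed
  then obtain U V g g' where g0: "?P U V g g'" by iprover
  then have g: "open U" "U \<subseteq> S" "x0 \<in> U" "open V" "homeomorphism U V ?F g"
    "\<And>y. y \<in> V \<Longrightarrow> (g has_derivative g' y) (at y)"
    "\<And>y. y \<in> V \<Longrightarrow> g' y = inv (blinfun_apply (F' (g y)))"
    "\<And>y. y \<in> V \<Longrightarrow> bij (blinfun_apply (F' (g y)))" by blast+
  have gU: "g y \<in> U" if "y \<in> V" for y using g(5) that unfolding homeomorphism_def by blast
  have "Ck_on k V g" for k
  proof (induction k)
    case 0
    then show ?case using g(5) by (simp add: homeomorphism_def)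
  next
    case (Suc k)
    show ?case
    proof (rule Ck_on_SucI[OF \<open>open V\<close> g(6)])
      fix v
      show "Ck_on k V (\<lambda>x. g' x v)"
      proof (rule Ck_on_linear_inverse[OF \<open>open V\<close>, where M="\<lambda>y. blinfun_apply (F' (g y))"])
        fix y assume y: "y \<in> V"
        show "linear (blinfun_apply (F' (g y)))" by (rule bounded_linear.linear[OF blinfun.bounded_linear_right])
        show "linear (g' y)" using g(6)[OF y] by (rule has_derivative_linear)
        show "g' y (blinfun_apply (F' (g y)) z) = z" for z
          using g(7,8)[OF y] by (simp add: bij_is_inj)
        show "blinfun_apply (F' (g y)) (g' y w) = w" for w
          using g(7,8)[OF y] by (simp add: bij_is_surj surj_f_inv_f)
      next
        fix v
        show "Ck_on k V (\<lambda>y. blinfun_apply (F' (g y)) v)"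
          using cF[of v] gU g(2)
          by (intro Ck_on_compose[OF \<open>open V\<close> \<open>open S\<close> Suc, where g="\<lambda>x. blinfun_apply (F' x) v"])
             (auto simp: csmooth_def)
      qed
    qed
  qed
  then have cg: "csmooth V g" by (simp add: csmooth_def)
  have cont\<iota>: "continuous_on A \<iota>" "continuous_on B \<kappa>" for A B
    using bl by (simp_all add: linear_continuous_on)
  have V': "\<kappa> ` V = \<iota> -` V" using iso by (auto simp: image_iff) metis
  have oV': "open (\<kappa> ` V)" unfolding V' using cont\<iota>(1)[of UNIV] g(4) by (auto intro: open_vimage)
  have "homeomorphism U (\<kappa> ` V) f (\<lambda>y. g (\<iota> y))"
    unfolding homeomorphism_def
  proof (intro conjI)
    show "\<forall>x\<in>U. g (\<iota> (f x)) = x" using g(5) by (simp add: homeomorphism_def)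
    have "f ` U = \<kappa> ` ?F ` U" using iso(3) by (simp add: image_image)
    then show "f ` U = \<kappa> ` V" using g(5) by (simp add: homeomorphism_def)
    show "continuous_on U f" using csmooth_continuous[OF f] g(2) continuous_on_subset by blast
    show "\<forall>y\<in>\<kappa> ` V. f (g (\<iota> y)) = y" using g(5) iso(3,4) by (metis homeomorphism_def imageE)
    show "(\<lambda>y. g (\<iota> y)) ` \<kappa> ` V = U" using g(5) iso(4) by (simp add: image_image homeomorphism_def)
    show "continuous_on (\<kappa> ` V) (\<lambda>y. g (\<iota> y))"
      by (rule continuous_on_compose2[OF _ cont\<iota>(1)]) (use g(5) iso(4) in \<open>auto simp: homeomorphism_def\<close>)
  qed
  moreover have "csmooth (\<kappa> ` V) (\<lambda>y. g (\<iota> y))"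
    by (rule csmooth_compose[OF oV' \<open>open V\<close> csmooth_linear[OF bl(1) oV'] cg]) (use iso(4) in auto)
  ultimately show thesis using that[OF g(1,3,2) oV'] by blast
qed

section \<open>Smooth maps on arbitrary subsets of vector spaces\<close>

lemma smooth_on_iff:
  "smooth_on S f \<longleftrightarrow> (\<forall>x\<in>S. \<exists>U g. open U \<and> x \<in> U \<and> csmooth U g \<and> (\<forall>y\<in>S \<inter> U. g y = f y))"
  by (simp add: smooth_on_def csmooth_def)

lemma smooth_onE:
  assumes "smooth_on S f" "x \<in> S"
  obtains U g where "open U" "x \<in> U" "csmooth U g" "\<And>y. y \<in> S \<Longrightarrow> y \<in> U \<Longrightarrow> g y = f y"
proof -
  obtain U g where "open U \<and> x \<in> U \<and> csmooth U g \<and> (\<forall>y\<in>S \<inter> U. g y = f y)"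
    using assms unfolding smooth_on_iff by blast
  then show thesis by (intro that[of U g]) auto
qed

lemma smooth_on_eq_on:
  assumes "smooth_on S f" "T \<subseteq> S" "\<And>x. x \<in> T \<Longrightarrow> f x = g x"
  shows "smooth_on T g"
  unfolding smooth_on_iff
proof
  fix x assume "x \<in> T"
  then obtain U h where "open U" "x \<in> U" "csmooth U h" "\<And>y. y \<in> S \<Longrightarrow> y \<in> U \<Longrightarrow> h y = f y"
    using smooth_onE[OF assms(1)] assms(2) by blast
  then show "\<exists>U h. open U \<and> x \<in> U \<and> csmooth U h \<and> (\<forall>y\<in>T \<inter> U. h y = g y)"
    using assms(2,3) by (intro exI[of _ U] exI[of _ h]) auto
qed

lemma smooth_on_subset: "smooth_on S f \<Longrightarrow> T \<subseteq> S \<Longrightarrow> smooth_on T f"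
  by (erule smooth_on_eq_on) auto

lemma smooth_on_cong: "smooth_on S f \<Longrightarrow> (\<And>x. x \<in> S \<Longrightarrow> f x = g x) \<Longrightarrow> smooth_on S g"
  by (erule smooth_on_eq_on) auto

lemma smooth_on_local:
  assumes "\<And>x. x \<in> S \<Longrightarrow> \<exists>U. open U \<and> x \<in> U \<and> smooth_on (S \<inter> U) f"
  shows "smooth_on S f"
  unfolding smooth_on_iff
proof
  fix x assume x: "x \<in> S"
  obtain U where U: "open U" "x \<in> U" "smooth_on (S \<inter> U) f" using assms[OF x] by blast
  obtain V g where V: "open V" "x \<in> V" "csmooth V g" "\<And>y. y \<in> S \<inter> U \<Longrightarrow> y \<in> V \<Longrightarrow> g y = f y"
    using smooth_onE[OF U(3), of x] U(2) x by blast
  show "\<exists>U g. open U \<and> x \<in> U \<and> csmooth U g \<and> (\<forall>y\<in>S \<inter> U. g y = f y)"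
    by (rule exI[of _ "U \<inter> V"], rule exI[of _ g])
       (use U V csmooth_subset[OF V(3), of "U \<inter> V"] in auto)
qed

lemma csmooth_imp_smooth_on: "csmooth U f \<Longrightarrow> open U \<Longrightarrow> S \<subseteq> U \<Longrightarrow> smooth_on S f"
  unfolding smooth_on_iff by blast

lemma smooth_on_open:
  assumes "open S"
  shows "smooth_on S f \<longleftrightarrow> csmooth S f"
proof
  assume s: "smooth_on S f"
  show "csmooth S f"
  proof (rule csmooth_local)
    fix x assume "x \<in> S"
    then obtain U g where U: "open U" "x \<in> U" "csmooth U g" "\<And>y. y \<in> S \<Longrightarrow> y \<in> U \<Longrightarrow> g y = f y"
      using smooth_onE[OF s] by blast
    have "csmooth (S \<inter> U) f"
      by (rule csmooth_cong[OF _ _ csmooth_subset[OF U(3)]]) (use U assms in auto)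
    then show "\<exists>V. open V \<and> x \<in> V \<and> csmooth (S \<inter> V) f" using U by blast
  qed
qed (use assms csmooth_imp_smooth_on in blast)

lemma smooth_on_continuous:
  assumes "smooth_on S f"
  shows "continuous_on S f"
  unfolding continuous_on_eq_continuous_within
proof
  fix x assume x: "x \<in> S"
  obtain U g where U: "open U" "x \<in> U" "csmooth U g" "\<And>y. y \<in> S \<Longrightarrow> y \<in> U \<Longrightarrow> g y = f y"
    using smooth_onE[OF assms x] by blast
  have "continuous_on (S \<inter> U) g" using csmooth_continuous[OF U(3)] continuous_on_subset by blast
  then have "continuous_on (S \<inter> U) f" by (rule continuous_on_eq) (use U in auto)
  then have "continuous (at x within S \<inter> U) f" using x U by (simp add: continuous_on_eq_continuous_within)
  moreover have "at x within S = at x within (S \<inter> U)"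
    by (rule at_within_nhd[of _ U]) (use U in auto)
  ultimately show "continuous (at x within S) f" by simp
qed

lemma smooth_on_compose:
  fixes f :: "'a::real_normed_vector \<Rightarrow> 'b::euclidean_space" and g :: "'b \<Rightarrow> 'c::real_normed_vector"
  assumes f: "smooth_on S f" and g: "smooth_on T g" and "f ` S \<subseteq> T"
  shows "smooth_on S (\<lambda>x. g (f x))"
  unfolding smooth_on_iff
proof
  fix x assume x: "x \<in> S"
  obtain U f' where U: "open U" "x \<in> U" "csmooth U f'" "\<And>y. y \<in> S \<Longrightarrow> y \<in> U \<Longrightarrow> f' y = f y"
    using smooth_onE[OF f x] by blast
  obtain V g' where V: "open V" "f x \<in> V" "csmooth V g'" "\<And>y. y \<in> T \<Longrightarrow> y \<in> V \<Longrightarrow> g' y = g y"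
    using smooth_onE[OF g, of "f x"] x assms(3) by blast
  let ?W = "U \<inter> f' -` V"
  have W: "open ?W"
    using continuous_open_preimage[OF csmooth_continuous[OF U(3)] U(1) V(1)] .
  have "csmooth ?W (\<lambda>x. g' (f' x))"
    by (rule csmooth_compose[OF W V(1) csmooth_subset[OF U(3)] V(3)]) auto
  moreover have "\<forall>y\<in>S \<inter> ?W. g' (f' y) = g (f y)" using U(4) V(4) assms(3) by auto
  moreover have "x \<in> ?W" using U V x by auto
  ultimately show "\<exists>U h. open U \<and> x \<in> U \<and> csmooth U h \<and> (\<forall>y\<in>S \<inter> U. h y = g (f y))"
    using W by (intro exI[of _ ?W] exI[of _ "\<lambda>x. g' (f' x)"]) simp
qed

lemma smooth_on_Pair:
  assumes f: "smooth_on S f" and g: "smooth_on S g"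
  shows "smooth_on S (\<lambda>x. (f x, g x))"
  unfolding smooth_on_iff
proof
  fix x assume x: "x \<in> S"
  obtain U f' where U: "open U" "x \<in> U" "csmooth U f'" "\<And>y. y \<in> S \<Longrightarrow> y \<in> U \<Longrightarrow> f' y = f y"
    using smooth_onE[OF f x] by blast
  obtain V g' where V: "open V" "x \<in> V" "csmooth V g'" "\<And>y. y \<in> S \<Longrightarrow> y \<in> V \<Longrightarrow> g' y = g y"
    using smooth_onE[OF g x] by blast
  have W: "open (U \<inter> V)" using U V by auto
  have "csmooth (U \<inter> V) (\<lambda>x. (f' x, g' x))"
    by (rule csmooth_Pair[OF W csmooth_subset[OF U(3)] csmooth_subset[OF V(3)]]) auto
  then show "\<exists>U h. open U \<and> x \<in> U \<and> csmooth U h \<and> (\<forall>y\<in>S \<inter> U. h y = (f y, g y))"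
    using W U V by (intro exI[of _ "U \<inter> V"] exI[of _ "\<lambda>x. (f' x, g' x)"]) simp
qed

section \<open>Straightening half-space patches\<close>

lemma half_space_zero [simp]: "half_space 0 = UNIV"
  by (simp add: half_space_def)

text \<open>From any of its points a half-space contains a short segment along every coordinate
  axis, in at least one of the two directions. So a derivative is determined by the values on the
  half-space, even at a point of the bounding hyperplane.\<close>

lemma frechet_derivative_ident_half_space:
  fixes F :: "'e::euclidean_space \<Rightarrow> 'e"
  assumes "open Q" "x0 \<in> Q" "x0 \<in> half_space b" and F: "(F has_derivative D) (at x0)"
    and id: "\<And>x. x \<in> half_space b \<inter> Q \<Longrightarrow> F x = x"
  shows "D = (\<lambda>v. v)"
proof (rule frechet_derivative_unique_within)
  let ?S = "half_space b \<inter> Q"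
  show "(F has_derivative D) (at x0 within ?S)" using F by (rule has_derivative_at_withinI)
  show "(F has_derivative (\<lambda>v. v)) (at x0 within ?S)"
    by (rule has_derivative_transform[OF _ _ has_derivative_ident]) (use assms id in auto)
  fix i :: 'e and e :: real assume i: "i \<in> Basis" and e: "e > 0"
  obtain r where r: "r > 0" "ball x0 r \<subseteq> Q" using assms(1,2) open_contains_ball by blast
  \<comment> \<open>The sign is chosen such that moving along \<open>i\<close> by \<open>d\<close>
    does not decrease the inner product with \<open>b\<close>.\<close>
  define d where "d = (if i \<bullet> b \<ge> 0 then min e r / 2 else - (min e r / 2))"
  have d: "0 < \<bar>d\<bar>" "\<bar>d\<bar> < e" "\<bar>d\<bar> < r" "d * (i \<bullet> b) \<ge> 0"
    using e r by (auto simp: d_def zero_le_mult_iff min_def)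
  have "x0 + d *\<^sub>R i \<in> ball x0 r" using d i by (simp add: dist_norm)
  moreover have "x0 + d *\<^sub>R i \<in> half_space b"
    using assms(3) d(4) by (simp add: half_space_def inner_add_left)
  ultimately show "\<exists>d. 0 < \<bar>d\<bar> \<and> \<bar>d\<bar> < e \<and> x0 + d *\<^sub>R i \<in> ?S" using d r by blast
qed

text \<open>The smooth extension of \<open>k\<close> is a left inverse of a smooth extension of \<open>h\<close> on the half-space,
  hence has invertible derivative.\<close>

theorem half_space_patch:
  fixes h :: "'e::euclidean_space \<Rightarrow> 'd::euclidean_space"
  assumes dim: "DIM('e) = DIM('d)" and "open Q" "x0 \<in> Q" "x0 \<in> half_space b"
    and h: "smooth_on (half_space b \<inter> Q) h" and k: "smooth_on (h ` (half_space b \<inter> Q)) k"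
    and kh: "\<And>x. x \<in> half_space b \<inter> Q \<Longrightarrow> k (h x) = x"
    and "open P" and P: "h ` (half_space b \<inter> Q) = S \<inter> P"
  obtains P' Q' \<beta> g where "open P'" "h x0 \<in> P'" "P' \<subseteq> P" "open Q'" "homeomorphism P' Q' \<beta> g"
    "csmooth P' \<beta>" "csmooth Q' g" "\<And>y. y \<in> P' \<Longrightarrow> y \<in> S \<longleftrightarrow> \<beta> y \<in> half_space b"
    "\<And>y. y \<in> P' \<Longrightarrow> y \<in> S \<Longrightarrow> \<beta> y = k y"
proof -
  let ?H = "half_space b \<inter> Q"
  have x0: "x0 \<in> ?H" using assms by blast
  obtain Q1 h' where Q1: "open Q1" "x0 \<in> Q1" "csmooth Q1 h'" "\<And>y. y \<in> ?H \<Longrightarrow> y \<in> Q1 \<Longrightarrow> h' y = h y"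
    using smooth_onE[OF h x0] by blast
  obtain P1 k' where P1: "open P1" "h x0 \<in> P1" "csmooth P1 k'" "\<And>y. y \<in> h ` ?H \<Longrightarrow> y \<in> P1 \<Longrightarrow> k' y = k y"
    using smooth_onE[OF k, of "h x0"] x0 by blast
  have hx0: "h' x0 = h x0" using Q1 x0 by blast
  define Q2 where "Q2 = Q \<inter> (Q1 \<inter> h' -` (P1 \<inter> P))"
  have Q2: "open Q2"
    unfolding Q2_def using continuous_open_preimage[OF csmooth_continuous[OF Q1(3)] Q1(1), of "P1 \<inter> P"]
      \<open>open P\<close> \<open>open Q\<close> P1(1) by blast
  have "h x0 \<in> P" using P x0 by blast
  then have x0Q2: "x0 \<in> Q2" using P1 Q1 hx0 assms by (auto simp: Q2_def)
  have k'h': "k' (h' x) = x" if "x \<in> half_space b \<inter> Q2" for x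
  proof -
    have "x \<in> ?H" "x \<in> Q1" "h' x \<in> P1" using that by (auto simp: Q2_def)
    then show ?thesis using Q1(4) P1(4)[of "h x"] kh by auto
  qed
  have dh: "(h' has_derivative frechet_derivative h' (at x0)) (at x0)"
    using csmooth_has_derivative[OF Q1(3,2)] .
  have dk: "(k' has_derivative frechet_derivative k' (at (h x0))) (at (h' x0))"
    using csmooth_has_derivative[OF P1(3,2)] hx0 by simp
  have "(\<lambda>v. frechet_derivative k' (at (h x0)) (frechet_derivative h' (at x0) v)) = (\<lambda>v. v)"
    by (rule frechet_derivative_ident_half_space[OF Q2 x0Q2 assms(4) has_derivative_compose[OF dh dk] k'h'])
  then have e: "frechet_derivative k' (at (h x0)) (frechet_derivative h' (at x0) v) = v" for v
    by (rule fun_cong)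
  have lk: "linear (frechet_derivative k' (at (h x0)))" using dk by (rule has_derivative_linear)
  have "surj (frechet_derivative k' (at (h x0)))" using e by (metis surjI)
  then have "inj (frechet_derivative k' (at (h x0)))"
    using lk dim by (intro linear_surjective_imp_injective) simp_all
  from csmooth_inverse_function[OF dim[symmetric] P1(1,3,2) this]
  obtain U V g where U: "open U" "h x0 \<in> U" "U \<subseteq> P1" "open V" "homeomorphism U V k' g" "csmooth V g"
    by metis
  have inj: "y = y'" if "y \<in> U" "y' \<in> U" "k' y = k' y'" for y y'
    using U(5) that unfolding homeomorphism_def by metis
  define R where "R = Q2 \<inter> (Q1 \<inter> h' -` (U \<inter> P))"
  have R: "open R"
    unfolding R_def using continuous_open_preimage[OF csmooth_continuous[OF Q1(3)] Q1(1), of "U \<inter> P"]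
      \<open>open P\<close> Q2 U(1) by blast
  have x0R: "x0 \<in> R" using x0Q2 Q1(2) hx0 U(2) \<open>h x0 \<in> P\<close> by (auto simp: R_def)
  \<comment> \<open>For \<open>y\<close> in this set with \<open>k' y\<close> in the half-space,
    \<open>h' (k' y)\<close> is a point of \<open>S\<close> that lies in \<open>U\<close> and has
    the same image under \<open>k'\<close>; injectivity of \<open>k'\<close> on \<open>U\<close>
    identifies it with \<open>y\<close>.\<close>
  define P' where "P' = P \<inter> (U \<inter> k' -` R)"
  have ck: "continuous_on U k'" using csmooth_continuous[OF P1(3)] U(3) continuous_on_subset by blast
  have oP': "open P'"
    unfolding P'_def using continuous_open_preimage[OF ck U(1) R] \<open>open P\<close> by blast
  have k'x0: "k' (h x0) = x0" using k'h'[of x0] x0 x0Q2 hx0 by simp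
  have hP': "h x0 \<in> P'" using U(2) k'x0 x0R \<open>h x0 \<in> P\<close> by (auto simp: P'_def)
  have hom: "homeomorphism P' (k' ` P') k' g"
    by (rule homeomorphism_of_subsets[OF U(5)]) (auto simp: P'_def)
  have hm: "\<And>x. x \<in> U \<Longrightarrow> g (k' x) = x" "\<And>x. x \<in> U \<Longrightarrow> k' x \<in> V" "\<And>y. y \<in> V \<Longrightarrow> k' (g y) = y"
    using U(5) unfolding homeomorphism_def by blast+
  have V': "k' ` P' = V \<inter> g -` P'"
  proof (intro set_eqI iffI)
    fix z assume "z \<in> k' ` P'"
    then obtain y where y: "y \<in> P'" "z = k' y" by blast
    then have "y \<in> U" by (simp add: P'_def)
    then show "z \<in> V \<inter> g -` P'" using y hm by simp
  next
    fix z assume z: "z \<in> V \<inter> g -` P'"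
    then have "z = k' (g z)" using hm(3)[of z] by simp
    then show "z \<in> k' ` P'" using z by blast
  qed
  have oQ': "open (k' ` P')"
    unfolding V' using continuous_open_preimage[OF csmooth_continuous[OF U(6)] U(4) oP'] .
  show thesis
  proof (rule that[OF oP' hP' _ oQ' hom])
    show "P' \<subseteq> P" by (auto simp: P'_def)
    show "csmooth P' k'" by (rule csmooth_subset[OF P1(3)]) (use U(3) in \<open>auto simp: P'_def\<close>)
    show "csmooth (k' ` P') g" by (rule csmooth_subset[OF U(6)]) (simp add: V')
    fix y assume y: "y \<in> P'"
    have yk: "k' y = k y" if "y \<in> S"
      using P1(4)[of y] P y U(3) that by (auto simp: P'_def)
    then show "k' y = k y" if "y \<in> S" using that .
    show "y \<in> S \<longleftrightarrow> k' y \<in> half_space b"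
    proof
      assume "y \<in> S"
      then have "y \<in> h ` ?H" using P y by (auto simp: P'_def)
      then show "k' y \<in> half_space b" using kh yk[OF \<open>y \<in> S\<close>] by auto
    next
      assume k: "k' y \<in> half_space b"
      let ?y = "h' (k' y)"
      have yR: "k' y \<in> R" using y by (auto simp: P'_def)
      then have a: "k' y \<in> ?H" "k' y \<in> Q1" "?y \<in> U" using k by (auto simp: R_def Q2_def)
      then have "?y = h (k' y)" using Q1(4) by blast
      then have "?y \<in> S" using a P by blast
      moreover have "k' ?y = k' y" using k'h' k yR by (auto simp: R_def)
      then have "?y = y" using inj a(3) y by (auto simp: P'_def)
      ultimately show "y \<in> S" by simp
    qed
  qed
qed

section \<open>Smooth maps between manifolds\<close>

text \<open>The part of \<open>smooth_mfd\<close> that computations in charts rely on: separation,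
  countability and the shape of the chart images are left out. In this form the notion passes to
  arbitrary products, where chart images may have corners.\<close>

definition premfd :: "('a, 'e::euclidean_space) mfd \<Rightarrow> bool" where
  "premfd M \<longleftrightarrow>
     (\<Union>(U, \<phi>)\<in>atlas M. U) = pts M \<and>
     (\<forall>(U, \<phi>)\<in>atlas M. openin (mtop M) U \<and>
        homeomorphic_map (subtopology (mtop M) U) (top_of_set (\<phi> ` U)) \<phi>) \<and>
     (\<forall>(U, \<phi>)\<in>atlas M. \<forall>(V, \<psi>)\<in>atlas M. smooth_on (\<phi> ` (U \<inter> V)) (\<psi> \<circ> inv_into U \<phi>))"

lemma smooth_mfd_premfd: "smooth_mfd M \<Longrightarrow> premfd M"
  unfolding smooth_mfd_def premfd_def by blast

lemma premfdI:
  assumes "\<And>x. x \<in> pts M \<Longrightarrow> \<exists>U \<phi>. (U, \<phi>) \<in> atlas M \<and> x \<in> U"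
    and "\<And>U \<phi>. (U, \<phi>) \<in> atlas M \<Longrightarrow> openin (mtop M) U"
    and "\<And>U \<phi>. (U, \<phi>) \<in> atlas M \<Longrightarrow> homeomorphic_map (subtopology (mtop M) U) (top_of_set (\<phi> ` U)) \<phi>"
    and "\<And>U \<phi> V \<psi>. (U, \<phi>) \<in> atlas M \<Longrightarrow> (V, \<psi>) \<in> atlas M \<Longrightarrow>
      smooth_on (\<phi> ` (U \<inter> V)) (\<lambda>y. \<psi> (inv_into U \<phi> y))"
  shows "premfd M"
proof -
  have sub: "U \<subseteq> pts M" if "(U, \<phi>) \<in> atlas M" for U \<phi>
    using assms(2)[OF that] by (rule openin_subset)
  have "(\<Union>(U, \<phi>)\<in>atlas M. U) = pts M"
  proof (intro equalityI subsetI)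
    fix x assume "x \<in> (\<Union>(U, \<phi>)\<in>atlas M. U)"
    then obtain U \<phi> where "(U, \<phi>) \<in> atlas M" "x \<in> U" by blast
    then show "x \<in> pts M" using sub by blast
  next
    fix x assume "x \<in> pts M"
    then obtain U \<phi> where "(U, \<phi>) \<in> atlas M" "x \<in> U" using assms(1) by blast
    then show "x \<in> (\<Union>(U, \<phi>)\<in>atlas M. U)" by blast
  qed
  moreover have "\<forall>c\<in>atlas M. case c of (U, \<phi>) \<Rightarrow> openin (mtop M) U \<and>
      homeomorphic_map (subtopology (mtop M) U) (top_of_set (\<phi> ` U)) \<phi>"
    by (auto simp: assms(2,3))
  moreover have "\<forall>c\<in>atlas M. case c of (U, \<phi>) \<Rightarrow> \<forall>d\<in>atlas M. case d of (V, \<psi>) \<Rightarrow>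
      smooth_on (\<phi> ` (U \<inter> V)) (\<psi> \<circ> inv_into U \<phi>)"
    by (auto simp: assms(4) comp_def)
  ultimately show ?thesis unfolding premfd_def by simp
qed

lemma chart_open: "premfd M \<Longrightarrow> (U, \<phi>) \<in> atlas M \<Longrightarrow> openin (mtop M) U"
  unfolding premfd_def by blast

lemma chart_subset: "premfd M \<Longrightarrow> (U, \<phi>) \<in> atlas M \<Longrightarrow> U \<subseteq> pts M"
  using chart_open openin_subset by metis

lemma chart_homeo:
  "premfd M \<Longrightarrow> (U, \<phi>) \<in> atlas M \<Longrightarrow> homeomorphic_map (subtopology (mtop M) U) (top_of_set (\<phi> ` U)) \<phi>"
  unfolding premfd_def by blast

lemma chart_inj: "premfd M \<Longrightarrow> (U, \<phi>) \<in> atlas M \<Longrightarrow> inj_on \<phi> U"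
  using chart_homeo[of M U \<phi>] chart_subset[of M U \<phi>] homeomorphic_imp_injective_map
  by (metis inf.absorb_iff2 topspace_subtopology)

lemma chart_inv: "premfd M \<Longrightarrow> (U, \<phi>) \<in> atlas M \<Longrightarrow> x \<in> U \<Longrightarrow> inv_into U \<phi> (\<phi> x) = x"
  using chart_inj inv_into_f_f by metis

lemma chart_trans:
  "premfd M \<Longrightarrow> (U, \<phi>) \<in> atlas M \<Longrightarrow> (V, \<psi>) \<in> atlas M \<Longrightarrow>
    smooth_on (\<phi> ` (U \<inter> V)) (\<lambda>y. \<psi> (inv_into U \<phi> y))"
  unfolding premfd_def comp_def by blast

lemma chart_at:
  assumes "premfd M" "x \<in> pts M"
  obtains U \<phi> where "(U, \<phi>) \<in> atlas M" "x \<in> U"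
  using assms unfolding premfd_def by blast

text \<open>The image of a chart need not be open in the model space, so a neighbourhood
  \<open>G\<close> is described by an open \<open>Q\<close> that is compared with \<open>G\<close>
  only on the chart domain.\<close>

lemma chart_nbhd:
  assumes M: "premfd M" "(U, \<phi>) \<in> atlas M" and G: "openin (mtop M) G" "x \<in> U" "x \<in> G"
  obtains Q where "open Q" "\<phi> x \<in> Q" "\<And>y. y \<in> U \<Longrightarrow> \<phi> y \<in> Q \<Longrightarrow> y \<in> G"
proof -
  have "openin (subtopology (mtop M) U) (U \<inter> G)"
    using G(1) by (simp add: openin_subtopology_Int2)
  then have "openin (top_of_set (\<phi> ` U)) (\<phi> ` (U \<inter> G))"
    using homeomorphic_imp_open_map[OF chart_homeo[OF M]] by (simp add: open_map_def)
  then obtain Q where Q: "open Q" "\<phi> ` (U \<inter> G) = \<phi> ` U \<inter> Q" by (auto simp: openin_open)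
  show thesis
  proof (rule that[OF Q(1)])
    show "\<phi> x \<in> Q" using Q(2) G by blast
    fix y assume "y \<in> U" "\<phi> y \<in> Q"
    then obtain z where "z \<in> U \<inter> G" "\<phi> y = \<phi> z" using Q(2) by blast
    then show "y \<in> G" using chart_inj[OF M] \<open>y \<in> U\<close> by (metis IntD1 IntD2 inj_onD)
  qed
qed

lemma smooth_map_onD:
  "smooth_map_on M A N f \<Longrightarrow> (U, \<phi>) \<in> atlas M \<Longrightarrow> (V, \<psi>) \<in> atlas N \<Longrightarrow>
    smooth_on (\<phi> ` {x \<in> A \<inter> U. f x \<in> V}) (\<lambda>y. \<psi> (f (inv_into U \<phi> y)))"
  unfolding smooth_map_on_def comp_def by blast

lemma smooth_map_onI:
  assumes "A \<subseteq> pts M" "continuous_map (subtopology (mtop M) A) (mtop N) f"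
    "\<And>U \<phi> V \<psi>. (U, \<phi>) \<in> atlas M \<Longrightarrow> (V, \<psi>) \<in> atlas N \<Longrightarrow>
      smooth_on (\<phi> ` {x \<in> A \<inter> U. f x \<in> V}) (\<lambda>y. \<psi> (f (inv_into U \<phi> y)))"
  shows "smooth_map_on M A N f"
  using assms unfolding smooth_map_on_def comp_def by blast

lemma smooth_map_on_continuous: "smooth_map_on M A N f \<Longrightarrow> continuous_map (subtopology (mtop M) A) (mtop N) f"
  unfolding smooth_map_on_def by blast

lemma smooth_map_on_pts: "smooth_map_on M A N f \<Longrightarrow> A \<subseteq> pts M"
  unfolding smooth_map_on_def by blast

lemma smooth_map_on_image: "smooth_map_on M A N f \<Longrightarrow> x \<in> A \<Longrightarrow> f x \<in> pts N"
  using continuous_map_image_subset_topspace[OF smooth_map_on_continuous, of M A N f] smooth_map_on_pts[of M A N f]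
  by (auto simp: image_subset_iff)

lemma smooth_map_on_nbhd:
  assumes "smooth_map_on M A N f" "openin (mtop N) V"
  obtains G where "openin (mtop M) G" "{x \<in> A. f x \<in> V} = A \<inter> G"
proof -
  have "openin (subtopology (mtop M) A) {x \<in> topspace (subtopology (mtop M) A). f x \<in> V}"
    using smooth_map_on_continuous[OF assms(1)] assms(2) by (rule openin_continuous_map_preimage)
  moreover have "topspace (subtopology (mtop M) A) = A" using smooth_map_on_pts[OF assms(1)] by auto
  ultimately obtain G where "openin (mtop M) G" "{x \<in> A. f x \<in> V} = G \<inter> A"
    by (auto simp: openin_subtopology)
  then show thesis using that by blast
qed

lemma smooth_map_on_subset: "smooth_map_on M A N f \<Longrightarrow> B \<subseteq> A \<Longrightarrow> smooth_map_on M B N f"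
proof (rule smooth_map_onI)
  assume *: "smooth_map_on M A N f" "B \<subseteq> A"
  show "B \<subseteq> pts M" using smooth_map_on_pts[OF *(1)] *(2) by blast
  show "continuous_map (subtopology (mtop M) B) (mtop N) f"
    by (rule continuous_map_from_subtopology_mono[OF smooth_map_on_continuous[OF *(1)] *(2)])
  fix U \<phi> V \<psi> assume "(U, \<phi>) \<in> atlas M" "(V, \<psi>) \<in> atlas N"
  from smooth_map_onD[OF *(1) this]
  show "smooth_on (\<phi> ` {x \<in> B \<inter> U. f x \<in> V}) (\<lambda>y. \<psi> (f (inv_into U \<phi> y)))"
    by (rule smooth_on_subset) (use *(2) in auto)
qed

lemma smooth_map_on_cong:
  assumes f: "smooth_map_on M A N f" and M: "premfd M" and fg: "\<And>x. x \<in> A \<Longrightarrow> f x = g x"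
  shows "smooth_map_on M A N g"
proof (rule smooth_map_onI)
  show "A \<subseteq> pts M" using smooth_map_on_pts[OF f] .
  show "continuous_map (subtopology (mtop M) A) (mtop N) g"
    by (rule continuous_map_eq[OF smooth_map_on_continuous[OF f]]) (use fg in auto)
  fix U \<phi> V \<psi> assume *: "(U, \<phi>) \<in> atlas M" "(V, \<psi>) \<in> atlas N"
  have "{x \<in> A \<inter> U. g x \<in> V} = {x \<in> A \<inter> U. f x \<in> V}" using fg by auto
  moreover have "smooth_on (\<phi> ` {x \<in> A \<inter> U. f x \<in> V}) (\<lambda>y. \<psi> (g (inv_into U \<phi> y)))"
    by (rule smooth_on_cong[OF smooth_map_onD[OF f *]]) (use chart_inv[OF M *(1)] fg in auto)
  ultimately show "smooth_on (\<phi> ` {x \<in> A \<inter> U. g x \<in> V}) (\<lambda>y. \<psi> (g (inv_into U \<phi> y)))"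
    by simp
qed

lemma continuous_map_local:
  assumes "A \<subseteq> topspace X"
    "\<And>x. x \<in> A \<Longrightarrow> \<exists>G. openin X G \<and> x \<in> G \<and> continuous_map (subtopology X (A \<inter> G)) Y f"
  shows "continuous_map (subtopology X A) Y f"
  unfolding continuous_map
proof (intro conjI allI impI)
  have t: "topspace (subtopology X A) = A" using assms(1) by auto
  have t': "topspace (subtopology X (A \<inter> G)) = A \<inter> G" for G using assms(1) by auto
  show "f ` topspace (subtopology X A) \<subseteq> topspace Y"
    unfolding t
  proof
    fix y assume "y \<in> f ` A"
    then obtain x where x: "x \<in> A" "y = f x" by blast
    obtain G where "openin X G" "x \<in> G" "continuous_map (subtopology X (A \<inter> G)) Y f" using assms(2)[OF x(1)] by blast
    then show "y \<in> topspace Y" using continuous_map_image_subset_topspace[of "subtopology X (A \<inter> G)" Y f] x t' by auto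
  qed
  fix V assume V: "openin Y V"
  show "openin (subtopology X A) {x \<in> topspace (subtopology X A). f x \<in> V}"
    unfolding t
  proof (subst openin_subopen, intro ballI)
    fix x assume x: "x \<in> {x \<in> A. f x \<in> V}"
    then obtain G where G: "openin X G" "x \<in> G" "continuous_map (subtopology X (A \<inter> G)) Y f" using assms(2) by blast
    have "openin (subtopology X (A \<inter> G)) {x \<in> A \<inter> G. f x \<in> V}"
      using openin_continuous_map_preimage[OF G(3) V] unfolding t' .
    moreover have "openin (subtopology X A) (A \<inter> G)" using G(1) by (simp add: openin_subtopology_Int2)
    moreover have "subtopology X (A \<inter> G) = subtopology (subtopology X A) (A \<inter> G)"
      by (simp add: subtopology_subtopology inf.absorb2)
    ultimately have "openin (subtopology X A) {x \<in> A \<inter> G. f x \<in> V}"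
      using openin_open_subtopology[of "subtopology X A" "A \<inter> G"] by metis
    then show "\<exists>T. openin (subtopology X A) T \<and> x \<in> T \<and> T \<subseteq> {x \<in> A. f x \<in> V}"
      using x G(2) by (intro exI[of _ "{x \<in> A \<inter> G. f x \<in> V}"]) auto
  qed
qed

lemma smooth_map_on_local:
  assumes M: "premfd M" and "A \<subseteq> pts M"
    and loc: "\<And>x. x \<in> A \<Longrightarrow> \<exists>G. openin (mtop M) G \<and> x \<in> G \<and> smooth_map_on M (A \<inter> G) N f"
  shows "smooth_map_on M A N f"
proof (rule smooth_map_onI[OF assms(2)])
  show "continuous_map (subtopology (mtop M) A) (mtop N) f"
  proof (rule continuous_map_local[OF assms(2)])
    fix x assume "x \<in> A"
    then obtain G where "openin (mtop M) G" "x \<in> G" "smooth_map_on M (A \<inter> G) N f" using loc by blast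
    then show "\<exists>G. openin (mtop M) G \<and> x \<in> G \<and> continuous_map (subtopology (mtop M) (A \<inter> G)) (mtop N) f"
      by (intro exI[of _ G] conjI smooth_map_on_continuous)
  qed
  fix U \<phi> V \<psi> assume c: "(U, \<phi>) \<in> atlas M" "(V, \<psi>) \<in> atlas N"
  show "smooth_on (\<phi> ` {x \<in> A \<inter> U. f x \<in> V}) (\<lambda>y. \<psi> (f (inv_into U \<phi> y)))"
  proof (rule smooth_on_local)
    fix y assume "y \<in> \<phi> ` {x \<in> A \<inter> U. f x \<in> V}"
    then obtain x where x: "y = \<phi> x" "x \<in> A" "x \<in> U" "f x \<in> V" by blast
    obtain G where G: "openin (mtop M) G" "x \<in> G" "smooth_map_on M (A \<inter> G) N f" using loc[OF x(2)] by blast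
    obtain Q where Q: "open Q" "\<phi> x \<in> Q" "\<And>z. z \<in> U \<Longrightarrow> \<phi> z \<in> Q \<Longrightarrow> z \<in> G"
      using chart_nbhd[OF M c(1) G(1) x(3) G(2)] by blast
    have "smooth_on (\<phi> ` {x \<in> A \<inter> U. f x \<in> V} \<inter> Q) (\<lambda>y. \<psi> (f (inv_into U \<phi> y)))"
      by (rule smooth_on_subset[OF smooth_map_onD[OF G(3) c]]) (use Q(3) in auto)
    then show "\<exists>Q. open Q \<and> y \<in> Q \<and> smooth_on (\<phi> ` {x \<in> A \<inter> U. f x \<in> V} \<inter> Q) (\<lambda>y. \<psi> (f (inv_into U \<phi> y)))"
      using Q x(1) by blast
  qed
qed

lemma smooth_map_on_compose:
  fixes M :: "('a, 'e::euclidean_space) mfd" and N :: "('b, 'd::euclidean_space) mfd"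
    and P :: "('c, 'p::euclidean_space) mfd"
  assumes f: "smooth_map_on M A N f" and g: "smooth_map_on N B P g" and fA: "\<And>x. x \<in> A \<Longrightarrow> f x \<in> B"
    and M: "premfd M" and N: "premfd N"
  shows "smooth_map_on M A P (\<lambda>x. g (f x))"
proof (rule smooth_map_onI)
  show A: "A \<subseteq> pts M" using smooth_map_on_pts[OF f] .
  have "continuous_map (subtopology (mtop M) A) (subtopology (mtop N) B) f"
    using smooth_map_on_continuous[OF f] fA A by (auto simp: continuous_map_in_subtopology)
  from continuous_map_compose[OF this smooth_map_on_continuous[OF g]]
  show "continuous_map (subtopology (mtop M) A) (mtop P) (\<lambda>x. g (f x))" by (simp add: comp_def)
  fix U \<phi> W \<omega> assume U: "(U, \<phi>) \<in> atlas M" and W: "(W, \<omega>) \<in> atlas P"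
  show "smooth_on (\<phi> ` {x \<in> A \<inter> U. g (f x) \<in> W}) (\<lambda>y. \<omega> (g (f (inv_into U \<phi> y))))"
  \<comment> \<open>No single chart of \<open>N\<close> need contain the whole image; around each
    point one is inserted between \<open>f\<close> and \<open>g\<close>.\<close>
  proof (rule smooth_on_local)
    fix y assume "y \<in> \<phi> ` {x \<in> A \<inter> U. g (f x) \<in> W}"
    then obtain x where x: "y = \<phi> x" "x \<in> A" "x \<in> U" "g (f x) \<in> W" by blast
    have "f x \<in> pts N" using smooth_map_on_image[OF f x(2)] .
    then obtain V \<psi> where V: "(V, \<psi>) \<in> atlas N" "f x \<in> V" using chart_at[OF N] by blast
    obtain G where G: "openin (mtop M) G" "{x \<in> A. f x \<in> V} = A \<inter> G"
      using smooth_map_on_nbhd[OF f chart_open[OF N V(1)]] by blast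
    then have "x \<in> G" using x V by blast
    then obtain Q where Q: "open Q" "\<phi> x \<in> Q" "\<And>z. z \<in> U \<Longrightarrow> \<phi> z \<in> Q \<Longrightarrow> z \<in> G"
      using chart_nbhd[OF M U G(1) x(3)] by blast
    let ?S = "\<phi> ` {x \<in> A \<inter> U. g (f x) \<in> W} \<inter> Q"
    have S: "\<exists>x. y = \<phi> x \<and> x \<in> A \<and> x \<in> U \<and> f x \<in> V \<and> g (f x) \<in> W" if "y \<in> ?S" for y
      using that Q(3) G(2) by blast
    have "smooth_on ?S (\<lambda>y. \<psi> (f (inv_into U \<phi> y)))"
      by (rule smooth_on_subset[OF smooth_map_onD[OF f U V(1)]]) (use S in blast)
    then have "smooth_on ?S (\<lambda>y. \<omega> (g (inv_into V \<psi> (\<psi> (f (inv_into U \<phi> y))))))"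
    proof (rule smooth_on_compose[OF _ smooth_map_onD[OF g V(1) W]])
      show "(\<lambda>y. \<psi> (f (inv_into U \<phi> y))) ` ?S \<subseteq> \<psi> ` {x \<in> B \<inter> V. g x \<in> W}"
      proof (rule image_subsetI)
        fix y assume "y \<in> ?S"
        then obtain x where *: "y = \<phi> x" "x \<in> A" "x \<in> U" "f x \<in> V" "g (f x) \<in> W" using S by blast
        then show "\<psi> (f (inv_into U \<phi> y)) \<in> \<psi> ` {x \<in> B \<inter> V. g x \<in> W}"
          using chart_inv[OF M U *(3)] fA by auto
      qed
    qed
    then have "smooth_on ?S (\<lambda>y. \<omega> (g (f (inv_into U \<phi> y))))"
    proof (rule smooth_on_cong)
      fix y assume "y \<in> ?S"
      then obtain x where *: "y = \<phi> x" "x \<in> A" "x \<in> U" "f x \<in> V" using S by blast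
      then show "\<omega> (g (inv_into V \<psi> (\<psi> (f (inv_into U \<phi> y))))) = \<omega> (g (f (inv_into U \<phi> y)))"
        using chart_inv[OF M U *(3)] chart_inv[OF N V(1) *(4)] by simp
    qed
    then show "\<exists>Q. open Q \<and> y \<in> Q \<and> smooth_on (\<phi> ` {x \<in> A \<inter> U. g (f x) \<in> W} \<inter> Q) (\<lambda>y. \<omega> (g (f (inv_into U \<phi> y))))"
      using Q x(1) by blast
  qed
qed

section \<open>Vector spaces, products and subsets as manifolds\<close>

lemma mtop_euclid [simp]: "mtop euclid = euclidean" and atlas_euclid [simp]: "atlas euclid = {(UNIV, id)}"
  by (simp_all add: euclid_def)

lemma smooth_map_on_euclid: "smooth_map_on euclid S euclid f \<longleftrightarrow> smooth_on S f"
proof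
  assume s: "smooth_on S f"
  show "smooth_map_on euclid S euclid f"
  proof (rule smooth_map_onI)
    show "continuous_map (subtopology (mtop euclid) S) (mtop euclid) f"
      using smooth_on_continuous[OF s] by simp
  qed (use s in auto)
next
  assume "smooth_map_on euclid S euclid f"
  from smooth_map_onD[OF this, of UNIV id UNIV id] show "smooth_on S f" by simp
qed

lemma premfd_euclid: "premfd euclid"
proof (rule premfdI)
  fix U V :: "'a set" and \<phi> \<psi> :: "'a \<Rightarrow> 'a" assume *: "(U, \<phi>) \<in> atlas euclid" "(V, \<psi>) \<in> atlas euclid"
  then show "smooth_on (\<phi> ` (U \<inter> V)) (\<lambda>y. \<psi> (inv_into U \<phi> y))"
    by (auto intro: csmooth_imp_smooth_on[OF csmooth_ident])
  show "homeomorphic_map (subtopology (mtop euclid) U) (top_of_set (\<phi> ` U)) \<phi>"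
    using * by (simp add: homeomorphic_map_id)
qed auto

lemma chart_smooth:
  assumes M: "premfd M" and U: "(U, \<phi>) \<in> atlas M"
  shows "smooth_map_on M U euclid \<phi>"
proof (rule smooth_map_onI[OF chart_subset[OF M U]])
  show "continuous_map (subtopology (mtop M) U) (mtop euclid) \<phi>"
    using homeomorphic_imp_continuous_map[OF chart_homeo[OF M U]] by (simp add: continuous_map_in_subtopology)
  fix V \<psi> W \<omega> assume V: "(V, \<psi>) \<in> atlas M" and W: "(W, \<omega>) \<in> atlas (euclid :: ('b, 'b) mfd)"
  have "{x \<in> U \<inter> V. \<phi> x \<in> W} = V \<inter> U" using W by auto
  then show "smooth_on (\<psi> ` {x \<in> U \<inter> V. \<phi> x \<in> W}) (\<lambda>y. \<omega> (\<phi> (inv_into V \<psi> y)))"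
    using chart_trans[OF M V U] W by simp
qed

lemma chart_inverse_smooth:
  assumes M: "premfd M" and U: "(U, \<phi>) \<in> atlas M"
  shows "smooth_map_on euclid (\<phi> ` U) M (inv_into U \<phi>)"
proof (rule smooth_map_onI)
  have i: "inv_into U \<phi> (\<phi> x) = x" if "x \<in> U" for x using chart_inv[OF M U that] .
  have ts: "topspace (subtopology (mtop M) U) = U" using chart_subset[OF M U] by auto
  obtain g where g: "homeomorphic_maps (subtopology (mtop M) U) (top_of_set (\<phi> ` U)) \<phi> g"
    using chart_homeo[OF M U] homeomorphic_map_maps by blast
  then have "continuous_map (top_of_set (\<phi> ` U)) (mtop M) g" "\<And>x. x \<in> U \<Longrightarrow> g (\<phi> x) = x"
    using ts by (auto simp: homeomorphic_maps_def continuous_map_in_subtopology)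
  then show "continuous_map (subtopology (mtop euclid) (\<phi> ` U)) (mtop M) (inv_into U \<phi>)"
    by (simp, elim continuous_map_eq) (auto simp: i)
  fix V \<psi> W \<omega> assume V: "(V, \<psi>) \<in> atlas (euclid :: ('b, 'b) mfd)" and W: "(W, \<omega>) \<in> atlas M"
  have "{x \<in> \<phi> ` U \<inter> UNIV. inv_into U \<phi> x \<in> W} = \<phi> ` (U \<inter> W)" using i by auto
  then show "smooth_on (\<psi> ` {x \<in> \<phi> ` U \<inter> V. inv_into U \<phi> x \<in> W}) (\<lambda>y. \<omega> (inv_into U \<phi> (inv_into V \<psi> y)))"
    using V chart_trans[OF M U W] by simp
qed auto

lemma smooth_map_on_id:
  assumes M: "premfd M" and "A \<subseteq> pts M"
  shows "smooth_map_on M A M (\<lambda>x. x)"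
proof (rule smooth_map_onI[OF assms(2)])
  show "continuous_map (subtopology (mtop M) A) (mtop M) (\<lambda>x. x)"
    by (simp add: continuous_map_from_subtopology)
  fix U \<phi> V \<psi> assume c: "(U, \<phi>) \<in> atlas M" "(V, \<psi>) \<in> atlas M"
  show "smooth_on (\<phi> ` {x \<in> A \<inter> U. x \<in> V}) (\<lambda>y. \<psi> (inv_into U \<phi> y))"
    by (rule smooth_on_subset[OF chart_trans[OF M c]]) auto
qed

lemma smooth_map_on_const:
  assumes M: "premfd M" and "A \<subseteq> pts M" "c \<in> pts N"
  shows "smooth_map_on M A N (\<lambda>x. c)"
  by (rule smooth_map_onI[OF assms(2)])
     (use assms(3) in \<open>auto intro: csmooth_imp_smooth_on[OF csmooth_const[OF open_UNIV]]\<close>)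

lemma smooth_map_on_csmooth:
  assumes "smooth_map_on M A euclid f" "csmooth U h" "open U" "\<And>x. x \<in> A \<Longrightarrow> f x \<in> U" "premfd M"
  shows "smooth_map_on M A euclid (\<lambda>x. h (f x))"
  by (rule smooth_map_on_compose[OF assms(1) _ assms(4,5) premfd_euclid])
     (simp add: smooth_map_on_euclid smooth_on_open[OF assms(3)] assms(2))

lemma smooth_map_on_euclid_pts:
  fixes f :: "'a \<Rightarrow> 'b::euclidean_space"
  shows "smooth_map_on M A euclid f \<Longrightarrow> (U, \<phi>) \<in> atlas M \<Longrightarrow>
    smooth_on (\<phi> ` (A \<inter> U)) (\<lambda>y. f (inv_into U \<phi> y))"
  using smooth_map_onD[of M A euclid f U \<phi> UNIV id] by (simp add: Int_def)

lemma inv_into_map_prod: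
  assumes "inj_on \<phi> U" "inj_on \<psi> V" "u \<in> U" "v \<in> V"
  shows "inv_into (U \<times> V) (map_prod \<phi> \<psi>) (\<phi> u, \<psi> v) = (u, v)"
proof -
  have "inj_on (map_prod \<phi> \<psi>) (U \<times> V)" using assms(1,2) by (rule map_prod_inj_on)
  from inv_into_f_f[OF this, of "(u, v)"] show ?thesis using assms by simp
qed

lemma mtop_prod [simp]: "mtop (prod_mfd M N) = prod_topology (mtop M) (mtop N)"
  and atlas_prod: "atlas (prod_mfd M N) =
    {(U \<times> V, map_prod \<phi> \<psi>) | U \<phi> V \<psi>. (U, \<phi>) \<in> atlas M \<and> (V, \<psi>) \<in> atlas N}"
  by (simp_all add: prod_mfd_def)

lemma smooth_map_on_Pair:
  assumes f: "smooth_map_on M A N f" and g: "smooth_map_on M A P g"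
  shows "smooth_map_on M A (prod_mfd N P) (\<lambda>x. (f x, g x))"
proof (rule smooth_map_onI[OF smooth_map_on_pts[OF f]])
  show "continuous_map (subtopology (mtop M) A) (mtop (prod_mfd N P)) (\<lambda>x. (f x, g x))"
    using smooth_map_on_continuous[OF f] smooth_map_on_continuous[OF g] by (simp add: continuous_map_pairedI)
  fix U \<phi> V \<psi> assume U: "(U, \<phi>) \<in> atlas M" and "(V, \<psi>) \<in> atlas (prod_mfd N P)"
  then obtain V1 \<psi>1 V2 \<psi>2 where V: "V = V1 \<times> V2" "\<psi> = map_prod \<psi>1 \<psi>2" "(V1, \<psi>1) \<in> atlas N" "(V2, \<psi>2) \<in> atlas P"
    by (auto simp: atlas_prod)
  have "smooth_on (\<phi> ` {x \<in> A \<inter> U. (f x, g x) \<in> V}) (\<lambda>y. (\<psi>1 (f (inv_into U \<phi> y)), \<psi>2 (g (inv_into U \<phi> y))))"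
    by (intro smooth_on_Pair smooth_on_subset[OF smooth_map_onD[OF f U V(3)]]
        smooth_on_subset[OF smooth_map_onD[OF g U V(4)]]) (auto simp: V)
  then show "smooth_on (\<phi> ` {x \<in> A \<inter> U. (f x, g x) \<in> V})
      (\<lambda>y. \<psi> (f (inv_into U \<phi> y), g (inv_into U \<phi> y)))" by (simp add: V)
qed

lemma smooth_on_fst_snd: "smooth_on S fst" "smooth_on S snd"
  by (auto intro: csmooth_imp_smooth_on[OF csmooth_linear] bounded_linear_fst bounded_linear_snd)

lemma smooth_map_on_fst_snd:
  assumes M: "premfd M" and N: "premfd N" and A: "A \<subseteq> pts M \<times> pts N"
  shows "smooth_map_on (prod_mfd M N) A M fst" "smooth_map_on (prod_mfd M N) A N snd"
proof -
  have A': "A \<subseteq> pts (prod_mfd M N)" using A by simp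
  have cont: "continuous_map (subtopology (mtop (prod_mfd M N)) A) (mtop M) fst"
     "continuous_map (subtopology (mtop (prod_mfd M N)) A) (mtop N) snd"
    by (auto intro: continuous_map_from_subtopology continuous_map_fst continuous_map_snd)
  have *: "smooth_on (\<phi> ` {x \<in> A \<inter> U. fst x \<in> V1}) (\<lambda>y. \<psi>1 (fst (inv_into U \<phi> y)))"
    "smooth_on (\<phi> ` {x \<in> A \<inter> U. snd x \<in> V2}) (\<lambda>y. \<psi>2 (snd (inv_into U \<phi> y)))"
    if "(U, \<phi>) \<in> atlas (prod_mfd M N)" and V1: "(V1, \<psi>1) \<in> atlas M" and V2: "(V2, \<psi>2) \<in> atlas N" for U \<phi> V1 \<psi>1 V2 \<psi>2
  proof -
    obtain U1 \<phi>1 U2 \<phi>2 where U: "U = U1 \<times> U2" "\<phi> = map_prod \<phi>1 \<phi>2" "(U1, \<phi>1) \<in> atlas M" "(U2, \<phi>2) \<in> atlas N"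
      using \<open>(U, \<phi>) \<in> atlas (prod_mfd M N)\<close> by (auto simp: atlas_prod)
    have inv: "inv_into U \<phi> (\<phi> (u, v)) = (u, v)" "inv_into U1 \<phi>1 (\<phi>1 u) = u" "inv_into U2 \<phi>2 (\<phi>2 v) = v"
      if "u \<in> U1" "v \<in> U2" for u v
      using inv_into_map_prod[OF chart_inj[OF M U(3)] chart_inj[OF N U(4)] that] that
        chart_inv[OF M U(3)] chart_inv[OF N U(4)] by (simp_all add: U)
    have "smooth_on (\<phi> ` {x \<in> A \<inter> U. fst x \<in> V1}) (\<lambda>y. \<psi>1 (inv_into U1 \<phi>1 (fst y)))"
      by (rule smooth_on_compose[OF smooth_on_fst_snd(1) chart_trans[OF M U(3) V1]]) (auto simp: U)
    then show "smooth_on (\<phi> ` {x \<in> A \<inter> U. fst x \<in> V1}) (\<lambda>y. \<psi>1 (fst (inv_into U \<phi> y)))"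
      by (rule smooth_on_cong) (use inv in \<open>auto simp: U\<close>)
    have "smooth_on (\<phi> ` {x \<in> A \<inter> U. snd x \<in> V2}) (\<lambda>y. \<psi>2 (inv_into U2 \<phi>2 (snd y)))"
      by (rule smooth_on_compose[OF smooth_on_fst_snd(2) chart_trans[OF N U(4) V2]]) (auto simp: U)
    then show "smooth_on (\<phi> ` {x \<in> A \<inter> U. snd x \<in> V2}) (\<lambda>y. \<psi>2 (snd (inv_into U \<phi> y)))"
      by (rule smooth_on_cong) (use inv in \<open>auto simp: U\<close>)
  qed
  show "smooth_map_on (prod_mfd M N) A M fst"
  proof (rule smooth_map_onI[OF A' cont(1)])
    fix U \<phi> V \<psi> assume c: "(U, \<phi>) \<in> atlas (prod_mfd M N)" "(V, \<psi>) \<in> atlas M"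
    then obtain V2 \<psi>2 where "(V2, \<psi>2) \<in> atlas N" by (auto simp: atlas_prod)
    from *(1)[OF c this] show "smooth_on (\<phi> ` {x \<in> A \<inter> U. fst x \<in> V}) (\<lambda>y. \<psi> (fst (inv_into U \<phi> y)))" .
  qed
  show "smooth_map_on (prod_mfd M N) A N snd"
  proof (rule smooth_map_onI[OF A' cont(2)])
    fix U \<phi> V \<psi> assume c: "(U, \<phi>) \<in> atlas (prod_mfd M N)" "(V, \<psi>) \<in> atlas N"
    then obtain V2 \<psi>2 where "(V2, \<psi>2) \<in> atlas M" by (auto simp: atlas_prod)
    from *(2)[OF c(1) this c(2)] show "smooth_on (\<phi> ` {x \<in> A \<inter> U. snd x \<in> V}) (\<lambda>y. \<psi> (snd (inv_into U \<phi> y)))" .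
  qed
qed

lemma premfd_prod:
  assumes M: "premfd M" and N: "premfd N"
  shows "premfd (prod_mfd M N)"
proof (rule premfdI)
  fix x assume "x \<in> pts (prod_mfd M N)"
  then have "fst x \<in> pts M" "snd x \<in> pts N" by auto
  then obtain U \<phi> V \<psi> where "(U, \<phi>) \<in> atlas M" "fst x \<in> U" "(V, \<psi>) \<in> atlas N" "snd x \<in> V"
    using chart_at[OF M] chart_at[OF N] by metis
  then show "\<exists>U \<phi>. (U, \<phi>) \<in> atlas (prod_mfd M N) \<and> x \<in> U"
    by (intro exI[of _ "U \<times> V"] exI[of _ "map_prod \<phi> \<psi>"]) (auto simp: atlas_prod mem_Times_iff)
next
  fix U \<phi> assume "(U, \<phi>) \<in> atlas (prod_mfd M N)"
  then obtain U1 \<phi>1 U2 \<phi>2 where U: "U = U1 \<times> U2" "\<phi> = map_prod \<phi>1 \<phi>2" "(U1, \<phi>1) \<in> atlas M" "(U2, \<phi>2) \<in> atlas N"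
    by (auto simp: atlas_prod)
  show o: "openin (mtop (prod_mfd M N)) U"
    using chart_open[OF M U(3)] chart_open[OF N U(4)] by (simp add: U openin_prod_Times_iff)
  obtain g1 g2 where g: "homeomorphic_maps (subtopology (mtop M) U1) (top_of_set (\<phi>1 ` U1)) \<phi>1 g1"
    "homeomorphic_maps (subtopology (mtop N) U2) (top_of_set (\<phi>2 ` U2)) \<phi>2 g2"
    using chart_homeo[OF M U(3), unfolded homeomorphic_map_maps]
      chart_homeo[OF N U(4), unfolded homeomorphic_map_maps] by blast
  have "homeomorphic_maps (prod_topology (subtopology (mtop M) U1) (subtopology (mtop N) U2))
      (prod_topology (top_of_set (\<phi>1 ` U1)) (top_of_set (\<phi>2 ` U2))) (\<lambda>(x,y). (\<phi>1 x, \<phi>2 y)) (\<lambda>(x,y). (g1 x, g2 y))"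
    by (subst homeomorphic_maps_prod) (use g in blast)
  moreover have "(\<lambda>(x,y). (\<phi>1 x, \<phi>2 y)) = map_prod \<phi>1 \<phi>2" by (auto simp: fun_eq_iff)
  ultimately show "homeomorphic_map (subtopology (mtop (prod_mfd M N)) U) (top_of_set (\<phi> ` U)) \<phi>"
    unfolding homeomorphic_map_maps
    by (auto simp: U map_prod_surj_on[OF refl refl] subtopology_Times[symmetric] euclidean_product_topology[symmetric]
        simp del: euclidean_product_topology)
  fix V \<psi> assume "(V, \<psi>) \<in> atlas (prod_mfd M N)"
  then obtain V1 \<psi>1 V2 \<psi>2 where V: "V = V1 \<times> V2" "\<psi> = map_prod \<psi>1 \<psi>2" "(V1, \<psi>1) \<in> atlas M" "(V2, \<psi>2) \<in> atlas N"
    by (auto simp: atlas_prod)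
  have inv: "inv_into U \<phi> (\<phi> (u, v)) = (u, v)" "inv_into U1 \<phi>1 (\<phi>1 u) = u" "inv_into U2 \<phi>2 (\<phi>2 v) = v"
    if "u \<in> U1" "v \<in> U2" for u v
    using inv_into_map_prod[OF chart_inj[OF M U(3)] chart_inj[OF N U(4)] that] that
      chart_inv[OF M U(3)] chart_inv[OF N U(4)] by (simp_all add: U)
  have "smooth_on (\<phi> ` (U \<inter> V)) (\<lambda>y. (\<psi>1 (inv_into U1 \<phi>1 (fst y)), \<psi>2 (inv_into U2 \<phi>2 (snd y))))"
    by (intro smooth_on_Pair smooth_on_compose[OF smooth_on_fst_snd(1) chart_trans[OF M U(3) V(3)]]
       smooth_on_compose[OF smooth_on_fst_snd(2) chart_trans[OF N U(4) V(4)]]) (auto simp: U V)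
  then show "smooth_on (\<phi> ` (U \<inter> V)) (\<lambda>y. \<psi> (inv_into U \<phi> y))"
    by (rule smooth_on_cong) (use inv in \<open>auto simp: U V\<close>)
qed

lemma prod_euclid: "prod_mfd euclid euclid = euclid"
  by (simp add: prod_mfd_def euclid_def prod.map_id0)

lemma mtop_submfd [simp]: "mtop (submfd M S) = subtopology (mtop M) S"
  by (simp add: submfd_def)

lemma submfd_atlas:
  "(U, \<phi>) \<in> atlas (submfd M S :: ('a, 'd::euclidean_space) mfd) \<longleftrightarrow>
    openin (subtopology (mtop M) S) U \<and> chart_image (\<phi> ` U) \<and> diffeo_on M U (euclid :: ('d, 'd) mfd) (\<phi> ` U) \<phi>"
  by (simp add: submfd_def)

lemma submfd_chartD:
  assumes "(U, \<phi>) \<in> atlas (submfd M S :: ('a, 'd::euclidean_space) mfd)"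
  shows "openin (subtopology (mtop M) S) U" "U \<subseteq> S" "smooth_map_on M U euclid \<phi>" "inj_on \<phi> U"
    "smooth_map_on euclid (\<phi> ` U) M (inv_into U \<phi>)" "U \<subseteq> pts M"
  using assms openin_subset[of "subtopology (mtop M) S" U] unfolding submfd_atlas diffeo_on_def
  by (auto simp: bij_betw_def)

text \<open>The charts of \<open>submfd\<close> are diffeomorphisms for the structure of the ambient
  manifold, so any two of them are automatically compatible. What remains in each application is to
  cover \<open>S\<close> by charts.\<close>

lemma premfd_submfd:
  assumes M: "premfd M"
    and cover: "\<And>x. x \<in> S \<Longrightarrow> \<exists>U \<phi>. (U, \<phi>) \<in> atlas (submfd M S :: ('a, 'd::euclidean_space) mfd) \<and> x \<in> U"
  shows "premfd (submfd M S :: ('a, 'd) mfd)"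
proof (rule premfdI)
  fix U and \<phi> :: "'a \<Rightarrow> 'd" assume U: "(U, \<phi>) \<in> atlas (submfd M S :: ('a, 'd) mfd)"
  note D = submfd_chartD[OF U]
  show "openin (mtop (submfd M S)) U" using D(1) by simp
  have st: "subtopology (subtopology (mtop M) S) U = subtopology (mtop M) U"
    using D(2) by (simp add: subtopology_subtopology inf.absorb2)
  have "homeomorphic_maps (subtopology (mtop M) U) (top_of_set (\<phi> ` U)) \<phi> (inv_into U \<phi>)"
    unfolding homeomorphic_maps_def
    using smooth_map_on_continuous[OF D(3)] smooth_map_on_continuous[OF D(5)] D(2,4,6)
    by (auto simp: continuous_map_in_subtopology inv_into_f_f inv_into_into)
  then show "homeomorphic_map (subtopology (mtop (submfd M S)) U) (top_of_set (\<phi> ` U)) \<phi>"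
    using homeomorphic_map_maps by (auto simp: st)
  fix V and \<psi> :: "'a \<Rightarrow> 'd" assume V: "(V, \<psi>) \<in> atlas (submfd M S :: ('a, 'd) mfd)"
  have "smooth_map_on euclid (\<phi> ` (U \<inter> V)) euclid (\<lambda>y. \<psi> (inv_into U \<phi> y))"
    by (rule smooth_map_on_compose[OF smooth_map_on_subset[OF D(5)] submfd_chartD(3)[OF V] _ premfd_euclid M])
       (use D(4) in auto)
  then show "smooth_on (\<phi> ` (U \<inter> V)) (\<lambda>y. \<psi> (inv_into U \<phi> y))" by (simp add: smooth_map_on_euclid)
qed (use cover in simp)

lemma smooth_map_on_submfd_dom:
  assumes h: "smooth_map_on M A P h" and AS: "A \<subseteq> S" and M: "premfd M"
  shows "smooth_map_on (submfd M S :: ('a, 'd::euclidean_space) mfd) A P h"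
proof (rule smooth_map_onI)
  show "A \<subseteq> pts (submfd M S)" using smooth_map_on_pts[OF h] AS by auto
  show "continuous_map (subtopology (mtop (submfd M S)) A) (mtop P) h"
    using smooth_map_on_continuous[OF h] AS by (simp add: subtopology_subtopology inf.absorb2)
  fix U and \<phi> :: "'a \<Rightarrow> 'd" and V \<psi>
  assume U: "(U, \<phi>) \<in> atlas (submfd M S :: ('a, 'd) mfd)" and V: "(V, \<psi>) \<in> atlas P"
  have "smooth_map_on euclid (\<phi> ` (A \<inter> U)) P (\<lambda>y. h (inv_into U \<phi> y))"
    by (rule smooth_map_on_compose[OF smooth_map_on_subset[OF submfd_chartD(5)[OF U]] h _ premfd_euclid M])
       (use submfd_chartD(4)[OF U] in auto)
  from smooth_map_onD[OF this _ V, of UNIV id]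
  have "smooth_on {x \<in> \<phi> ` (A \<inter> U). h (inv_into U \<phi> x) \<in> V} (\<lambda>y. \<psi> (h (inv_into U \<phi> y)))" by simp
  then show "smooth_on (\<phi> ` {x \<in> A \<inter> U. h x \<in> V}) (\<lambda>y. \<psi> (h (inv_into U \<phi> y)))"
    by (rule smooth_on_subset) (use submfd_chartD(4)[OF U] in auto)
qed

text \<open>A chart of \<open>submfd N S\<close> is smooth on its domain for the structure of
  \<open>N\<close>, so composing \<open>h\<close> with it uses nothing but smoothness of
  \<open>h\<close> as a map into \<open>N\<close>.\<close>

lemma smooth_map_on_submfd_cod:
  assumes h: "smooth_map_on M A N h" and hS: "\<And>x. x \<in> A \<Longrightarrow> h x \<in> S" and M: "premfd M" and N: "premfd N"
  shows "smooth_map_on M A (submfd N S :: ('b, 'd::euclidean_space) mfd) h"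
proof (rule smooth_map_onI[OF smooth_map_on_pts[OF h]])
  show "continuous_map (subtopology (mtop M) A) (mtop (submfd N S)) h"
    using smooth_map_on_continuous[OF h] hS by (auto simp: continuous_map_in_subtopology)
  fix U \<phi> V and \<psi> :: "'b \<Rightarrow> 'd"
  assume U: "(U, \<phi>) \<in> atlas M" and V: "(V, \<psi>) \<in> atlas (submfd N S :: ('b, 'd) mfd)"
  have "smooth_map_on M {x \<in> A. h x \<in> V} euclid (\<lambda>x. \<psi> (h x))"
    by (rule smooth_map_on_compose[OF smooth_map_on_subset[OF h] submfd_chartD(3)[OF V] _ M N]) auto
  from smooth_map_on_euclid_pts[OF this U]
  show "smooth_on (\<phi> ` {x \<in> A \<inter> U. h x \<in> V}) (\<lambda>y. \<psi> (h (inv_into U \<phi> y)))"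
    by (rule smooth_on_subset) auto
qed

lemma smooth_map_on_submfd_codD:
  assumes h: "smooth_map_on M A (submfd N S :: ('b, 'd::euclidean_space) mfd) h"
    and M: "premfd M" and N: "premfd N" and E: "premfd (submfd N S :: ('b, 'd) mfd)" and S: "S \<subseteq> pts N"
  shows "smooth_map_on M A N h" "\<And>x. x \<in> A \<Longrightarrow> h x \<in> S"
proof -
  show hS: "h x \<in> S" if "x \<in> A" for x using smooth_map_on_image[OF h that] by simp
  show "smooth_map_on M A N h"
    by (rule smooth_map_on_compose[OF h smooth_map_on_submfd_dom[OF smooth_map_on_id[OF N S] order_refl N] hS M E])
qed

lemma diffeo_onI:
  assumes f: "smooth_map_on M A N f" and g: "smooth_map_on N B M g" and N: "premfd N"
    and "\<And>x. x \<in> A \<Longrightarrow> f x \<in> B" "\<And>y. y \<in> B \<Longrightarrow> g y \<in> A" "\<And>x. x \<in> A \<Longrightarrow> g (f x) = x" "\<And>y. y \<in> B \<Longrightarrow> f (g y) = y"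
  shows "diffeo_on M A N B f"
proof -
  have b: "bij_betw f A B" by (rule bij_betwI[of _ _ _ g]) (use assms in auto)
  have "inv_into A f y = g y" if "y \<in> B" for y
    by (rule inv_into_f_eq) (use b that assms in \<open>auto simp: bij_betw_def\<close>)
  then have "smooth_map_on N B M (inv_into A f)"
    by (intro smooth_map_on_cong[OF g N]) simp
  then show ?thesis using b f by (simp add: diffeo_on_def)
qed

section \<open>Boundary points\<close>

text \<open>A characterization of interior points that mentions no chart. By invariance of domain it
  agrees with the description in charts, which shows that the boundary does not depend on the chart
  and is preserved by local homeomorphisms.\<close>

definition interior_pt :: "'e::euclidean_space itself \<Rightarrow> 'a topology \<Rightarrow> 'a \<Rightarrow> bool" where
  "interior_pt _ T x \<longleftrightarrow>
     (\<exists>G (g :: 'e \<Rightarrow> 'a). open G \<and> continuous_map (top_of_set G) T g \<and> inj_on g G \<and> x \<in> g ` G)"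

lemma interior_pt_image:
  assumes ip: "interior_pt TYPE('e::euclidean_space) T x" and G: "openin T G" "x \<in> G"
    and q: "continuous_map (subtopology T G) T' q" "inj_on q G"
  shows "interior_pt TYPE('e) T' (q x)"
proof -
  obtain O1 and g :: "'e \<Rightarrow> 'a" where g: "open O1" "continuous_map (top_of_set O1) T g" "inj_on g O1" "x \<in> g ` O1"
    using ip unfolding interior_pt_def by blast
  let ?O = "{y \<in> O1. g y \<in> G}"
  have "openin (top_of_set O1) ?O"
    using openin_continuous_map_preimage[OF g(2) G(1)] by simp
  then have O: "open ?O" using g(1) openin_open_trans by blast
  have "continuous_map (top_of_set ?O) (subtopology T G) g"
    using continuous_map_from_subtopology_mono[OF g(2), of ?O] by (auto simp: continuous_map_in_subtopology)
  from continuous_map_compose[OF this q(1)]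
  have "continuous_map (top_of_set ?O) T' (\<lambda>y. q (g y))" by (simp add: comp_def)
  moreover have "inj_on (\<lambda>y. q (g y)) ?O"
    using g(3) q(2) unfolding inj_on_def by simp
  moreover have "q x \<in> (\<lambda>y. q (g y)) ` ?O" using g(4) G(2) by auto
  ultimately show ?thesis unfolding interior_pt_def using O by blast
qed

text \<open>Followed by the chart, a continuous injection of an open set of the model space into the
  manifold becomes a map between subsets of the same vector space. Invariance of domain then makes
  its image open, and this image lies in that of the chart.\<close>

lemma interior_pt_chart:
  fixes M :: "('a, 'e::euclidean_space) mfd"
  assumes M: "premfd M" and U: "(U, \<phi>) \<in> atlas M" "x \<in> U"
  shows "interior_pt TYPE('e) (mtop M) x \<longleftrightarrow> \<phi> x \<in> interior (\<phi> ` U)"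
proof
  assume "\<phi> x \<in> interior (\<phi> ` U)"
  moreover have "continuous_map (top_of_set (interior (\<phi> ` U))) (mtop M) (inv_into U \<phi>)"
    using smooth_map_on_continuous[OF smooth_map_on_subset[OF chart_inverse_smooth[OF M U(1)] interior_subset]] by simp
  moreover have "inj_on (inv_into U \<phi>) (interior (\<phi> ` U))"
    using inj_on_inv_into[OF interior_subset] by metis
  moreover have "inv_into U \<phi> (\<phi> x) = x" using chart_inv[OF M U] .
  ultimately show "interior_pt TYPE('e) (mtop M) x"
    unfolding interior_pt_def by (intro exI[of _ "interior (\<phi> ` U)"] exI[of _ "inv_into U \<phi>"]) force
next
  assume "interior_pt TYPE('e) (mtop M) x"
  then obtain O1 and g :: "'e \<Rightarrow> 'a" where g: "open O1" "continuous_map (top_of_set O1) (mtop M) g" "inj_on g O1" "x \<in> g ` O1"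
    unfolding interior_pt_def by blast
  let ?O = "{y \<in> O1. g y \<in> U}"
  have "openin (top_of_set O1) ?O"
    using openin_continuous_map_preimage[OF g(2) chart_open[OF M U(1)]] by simp
  then have O: "open ?O" using g(1) openin_open_trans by blast
  have "continuous_map (top_of_set ?O) (subtopology (mtop M) U) g"
    using continuous_map_from_subtopology_mono[OF g(2), of ?O] by (auto simp: continuous_map_in_subtopology)
  from continuous_map_compose[OF this, of euclidean \<phi>] smooth_map_on_continuous[OF chart_smooth[OF M U(1)]]
  have "continuous_on ?O (\<lambda>y. \<phi> (g y))" by (simp add: comp_def)
  moreover have "inj_on (\<lambda>y. \<phi> (g y)) ?O"
    using g(3) chart_inj[OF M U(1)] unfolding inj_on_def by simp
  ultimately have "open ((\<lambda>y. \<phi> (g y)) ` ?O)" using O invariance_of_domain by blast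
  moreover have "(\<lambda>y. \<phi> (g y)) ` ?O \<subseteq> \<phi> ` U" by auto
  moreover have "\<phi> x \<in> (\<lambda>y. \<phi> (g y)) ` ?O" using g(4) U(2) by auto
  ultimately show "\<phi> x \<in> interior (\<phi> ` U)" using interiorI by metis
qed

lemma bd_iff_interior_pt:
  fixes M :: "('a, 'e::euclidean_space) mfd"
  assumes M: "premfd M"
  shows "x \<in> bd M \<longleftrightarrow> x \<in> pts M \<and> \<not> interior_pt TYPE('e) (mtop M) x"
proof
  assume "x \<in> bd M"
  then obtain U \<phi> where "x \<in> pts M" "(U, \<phi>) \<in> atlas M" "x \<in> U" "\<phi> x \<notin> interior (\<phi> ` U)"
    unfolding bd_def by blast
  then show "x \<in> pts M \<and> \<not> interior_pt TYPE('e) (mtop M) x" using interior_pt_chart[OF M] by blast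
next
  assume x: "x \<in> pts M \<and> \<not> interior_pt TYPE('e) (mtop M) x"
  then obtain U \<phi> where U: "(U, \<phi>) \<in> atlas M" "x \<in> U" using chart_at[OF M] by blast
  then have "\<phi> x \<notin> interior (\<phi> ` U)" using interior_pt_chart[OF M U] x by blast
  then show "x \<in> bd M" using x U unfolding bd_def by blast
qed

text \<open>\<open>bd\<close> asks for some chart that shows a boundary point; by invariance of
  domain every chart around the point gives the same answer.\<close>

lemma bd_iff_chart:
  assumes M: "premfd M" and U: "(U, \<phi>) \<in> atlas M" "x \<in> U"
  shows "x \<in> bd M \<longleftrightarrow> \<phi> x \<notin> interior (\<phi> ` U)"
  using bd_iff_interior_pt[OF M] interior_pt_chart[OF M U] chart_subset[OF M U(1)] U(2) by blast

lemma chart_image_open: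
  assumes M: "premfd M" "bd M = {}" and U: "(U, \<phi>) \<in> atlas M" and G: "openin (mtop M) G"
  shows "open (\<phi> ` (U \<inter> G))"
proof -
  have "\<phi> ` U \<subseteq> interior (\<phi> ` U)"
    using bd_iff_chart[OF M(1) U] M(2) by blast
  then have o: "open (\<phi> ` U)" by (metis interior_subset open_interior subset_antisym)
  have "openin (subtopology (mtop M) U) (U \<inter> G)"
    using G by (simp add: openin_subtopology_Int2)
  then have "openin (top_of_set (\<phi> ` U)) (\<phi> ` (U \<inter> G))"
    using homeomorphic_imp_open_map[OF chart_homeo[OF M(1) U]] by (simp add: open_map_def)
  then show ?thesis using o openin_open_trans by blast
qed

text \<open>Serves both for the solid torus around a knot in \<open>Y\<close> and for a piece
  embedded in the glued manifold. In both cases \<open>S\<close> is known only as an image of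
  half-space patches, and \<open>\<beta>\<close> is an ambient coordinate map, defined also off
  \<open>S\<close>, in which it becomes a half-space.\<close>

lemma mfd_half_space_patch:
  fixes M :: "('m, 'd::euclidean_space) mfd" and h :: "'e::euclidean_space \<Rightarrow> 'm"
  assumes M: "premfd M" "bd M = {}" and dim: "DIM('e) = DIM('d)"
    and Q: "open Q" "x0 \<in> Q" "x0 \<in> half_space b"
    and h: "smooth_map_on euclid (half_space b \<inter> Q) M h"
    and k: "smooth_map_on M (h ` (half_space b \<inter> Q)) euclid k"
    and kh: "\<And>x. x \<in> half_space b \<inter> Q \<Longrightarrow> k (h x) = x"
    and G0: "openin (mtop M) G0" "h ` (half_space b \<inter> Q) = S \<inter> G0"
  obtains G \<beta> g where "openin (mtop M) G" "h x0 \<in> G" "open (\<beta> ` G)" "smooth_map_on M G euclid \<beta>"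
    "smooth_map_on euclid (\<beta> ` G) M g" "\<And>y. y \<in> G \<Longrightarrow> g (\<beta> y) = y"
    "\<And>y. y \<in> G \<Longrightarrow> y \<in> S \<longleftrightarrow> \<beta> y \<in> half_space b" "\<And>y. y \<in> G \<Longrightarrow> y \<in> S \<Longrightarrow> \<beta> y = k y"
proof -
  let ?D = "half_space b \<inter> Q"
  have x0: "x0 \<in> ?D" using Q by blast
  obtain V \<psi> where V: "(V, \<psi>) \<in> atlas M" "h x0 \<in> V"
    using chart_at[OF M(1) smooth_map_on_image[OF h x0]] by blast
  have inv: "inv_into V \<psi> (\<psi> y) = y" if "y \<in> V" for y using chart_inv[OF M(1) V(1) that] .
  obtain Q1 where Q1: "open Q1" "{x \<in> ?D. h x \<in> V} = ?D \<inter> Q1"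
    using smooth_map_on_nbhd[OF h chart_open[OF M(1) V(1)]] by (metis mtop_euclid open_openin)
  let ?Q = "Q \<inter> Q1"
  have DQ: "half_space b \<inter> ?Q = {x \<in> ?D. h x \<in> V}" using Q1(2) by blast
  have x0Q: "x0 \<in> ?Q" using x0 V(2) Q1(2) by blast
  let ?h = "\<lambda>y. \<psi> (h y)" and ?k = "\<lambda>z. k (inv_into V \<psi> z)"
  have sh: "smooth_on (half_space b \<inter> ?Q) ?h"
    unfolding DQ smooth_map_on_euclid[symmetric]
    by (rule smooth_map_on_compose[OF smooth_map_on_subset[OF h] chart_smooth[OF M(1) V(1)] _ premfd_euclid M(1)]) auto
  have sk: "smooth_on (?h ` (half_space b \<inter> ?Q)) ?k"
    unfolding DQ smooth_map_on_euclid[symmetric]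
    by (rule smooth_map_on_compose[OF smooth_map_on_subset[OF chart_inverse_smooth[OF M(1) V(1)]] k _ premfd_euclid M(1)])
       (auto simp: inv)
  have kh': "?k (?h x) = x" if "x \<in> half_space b \<inter> ?Q" for x
  proof -
    have "x \<in> ?D" "h x \<in> V" using that unfolding DQ by auto
    then show ?thesis using kh inv by simp
  qed
  have P: "open (\<psi> ` (V \<inter> G0))" using chart_image_open[OF M V(1) G0(1)] .
  have "h ` (half_space b \<inter> ?Q) = S \<inter> V \<inter> G0" proof -
    have "h ` {x \<in> ?D. h x \<in> V} = h ` ?D \<inter> V" by blast
    then show ?thesis unfolding DQ G0(2) by (simp only: Int_ac)
  qed
  then have "?h ` (half_space b \<inter> ?Q) = \<psi> ` (S \<inter> V \<inter> G0)" by (metis image_image)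
  also have "\<dots> = \<psi> ` (S \<inter> V) \<inter> \<psi> ` (V \<inter> G0)"
    using inj_on_image_Int[OF chart_inj[OF M(1) V(1)], of "S \<inter> V" "V \<inter> G0"] by (simp add: Int_ac)
  finally have im: "?h ` (half_space b \<inter> ?Q) = \<psi> ` (S \<inter> V) \<inter> \<psi> ` (V \<inter> G0)" .
  show thesis
  proof (rule half_space_patch[OF dim open_Int[OF Q(1) Q1(1)] x0Q Q(3) sh sk kh' P im])
  fix P' Q' \<beta> g
  assume R: "open P'" "\<psi> (h x0) \<in> P'" "P' \<subseteq> \<psi> ` (V \<inter> G0)" "open Q'" "homeomorphism P' Q' \<beta> g"
    "csmooth P' \<beta>" "csmooth Q' g" "\<And>y. y \<in> P' \<Longrightarrow> y \<in> \<psi> ` (S \<inter> V) \<longleftrightarrow> \<beta> y \<in> half_space b"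
    "\<And>y. y \<in> P' \<Longrightarrow> y \<in> \<psi> ` (S \<inter> V) \<Longrightarrow> \<beta> y = ?k y"
  define G where "G = {y \<in> V. \<psi> y \<in> P'}"
  have GV: "G \<subseteq> V" by (auto simp: G_def)
  have \<psi>G: "\<psi> ` G = P'" using R(3) by (auto simp: G_def)
  have S: "\<psi> y \<in> \<psi> ` (S \<inter> V) \<longleftrightarrow> y \<in> S" if "y \<in> V" for y
    using inj_on_image_mem_iff[OF chart_inj[OF M(1) V(1)] that, of "S \<inter> V"] that by simp
  obtain G1 where G1: "openin (mtop M) G1" "{y \<in> V. \<psi> y \<in> P'} = V \<inter> G1"
    using smooth_map_on_nbhd[OF chart_smooth[OF M(1) V(1)], of P'] R(1) by auto
  have oG: "openin (mtop M) G" unfolding G_def G1(2) using chart_open[OF M(1) V(1)] G1(1) by blast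
  have hm: "\<And>x. x \<in> P' \<Longrightarrow> g (\<beta> x) = x" "\<beta> ` P' = Q'"
    using R(5) unfolding homeomorphism_def by blast+
  have sb: "smooth_map_on euclid P' euclid \<beta>" "smooth_map_on euclid Q' euclid g"
    using R(1,4,6,7) by (simp_all add: smooth_map_on_euclid smooth_on_open)
  have im2: "(\<lambda>y. \<beta> (\<psi> y)) ` G = Q'" using \<psi>G hm(2) by (metis image_image)
  show thesis
  proof (rule that[OF oG, where \<beta>="\<lambda>y. \<beta> (\<psi> y)" and g="\<lambda>z. inv_into V \<psi> (g z)"])
    show "h x0 \<in> G" using V(2) R(2) by (simp add: G_def)
    show "open ((\<lambda>y. \<beta> (\<psi> y)) ` G)" unfolding im2 by (rule R(4))
    show "smooth_map_on M G euclid (\<lambda>y. \<beta> (\<psi> y))"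
      by (rule smooth_map_on_compose[OF smooth_map_on_subset[OF chart_smooth[OF M(1) V(1)] GV] sb(1) _ M(1) premfd_euclid])
         (simp add: G_def)
    show "smooth_map_on euclid ((\<lambda>y. \<beta> (\<psi> y)) ` G) M (\<lambda>z. inv_into V \<psi> (g z))"
      unfolding im2
      by (rule smooth_map_on_compose[OF sb(2) chart_inverse_smooth[OF M(1) V(1)] _ premfd_euclid premfd_euclid])
         (use hm \<psi>G GV in auto)
    fix y assume y: "y \<in> G"
    then have y': "y \<in> V" "\<psi> y \<in> P'" by (auto simp: G_def)
    show "inv_into V \<psi> (g (\<beta> (\<psi> y))) = y" using hm(1)[OF y'(2)] inv[OF y'(1)] by simp
    show "y \<in> S \<longleftrightarrow> \<beta> (\<psi> y) \<in> half_space b" using R(8)[OF y'(2)] S[OF y'(1)] by simp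
    show "\<beta> (\<psi> y) = k y" if "y \<in> S" using R(9)[OF y'(2)] S[OF y'(1)] that inv[OF y'(1)] by simp
  qed
  qed
qed

section \<open>The circle\<close>

lemma premfd_open_chart:
  fixes \<phi> :: "'a \<Rightarrow> 'd::euclidean_space"
  assumes "openin (subtopology (mtop M) S) U" "open (\<phi> ` U)" "smooth_map_on M U euclid \<phi>"
    "smooth_map_on euclid (\<phi> ` U) M g" "\<And>x. x \<in> U \<Longrightarrow> g (\<phi> x) = x"
  shows "(U, \<phi>) \<in> atlas (submfd M S)"
  unfolding submfd_atlas
proof (intro conjI)
  show "chart_image (\<phi> ` U)" unfolding chart_image_def using assms(2) by (intro exI[of _ 0]) auto
  show "diffeo_on M U euclid (\<phi> ` U) \<phi>"
    by (rule diffeo_onI[OF assms(3,4) premfd_euclid]) (use assms(5) in auto)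
qed (rule assms(1))

lemma cis_Im_Ln: assumes "norm z = 1" shows "cis (Im (Ln z)) = z"
proof -
  have z: "z \<noteq> 0" using assms by auto
  then have "Ln z = \<i> * of_real (Im (Ln z))" using assms by (simp add: complex_eq_iff)
  then show ?thesis using exp_Ln[OF z] by (metis cis_conv_exp)
qed

lemma Im_Ln_cis: "\<bar>a\<bar> < pi \<Longrightarrow> Im (Ln (cis a)) = a"
  using Ln_unique[of "\<i> * of_real a" "cis a"] by (simp add: cis_conv_exp)

text \<open>The angle of \<open>w\<close> relative to \<open>w0\<close>, with the branch cut at the
  antipode of a unit vector \<open>w0\<close>. On the half-plane where the real part of
  \<open>w * cnj w0\<close> is positive it is smooth and of size less than
  \<open>pi / 2\<close>.\<close>

definition angle_from :: "complex \<Rightarrow> complex \<Rightarrow> real" where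
  "angle_from w0 w = Im (Ln (w * cnj w0))"

context
  fixes w0 :: complex
  assumes w0: "norm w0 = 1"
begin

lemma unit_cancel: "w0 * (w * cnj w0) = w" "w0 * w * cnj w0 = w"
proof -
  have n: "w0 * cnj w0 = 1" using w0 by (simp add: complex_norm_square[symmetric])
  have "w0 * (w * cnj w0) = (w0 * cnj w0) * w" "w0 * w * cnj w0 = (w0 * cnj w0) * w"
    by (simp_all only: mult_ac)
  then show "w0 * (w * cnj w0) = w" "w0 * w * cnj w0 = w" by (simp_all only: n mult_1_left)
qed

lemma angle_from_cis: "\<bar>a\<bar> < pi \<Longrightarrow> angle_from w0 (w0 * cis a) = a"
  unfolding angle_from_def unit_cancel by (rule Im_Ln_cis)

lemma Re_cis_pos: "\<bar>a\<bar> < pi/2 \<Longrightarrow> Re (w0 * cis a * cnj w0) > 0"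
  unfolding unit_cancel using cos_gt_zero_pi[of a] by (auto simp: abs_less_iff)

lemma cis_angle_from: "norm w = 1 \<Longrightarrow> w0 * cis (angle_from w0 w) = w"
proof -
  assume "norm w = 1"
  then have "norm (w * cnj w0) = 1" using w0 by (simp add: norm_mult)
  then show ?thesis unfolding angle_from_def by (simp only: cis_Im_Ln unit_cancel)
qed

lemma angle_from_bound: "Re (w * cnj w0) > 0 \<Longrightarrow> \<bar>angle_from w0 w\<bar> < pi/2"
proof -
  assume p: "Re (w * cnj w0) > 0"
  then have "w * cnj w0 \<noteq> 0" by (metis less_irrefl zero_complex.sel(1))
  from Re_Ln_pos_lt[OF this] p show ?thesis unfolding angle_from_def by blast
qed

lemma open_Re_pos: "open {w::complex. Re (w * cnj w0) > 0}"
  by (rule open_Collect_less) (intro continuous_intros)+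

lemma csmooth_Ln_from: "csmooth {w. Re (w * cnj w0) > 0} (\<lambda>w. Ln (w * cnj w0))"
proof (rule csmooth_holomorphic[OF _ open_Re_pos])
  have "w * cnj w0 \<notin> \<real>\<^sub>\<le>\<^sub>0" if "Re (w * cnj w0) > 0" for w
    using that unfolding complex_nonpos_Reals_iff by linarith
  then show "(\<lambda>w. Ln (w * cnj w0)) holomorphic_on {w. Re (w * cnj w0) > 0}" by (intro holomorphic_intros) simp
qed

lemma csmooth_angle_from: "csmooth {w. Re (w * cnj w0) > 0} (angle_from w0)"
  using csmooth_linear_compose[OF bounded_linear_Im open_Re_pos csmooth_Ln_from]
  by (simp add: angle_from_def[abs_def])

lemma csmooth_cis_from: "csmooth UNIV (\<lambda>a. w0 * cis a)"
  by (rule csmooth_mult[OF open_UNIV csmooth_const[OF open_UNIV] csmooth_cis])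

lemma angle_chart_image:
  "angle_from w0 ` {w \<in> sphere 0 1. Re (w * cnj w0) > 0} = {-pi/2<..<pi/2}"
proof (intro equalityI subsetI)
  fix a assume "a \<in> {-pi/2<..<pi/2}"
  then have l: "\<bar>a\<bar> < pi/2" by auto
  have "norm (w0 * cis a) = 1" using w0 by (simp add: norm_mult)
  then have "w0 * cis a \<in> {w \<in> sphere 0 1. Re (w * cnj w0) > 0}" using Re_cis_pos[OF l] by simp
  moreover have "angle_from w0 (w0 * cis a) = a" by (rule angle_from_cis) (use l pi_gt_zero in linarith)
  ultimately show "a \<in> angle_from w0 ` {w \<in> sphere 0 1. Re (w * cnj w0) > 0}" by (metis (no_types, lifting) imageI)
next
  fix a assume "a \<in> angle_from w0 ` {w \<in> sphere 0 1. Re (w * cnj w0) > 0}"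
  then obtain w where "Re (w * cnj w0) > 0" "a = angle_from w0 w" by blast
  then have "\<bar>a\<bar> < pi/2" using angle_from_bound by blast
  then show "a \<in> {-pi/2<..<pi/2}" by auto
qed

lemma circle_angle_chart:
  "({w \<in> sphere 0 1. Re (w * cnj w0) > 0}, angle_from w0) \<in> atlas circle"
  "w0 \<in> {w \<in> sphere 0 1. Re (w * cnj w0) > 0}"
proof -
  let ?U = "{w \<in> sphere 0 1. Re (w * cnj w0) > 0}"
  show "(?U, angle_from w0) \<in> atlas circle"
    unfolding circle_def
  proof (rule premfd_open_chart)
    show "openin (subtopology (mtop euclid) (sphere 0 1)) ?U"
      using open_Re_pos by (auto simp: openin_open)
    show "open (angle_from w0 ` ?U)" unfolding angle_chart_image by simp
    show "smooth_map_on euclid ?U euclid (angle_from w0)"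
      unfolding smooth_map_on_euclid by (rule csmooth_imp_smooth_on[OF csmooth_angle_from open_Re_pos]) blast
    show "smooth_map_on euclid (angle_from w0 ` ?U) euclid (\<lambda>a. w0 * cis a)"
      unfolding smooth_map_on_euclid by (rule csmooth_imp_smooth_on[OF csmooth_cis_from]) auto
    show "w0 * cis (angle_from w0 w) = w" if "w \<in> ?U" for w using that cis_angle_from by simp
  qed
  have "Re (w0 * cnj w0) = 1" using unit_cancel(2)[of 1] by (simp only: mult_1_right one_complex.sel)
  then show "w0 \<in> ?U" using w0 by simp
qed

end

lemma mtop_circle [simp]: "mtop circle = top_of_set (sphere 0 1)"
  by (simp add: circle_def)

lemma premfd_circle: "premfd circle"
  unfolding circle_def
proof (rule premfd_submfd[OF premfd_euclid])
  fix w :: complex assume "w \<in> sphere 0 1"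
  then have "norm w = 1" by simp
  from circle_angle_chart[OF this]
  show "\<exists>U \<phi>. (U, \<phi>) \<in> atlas (submfd euclid (sphere 0 1) :: (complex, real) mfd) \<and> w \<in> U"
    unfolding circle_def by blast
qed

lemma bd_circle: "bd circle = {}"
proof -
  have False if b: "w \<in> bd circle" for w
  proof -
    have w: "norm w = 1" using b unfolding bd_iff_interior_pt[OF premfd_circle] by simp
    have "angle_from w w = 0" using angle_from_cis[OF w, of 0] by simp
    then show False
      using bd_iff_chart[OF premfd_circle circle_angle_chart[OF w]] b
      unfolding angle_chart_image[OF w] by simp
  qed
  then show ?thesis by blast
qed

text \<open>The charts of the circle are smooth for the structure of the plane. Maps to the circle
  can thus be treated as complex-valued, so that products and powers of them make sense.\<close>

lemma smooth_map_on_circle: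
  assumes "premfd M"
  shows "smooth_map_on M A circle h \<longleftrightarrow> smooth_map_on M A euclid h \<and> (\<forall>x\<in>A. norm (h x) = 1)"
  using smooth_map_on_submfd_cod[OF _ _ assms premfd_euclid, of A h "sphere 0 1"]
    smooth_map_on_submfd_codD[OF _ assms premfd_euclid premfd_circle[unfolded circle_def], of A h]
  unfolding circle_def by (metis dist_0_norm mem_sphere mtop_euclid subset_UNIV topspace_euclidean)

section \<open>Knot exteriors\<close>

lemma not_interior_half_space:
  assumes "b \<noteq> 0" "x \<bullet> b = 0" "S \<subseteq> half_space b"
  shows "x \<notin> interior S"
proof
  assume "x \<in> interior S"
  then obtain e where e: "e > 0" "ball x e \<subseteq> S" by (meson mem_interior)
  let ?y = "x - (e / (2 * norm b)) *\<^sub>R b"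
  have "?y \<in> ball x e" using e(1) assms(1) by (simp add: dist_norm)
  then have "?y \<in> half_space b" using e(2) assms(3) by blast
  then have "0 \<le> ?y \<bullet> b" unfolding half_space_def by blast
  moreover have "?y \<bullet> b = - (e / (2 * norm b)) * (norm b * norm b)"
    using assms(2) by (simp add: inner_diff_left power2_norm_eq_inner[symmetric] power2_eq_square)
  moreover have "(e / (2 * norm b)) * (norm b * norm b) > 0" using e(1) assms(1) by simp
  ultimately show False by simp
qed

lemma smooth_map_on_open_image:
  assumes "smooth_map_on euclid (\<beta> ` G) M g" "open (\<beta> ` G)" "\<And>y. y \<in> G \<Longrightarrow> g (\<beta> y) = y" "openin (mtop M) H"
  shows "open (\<beta> ` (G \<inter> H))"
proof -
  obtain Q where Q: "open Q" "{z \<in> \<beta> ` G. g z \<in> H} = \<beta> ` G \<inter> Q"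
    using smooth_map_on_nbhd[OF assms(1,4)] by (metis mtop_euclid open_openin)
  have "\<beta> ` (G \<inter> H) = {z \<in> \<beta> ` G. g z \<in> H}" using assms(3) by auto
  then show ?thesis using Q assms(2) by auto
qed

text \<open>By definition \<open>exterior\<close> is just a subset equipped with all compatible
  charts. That these charts cover it, and that its boundary is the image under \<open>t\<close> of
  the product of two circles, is derived here from the parametrization \<open>t\<close> of the
  tubular neighbourhood.\<close>

locale tube =
  fixes Y :: "('a, real^3) mfd" and N :: "'a set" and t :: "complex \<times> complex \<Rightarrow> 'a"
  assumes Y: "smooth_mfd Y" "bd Y = {}" "compact_space (mtop Y)"
    and t: "diffeo_on (euclid :: (complex \<times> complex, complex \<times> complex) mfd) (sphere 0 1 \<times> cball 0 1) Y N t"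
begin

abbreviation "ST \<equiv> (sphere 0 1 \<times> cball 0 1 :: (complex \<times> complex) set)"

abbreviation "E \<equiv> exterior Y N"

definition "s = inv_into ST t"

lemma premfd_Y: "premfd Y"
  using Y(1) by (rule smooth_mfd_premfd)

lemma smooth_t: "smooth_map_on euclid ST Y t" and smooth_s: "smooth_map_on Y N euclid s"
  using t unfolding diffeo_on_def s_def by blast+

lemma st: "z \<in> ST \<Longrightarrow> s (t z) = z" and ts: "y \<in> N \<Longrightarrow> t (s y) = y"
  and s_ST: "y \<in> N \<Longrightarrow> s y \<in> ST" and t_N: "z \<in> ST \<Longrightarrow> t z \<in> N"
  using t unfolding diffeo_on_def s_def bij_betw_def by (auto simp: inv_into_f_f f_inv_into_f intro: inv_into_into)

lemma N_eq: "N = t ` ST"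
  using t unfolding diffeo_on_def bij_betw_def by blast

lemma N_pts: "N \<subseteq> pts Y"
  using smooth_map_on_pts[OF smooth_s] .

lemma compact_N: "compactin (mtop Y) N"
proof -
  have "compactin (top_of_set ST) ST" by (simp add: compactin_subtopology compact_Times)
  from image_compactin[OF this, of "mtop Y" t] smooth_map_on_continuous[OF smooth_t] show ?thesis
    by (simp add: N_eq)
qed

lemma closed_N: "closedin (mtop Y) N"
  using compactin_imp_closedin[OF _ compact_N] Y(1) by (simp add: smooth_mfd_def)

lemma t_image_relatively_open:
  assumes "open A"
  obtains G where "openin (mtop Y) G" "t ` (ST \<inter> A) = N \<inter> G"
proof -
  obtain G where G: "openin (mtop Y) G" "{y \<in> N. s y \<in> A} = N \<inter> G"
    using smooth_map_on_nbhd[OF smooth_s, of A] assms by auto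
  have "t ` (ST \<inter> A) = {y \<in> N. s y \<in> A}"
  proof (intro equalityI subsetI)
    fix y assume "y \<in> t ` (ST \<inter> A)"
    then show "y \<in> {y \<in> N. s y \<in> A}" using st t_N by auto
  next
    fix y assume y: "y \<in> {y \<in> N. s y \<in> A}"
    then have "s y \<in> ST \<inter> A" using s_ST by blast
    then show "y \<in> t ` (ST \<inter> A)" using y ts[of y] by (metis (mono_tags, lifting) imageI mem_Collect_eq)
  qed
  then show thesis using that G by simp
qed

text \<open>With normal vector 0 the half-space is the whole space, and straightening a patch
  amounts to openness of \<open>t\<close> at points of the open solid torus.\<close>

lemma interior_patch:
  assumes w0: "norm w0 = 1" and v0: "norm v0 < 1"
  obtains G where "openin (mtop Y) G" "t (w0, v0) \<in> G" "G \<subseteq> N"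
proof -
  define L :: "real \<times> complex \<Rightarrow> complex \<times> complex" where "L = (\<lambda>y. (w0 * cis (fst y), snd y))"
  define Q :: "(real \<times> complex) set" where "Q = {-pi/2<..<pi/2} \<times> ball 0 1"
  define A :: "(complex \<times> complex) set" where "A = {w. Re (w * cnj w0) > 0} \<times> ball 0 1"
  have Q: "open Q" unfolding Q_def by (intro open_Times) auto
  have A: "open A" unfolding A_def using open_Re_pos[OF w0] by (intro open_Times) auto
  have LQ: "L ` Q = ST \<inter> A"
  proof (intro equalityI subsetI)
    fix z assume "z \<in> L ` Q"
    then obtain y where "y \<in> Q" "z = L y" by blast
    then have z: "z = (w0 * cis (fst y), snd y)" "\<bar>fst y\<bar> < pi/2" "norm (snd y) < 1" by (auto simp: L_def Q_def)
    then show "z \<in> ST \<inter> A" using Re_cis_pos[OF w0 z(2)] w0 by (simp add: A_def norm_mult)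
  next
    fix z assume z: "z \<in> ST \<inter> A"
    then have n: "norm (fst z) = 1" "Re (fst z * cnj w0) > 0" "norm (snd z) < 1" by (auto simp: A_def)
    have "z = L (angle_from w0 (fst z), snd z)" using cis_angle_from[OF w0 n(1)] by (simp add: L_def)
    moreover have "(angle_from w0 (fst z), snd z) \<in> Q"
      using angle_from_bound[OF w0 n(2)] n(3) unfolding Q_def by auto
    ultimately show "z \<in> L ` Q" by blast
  qed
  have "csmooth UNIV (\<lambda>y::real \<times> complex. w0 * cis (fst y))"
    by (rule csmooth_compose[OF open_UNIV open_UNIV csmooth_linear[OF bounded_linear_fst open_UNIV] csmooth_cis_from[OF w0]]) simp
  then have "csmooth UNIV L"
    unfolding L_def by (rule csmooth_Pair[OF open_UNIV _ csmooth_linear[OF bounded_linear_snd open_UNIV]])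
  then have sL: "smooth_map_on euclid Q euclid L"
    by (simp add: smooth_map_on_euclid csmooth_imp_smooth_on)
  have sh: "smooth_map_on euclid (half_space 0 \<inter> Q) Y (\<lambda>y. t (L y))"
    by (rule smooth_map_on_compose[OF _ smooth_t _ premfd_euclid premfd_euclid]) (use sL LQ in auto)
  define k where "k = (\<lambda>y. (angle_from w0 (fst (s y)), snd (s y)))"
  have "csmooth A (\<lambda>z. angle_from w0 (fst z))"
    by (rule csmooth_compose[OF A open_Re_pos[OF w0] csmooth_linear[OF bounded_linear_fst A] csmooth_angle_from[OF w0]])
       (auto simp: A_def)
  then have cL': "csmooth A (\<lambda>z. (angle_from w0 (fst z), snd z))"
    by (rule csmooth_Pair[OF A _ csmooth_linear[OF bounded_linear_snd A]])
  obtain G0 where G0: "openin (mtop Y) G0" "t ` (ST \<inter> A) = N \<inter> G0" using t_image_relatively_open[OF A] .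
  have him: "(\<lambda>y. t (L y)) ` (half_space 0 \<inter> Q) = N \<inter> G0"
    using LQ G0(2) by (metis half_space_zero image_image inf_top_left)
  have hN: "(\<lambda>y. t (L y)) ` (half_space 0 \<inter> Q) \<subseteq> N" unfolding him by blast
  have sk: "smooth_map_on Y ((\<lambda>y. t (L y)) ` (half_space 0 \<inter> Q)) euclid k"
    unfolding k_def
  proof (rule smooth_map_on_csmooth[OF smooth_map_on_subset[OF smooth_s hN] cL' A _ premfd_Y])
    fix y assume "y \<in> (\<lambda>y. t (L y)) ` (half_space 0 \<inter> Q)"
    then obtain z where "z \<in> Q" "y = t (L z)" by auto
    then show "s y \<in> A" using LQ st[of "L z"] by auto
  qed
  have kh: "k (t (L y)) = y" if "y \<in> half_space 0 \<inter> Q" for y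
  proof -
    have "L y \<in> ST" using that LQ by auto
    moreover have "\<bar>fst y\<bar> < pi" using that pi_gt_zero unfolding Q_def by auto
    ultimately show ?thesis using st[of "L y"] angle_from_cis[OF w0, of "fst y"] by (simp add: k_def L_def)
  qed
  have x0: "(0, v0) \<in> Q" "(0, v0) \<in> half_space 0" using v0 by (auto simp: Q_def)
  show thesis
  proof (rule mfd_half_space_patch[OF premfd_Y Y(2) _ Q x0 sh sk kh G0(1) him])
    fix G \<beta> g assume *: "openin (mtop Y) G" "t (L (0, v0)) \<in> G"
      "\<And>y. y \<in> G \<Longrightarrow> (y \<in> N) = (\<beta> y \<in> half_space (0::real \<times> complex))"
    show thesis by (rule that[of G]) (use * in \<open>auto simp: L_def\<close>)
  qed simp_all
qed

text \<open>In the coordinates given by the angle of the first factor and \<open>Ln (v / v0)\<close>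
  of the second one, the disk becomes the half-plane of nonpositive real parts, because
  \<open>norm (exp z) = exp (Re z)\<close>. Straightening extends these coordinates across the
  boundary of the solid torus.\<close>

lemma boundary_patch:
  assumes w0: "norm w0 = 1" and v0: "norm v0 = 1"
  obtains G and \<beta> :: "'a \<Rightarrow> real \<times> complex" and g where "openin (mtop Y) G" "t (w0, v0) \<in> G" "open (\<beta> ` G)"
    "smooth_map_on Y G euclid \<beta>" "smooth_map_on euclid (\<beta> ` G) Y g" "\<And>y. y \<in> G \<Longrightarrow> g (\<beta> y) = y"
    "\<And>y. y \<in> G \<Longrightarrow> y \<in> N \<longleftrightarrow> Re (snd (\<beta> y)) \<le> 0"
    "\<And>y. y \<in> G \<Longrightarrow> y \<in> N \<Longrightarrow> Re (snd (\<beta> y)) = 0 \<longleftrightarrow> norm (snd (s y)) = 1"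
    "\<beta> (t (w0, v0)) = (0, 0)"
proof -
  define L :: "real \<times> complex \<Rightarrow> complex \<times> complex" where "L = (\<lambda>y. (w0 * cis (fst y), v0 * exp (snd y)))"
  define Q :: "(real \<times> complex) set" where "Q = {-pi/2<..<pi/2} \<times> {z. \<bar>Im z\<bar> < pi/2}"
  define A :: "(complex \<times> complex) set" where "A = {w. Re (w * cnj w0) > 0} \<times> {v. Re (v * cnj v0) > 0}"
  define b :: "real \<times> complex" where "b = (0, -1)"
  have H: "y \<in> half_space b \<longleftrightarrow> Re (snd y) \<le> 0" for y
    by (cases y) (simp add: half_space_def b_def inner_complex_def)
  have Q: "open Q" unfolding Q_def by (intro open_Times open_Collect_less continuous_intros open_greaterThanLessThan)
  have A: "open A" unfolding A_def using open_Re_pos[OF w0] open_Re_pos[OF v0] by (intro open_Times) auto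
  have Lnv: "Ln (v0 * exp z * cnj v0) = z" if "\<bar>Im z\<bar> < pi/2" for z
    unfolding unit_cancel[OF v0] by (rule Ln_exp) (use that pi_gt_zero in linarith)+
  have LQ: "L ` (half_space b \<inter> Q) = ST \<inter> A"
  proof (intro equalityI subsetI)
    fix z assume "z \<in> L ` (half_space b \<inter> Q)"
    then obtain y where "y \<in> half_space b" "y \<in> Q" "z = L y" by blast
    moreover define a v where "a = fst y" and "v = snd y"
    ultimately have z: "z = (w0 * cis a, v0 * exp v)" "\<bar>a\<bar> < pi/2" "\<bar>Im v\<bar> < pi/2" "Re v \<le> 0"
      by (auto simp: L_def Q_def H)
    have "Re (v0 * exp v * cnj v0) > 0"
      unfolding unit_cancel[OF v0] Re_exp using cos_gt_zero_pi[of "Im v"] z(3) by (auto simp: abs_less_iff)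
    then have "z \<in> A" using Re_cis_pos[OF w0 z(2)] unfolding A_def z(1) by blast
    moreover have "z \<in> ST" using w0 v0 z(4) unfolding z(1) by (simp add: norm_mult)
    ultimately show "z \<in> ST \<inter> A" by blast
  next
    fix z assume z: "z \<in> ST \<inter> A"
    then have n: "norm (fst z) = 1" "Re (fst z * cnj w0) > 0" "norm (snd z) \<le> 1" "Re (snd z * cnj v0) > 0"
      by (auto simp: A_def)
    have nz: "snd z * cnj v0 \<noteq> 0" using n(4) by (metis less_irrefl zero_complex.sel(1))
    let ?v = "Ln (snd z * cnj v0)"
    have "v0 * exp ?v = snd z" unfolding exp_Ln[OF nz] by (rule unit_cancel(1)[OF v0])
    then have "z = L (angle_from w0 (fst z), ?v)" using cis_angle_from[OF w0 n(1)] by (simp add: L_def)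
    moreover have "\<bar>Im ?v\<bar> < pi/2" using Re_Ln_pos_lt[OF nz] n(4) by blast
    moreover have "Re ?v \<le> 0" using nz n(3) v0 by (simp add: norm_mult)
    ultimately show "z \<in> L ` (half_space b \<inter> Q)"
      using angle_from_bound[OF w0 n(2)] by (intro image_eqI[of _ _ "(angle_from w0 (fst z), ?v)"]) (auto simp: Q_def H)
  qed
  have "csmooth UNIV (\<lambda>y::real \<times> complex. w0 * cis (fst y))"
    by (rule csmooth_compose[OF open_UNIV open_UNIV csmooth_linear[OF bounded_linear_fst open_UNIV] csmooth_cis_from[OF w0]]) simp
  moreover have "csmooth UNIV (\<lambda>z. v0 * exp z)"
    by (intro csmooth_holomorphic holomorphic_intros open_UNIV)
  then have "csmooth UNIV (\<lambda>y::real \<times> complex. v0 * exp (snd y))"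
    by (rule csmooth_compose[OF open_UNIV open_UNIV csmooth_linear[OF bounded_linear_snd open_UNIV]]) simp
  ultimately have "csmooth UNIV L"
    unfolding L_def by (intro csmooth_Pair open_UNIV)
  then have sL: "smooth_map_on euclid (half_space b \<inter> Q) euclid L"
    by (simp add: smooth_map_on_euclid csmooth_imp_smooth_on)
  have sh: "smooth_map_on euclid (half_space b \<inter> Q) Y (\<lambda>y. t (L y))"
    by (rule smooth_map_on_compose[OF sL smooth_t _ premfd_euclid premfd_euclid]) (use LQ in blast)
  define k where "k = (\<lambda>y. (angle_from w0 (fst (s y)), Ln (snd (s y) * cnj v0)))"
  have "csmooth A (\<lambda>z. angle_from w0 (fst z))"
    by (rule csmooth_compose[OF A open_Re_pos[OF w0] csmooth_linear[OF bounded_linear_fst A] csmooth_angle_from[OF w0]])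
       (auto simp: A_def)
  moreover have "csmooth A (\<lambda>z. Ln (snd z * cnj v0))"
    by (rule csmooth_compose[OF A open_Re_pos[OF v0] csmooth_linear[OF bounded_linear_snd A] csmooth_Ln_from[OF v0]])
       (auto simp: A_def)
  ultimately have cL': "csmooth A (\<lambda>z. (angle_from w0 (fst z), Ln (snd z * cnj v0)))"
    by (intro csmooth_Pair A)
  obtain G0 where G0: "openin (mtop Y) G0" "t ` (ST \<inter> A) = N \<inter> G0" using t_image_relatively_open[OF A] .
  have him: "(\<lambda>y. t (L y)) ` (half_space b \<inter> Q) = N \<inter> G0"
    using LQ G0(2) by (metis image_image)
  have hN: "(\<lambda>y. t (L y)) ` (half_space b \<inter> Q) \<subseteq> N" unfolding him by blast
  have sk: "smooth_map_on Y ((\<lambda>y. t (L y)) ` (half_space b \<inter> Q)) euclid k"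
    unfolding k_def
  proof (rule smooth_map_on_csmooth[OF smooth_map_on_subset[OF smooth_s hN] cL' A _ premfd_Y])
    fix y assume "y \<in> (\<lambda>y. t (L y)) ` (half_space b \<inter> Q)"
    then obtain z where "z \<in> half_space b \<inter> Q" "y = t (L z)" by blast
    then show "s y \<in> A" using LQ st[of "L z"] by blast
  qed
  have kL: "(angle_from w0 (fst (L y)), Ln (snd (L y) * cnj v0)) = y" if "y \<in> half_space b \<inter> Q" for y
  proof -
    have "\<bar>fst y\<bar> < pi" using that pi_gt_zero unfolding Q_def by auto
    moreover have "\<bar>Im (snd y)\<bar> < pi/2" using that unfolding Q_def by auto
    ultimately show ?thesis using angle_from_cis[OF w0, of "fst y"] Lnv[of "snd y"] unfolding L_def by simp
  qed
  have kh: "k (t (L y)) = y" if "y \<in> half_space b \<inter> Q" for y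
  proof -
    have "L y \<in> ST" using that LQ by blast
    then show ?thesis unfolding k_def using st[of "L y"] kL[OF that] by simp
  qed
  have x0: "(0, 0) \<in> Q" "(0, 0) \<in> half_space b" by (auto simp: Q_def H)
  have L0: "L (0, 0) = (w0, v0)" by (simp add: L_def)
  show thesis
  proof (rule mfd_half_space_patch[OF premfd_Y Y(2) _ Q x0 sh sk kh G0(1) him])
    fix G \<beta> g
    assume *: "openin (mtop Y) G" "t (L (0, 0)) \<in> G" "open (\<beta> ` G)" "smooth_map_on Y G euclid \<beta>"
      "smooth_map_on euclid (\<beta> ` G) Y g" "\<And>y. y \<in> G \<Longrightarrow> g (\<beta> y) = y"
      "\<And>y. y \<in> G \<Longrightarrow> (y \<in> N) = (\<beta> y \<in> half_space b)" "\<And>y. y \<in> G \<Longrightarrow> y \<in> N \<Longrightarrow> \<beta> y = k y"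
    have wv: "(w0, v0) \<in> ST" using w0 v0 by simp
    \<comment> \<open>The core of the solid torus is removed, since there the logarithm is applied
      to 0 and tells nothing about the norm.\<close>
    define G' where "G' = G - {y \<in> N. snd (s y) = 0}"
    have "closedin (mtop Y) {y \<in> N. snd (s y) = 0}"
    proof -
      have "continuous_map (subtopology (mtop Y) N) euclidean (\<lambda>y. snd (s y))"
        using continuous_map_compose[OF smooth_map_on_continuous[OF smooth_s], of euclidean snd]
        by (simp add: comp_def continuous_on_snd)
      then have "closedin (subtopology (mtop Y) N) {y \<in> topspace (subtopology (mtop Y) N). snd (s y) \<in> {0}}"
        by (rule closedin_continuous_map_preimage) simp
      moreover have "{y \<in> topspace (subtopology (mtop Y) N). snd (s y) \<in> {0}} = {y \<in> N. snd (s y) \<in> {0}}"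
        using N_pts by auto
      ultimately have "closedin (subtopology (mtop Y) N) {y \<in> N. snd (s y) \<in> {0}}" by metis
      from closedin_trans_full[OF this closed_N] show ?thesis by simp
    qed
    then have G': "openin (mtop Y) G'" unfolding G'_def using *(1) by blast
    have G'G: "G' \<subseteq> G" by (auto simp: G'_def)
    have im: "\<beta> ` G' = \<beta> ` (G \<inter> G')" using G'G by (simp add: inf.absorb2)
    show thesis
    proof (rule that[of G' \<beta> g])
      show "openin (mtop Y) G'" by (rule G')
      show "t (w0, v0) \<in> G'" using *(2) L0 st[OF wv] v0 by (auto simp: G'_def)
      show "open (\<beta> ` G')" unfolding im by (rule smooth_map_on_open_image[OF *(5,3,6) G'])
      show "smooth_map_on Y G' euclid \<beta>" by (rule smooth_map_on_subset[OF *(4) G'G])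
      show "smooth_map_on euclid (\<beta> ` G') Y g" by (rule smooth_map_on_subset[OF *(5)]) (use G'G in blast)
      show "g (\<beta> y) = y" if "y \<in> G'" for y using *(6) that G'G by blast
      show "y \<in> N \<longleftrightarrow> Re (snd (\<beta> y)) \<le> 0" if "y \<in> G'" for y using *(7) H that G'G by blast
      show "Re (snd (\<beta> y)) = 0 \<longleftrightarrow> norm (snd (s y)) = 1" if "y \<in> G'" "y \<in> N" for y
      proof -
        have "\<beta> y = k y" "snd (s y) \<noteq> 0" using *(8)[of y] that G'G by (auto simp: G'_def)
        moreover have "v0 \<noteq> 0" using v0 by auto
        ultimately have "Re (snd (\<beta> y)) = ln (norm (snd (s y)))" using v0 by (simp add: k_def norm_mult)
        then show ?thesis using \<open>snd (s y) \<noteq> 0\<close> by (simp add: ln_eq_zero_iff)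
      qed
      have "t (w0, v0) \<in> N" using t_N[OF wv] .
      then have "\<beta> (t (w0, v0)) = k (t (w0, v0))" using *(2,8) L0 by simp
      also have "\<dots> = (0, 0)" using kh[of "(0,0)"] x0 L0 by simp
      finally show "\<beta> (t (w0, v0)) = (0, 0)" .
    qed
  qed simp_all
qed

text \<open>A point with \<open>norm v = 1\<close> cannot be interior: \<open>\<beta>\<close> would
  map a neighbourhood contained in \<open>N\<close> onto an open set around the origin, and such a
  set contains points of positive real part.\<close>

lemma interior_N: "mtop Y interior_of N = t ` (sphere 0 1 \<times> ball 0 1)"
proof (intro equalityI subsetI)
  fix y assume "y \<in> t ` (sphere 0 1 \<times> ball 0 1)"
  then obtain w v where "y = t (w, v)" "norm w = 1" "norm v < 1" by auto
  then obtain G where "openin (mtop Y) G" "y \<in> G" "G \<subseteq> N" using interior_patch by blast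
  then show "y \<in> mtop Y interior_of N" by (auto simp: interior_of_def)
next
  fix y assume "y \<in> mtop Y interior_of N"
  then obtain O1 where O1: "openin (mtop Y) O1" "y \<in> O1" "O1 \<subseteq> N" by (auto simp: interior_of_def)
  then obtain w v where y: "y = t (w, v)" "norm w = 1" "norm v \<le> 1" unfolding N_eq by auto
  have "norm v \<noteq> 1"
  proof
    assume v: "norm v = 1"
    show False
    proof (rule boundary_patch[OF y(2) v])
      fix G \<beta> g
      assume *: "openin (mtop Y) G" "t (w, v) \<in> G" "open (\<beta> ` G)" "smooth_map_on euclid (\<beta> ` G) Y g"
        "\<And>y. y \<in> G \<Longrightarrow> g (\<beta> y) = y" "\<And>y. y \<in> G \<Longrightarrow> (y \<in> N) = (Re (snd (\<beta> y)) \<le> 0)"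
        "\<beta> (t (w, v)) = (0::real, 0)"
      have "open (\<beta> ` (G \<inter> O1))" by (rule smooth_map_on_open_image[OF *(4,3,5) O1(1)])
      moreover have "(0, 0) \<in> \<beta> ` (G \<inter> O1)" using *(2,7) O1(2) y(1) by (metis IntI imageI)
      ultimately obtain e where e: "e > 0" "ball (0, 0) e \<subseteq> \<beta> ` (G \<inter> O1)" by (meson open_contains_ball)
      have "(0, of_real (e/2)) \<in> ball (0::real, 0::complex) e" using e(1) by (simp add: dist_Pair_Pair)
      then have "(0, of_real (e/2)) \<in> \<beta> ` (G \<inter> O1)" using e(2) by blast
      then obtain z where "z \<in> G" "z \<in> O1" "(0, of_real (e/2)) = \<beta> z" by blast
      then have "z \<in> G" "z \<in> O1" "\<beta> z = (0, of_real (e/2))" by simp_all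
      then show False using *(6)[of z] O1(3) e(1) by auto
    qed
  qed
  then show "y \<in> t ` (sphere 0 1 \<times> ball 0 1)" using y by auto
qed

lemma pts_E: "pts E = pts Y - t ` (sphere 0 1 \<times> ball 0 1)"
  unfolding exterior_def interior_N by auto

lemma E_def': "E = submfd Y (pts Y - t ` (sphere 0 1 \<times> ball 0 1))"
  unfolding exterior_def interior_N ..

definition "bdN = t ` (sphere 0 1 \<times> sphere 0 1)"

lemma E_Int_N: "y \<in> N \<Longrightarrow> y \<in> pts E \<longleftrightarrow> norm (snd (s y)) = 1"
proof -
  assume y: "y \<in> N"
  have "y \<in> t ` (sphere 0 1 \<times> ball 0 1) \<longleftrightarrow> norm (snd (s y)) < 1"
  proof
    assume "y \<in> t ` (sphere 0 1 \<times> ball 0 1)"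
    then obtain z where z: "y = t z" "z \<in> sphere 0 1 \<times> ball 0 1" by blast
    then have "z \<in> ST" by auto
    then show "norm (snd (s y)) < 1" using z st[of z] by auto
  next
    assume "norm (snd (s y)) < 1"
    then have "s y \<in> sphere 0 1 \<times> ball 0 1" using s_ST[OF y] by (auto simp: mem_Times_iff)
    then show "y \<in> t ` (sphere 0 1 \<times> ball 0 1)" using ts[OF y] by (metis imageI)
  qed
  moreover have "norm (snd (s y)) \<le> 1" using s_ST[OF y] by (auto simp: mem_Times_iff)
  ultimately show ?thesis unfolding pts_E using y N_pts by auto
qed

lemma bdN_iff: "y \<in> bdN \<longleftrightarrow> y \<in> N \<and> y \<in> pts E"
proof
  assume "y \<in> bdN"
  then obtain z where z: "y = t z" "z \<in> sphere 0 1 \<times> sphere 0 1" unfolding bdN_def by blast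
  then have "z \<in> ST" by auto
  then have "y \<in> N" "norm (snd (s y)) = 1" using z st[of z] t_N[of z] by auto
  then show "y \<in> N \<and> y \<in> pts E" using E_Int_N by blast
next
  assume y: "y \<in> N \<and> y \<in> pts E"
  then have "s y \<in> sphere 0 1 \<times> sphere 0 1" using E_Int_N[of y] s_ST[of y] by (auto simp: mem_Times_iff)
  then show "y \<in> bdN" unfolding bdN_def using ts[of y] y by (metis imageI)
qed

lemma E_interior_chart:
  assumes "x \<in> pts E" "x \<notin> N"
  obtains U \<phi> where "(U, \<phi>) \<in> atlas E" "x \<in> U" "open (\<phi> ` U)"
proof -
  have x: "x \<in> pts Y" using assms(1) unfolding pts_E by blast
  obtain V \<psi> where V: "(V, \<psi>) \<in> atlas Y" "x \<in> V" using chart_at[OF premfd_Y x] .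
  let ?U = "V \<inter> (pts Y - N)"
  have o: "openin (mtop Y) (pts Y - N)" using closed_N by blast
  have im: "open (\<psi> ` ?U)" using chart_image_open[OF premfd_Y Y(2) V(1) o] .
  have "openin (mtop Y) ?U" using chart_open[OF premfd_Y V(1)] o by blast
  moreover have "?U \<subseteq> pts Y - t ` (sphere 0 1 \<times> ball 0 1)"
  proof -
    have "t ` (sphere 0 1 \<times> ball 0 1) \<subseteq> N" unfolding N_eq by auto
    then show ?thesis by blast
  qed
  ultimately have oU: "openin (subtopology (mtop Y) (pts Y - t ` (sphere 0 1 \<times> ball 0 1))) ?U"
    by (auto simp: openin_subtopology)
  have "(?U, \<psi>) \<in> atlas E"
    unfolding E_def'
    by (rule premfd_open_chart[OF oU im smooth_map_on_subset[OF chart_smooth[OF premfd_Y V(1)]]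
        smooth_map_on_subset[OF chart_inverse_smooth[OF premfd_Y V(1)]] chart_inv[OF premfd_Y V(1)]]) auto
  then show thesis using that im x V(2) assms(2) by blast
qed

text \<open>The coordinates that take the solid torus to nonpositive real parts take the exterior to
  nonnegative ones, so the same patch is a boundary chart for the other side.\<close>

lemma E_boundary_chart:
  assumes "x \<in> bdN"
  obtains U \<phi> b where "(U, \<phi>) \<in> atlas E" "x \<in> U" "b \<noteq> 0" "\<phi> x \<bullet> b = 0" "\<phi> ` U \<subseteq> half_space b"
proof -
  obtain w0 v0 where x: "x = t (w0, v0)" "norm w0 = 1" "norm v0 = 1" using assms unfolding bdN_def by auto
  have xE: "x \<in> pts E" using assms bdN_iff by blast
  have dim: "DIM(real \<times> complex) = DIM(real^3)" by simp
  obtain \<iota> :: "real \<times> complex \<Rightarrow> real^3" and \<kappa> where iso: "linear \<iota>" "linear \<kappa>" "\<And>x. \<kappa> (\<iota> x) = x" "\<And>y. \<iota> (\<kappa> y) = y"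
    using linear_iso_DIM[OF dim] by metis
  have bl: "bounded_linear \<iota>" "bounded_linear \<kappa>" using iso by (simp_all add: linear_conv_bounded_linear)
  show thesis
  proof (rule boundary_patch[OF x(2,3)])
    fix G and \<beta> :: "'a \<Rightarrow> real \<times> complex" and g
    assume *: "openin (mtop Y) G" "t (w0, v0) \<in> G" "open (\<beta> ` G)"
      "smooth_map_on Y G euclid \<beta>" "smooth_map_on euclid (\<beta> ` G) Y g" "\<And>y. y \<in> G \<Longrightarrow> g (\<beta> y) = y"
      "\<And>y. y \<in> G \<Longrightarrow> (y \<in> N) = (Re (snd (\<beta> y)) \<le> 0)"
      "\<And>y. y \<in> G \<Longrightarrow> y \<in> N \<Longrightarrow> (Re (snd (\<beta> y)) = 0) = (norm (snd (s y)) = 1)"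
      "\<beta> (t (w0, v0)) = (0, 0)"
    have GE: "y \<in> pts E \<longleftrightarrow> Re (snd (\<beta> y)) \<ge> 0" if "y \<in> G" for y
    proof (cases "y \<in> N")
      case True
      then show ?thesis using E_Int_N[OF True] *(7,8)[OF that] by auto
    next
      case False
      have "y \<in> pts Y" using that *(1) openin_subset by blast
      moreover have "t ` (sphere 0 1 \<times> ball 0 1) \<subseteq> N" unfolding N_eq by auto
      ultimately have "y \<in> pts E" using False unfolding pts_E by blast
      then show ?thesis using False *(7)[OF that] by auto
    qed
    \<comment> \<open>\<open>\<iota>\<close> moves the coordinates to the model space of
      \<open>Y\<close>, and the adjoint supplies the vector \<open>?b\<close> whose inner product
      with a point is the real part in question.\<close>
    let ?U = "G \<inter> pts E" and ?\<phi> = "\<lambda>y. \<iota> (\<beta> y)" and ?b = "adjoint \<kappa> (0, 1)"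
    have adj: "y \<bullet> ?b = Re (snd (\<kappa> y))" for y
      unfolding adjoint_works[OF iso(2)] by (cases "\<kappa> y") (simp add: inner_complex_def)
    have im: "?\<phi> ` ?U = half_space ?b \<inter> \<kappa> -` (\<beta> ` G)"
    proof (intro equalityI subsetI)
      fix z assume "z \<in> ?\<phi> ` ?U"
      then obtain y where "y \<in> G" "y \<in> pts E" "z = \<iota> (\<beta> y)" by blast
      then show "z \<in> half_space ?b \<inter> \<kappa> -` (\<beta> ` G)" using GE iso(3) by (simp add: half_space_def adj)
    next
      fix z assume "z \<in> half_space ?b \<inter> \<kappa> -` (\<beta> ` G)"
      then obtain y where y: "y \<in> G" "\<kappa> z = \<beta> y" "Re (snd (\<kappa> z)) \<ge> 0" by (auto simp: half_space_def adj)
      then have "y \<in> ?U" "z = \<iota> (\<beta> y)" using GE iso(4) by (auto, metis)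
      then show "z \<in> ?\<phi> ` ?U" by blast
    qed
    have "open (\<kappa> -` (\<beta> ` G))"
      using continuous_open_preimage[OF linear_continuous_on[OF bl(2)] open_UNIV *(3)] by simp
    then have ci: "chart_image (?\<phi> ` ?U)"
      unfolding chart_image_def im by (metis openin_open_Int)
    have oU: "openin (subtopology (mtop Y) (pts Y - t ` (sphere 0 1 \<times> ball 0 1))) ?U"
      unfolding pts_E using *(1) by (metis inf_commute openin_subtopology)
    have s\<iota>: "smooth_map_on euclid UNIV euclid \<iota>" "smooth_map_on euclid UNIV euclid \<kappa>"
      unfolding smooth_map_on_euclid
      by (rule csmooth_imp_smooth_on[OF csmooth_linear[OF _ open_UNIV] open_UNIV], use bl in auto)+
    have iso\<beta>: "\<kappa> (\<iota> (\<beta> y)) = \<beta> y" for y by (rule iso(3))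
    have s1: "smooth_map_on Y ?U euclid ?\<phi>"
      by (rule smooth_map_on_compose[OF smooth_map_on_subset[OF *(4)] s\<iota>(1) _ premfd_Y premfd_euclid]) auto
    have s2: "smooth_map_on euclid (?\<phi> ` ?U) Y (\<lambda>z. g (\<kappa> z))"
      by (rule smooth_map_on_compose[OF smooth_map_on_subset[OF s\<iota>(2)] *(5) _ premfd_euclid premfd_euclid])
         (use iso\<beta> in auto)
    have "diffeo_on Y ?U euclid (?\<phi> ` ?U) ?\<phi>"
      by (rule diffeo_onI[OF s1 s2 premfd_euclid]) (use iso\<beta> *(6) in auto)
    then have "(?U, ?\<phi>) \<in> atlas (submfd Y (pts Y - t ` (sphere 0 1 \<times> ball 0 1)))"
      unfolding submfd_atlas using oU ci by blast
    then have "(?U, ?\<phi>) \<in> atlas E" by (simp only: E_def')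
    moreover have "x \<in> ?U" using *(2) x(1) xE by blast
    moreover have "?\<phi> x \<bullet> ?b = 0" unfolding adj iso(3) x(1) *(9) by simp
    moreover have "?b \<noteq> 0" using adj[of "\<iota> (0, 1)"] iso(3) by auto
    moreover have "?\<phi> ` ?U \<subseteq> half_space ?b" unfolding im by blast
    ultimately show thesis using that[of ?U ?\<phi> ?b] by blast
  qed
qed

lemma premfd_E: "premfd E"
  unfolding E_def'
proof (rule premfd_submfd[OF premfd_Y], fold E_def')
  fix x assume "x \<in> pts Y - t ` (sphere 0 1 \<times> ball 0 1)"
  then have x: "x \<in> pts E" unfolding pts_E .
  show "\<exists>U \<phi>. (U, \<phi>) \<in> atlas E \<and> x \<in> U"
  proof (cases "x \<in> N")
    case True
    then have "x \<in> bdN" using x bdN_iff by blast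
    then show ?thesis using E_boundary_chart by metis
  next
    case False
    then show ?thesis using E_interior_chart[OF x] by metis
  qed
qed

lemma bd_E: "bd E = bdN"
proof (intro equalityI subsetI)
  fix x assume x: "x \<in> bd E"
  then have xE: "x \<in> pts E" unfolding bd_def by blast
  have "x \<in> N"
  proof (rule ccontr)
    assume "x \<notin> N"
    then obtain U \<phi> where U: "(U, \<phi>) \<in> atlas E" "x \<in> U" "open (\<phi> ` U)" using E_interior_chart[OF xE] by blast
    then show False using bd_iff_chart[OF premfd_E U(1,2)] x by (simp add: interior_open)
  qed
  then show "x \<in> bdN" using xE bdN_iff by blast
next
  fix x assume "x \<in> bdN"
  then obtain U \<phi> b where U: "(U, \<phi>) \<in> atlas E" "x \<in> U" "b \<noteq> 0" "\<phi> x \<bullet> b = 0" "\<phi> ` U \<subseteq> half_space b"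
    using E_boundary_chart by metis
  then show "x \<in> bd E" using bd_iff_chart[OF premfd_E U(1,2)] not_interior_half_space by blast
qed

lemma compact_E: "compact_space (mtop E)"
proof -
  have "pts E = pts Y - mtop Y interior_of N" unfolding pts_E interior_N ..
  then have "closedin (mtop Y) (pts E)" by auto
  then have "compactin (mtop Y) (pts E)" using Y(3) closedin_compact_space by blast
  moreover have "mtop E = subtopology (mtop Y) (pts E)" unfolding E_def' pts_E by (simp add: subtopology_restrict)
  ultimately show ?thesis by (metis compact_space_subtopology)
qed

end

section \<open>The pieces of the gluing\<close>

text \<open>What the gluing has to know about \<open>S^1 x E\<close>. The assumption
  \<open>curve\<close> expresses through curves that \<open>z\<close> to the \<open>a\<close> times
  \<open>P\<close> to the \<open>b\<close> is a submersion for every nonzero exponent pair, also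
  after restriction to the boundary; curves avoid derivatives at boundary points, where a smooth map
  only has local extensions. The assumption \<open>torus\<close> is topological:
  \<open>\<Theta>\<close> is a universal covering map of the boundary with period lattice
  \<open>2 * pi\<close> times the integer lattice.\<close>

locale piece =
  fixes W :: "('w, 'e::euclidean_space) mfd" and z P :: "'w \<Rightarrow> complex"
  assumes premfd_W: "premfd W"
    and compact_W: "compact_space (mtop W)" and Hausdorff_W: "Hausdorff_space (mtop W)"
    and chart_image_W: "(U, \<phi>) \<in> atlas W \<Longrightarrow> chart_image (\<phi> ` U)"
    and smooth_z: "smooth_map_on W (pts W) euclid z" and smooth_P: "smooth_map_on W (pts W) euclid P"
    and norm_z: "w \<in> pts W \<Longrightarrow> norm (z w) = 1" and norm_P: "w \<in> pts W \<Longrightarrow> norm (P w) = 1"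
    and curve: "w \<in> pts W \<Longrightarrow> a \<noteq> 0 \<or> b \<noteq> 0 \<Longrightarrow>
      \<exists>\<gamma> c. c \<noteq> (0::real) \<and> smooth_map_on euclid UNIV W \<gamma> \<and> \<gamma> (0::real) = w \<and> (w \<in> bd W \<longrightarrow> (\<forall>s. \<gamma> s \<in> bd W)) \<and>
        (\<forall>s. z (\<gamma> s) powi a * P (\<gamma> s) powi b = z w powi a * P w powi b * cis (c * s))"
    and torus: "\<exists>\<Theta>. continuous_map euclidean (mtop W) \<Theta> \<and> range \<Theta> = bd W \<and>
      (\<forall>x y x' y' x'' y''. \<Theta> (x, x', x'') = \<Theta> (y, y', y'') \<longleftrightarrow> cis x = cis y \<and> cis x' = cis y' \<and> cis x'' = cis y'')"

section \<open>Curves along which the circle-valued maps rotate\<close>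

lemma local_diffeo_smooth:
  assumes "local_diffeo M N f" "premfd M"
  shows "smooth_map_on M (pts M) N f"
proof (rule smooth_map_on_local[OF assms(2) order_refl])
  fix x assume "x \<in> pts M"
  then obtain U where U: "openin (mtop M) U" "x \<in> U" "diffeo_on M U N (f ` U) f"
    using assms(1) unfolding local_diffeo_def by blast
  then have "smooth_map_on M U N f" unfolding diffeo_on_def by blast
  moreover have "pts M \<inter> U = U" using openin_subset[OF U(1)] by blast
  ultimately show "\<exists>G. openin (mtop M) G \<and> x \<in> G \<and> smooth_map_on M (pts M \<inter> G) N f" using U by metis
qed

lemma local_diffeo_interior_pt:
  assumes "local_diffeo M N f" "x \<in> pts M"
  shows "interior_pt TYPE('e::euclidean_space) (mtop M) x \<longleftrightarrow> interior_pt TYPE('e) (mtop N) (f x)"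
proof -
  obtain U where U: "openin (mtop M) U" "x \<in> U" "openin (mtop N) (f ` U)" "diffeo_on M U N (f ` U) f"
    using assms unfolding local_diffeo_def by blast
  then have inj: "inj_on f U" unfolding diffeo_on_def bij_betw_def by blast
  have c: "continuous_map (subtopology (mtop M) U) (mtop N) f"
    "continuous_map (subtopology (mtop N) (f ` U)) (mtop M) (inv_into U f)"
    using U(4) smooth_map_on_continuous unfolding diffeo_on_def by blast+
  have inv: "inv_into U f (f x) = x" using inj U(2) by simp
  have inj': "inj_on (inv_into U f) (f ` U)" by (rule inj_on_inv_into) simp
  show ?thesis
  proof
    assume "interior_pt TYPE('e) (mtop M) x"
    from interior_pt_image[OF this U(1,2) c(1) inj] show "interior_pt TYPE('e) (mtop N) (f x)" .
  next
    assume "interior_pt TYPE('e) (mtop N) (f x)"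
    from interior_pt_image[OF this U(3) _ c(2) inj'] U(2) inv show "interior_pt TYPE('e) (mtop M) x" by simp
  qed
qed

text \<open>Translation of the real factor is a homeomorphism. This keeps curves in the boundary of
  a mapping torus without determining the boundary of the product of the fiber with the
  line.\<close>

lemma interior_pt_translate:
  assumes "interior_pt TYPE('e::euclidean_space) (prod_topology T euclidean) (y, s::real)" "y \<in> topspace T"
  shows "interior_pt TYPE('e) (prod_topology T euclidean) (y, s'::real)"
proof -
  let ?q = "\<lambda>x. (fst x, snd x + (s' - s))"
  have "continuous_map (prod_topology T euclidean) euclidean (\<lambda>x. snd x + (s' - s))"
    by (intro continuous_map_add continuous_map_snd) simp
  then have "continuous_map (prod_topology T euclidean) (prod_topology T euclidean) ?q"
    by (intro continuous_map_pairedI continuous_map_fst)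
  then have c: "continuous_map (subtopology (prod_topology T euclidean) (topspace (prod_topology T euclidean)))
      (prod_topology T euclidean) ?q" unfolding subtopology_topspace .
  have i: "inj_on ?q (topspace (prod_topology T euclidean))" by (auto simp: inj_on_def)
  have "(y, s) \<in> topspace (prod_topology T (euclidean :: real topology))" using assms(2) by simp
  from interior_pt_image[OF assms(1) openin_topspace this c i] show ?thesis by simp
qed

context tube
begin

text \<open>The curve is an orbit of the suspension flow, the image under the quotient map
  \<open>q\<close> of a line \<open>{y} x R\<close>. As \<open>q\<close> is a local diffeomorphism,
  either all points of the orbit lie in the boundary or none do.\<close>

lemma E_curve:
  fixes F :: "('a, real^2) mfd"
  assumes F: "smooth_mfd F" and mono: "monodromy E p F \<phi>" and x: "x \<in> pts E"
  obtains \<gamma> :: "real \<Rightarrow> 'a" where "smooth_map_on euclid UNIV E \<gamma>" "\<gamma> 0 = x"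
    "\<And>s. x \<in> bd E \<Longrightarrow> \<gamma> s \<in> bd E" "\<And>s. p (\<gamma> s) = p x * cis (2 * pi * s)"
proof -
  have pF: "premfd F" using F by (rule smooth_mfd_premfd)
  let ?FR = "prod_mfd F (euclid :: (real, real) mfd)"
  have pFR: "premfd ?FR" by (rule premfd_prod[OF pF premfd_euclid])
  obtain q where q: "q ` (pts F \<times> UNIV) = pts E" "local_diffeo ?FR E q"
    "\<And>x s. x \<in> pts F \<Longrightarrow> p (q (x, s)) = cis (2 * pi * s)"
    using mono unfolding monodromy_def by blast
  obtain y s0 where y: "y \<in> pts F" "x = q (y, s0)" using x q(1) by blast
  define \<gamma> where "\<gamma> = (\<lambda>s. q (y, s0 + s))"
  have ys: "(y, s) \<in> pts ?FR" for s using y(1) by simp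
  have 1: "smooth_map_on euclid UNIV F (\<lambda>s::real. y)"
    by (rule smooth_map_on_const[OF premfd_euclid _ y(1)]) simp
  have "csmooth UNIV (\<lambda>s::real. s0 + s)" by (intro csmooth_add csmooth_const csmooth_ident open_UNIV)
  then have 2: "smooth_map_on euclid UNIV euclid (\<lambda>s::real. s0 + s)"
    by (simp add: smooth_map_on_euclid csmooth_imp_smooth_on)
  have sm: "smooth_map_on euclid UNIV E \<gamma>"
    unfolding \<gamma>_def
    by (rule smooth_map_on_compose[OF smooth_map_on_Pair[OF 1 2] local_diffeo_smooth[OF q(2) pFR] _ premfd_euclid pFR])
       (use y(1) in simp)
  have ip: "interior_pt TYPE(real^3) (mtop E) (q (y, s)) \<longleftrightarrow> interior_pt TYPE(real^3) (mtop ?FR) (y, s)" for s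
    using local_diffeo_interior_pt[OF q(2) ys] by blast
  have "\<gamma> s \<in> bd E" if "x \<in> bd E" for s
  proof -
    have "\<not> interior_pt TYPE(real^3) (mtop ?FR) (y, s0)"
      using that ip unfolding bd_iff_interior_pt[OF premfd_E] y(2) by blast
    then have "\<not> interior_pt TYPE(real^3) (mtop ?FR) (y, s0 + s)"
      using interior_pt_translate[of "mtop F" y "s0 + s" s0] y(1) by auto
    then have "\<not> interior_pt TYPE(real^3) (mtop E) (\<gamma> s)" using ip unfolding \<gamma>_def by blast
    moreover have "\<gamma> s \<in> pts E" using smooth_map_on_image[OF sm] by simp
    ultimately show ?thesis unfolding bd_iff_interior_pt[OF premfd_E] by blast
  qed
  moreover have "p (\<gamma> s) = p x * cis (2 * pi * s)" for s
    using q(3)[OF y(1)] unfolding \<gamma>_def y(2) by (simp add: cis_mult ring_distribs)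
  moreover have "\<gamma> 0 = x" by (simp add: \<gamma>_def y(2))
  ultimately show thesis using that sm by blast
qed

abbreviation "W \<equiv> prod_mfd circle E"

lemma premfd_prod_E: "premfd W"
  by (rule premfd_prod[OF premfd_circle premfd_E])

lemma pts_prod_E: "pts W = sphere 0 1 \<times> pts E"
  by simp

lemma circle_chart_open: "(U, \<phi>) \<in> atlas circle \<Longrightarrow> open (\<phi> ` U)"
  using chart_image_open[OF premfd_circle bd_circle _ openin_topspace, of U \<phi>]
    chart_subset[OF premfd_circle, of U \<phi>] by (metis inf.absorb1)

lemma bd_prod_E: "bd W = sphere 0 1 \<times> bd E"
proof -
  have "(\<theta>, x) \<in> bd W \<longleftrightarrow> x \<in> bd E" if \<theta>: "\<theta> \<in> sphere 0 1" and x: "x \<in> pts E" for \<theta> x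
  proof -
    have "\<theta> \<in> pts circle" using \<theta> by simp
    then obtain U c where U: "(U, c) \<in> atlas circle" "\<theta> \<in> U" using chart_at[OF premfd_circle] by blast
    obtain V \<psi> where V: "(V, \<psi>) \<in> atlas E" "x \<in> V" using chart_at[OF premfd_E x] by blast
    have UV: "(U \<times> V, map_prod c \<psi>) \<in> atlas W" using U V unfolding atlas_prod by blast
    have "map_prod c \<psi> ` (U \<times> V) = c ` U \<times> \<psi> ` V" by (rule map_prod_surj_on) auto
    then have "interior (map_prod c \<psi> ` (U \<times> V)) = c ` U \<times> interior (\<psi> ` V)"
      using circle_chart_open[OF U(1)] by (simp add: interior_Times interior_open)
    then show ?thesis
      using bd_iff_chart[OF premfd_prod_E UV, of "(\<theta>, x)"] bd_iff_chart[OF premfd_E V] U V by auto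
  qed
  moreover have "bd W \<subseteq> sphere 0 1 \<times> pts E" unfolding bd_def pts_prod_E[symmetric] by blast
  moreover have "bd E \<subseteq> pts E" unfolding bd_def by blast
  ultimately show ?thesis by blast
qed

lemma chart_image_prod_E:
  assumes "(U, \<phi>) \<in> atlas W"
  shows "chart_image (\<phi> ` U)"
proof -
  obtain U1 c V \<psi> where U: "U = U1 \<times> V" "\<phi> = map_prod c \<psi>" "(U1, c) \<in> atlas circle" "(V, \<psi>) \<in> atlas E"
    using assms unfolding atlas_prod by blast
  obtain b where "openin (top_of_set (half_space b)) (\<psi> ` V)"
    using U(4) unfolding exterior_def submfd_atlas chart_image_def by blast
  then obtain Q where Q: "open Q" "\<psi> ` V = half_space b \<inter> Q" by (auto simp: openin_open)
  have "map_prod c \<psi> ` (U1 \<times> V) = c ` U1 \<times> \<psi> ` V" by (rule map_prod_surj_on) auto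
  also have "\<dots> = half_space (0, b) \<inter> (c ` U1 \<times> Q)"
    unfolding Q(2) by (auto simp: half_space_def)
  finally have "\<phi> ` U = half_space (0, b) \<inter> (c ` U1 \<times> Q)" unfolding U .
  moreover have "open (c ` U1 \<times> Q)" using circle_chart_open[OF U(3)] Q(1) by (rule open_Times)
  ultimately show ?thesis unfolding chart_image_def by (metis openin_open_Int)
qed

lemma torus_coordinates:
  "\<exists>\<Theta>. continuous_map euclidean (mtop W) \<Theta> \<and> range \<Theta> = bd W \<and>
      (\<forall>x y x' y' x'' y''. \<Theta> (x, x', x'') = \<Theta> (y, y', y'') \<longleftrightarrow> cis x = cis y \<and> cis x' = cis y' \<and> cis x'' = cis y'')"
proof (intro exI[of _ "\<lambda>(x, x', x''). (cis x, t (cis x', cis x''))"] conjI allI)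
  let ?\<Theta> = "\<lambda>(x, x', x''). (cis x, t (cis x', cis x''))"
  have "continuous_map euclidean (subtopology euclidean ST) (\<lambda>x::real \<times> real \<times> real. (cis (fst (snd x)), cis (snd (snd x))))"
    by (auto simp: continuous_map_in_subtopology intro!: continuous_intros)
  from continuous_map_compose[OF this, of "mtop Y" t] smooth_map_on_continuous[OF smooth_t]
  have cY: "continuous_map euclidean (mtop Y) (\<lambda>x::real \<times> real \<times> real. t (cis (fst (snd x)), cis (snd (snd x))))"
    by (simp add: comp_def)
  have tE: "t (cis x', cis x'') \<in> pts E" "t (cis x', cis x'') \<in> bdN" for x' x''
  proof -
    show "t (cis x', cis x'') \<in> bdN" unfolding bdN_def by (rule imageI) simp
    then show "t (cis x', cis x'') \<in> pts E" using bdN_iff by blast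
  qed
  have mE: "mtop E = subtopology (mtop Y) (pts E)"
    unfolding E_def' pts_E by (simp add: subtopology_restrict)
  have "continuous_map euclidean (subtopology (mtop Y) (pts E))
      (\<lambda>x::real \<times> real \<times> real. t (cis (fst (snd x)), cis (snd (snd x))))"
    unfolding continuous_map_in_subtopology using cY tE(1) by blast
  then have "continuous_map euclidean (mtop E) (\<lambda>x::real \<times> real \<times> real. t (cis (fst (snd x)), cis (snd (snd x))))"
    by (subst mE)
  moreover have "continuous_map euclidean (mtop circle) (\<lambda>x::real \<times> real \<times> real. cis (fst x))"
    by (auto simp: continuous_map_in_subtopology intro!: continuous_intros)
  ultimately have "continuous_map euclidean (mtop W) (\<lambda>x. (cis (fst x), t (cis (fst (snd x)), cis (snd (snd x)))))"
    by (simp add: continuous_map_pairedI del: mtop_circle)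
  then show "continuous_map euclidean (mtop W) ?\<Theta>" by (simp add: case_prod_unfold)
  show "range ?\<Theta> = bd W"
  proof (intro equalityI subsetI)
    fix w assume "w \<in> range ?\<Theta>"
    then show "w \<in> bd W" unfolding bd_prod_E bd_E using tE(2) by auto
  next
    have c: "\<exists>a. u = cis a" if "norm u = 1" for u
      using that cis_Arg[of u] by (metis norm_eq_zero sgn_eq zero_neq_one div_by_1 of_real_1)
    fix w assume "w \<in> bd W"
    then obtain \<theta> u v where w: "w = (\<theta>, t (u, v))" "norm \<theta> = 1" "norm u = 1" "norm v = 1"
      unfolding bd_prod_E bd_E bdN_def by auto
    then obtain x x' x'' where "\<theta> = cis x" "u = cis x'" "v = cis x''" using c by metis
    then have "w = ?\<Theta> (x, x', x'')" using w(1) by simp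
    then show "w \<in> range ?\<Theta>" by blast
  qed
  fix x y x' y' x'' y''
  have "t (cis x', cis x'') = t (cis y', cis y'') \<longleftrightarrow> (cis x', cis x'') = (cis y', cis y'')"
  proof -
    have "(cis a, cis b) \<in> ST" for a b by simp
    then show ?thesis using st by metis
  qed
  then show "?\<Theta> (x, x', x'') = ?\<Theta> (y, y', y'') \<longleftrightarrow> cis x = cis y \<and> cis x' = cis y' \<and> cis x'' = cis y''"
    by simp
qed

lemma fibered_piece:
  fixes F :: "('a, real^2) mfd"
  assumes F: "smooth_mfd F" and mono: "monodromy E p F \<phi>" and p: "smooth_map E circle p"
  shows "piece W fst (\<lambda>w. p (snd w))"
proof
  show "premfd W" by (rule premfd_prod_E)
  show "compact_space (mtop W)"
  proof -
    have "compact_space (mtop circle)"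
      unfolding mtop_circle by (rule compact_space_subtopology) simp
    then show ?thesis unfolding mtop_prod compact_space_prod_topology using compact_E by blast
  qed
  show "Hausdorff_space (mtop W)"
    using Y(1) unfolding mtop_prod E_def' smooth_mfd_def
    by (simp add: Hausdorff_space_prod_topology Hausdorff_space_subtopology)
  show "chart_image (\<phi> ` U)" if "(U, \<phi>) \<in> atlas W" for U and \<phi> :: "complex \<times> 'a \<Rightarrow> real \<times> (real^3)"
    using chart_image_prod_E[OF that] .
  have A: "pts W \<subseteq> pts circle \<times> pts E" by simp
  note fs = smooth_map_on_fst_snd[OF premfd_circle premfd_E A]
  show "smooth_map_on W (pts W) euclid fst" using fs(1) smooth_map_on_circle[OF premfd_prod_E] by blast
  have "smooth_map_on W (pts W) circle (\<lambda>w. p (snd w))"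
    by (rule smooth_map_on_compose[OF fs(2) p _ premfd_prod_E premfd_E]) auto
  note sp = smooth_map_on_circle[OF premfd_prod_E, THEN iffD1, OF this]
  show "smooth_map_on W (pts W) euclid (\<lambda>w. p (snd w))" by (rule conjunct1[OF sp])
  show "norm (p (snd w)) = 1" if "w \<in> pts W" for w using conjunct2[OF sp] that by (rule bspec)
  show "norm (fst w) = 1" if "w \<in> pts W" for w using that by auto
  show "\<exists>\<Theta>. continuous_map euclidean (mtop W) \<Theta> \<and> range \<Theta> = bd W \<and>
      (\<forall>x y x' y' x'' y''. \<Theta> (x, x', x'') = \<Theta> (y, y', y'') \<longleftrightarrow> cis x = cis y \<and> cis x' = cis y' \<and> cis x'' = cis y'')"
    by (rule torus_coordinates)
  have pw: "cis s powi n = cis (of_int n * s)" for s and n :: int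
    by (simp add: cis_power_int mult.commute)
  fix w and a b :: int assume w: "w \<in> pts W" and ab: "a \<noteq> 0 \<or> b \<noteq> 0"
  obtain \<theta> x where wx: "w = (\<theta>, x)" "norm \<theta> = 1" "x \<in> pts E" using w by auto
  show "\<exists>\<gamma> c. c \<noteq> (0::real) \<and> smooth_map_on euclid UNIV W \<gamma> \<and> \<gamma> (0::real) = w \<and> (w \<in> bd W \<longrightarrow> (\<forall>s. \<gamma> s \<in> bd W)) \<and>
        (\<forall>s. fst (\<gamma> s) powi a * p (snd (\<gamma> s)) powi b = fst w powi a * p (snd w) powi b * cis (c * s))"
  \<comment> \<open>For nonzero \<open>a\<close> it suffices to rotate the circle factor, at speed
    \<open>a\<close>, with the point of the exterior fixed. Otherwise the point of the exterior
    moves along the suspension flow, at speed \<open>2 * pi * b\<close>.\<close>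
  proof (cases "a = 0")
    case False
    have "smooth_map_on euclid UNIV euclid (\<lambda>s. \<theta> * cis s)"
      unfolding smooth_map_on_euclid by (rule csmooth_imp_smooth_on[OF csmooth_cis_from[OF wx(2)]]) auto
    then have "smooth_map_on euclid UNIV circle (\<lambda>s. \<theta> * cis s)"
      unfolding smooth_map_on_circle[OF premfd_euclid] using wx(2) by (simp add: norm_mult)
    moreover have "smooth_map_on euclid UNIV E (\<lambda>s::real. x)"
      by (rule smooth_map_on_const[OF premfd_euclid _ wx(3)]) simp
    ultimately have "smooth_map_on euclid UNIV W (\<lambda>s. (\<theta> * cis s, x))" by (rule smooth_map_on_Pair)
    then show ?thesis
      using False wx by (intro exI[of _ "\<lambda>s. (\<theta> * cis s, x)"] exI[of _ "of_int a"])
        (auto simp: bd_prod_E norm_mult power_int_mult_distrib pw)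
  next
    case True
    then have b: "b \<noteq> 0" using ab by simp
    obtain \<gamma> where \<gamma>: "smooth_map_on euclid UNIV E \<gamma>" "\<gamma> (0::real) = x"
      "\<And>s. x \<in> bd E \<Longrightarrow> \<gamma> s \<in> bd E" "\<And>s. p (\<gamma> s) = p x * cis (2 * pi * s)"
      using E_curve[OF F mono wx(3)] by blast
    have "smooth_map_on euclid UNIV circle (\<lambda>s::real. \<theta>)"
      by (rule smooth_map_on_const[OF premfd_euclid]) (use wx(2) in auto)
    then have "smooth_map_on euclid UNIV W (\<lambda>s. (\<theta>, \<gamma> s))" using \<gamma>(1) by (rule smooth_map_on_Pair)
    then show ?thesis
      using b wx True \<gamma>(2,3) by (intro exI[of _ "\<lambda>s. (\<theta>, \<gamma> s)"] exI[of _ "of_int b * (2 * pi)"])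
        (auto simp: bd_prod_E \<gamma>(4) power_int_mult_distrib pw mult.assoc)
  qed
qed

end

lemma fibered_knot_piece:
  assumes Y: "closed_mfd Y" and K: "fibered_knot Y K N F \<phi>"
  obtains P where "piece (prod_mfd circle (exterior Y N)) fst P"
proof -
  obtain t where t: "diffeo_on (euclid :: (complex \<times> complex, complex \<times> complex) mfd) (sphere 0 1 \<times> cball 0 1) Y N t"
    using K unfolding fibered_knot_def closed_tubular_nbhd_def by blast
  interpret tube Y N t
    using Y t unfolding closed_mfd_def by unfold_locales blast+
  obtain p where p: "smooth_fiber_bundle E circle (surface_in E F) p" "monodromy E p (surface_in E F) \<phi>"
    using K unfolding fibered_knot_def by blast
  then have "piece W fst (\<lambda>w. p (snd w))"
    unfolding smooth_fiber_bundle_def by (intro fibered_piece) blast+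
  then show thesis by (rule that)
qed

section \<open>Matching cohomology classes on the boundary torus\<close>

text \<open>Gaussian elimination without division: with a pivot \<open>a j k\<close>, every other
  row \<open>a i\<close> is replaced by \<open>a j k * a i - a i k * a j\<close>, which has integer
  entries and vanishes in column \<open>k\<close>.\<close>

lemma int_dependence:
  fixes a :: "'i \<Rightarrow> 'k \<Rightarrow> int"
  assumes "finite K" "finite I" "card K < card I"
  shows "\<exists>c. (\<exists>i\<in>I. c i \<noteq> 0) \<and> (\<forall>k\<in>K. (\<Sum>i\<in>I. c i * a i k) = 0)"
  using assms
proof (induction K arbitrary: a I rule: finite_induct)
  case empty
  then have "I \<noteq> {}" by auto
  then show ?case by (intro exI[of _ "\<lambda>_. 1"]) auto
next
  case (insert k K)
  show ?case
  proof (cases "\<forall>i\<in>I. a i k = 0")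
    case True
    have "card K < card I" using insert by simp
    from insert.IH[OF insert.prems(1) this, of a] obtain c
      where c: "\<exists>i\<in>I. c i \<noteq> 0" "\<forall>k\<in>K. (\<Sum>i\<in>I. c i * a i k) = 0" by blast
    have "(\<Sum>i\<in>I. c i * a i k) = 0" using True by (intro sum.neutral) simp
    then show ?thesis using c by (intro exI[of _ c]) simp
  next
    case False
    then obtain j where j: "j \<in> I" "a j k \<noteq> 0" by blast
    let ?I = "I - {j}"
    have "card K < card ?I" using insert j by simp
    then obtain c where c: "\<exists>i\<in>?I. c i \<noteq> 0"
      "\<forall>l\<in>K. (\<Sum>i\<in>?I. c i * (a j k * a i l - a i k * a j l)) = 0"
      using insert.IH[of ?I "\<lambda>i l. a j k * a i l - a i k * a j l"] insert.prems(1) by blast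
    \<comment> \<open>A relation among the reduced rows, rewritten in terms of the original rows;
      the coefficient at \<open>j\<close> collects what the elimination subtracted.\<close>
    define d where "d = (\<lambda>i. if i = j then - (\<Sum>i\<in>?I. c i * a i k) else c i * a j k)"
    have sumI: "(\<Sum>i\<in>I. d i * a i l) = (\<Sum>i\<in>?I. c i * (a j k * a i l - a i k * a j l))" for l
    proof -
      have "(\<Sum>i\<in>I. d i * a i l) = d j * a j l + (\<Sum>i\<in>?I. d i * a i l)"
        using sum.remove[OF insert.prems(1) j(1)] by simp
      also have "(\<Sum>i\<in>?I. d i * a i l) = (\<Sum>i\<in>?I. c i * a j k * a i l)"
        by (rule sum.cong) (auto simp: d_def)
      finally show ?thesis
        by (simp add: d_def sum_distrib_right sum_subtractf right_diff_distrib mult.assoc)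
    qed
    have "(\<Sum>i\<in>I. d i * a i k) = 0" unfolding sumI by (simp add: mult.commute)
    moreover have "(\<Sum>i\<in>I. d i * a i l) = 0" if "l \<in> K" for l unfolding sumI using c(2) that by blast
    moreover have "\<exists>i\<in>I. d i \<noteq> 0"
    proof -
      obtain i where "i \<in> ?I" "c i \<noteq> 0" using c(1) by blast
      then have "i \<in> I" "d i \<noteq> 0" using j(2) by (auto simp: d_def)
      then show ?thesis by blast
    qed
    ultimately show ?thesis by (intro exI[of _ d]) auto
  qed
qed

lemma cis_eq_1_iff: "cis x = 1 \<longleftrightarrow> (\<exists>n::int. x = 2 * pi * n)"
proof -
  have "cis x = 1 \<longleftrightarrow> cos x = 1" by (auto simp: complex_eq_iff) (metis cos_one_sin_zero)
  also have "\<dots> \<longleftrightarrow> (\<exists>n::int. x = n * 2 * pi)" by (rule cos_one_2pi_int)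
  also have "\<dots> \<longleftrightarrow> (\<exists>n::int. x = 2 * pi * n)" by (simp add: mult_ac)
  finally show ?thesis .
qed

lemma cis_eq_iff: "cis x = cis y \<longleftrightarrow> (\<exists>n::int. x = y + 2 * pi * n)"
proof -
  have "cis x = cis y \<longleftrightarrow> cis (x - y) = 1"
    by (simp add: cis_divide[symmetric])
  then show ?thesis unfolding cis_eq_1_iff by (auto simp: algebra_simps)
qed

text \<open>The values are multiples of \<open>2 * pi\<close>, so distinct ones are at least that
  far apart.\<close>

lemma cis_constant:
  fixes f :: "'a::topological_space \<Rightarrow> real"
  assumes "connected S" "continuous_on S f" "\<And>x. x \<in> S \<Longrightarrow> cis (f x) = 1" "x \<in> S" "y \<in> S"
  shows "f x = f y"
proof -
  have "f constant_on S"
  proof (rule continuous_discrete_range_constant[OF assms(1,2)])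
    fix x assume x: "x \<in> S"
    have "2 * pi \<le> norm (f y - f x)" if y: "y \<in> S" "f y \<noteq> f x" for y
    proof -
      obtain n :: int where n: "f x = 2 * pi * n" using assms(3)[OF x] unfolding cis_eq_1_iff by blast
      obtain m :: int where m: "f y = 2 * pi * m" using assms(3)[OF y(1)] unfolding cis_eq_1_iff by blast
      note nm = n m
      have "m \<noteq> n" using y(2) nm by auto
      then have "\<bar>real_of_int (m - n)\<bar> \<ge> 1" by linarith
      then have "2 * pi * 1 \<le> 2 * pi * \<bar>real_of_int (m - n)\<bar>" by (intro mult_left_mono) auto
      also have "\<dots> = norm (f y - f x)" unfolding nm by (simp add: abs_mult flip: right_diff_distrib)
      finally show ?thesis by simp
    qed
    then show "\<exists>e>0. \<forall>y. y \<in> S \<and> f y \<noteq> f x \<longrightarrow> e \<le> norm (f y - f x)"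
      using pi_gt_zero by (intro exI[of _ "2 * pi"]) auto
  qed
  then show ?thesis using assms(4,5) unfolding constant_on_def by metis
qed

lemma unit_lift:
  fixes h :: "'a::real_normed_vector \<Rightarrow> complex"
  assumes "continuous_on UNIV h" "\<And>x. norm (h x) = 1"
  obtains L where "continuous_on UNIV L" "\<And>x. h x = cis (L x)"
proof -
  obtain g where g: "continuous_on UNIV g" "\<And>x. h x = exp (g x)"
    using continuous_logarithm_on_contractible[OF assms(1) contractible_UNIV] assms(2)
    by (metis UNIV_I norm_zero zero_neq_one)
  have "Re (g x) = 0" for x using assms(2)[of x] g(2)[of x] by simp
  then have "h x = cis (Im (g x))" for x using g(2)[of x] by (simp add: exp_eq_polar)
  then show thesis using that[of "\<lambda>x. Im (g x)"] g(1) by (simp add: continuous_on_Im)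
qed

lemma periodic_int:
  fixes L :: "'a::real_vector \<Rightarrow> real"
  assumes "\<And>x. L (x + v) = L x"
  shows "L (x + of_int n *\<^sub>R v) = L x"
proof -
  have nat: "L (x + real n *\<^sub>R v) = L x" for x n
    by (induction n) (use assms[of "x + real _ *\<^sub>R v"] in \<open>auto simp: algebra_simps\<close>)
  show ?thesis
  proof (cases "n \<ge> 0")
    case True
    then show ?thesis using nat[of x "nat n"] by simp
  next
    case False
    then show ?thesis using nat[of "x + of_int n *\<^sub>R v" "nat (- n)"] by (simp add: algebra_simps flip: scaleR_left.add)
  qed
qed

context piece
begin

abbreviation "bdW \<equiv> subtopology (mtop W) (bd W)"

lemma bd_subset: "bd W \<subseteq> pts W"
  unfolding bd_def by blast

lemma topspace_bdW [simp]: "topspace bdW = bd W"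
  using bd_subset by auto

text \<open>Restricted to a cube of side \<open>2 * pi\<close>, the map \<open>\<Theta>\<close> is a
  continuous surjection from a compact space to a Hausdorff space, hence closed and a quotient map.
  Functions on the boundary can then be constructed on the covering space and checked for
  periodicity.\<close>

lemma bd_quotient:
  obtains \<Theta> where "continuous_map euclidean bdW \<Theta>"
    "quotient_map (top_of_set ({0..2*pi} \<times> {0..2*pi} \<times> {0..2*pi})) bdW \<Theta>"
    "\<And>x y x' y' x'' y''. \<Theta> (x, x', x'') = \<Theta> (y, y', y'') \<longleftrightarrow> cis x = cis y \<and> cis x' = cis y' \<and> cis x'' = cis y''"
proof -
  obtain \<Theta> where \<Theta>: "continuous_map euclidean (mtop W) \<Theta>" "range \<Theta> = bd W"
    "\<And>x y x' y' x'' y''. \<Theta> (x, x', x'') = \<Theta> (y, y', y'') \<longleftrightarrow> cis x = cis y \<and> cis x' = cis y' \<and> cis x'' = cis y''"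
    using torus by blast
  let ?C = "{0..2*pi} \<times> {0..2*pi} \<times> {0..2*pi}"
  have c: "continuous_map euclidean bdW \<Theta>" using \<Theta>(1,2) by (auto simp: continuous_map_in_subtopology)
  then have cC: "continuous_map (top_of_set ?C) bdW \<Theta>" by (rule continuous_map_from_subtopology)
  have red: "\<exists>y\<in>{0..2*pi}. cis x = cis y" for x
  proof -
    define n where "n = \<lfloor>x / (2 * pi)\<rfloor>"
    have "x - 2 * pi * n \<in> {0..2*pi}"
      using floor_correct[of "x / (2 * pi)"] unfolding n_def[symmetric]
      by (simp add: field_simps)
    moreover have "cis x = cis (x - 2 * pi * n)" unfolding cis_eq_iff by (rule exI[of _ n]) simp
    ultimately show ?thesis by blast
  qed
  have "\<Theta> ` ?C = bd W"
  proof (intro equalityI subsetI)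
    fix w assume "w \<in> bd W"
    then obtain x x' x'' where "w = \<Theta> (x, x', x'')" using \<Theta>(2) by (metis imageE prod_cases3)
    moreover obtain y y' y'' where "y \<in> {0..2*pi}" "y' \<in> {0..2*pi}" "y'' \<in> {0..2*pi}"
      "cis x = cis y" "cis x' = cis y'" "cis x'' = cis y''" using red by metis
    ultimately have "w = \<Theta> (y, y', y'')" "(y, y', y'') \<in> ?C" using \<Theta>(3) by auto
    then show "w \<in> \<Theta> ` ?C" by blast
  qed (use \<Theta>(2) in blast)
  moreover have "closed_map (top_of_set ?C) bdW \<Theta>"
    by (rule continuous_imp_closed_map[OF cC])
       (auto simp: compact_space_subtopology compact_Times Hausdorff_space_subtopology Hausdorff_W)
  ultimately have "quotient_map (top_of_set ?C) bdW \<Theta>"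
    using continuous_closed_imp_quotient_map[OF cC] by (metis topspace_bdW topspace_euclidean_subtopology)
  then show thesis using that c \<Theta>(3) by blast
qed

lemma bd_nonempty: "bd W \<noteq> {}"
  using torus by blast

lemma compact_bd: "compact_space bdW"
proof -
  let ?C = "{0..2*pi} \<times> {0..2*pi} \<times> {0..2*pi}"
  obtain \<Theta> where \<Theta>: "continuous_map euclidean bdW \<Theta>" "quotient_map (top_of_set ?C) bdW \<Theta>"
    "\<And>x y x' y' x'' y''. \<Theta> (x, x', x'') = \<Theta> (y, y', y'') \<longleftrightarrow> cis x = cis y \<and> cis x' = cis y' \<and> cis x'' = cis y''"
    using bd_quotient by blast
  have "compactin (top_of_set ?C) ?C" by (simp add: compactin_subtopology compact_Times)
  from image_compactin[OF this quotient_imp_continuous_map[OF \<Theta>(2)]]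
  show ?thesis using quotient_imp_surjective_map[OF \<Theta>(2)] unfolding compact_space_def
    by (metis topspace_euclidean_subtopology)
qed

text \<open>Composed with \<open>\<Theta>\<close>, each \<open>h i\<close> has a real lift. Its
  increments along the three periods are \<open>2 * pi\<close> times integers \<open>n i k\<close>,
  the coordinates of the class of \<open>h i\<close> in the first cohomology. More than three such
  rows are dependent over the integers, and the corresponding combination of the lifts is periodic,
  hence descends to \<open>u\<close>.\<close>

lemma null_combination:
  fixes h :: "'i \<Rightarrow> 'w \<Rightarrow> complex"
  assumes I: "finite I" "card I > 3"
    and h: "\<And>i. i \<in> I \<Longrightarrow> continuous_map bdW euclidean (h i)" "\<And>i w. i \<in> I \<Longrightarrow> w \<in> bd W \<Longrightarrow> norm (h i w) = 1"
  obtains i and c :: "'i \<Rightarrow> int" and u where "i \<in> I" "c i \<noteq> 0" "continuous_map bdW euclideanreal u"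
    "\<And>w. w \<in> bd W \<Longrightarrow> (\<Prod>i\<in>I. h i w powi c i) = cis (u w)"
proof -
  let ?C = "{0..2*pi} \<times> {0..2*pi} \<times> {0..2*pi}"
  obtain \<Theta> where \<Theta>: "continuous_map euclidean bdW \<Theta>" "quotient_map (top_of_set ?C) bdW \<Theta>"
    "\<And>x y x' y' x'' y''. \<Theta> (x, x', x'') = \<Theta> (y, y', y'') \<longleftrightarrow> cis x = cis y \<and> cis x' = cis y' \<and> cis x'' = cis y''"
    using bd_quotient by blast
  have \<Theta>bd: "\<Theta> x \<in> bd W" for x using continuous_map_image_subset_topspace[OF \<Theta>(1)] by auto
  have "\<exists>L. continuous_on UNIV L \<and> (\<forall>x. h i (\<Theta> x) = cis (L x))" if "i \<in> I" for i
  proof -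
    have "continuous_on UNIV (\<lambda>x. h i (\<Theta> x))"
      using continuous_map_compose[OF \<Theta>(1) h(1)[OF that]] by (simp add: comp_def)
    then show ?thesis using unit_lift[of "\<lambda>x. h i (\<Theta> x)"] h(2)[OF that \<Theta>bd] by metis
  qed
  then obtain L where L: "\<And>i. i \<in> I \<Longrightarrow> continuous_on UNIV (L i)" "\<And>i x. i \<in> I \<Longrightarrow> h i (\<Theta> x) = cis (L i x)"
    by metis
  \<comment> \<open>Generators of the period lattice of \<open>\<Theta>\<close>, numbered 0, 1, 2;
    larger \<open>k\<close> repeat the last one.\<close>
  define e :: "nat \<Rightarrow> real \<times> real \<times> real" where
    "e k = (if k = 0 then (2*pi, 0, 0) else if k = 1 then (0, 2*pi, 0) else (0, 0, 2*pi))" for k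
  have c2: "cis (x + 2 * pi) = cis x" for x unfolding cis_eq_iff by (rule exI[of _ 1]) simp
  have \<Theta>e: "\<Theta> (x + e k) = \<Theta> x" for x k
    by (cases x) (auto simp: e_def \<Theta>(3) c2)
  have "\<exists>n::int. \<forall>x. L i (x + e k) = L i x + 2 * pi * n" if i: "i \<in> I" for i k
  proof -
    let ?d = "\<lambda>x. L i (x + e k) - L i x"
    have cis1: "cis (?d x) = 1" for x
      using L(2)[OF i, of "x + e k"] L(2)[OF i, of x] \<Theta>e[of x k] by (simp add: cis_divide[symmetric])
    have "continuous_on UNIV ?d"
      by (intro continuous_on_diff continuous_on_compose2[OF L(1)[OF i]] L(1)[OF i] continuous_intros) auto
    then have "?d x = ?d 0" for x
      by (intro cis_constant[of UNIV ?d] connected_UNIV cis1) auto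
    moreover obtain n :: int where "?d 0 = 2 * pi * n" using cis1 cis_eq_1_iff by blast
    ultimately have "\<forall>x. L i (x + e k) = L i x + 2 * pi * n" by (metis add.commute diff_add_cancel)
    then show ?thesis by blast
  qed
  then obtain n :: "'i \<Rightarrow> nat \<Rightarrow> int" where n: "\<And>i k x. i \<in> I \<Longrightarrow> L i (x + e k) = L i x + 2 * pi * n i k"
    by metis
  have "card {..<3::nat} < card I" using I(2) by simp
  then obtain c where c: "\<exists>i\<in>I. c i \<noteq> 0" "\<And>k. k < 3 \<Longrightarrow> (\<Sum>i\<in>I. c i * n i k) = 0"
    using int_dependence[OF _ I(1), of "{..<3}" n] by auto
  define M where "M x = (\<Sum>i\<in>I. real_of_int (c i) * L i x)" for x
  have Mper: "M (x + e k) = M x" if "k < 3" for x k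
  proof -
    have "M (x + e k) = (\<Sum>i\<in>I. real_of_int (c i) * L i x + 2 * pi * real_of_int (c i * n i k))"
      unfolding M_def by (rule sum.cong) (auto simp: n algebra_simps)
    also have "\<dots> = M x + 2 * pi * real_of_int (\<Sum>i\<in>I. c i * n i k)"
      by (simp add: M_def sum.distrib sum_distrib_left)
    finally show ?thesis using c(2)[OF that] by simp
  qed
  have M\<Theta>: "M x = M y" if xy\<Theta>: "\<Theta> x = \<Theta> y" for x y
  proof -
    obtain x1 x2 x3 y1 y2 y3 where xy: "x = (x1, x2, x3)" "y = (y1, y2, y3)" by (metis prod_cases3)
    have "cis x1 = cis y1 \<and> cis x2 = cis y2 \<and> cis x3 = cis y3" using xy\<Theta> unfolding xy \<Theta>(3) .
    then obtain m1 m2 m3 :: int where m: "x1 = y1 + 2 * pi * m1" "x2 = y2 + 2 * pi * m2" "x3 = y3 + 2 * pi * m3"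
      unfolding cis_eq_iff by blast
    have "x = ((y + of_int m1 *\<^sub>R e 0) + of_int m2 *\<^sub>R e 1) + of_int m3 *\<^sub>R e 2"
      unfolding xy m by (simp add: e_def mult_ac)
    then show ?thesis
      using periodic_int[of M "e 0"] periodic_int[of M "e 1"] periodic_int[of M "e 2"] Mper by simp
  qed
  \<comment> \<open>Any preimage may be chosen, since \<open>M\<close> is constant on the fibers of
    \<open>\<Theta>\<close>; continuity comes from the quotient map.\<close>
  define u where "u w = M (SOME x. \<Theta> x = w)" for w
  have u\<Theta>: "u (\<Theta> x) = M x" for x
    unfolding u_def by (rule M\<Theta>) (rule someI[of "\<lambda>y. \<Theta> y = \<Theta> x"], simp)
  have "continuous_on UNIV M" unfolding M_def by (intro continuous_intros L(1))
  then have "continuous_map (top_of_set ?C) euclideanreal (u \<circ> \<Theta>)"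
    using continuous_on_subset[of UNIV M ?C] by (simp add: comp_def u\<Theta>)
  then have cu: "continuous_map bdW euclideanreal u"
    using continuous_compose_quotient_map[OF \<Theta>(2)] by blast
  have "(\<Prod>i\<in>I. h i w powi c i) = cis (u w)" if w: "w \<in> bd W" for w
  proof -
    have "w \<in> \<Theta> ` ?C" using quotient_imp_surjective_map[OF \<Theta>(2)] w
      by (simp only: topspace_bdW topspace_euclidean_subtopology)
    then obtain x where x: "w = \<Theta> x" by blast
    have "(\<Prod>i\<in>I. h i w powi c i) = (\<Prod>i\<in>I. cis (real_of_int (c i) * L i x))"
      unfolding x by (rule prod.cong) (simp_all add: L(2) cis_power_int mult.commute)
    also have "\<dots> = cis (M x)"
      unfolding M_def by (induction I rule: infinite_finite_induct) (auto simp: cis_mult)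
    finally show ?thesis unfolding x u\<Theta> .
  qed
  then show thesis using that c(1) cu by blast
qed

text \<open>By compactness \<open>u\<close> has a maximum. Along the curve through a maximum point,
  however, \<open>u\<close> is affine with slope \<open>c\<close>, so that at the time
  \<open>sgn c\<close> it has grown by \<open>\<bar>c\<bar>\<close>.\<close>

lemma not_null:
  assumes ab: "a \<noteq> 0 \<or> b \<noteq> 0" and u: "continuous_map bdW euclideanreal u"
    and eq: "\<And>w. w \<in> bd W \<Longrightarrow> z w powi a * P w powi b = cis (u w)"
  shows False
proof -
  have "compact (u ` bd W)"
    using image_compactin[of bdW "bd W" euclideanreal u] u compact_bd
    unfolding compact_space_def topspace_bdW by simp
  then obtain w where w: "w \<in> bd W" "\<And>w'. w' \<in> bd W \<Longrightarrow> u w' \<le> u w"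
    using compact_attains_sup[of "u ` bd W"] bd_nonempty by auto
  obtain \<gamma> and c :: real where \<gamma>: "c \<noteq> 0" "smooth_map_on euclid UNIV W \<gamma>" "\<gamma> (0::real) = w" "\<And>s. \<gamma> s \<in> bd W"
    "\<And>s. z (\<gamma> s) powi a * P (\<gamma> s) powi b = z w powi a * P w powi b * cis (c * s)"
    using curve[OF _ ab, of w] w(1) bd_subset by blast
  have "continuous_map euclidean bdW \<gamma>"
    using smooth_map_on_continuous[OF \<gamma>(2)] \<gamma>(4) by (auto simp: continuous_map_in_subtopology)
  from continuous_map_compose[OF this u] have cu: "continuous_on UNIV (\<lambda>s. u (\<gamma> s))" by (simp add: comp_def)
  \<comment> \<open>Both \<open>u\<close> along the curve and the affine function are real lifts of
    the same rotating map, so their difference is constant.\<close>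
  let ?v = "\<lambda>s. u (\<gamma> s) - (u w + c * s)"
  have "cis (?v s) = 1" for s
  proof -
    have "cis (u (\<gamma> s)) = cis (u w) * cis (c * s)" using \<gamma>(4,5) eq w(1) by metis
    then show ?thesis by (simp add: cis_divide[symmetric] cis_mult[symmetric])
  qed
  moreover have "continuous_on UNIV ?v" by (intro continuous_intros cu)
  ultimately have "?v (sgn c) = ?v 0" by (intro cis_constant[of UNIV ?v]) auto
  then have "u (\<gamma> (sgn c)) = u w + \<bar>c\<bar>" using \<gamma>(3) by (simp add: abs_sgn)
  then show False using w(2)[OF \<gamma>(4), of "sgn c"] \<gamma>(1) by simp
qed

end

section \<open>Functions on closed manifolds\<close>

lemma vector_derivative_chain:
  assumes h: "(h has_vector_derivative v) (at s)" and f: "(f has_derivative D) (at (h s))"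
  shows "((\<lambda>s. f (h s)) has_vector_derivative D v) (at s)"
proof -
  have "(\<lambda>t. D (t *\<^sub>R v)) = (\<lambda>t. t *\<^sub>R D v)"
    using linear_scale[OF has_derivative_linear[OF f]] by blast
  then show ?thesis
    using has_derivative_compose[OF h[unfolded has_vector_derivative_def] f]
    unfolding has_vector_derivative_def by simp
qed

lemma smooth_map_on_binop:
  fixes f :: "'a \<Rightarrow> 'b::euclidean_space" and g :: "'a \<Rightarrow> 'c::euclidean_space" and h :: "'b \<Rightarrow> 'c \<Rightarrow> 'd::euclidean_space"
  assumes f: "smooth_map_on M A euclid f" and g: "smooth_map_on M A euclid g" and M: "premfd M"
    and h: "bounded_bilinear h"
  shows "smooth_map_on M A euclid (\<lambda>x. h (f x) (g x))"
proof -
  have "smooth_map_on M A euclid (\<lambda>x. (f x, g x))"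
    using smooth_map_on_Pair[OF f g] by (simp add: prod_euclid)
  moreover have "csmooth UNIV (\<lambda>y::'b \<times> 'c. h (fst y) (snd y))"
    by (intro csmooth_bilinear[OF h] csmooth_linear bounded_linear_fst bounded_linear_snd open_UNIV)
  ultimately show ?thesis
    using smooth_map_on_csmooth[of M A "\<lambda>x. (f x, g x)" UNIV "\<lambda>y. h (fst y) (snd y)"] M by simp
qed

lemma smooth_map_on_add:
  fixes f g :: "'a \<Rightarrow> 'b::euclidean_space"
  assumes f: "smooth_map_on M A euclid f" and g: "smooth_map_on M A euclid g" and M: "premfd M"
  shows "smooth_map_on M A euclid (\<lambda>x. f x + g x)"
proof -
  have "smooth_map_on M A euclid (\<lambda>x. (f x, g x))"
    using smooth_map_on_Pair[OF f g] by (simp add: prod_euclid)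
  moreover have "csmooth UNIV (\<lambda>y::'b \<times> 'b. fst y + snd y)"
    by (intro csmooth_add csmooth_linear bounded_linear_fst bounded_linear_snd open_UNIV)
  ultimately show ?thesis
    using smooth_map_on_csmooth[of M A "\<lambda>x. (f x, g x)" UNIV "\<lambda>y. fst y + snd y"] M by simp
qed

lemma smooth_map_on_sum:
  fixes f :: "'i \<Rightarrow> 'a \<Rightarrow> 'b::euclidean_space"
  assumes "\<And>i. i \<in> I \<Longrightarrow> smooth_map_on M A euclid (f i)" "premfd M" "A \<subseteq> pts M"
  shows "smooth_map_on M A euclid (\<lambda>x. \<Sum>i\<in>I. f i x)"
  using assms(1)
  by (induction I rule: infinite_finite_induct)
     (auto intro!: smooth_map_on_add smooth_map_on_const assms(2,3))

lemmas smooth_map_on_mult = smooth_map_on_binop[OF _ _ _ bounded_bilinear_mult]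
lemmas smooth_map_on_scaleR = smooth_map_on_binop[OF _ _ _ bounded_bilinear_scaleR]

locale cmfd =
  fixes X :: "('x, 'e::euclidean_space) mfd"
  assumes smooth_X: "smooth_mfd X" and compact_X: "compact_space (mtop X)" and bd_X: "bd X = {}"
begin

lemma pX: "premfd X"
  using smooth_X by (rule smooth_mfd_premfd)

lemma Hausdorff_X: "Hausdorff_space (mtop X)"
  using smooth_X by (simp add: smooth_mfd_def)

lemma continuous_real:
  fixes f :: "'x \<Rightarrow> 'b::euclidean_space"
  assumes "smooth_map_on X (pts X) euclid f"
  shows "continuous_map (mtop X) euclidean f"
  using smooth_map_on_continuous[OF assms] by (simp add: subtopology_topspace)

lemma open_preimage: "continuous_map (mtop X) euclidean f \<Longrightarrow> open V \<Longrightarrow> openin (mtop X) {x \<in> pts X. f x \<in> V}"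
  using openin_continuous_map_preimage by fastforce

lemma closed_preimage: "continuous_map (mtop X) euclidean f \<Longrightarrow> closed V \<Longrightarrow> closedin (mtop X) {x \<in> pts X. f x \<in> V}"
  using closedin_continuous_map_preimage by fastforce

lemma chart_img: "(U, \<phi>) \<in> atlas X \<Longrightarrow> openin (mtop X) G \<Longrightarrow> open (\<phi> ` (U \<inter> G))"
  using chart_image_open[OF pX bd_X] by blast

lemma chart_csmooth:
  fixes f :: "'x \<Rightarrow> 'b::euclidean_space"
  assumes "smooth_map_on X G euclid f" "openin (mtop X) G" "(U, \<phi>) \<in> atlas X"
  shows "csmooth (\<phi> ` (U \<inter> G)) (\<lambda>y. f (inv_into U \<phi> y))"
  using smooth_map_on_euclid_pts[OF assms(1,3)]
  unfolding Int_commute[of G U] smooth_on_open[OF chart_img[OF assms(3,2)]] .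

lemma compact_cover:
  assumes "closedin (mtop X) Z" "\<And>x. x \<in> Z \<Longrightarrow> openin (mtop X) (G x) \<and> x \<in> G x"
  obtains K where "finite K" "K \<subseteq> Z" "Z \<subseteq> (\<Union>x\<in>K. G x)"
proof -
  have c: "compactin (mtop X) Z" using closedin_compact_space[OF compact_X assms(1)] .
  obtain \<F> where F: "finite \<F>" "\<F> \<subseteq> G ` Z" "Z \<subseteq> \<Union>\<F>"
    using compactinD[OF c, of "G ` Z"] assms(2) by blast
  then obtain K where "K \<subseteq> Z" "finite K" "\<F> = G ` K" using finite_subset_image by metis
  then show thesis using F(3) by (intro that[of K]) auto
qed

text \<open>The support lies in the preimage \<open>Z\<close> of a closed ball under a chart, which
  is compact and therefore closed in \<open>X\<close>. This makes the extension by zero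
  smooth.\<close>

lemma bump_function:
  assumes "openin (mtop X) G" "x \<in> G"
  obtains b :: "'x \<Rightarrow> real" and Z where "smooth_map_on X (pts X) euclid b" "\<And>y. b y \<ge> 0" "b x > 0"
    "closedin (mtop X) Z" "Z \<subseteq> G" "\<And>y. y \<notin> Z \<Longrightarrow> b y = 0"
proof -
  have "x \<in> pts X" using assms openin_subset by blast
  then obtain U \<phi> where U: "(U, \<phi>) \<in> atlas X" "x \<in> U" using chart_at[OF pX] by blast
  have "\<phi> x \<in> \<phi> ` (U \<inter> G)" using U assms(2) by blast
  then obtain r where r: "r > 0" "cball (\<phi> x) r \<subseteq> \<phi> ` (U \<inter> G)"
    using chart_img[OF U(1) assms(1)] open_contains_cball by blast
  define Z where "Z = inv_into U \<phi> ` cball (\<phi> x) r"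
  define b where "b y = (if y \<in> U then bump (r\<^sup>2 - (\<phi> y - \<phi> x) \<bullet> (\<phi> y - \<phi> x)) else 0)" for y
  have inv: "inv_into U \<phi> (\<phi> y) = y" if "y \<in> U" for y using chart_inv[OF pX U(1) that] .
  have cU: "cball (\<phi> x) r \<subseteq> \<phi> ` U" using r(2) by blast
  have "compactin (top_of_set (\<phi> ` U)) (cball (\<phi> x) r)" using cU by (simp add: compactin_subtopology)
  from image_compactin[OF this] smooth_map_on_continuous[OF chart_inverse_smooth[OF pX U(1)]]
  have "compactin (mtop X) Z" unfolding Z_def by simp
  then have Zc: "closedin (mtop X) Z" using compactin_imp_closedin[OF Hausdorff_X] by blast
  have ZG: "Z \<subseteq> U \<inter> G"
  proof
    fix y assume "y \<in> Z"
    then obtain w where "w \<in> cball (\<phi> x) r" "y = inv_into U \<phi> w" unfolding Z_def by blast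
    moreover then obtain y' where "y' \<in> U \<inter> G" "w = \<phi> y'" using r(2) by blast
    ultimately show "y \<in> U \<inter> G" using inv by simp
  qed
  have bZ: "b y = 0" if "y \<notin> Z" for y
  proof (cases "y \<in> U")
    case True
    have "\<phi> y \<notin> cball (\<phi> x) r" using that inv[OF True] unfolding Z_def by (metis imageI)
    then have "norm (\<phi> y - \<phi> x) > r" by (simp add: dist_norm norm_minus_commute)
    then have "(norm (\<phi> y - \<phi> x))\<^sup>2 > r\<^sup>2" using r(1) by (intro power_strict_mono) auto
    then show ?thesis using True by (simp add: b_def bump_zero dot_square_norm)
  qed (simp add: b_def)
  have sm: "smooth_map_on X (pts X) euclid b"
  proof (rule smooth_map_on_local[OF pX order_refl])
    fix y assume y: "y \<in> pts X"
    show "\<exists>H. openin (mtop X) H \<and> y \<in> H \<and> smooth_map_on X (pts X \<inter> H) euclid b"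
    proof (cases "y \<in> U")
      case True
      have "csmooth UNIV (\<lambda>w. r\<^sup>2 - (w - \<phi> x) \<bullet> (w - \<phi> x))"
        by (intro csmooth_diff csmooth_bilinear[OF bounded_bilinear_inner] csmooth_const csmooth_ident open_UNIV)
      then have "csmooth UNIV (\<lambda>w. bump (r\<^sup>2 - (w - \<phi> x) \<bullet> (w - \<phi> x)))"
        by (rule csmooth_compose[OF open_UNIV open_UNIV _ csmooth_bump]) simp
      then have "smooth_map_on X U euclid (\<lambda>y. bump (r\<^sup>2 - (\<phi> y - \<phi> x) \<bullet> (\<phi> y - \<phi> x)))"
        using smooth_map_on_csmooth[OF chart_smooth[OF pX U(1)] _ open_UNIV _ pX] by blast
      then have "smooth_map_on X U euclid b"
        by (rule smooth_map_on_cong[OF _ pX]) (simp add: b_def)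
      then show ?thesis using chart_open[OF pX U(1)] True smooth_map_on_subset by (metis inf_le2)
    next
      case False
      have "smooth_map_on X (pts X - Z) euclid (\<lambda>_. 0::real)" by (rule smooth_map_on_const[OF pX]) auto
      then have s: "smooth_map_on X (pts X - Z) euclid b"
        by (rule smooth_map_on_cong[OF _ pX]) (use bZ in auto)
      have "openin (mtop X) (pts X - Z)" using Zc by blast
      moreover have "y \<in> pts X - Z" using False y ZG by blast
      moreover have "smooth_map_on X (pts X \<inter> (pts X - Z)) euclid b" by (rule smooth_map_on_subset[OF s]) auto
      ultimately show ?thesis by blast
    qed
  qed
  have "b x > 0" using U(2) r(1) by (simp add: b_def bump_pos)
  moreover have "b y \<ge> 0" for y by (simp add: b_def bump_nonneg)
  ultimately show thesis using that[of b Z] sm Zc ZG bZ by blast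
qed

text \<open>The predicate \<open>Q\<close> carries the local data of the application: a defining
  function of one side, a straightened chart, or a set on which a map is nearly constant. By
  compactness finitely many sets suffice, so all sums are finite.\<close>

lemma partition_of_unity:
  assumes "\<And>x. x \<in> pts X \<Longrightarrow> \<exists>G. openin (mtop X) G \<and> x \<in> G \<and> Q G"
  obtains K :: "'x set" and G Z and \<rho> :: "'x \<Rightarrow> 'x \<Rightarrow> real" where "finite K"
    "\<And>k. k \<in> K \<Longrightarrow> openin (mtop X) (G k)" "\<And>k. k \<in> K \<Longrightarrow> Q (G k)"
    "\<And>k. k \<in> K \<Longrightarrow> smooth_map_on X (pts X) euclid (\<rho> k)" "\<And>k y. k \<in> K \<Longrightarrow> y \<in> pts X \<Longrightarrow> \<rho> k y \<ge> 0"
    "\<And>k. k \<in> K \<Longrightarrow> closedin (mtop X) (Z k)" "\<And>k. k \<in> K \<Longrightarrow> Z k \<subseteq> G k"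
    "\<And>k y. k \<in> K \<Longrightarrow> y \<in> pts X \<Longrightarrow> y \<notin> Z k \<Longrightarrow> \<rho> k y = 0" "\<And>y. y \<in> pts X \<Longrightarrow> (\<Sum>k\<in>K. \<rho> k y) = 1"
proof -
  define good where "good x G b Z \<longleftrightarrow> openin (mtop X) G \<and> x \<in> G \<and> Q G \<and> smooth_map_on X (pts X) euclid b \<and>
      (\<forall>y. b y \<ge> 0) \<and> b x > (0::real) \<and> closedin (mtop X) Z \<and> Z \<subseteq> G \<and> (\<forall>y. y \<notin> Z \<longrightarrow> b y = 0)" for x G b Z
  have "\<exists>G b Z. good x G b Z" if x: "x \<in> pts X" for x
  proof -
    obtain G where G: "openin (mtop X) G" "x \<in> G" "Q G" using assms[OF x] by blast
    show ?thesis
      unfolding good_def by (rule bump_function[OF G(1,2)]) (use G in blast)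
  qed
  then obtain G b Z where g: "\<And>x. x \<in> pts X \<Longrightarrow> good x (G x) (b x) (Z x)" by metis
  note * = g[unfolded good_def]
  define B where "B x = {y \<in> pts X. b x y \<in> {0<..}}" for x
  have pos: "openin (mtop X) (B x) \<and> x \<in> B x" if "x \<in> pts X" for x
    using open_preimage[OF continuous_real, of "b x" "{0<..}"] *[OF that] that unfolding B_def by auto
  obtain K where K: "finite K" "K \<subseteq> pts X" "pts X \<subseteq> (\<Union>x\<in>K. B x)"
    using compact_cover[OF closedin_topspace pos] by blast
  note ** = *[OF subsetD[OF K(2)]]
  define S where "S y = (\<Sum>k\<in>K. b k y)" for y
  have S: "S y > 0" if y: "y \<in> pts X" for y
  proof -
    obtain k where "k \<in> K" "b k y > 0" using K(3) y unfolding B_def by blast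
    then show ?thesis unfolding S_def using ** by (intro sum_pos2[OF K(1)]) auto
  qed
  have smS: "smooth_map_on X (pts X) euclid S"
    unfolding S_def by (rule smooth_map_on_sum[OF _ pX]) (use ** in auto)
  have o: "open {x::real. x \<noteq> 0}" using open_Compl[of "{0::real}"] by (simp add: Compl_eq)
  have "smooth_map_on X (pts X) euclid (\<lambda>y. inverse (S y))"
    by (rule smooth_map_on_csmooth[OF smS csmooth_inverse_real o _ pX]) (use S in fastforce)
  then have sm: "smooth_map_on X (pts X) euclid (\<lambda>y. inverse (S y) * b k y)" if "k \<in> K" for k
    by (rule smooth_map_on_mult[OF _ _ pX]) (use **[OF that] in blast)
  show thesis
  proof (rule that[OF K(1), of G "\<lambda>k y. inverse (S y) * b k y" Z])
    fix k assume k: "k \<in> K"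
    show "openin (mtop X) (G k)" "Q (G k)" "closedin (mtop X) (Z k)" "Z k \<subseteq> G k" using **[OF k] by blast+
    show "smooth_map_on X (pts X) euclid (\<lambda>y. inverse (S y) * b k y)" by (rule sm[OF k])
    show "0 \<le> inverse (S y) * b k y" if "y \<in> pts X" for y using S[OF that] **[OF k] by simp
    show "inverse (S y) * b k y = 0" if "y \<in> pts X" "y \<notin> Z k" for y using **[OF k] that by simp
  next
    fix y assume y: "y \<in> pts X"
    have "(\<Sum>k\<in>K. inverse (S y) * b k y) = inverse (S y) * S y" by (simp add: S_def sum_distrib_left)
    then show "(\<Sum>k\<in>K. inverse (S y) * b k y) = 1" using S[OF y] by simp
  qed
qed

text \<open>The values of \<open>u\<close> outside \<open>G\<close> do not enter, since near each
  point off the closed set \<open>Z\<close> the product is identically zero.\<close>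

lemma smooth_localized:
  fixes u :: "'x \<Rightarrow> 'b::euclidean_space"
  assumes \<rho>: "smooth_map_on X (pts X) euclid \<rho>" and u: "smooth_map_on X G euclid u" and G: "openin (mtop X) G"
    and Z: "closedin (mtop X) Z" "Z \<subseteq> G" and 0: "\<And>y. y \<in> pts X \<Longrightarrow> y \<notin> Z \<Longrightarrow> \<rho> y = (0::real)"
  shows "smooth_map_on X (pts X) euclid (\<lambda>y. \<rho> y *\<^sub>R u y)"
proof (rule smooth_map_on_local[OF pX order_refl])
  fix y assume y: "y \<in> pts X"
  show "\<exists>H. openin (mtop X) H \<and> y \<in> H \<and> smooth_map_on X (pts X \<inter> H) euclid (\<lambda>y. \<rho> y *\<^sub>R u y)"
  proof (cases "y \<in> Z")
    case True
    have "smooth_map_on X G euclid (\<lambda>y. \<rho> y *\<^sub>R u y)"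
      by (rule smooth_map_on_scaleR[OF smooth_map_on_subset[OF \<rho>] u pX]) (use G openin_subset in blast)
    then have "smooth_map_on X (pts X \<inter> G) euclid (\<lambda>y. \<rho> y *\<^sub>R u y)" by (rule smooth_map_on_subset) auto
    then show ?thesis using G True Z(2) by blast
  next
    case False
    have "smooth_map_on X (pts X - Z) euclid (\<lambda>_. 0::'b)" by (rule smooth_map_on_const[OF pX]) auto
    then have s: "smooth_map_on X (pts X - Z) euclid (\<lambda>y. \<rho> y *\<^sub>R u y)"
      by (rule smooth_map_on_cong[OF _ pX]) (use 0 in auto)
    have "openin (mtop X) (pts X - Z)" using Z(1) by blast
    moreover have "smooth_map_on X (pts X \<inter> (pts X - Z)) euclid (\<lambda>y. \<rho> y *\<^sub>R u y)" by (rule smooth_map_on_subset[OF s]) auto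
    ultimately show ?thesis using False y by blast
  qed
qed

text \<open>Takes the place of the differential on tangent vectors: the derivative is read in one
  chart at a time, and \<open>v\<close> is a vector of coordinates in that chart.\<close>

definition cder :: "('x \<Rightarrow> 'b::real_normed_vector) \<Rightarrow> 'x set \<Rightarrow> ('x \<Rightarrow> 'e) \<Rightarrow> 'x \<Rightarrow> 'e \<Rightarrow> 'b" where
  "cder f U \<phi> x v = frechet_derivative (\<lambda>y. f (inv_into U \<phi> y)) (at (\<phi> x)) v"

lemma cder_has_derivative:
  fixes f :: "'x \<Rightarrow> 'b::euclidean_space"
  assumes "smooth_map_on X G euclid f" "openin (mtop X) G" "(U, \<phi>) \<in> atlas X" "x \<in> U" "x \<in> G"
  shows "((\<lambda>y. f (inv_into U \<phi> y)) has_derivative cder f U \<phi> x) (at (\<phi> x))"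
  using csmooth_has_derivative[OF chart_csmooth[OF assms(1-3)], of "\<phi> x"] assms(4,5)
  unfolding cder_def[abs_def] by blast

lemma cder_eq:
  assumes "((\<lambda>y. f (inv_into U \<phi> y)) has_derivative D) (at (\<phi> x))"
  shows "cder f U \<phi> x = D"
  using frechet_derivative_at[OF assms] unfolding cder_def[abs_def] by simp

lemma cder_cong:
  fixes f :: "'x \<Rightarrow> 'b::euclidean_space"
  assumes G: "openin (mtop X) G" "(U, \<phi>) \<in> atlas X" "x \<in> U" "x \<in> G" and fg: "\<And>y. y \<in> G \<Longrightarrow> f y = g y"
    and f: "smooth_map_on X G euclid f"
  shows "cder g U \<phi> x = cder f U \<phi> x"
proof (rule cder_eq)
  show "((\<lambda>y. g (inv_into U \<phi> y)) has_derivative cder f U \<phi> x) (at (\<phi> x))"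
    by (rule has_derivative_transform_within_open[OF cder_has_derivative[OF f G(1,2,3,4)] chart_img[OF G(2,1)]])
       (use G chart_inv[OF pX G(2)] fg in auto)
qed

lemma continuous_cder:
  fixes f :: "'x \<Rightarrow> 'b::euclidean_space"
  assumes "smooth_map_on X G euclid f" "openin (mtop X) G" "(U, \<phi>) \<in> atlas X"
  shows "continuous_map (subtopology (mtop X) (U \<inter> G)) euclidean (\<lambda>y. cder f U \<phi> y v)"
proof -
  have "continuous_on (\<phi> ` (U \<inter> G)) (\<lambda>y. frechet_derivative (\<lambda>y. f (inv_into U \<phi> y)) (at y) v)"
    by (rule csmooth_continuous[OF csmooth_derivative[OF chart_csmooth[OF assms]]])
  moreover have "continuous_map (subtopology (mtop X) (U \<inter> G)) (top_of_set (\<phi> ` (U \<inter> G))) \<phi>"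
    using smooth_map_on_continuous[OF smooth_map_on_subset[OF chart_smooth[OF pX assms(3)], of "U \<inter> G"]]
    by (auto simp: continuous_map_in_subtopology)
  ultimately have "continuous_map (subtopology (mtop X) (U \<inter> G)) euclidean
      ((\<lambda>y. frechet_derivative (\<lambda>y. f (inv_into U \<phi> y)) (at y) v) \<circ> \<phi>)"
    by (intro continuous_map_compose[where X'="top_of_set (\<phi> ` (U \<inter> G))"]) auto
  then show ?thesis by (simp add: comp_def cder_def)
qed

lemma chart_curve:
  assumes U: "(U, \<phi>) \<in> atlas X" "x \<in> U" and \<gamma>: "smooth_map_on euclid UNIV X \<gamma>" "\<gamma> (0::real) = x"
  obtains v B where "((\<lambda>s. \<phi> (\<gamma> s)) has_vector_derivative v) (at 0)" "open B" "0 \<in> B" "\<And>s. s \<in> B \<Longrightarrow> \<gamma> s \<in> U"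
    "continuous_on B (\<lambda>s. \<phi> (\<gamma> s))"
proof -
  obtain B where B: "open B" "{s \<in> UNIV. \<gamma> s \<in> U} = UNIV \<inter> B"
    using smooth_map_on_nbhd[OF \<gamma>(1) chart_open[OF pX U(1)]] by (metis mtop_euclid open_openin)
  have B': "B = {s. \<gamma> s \<in> U}" using B(2) by auto
  have "smooth_map_on euclid B euclid (\<lambda>s. \<phi> (\<gamma> s))"
    by (rule smooth_map_on_compose[OF smooth_map_on_subset[OF \<gamma>(1)] chart_smooth[OF pX U(1)] _ premfd_euclid pX])
       (auto simp: B')
  then have "csmooth B (\<lambda>s. \<phi> (\<gamma> s))" using B(1) by (simp add: smooth_map_on_euclid smooth_on_open)
  then have d: "((\<lambda>s. \<phi> (\<gamma> s)) has_derivative frechet_derivative (\<lambda>s. \<phi> (\<gamma> s)) (at 0)) (at 0)"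
    by (rule csmooth_has_derivative) (use U \<gamma> in \<open>simp add: B'\<close>)
  define v where "v = frechet_derivative (\<lambda>s. \<phi> (\<gamma> s)) (at 0) 1"
  have dv: "((\<lambda>s. \<phi> (\<gamma> s)) has_vector_derivative v) (at 0)"
  proof -
    have e: "frechet_derivative (\<lambda>s. \<phi> (\<gamma> s)) (at 0) = (\<lambda>s. s *\<^sub>R v)"
    proof
      fix s show "frechet_derivative (\<lambda>s. \<phi> (\<gamma> s)) (at 0) s = s *\<^sub>R v"
        using linear_scale[OF has_derivative_linear[OF d], of s 1] by (simp add: v_def)
    qed
    show ?thesis using d unfolding has_vector_derivative_def e .
  qed
  have B0: "0 \<in> B" using U(2) \<gamma>(2) B' by simp
  have BU: "\<gamma> s \<in> U" if "s \<in> B" for s using that B' by blast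
  show thesis using that[OF dv B(1) B0 BU csmooth_continuous[OF \<open>csmooth B (\<lambda>s. \<phi> (\<gamma> s))\<close>]] by blast
qed

end

section \<open>A submersion onto the circle\<close>

lemma directional_derivative:
  assumes "(f has_derivative D) (at a)"
  shows "((\<lambda>t. f (a + t *\<^sub>R v)) has_real_derivative D v) (at 0)"
proof -
  have "((\<lambda>t::real. a + t *\<^sub>R v) has_vector_derivative v) (at 0)"
    by (auto intro!: derivative_eq_intros simp: has_vector_derivative_def)
  from vector_derivative_chain[OF this, of f D] assms show ?thesis
    by (simp add: has_real_derivative_iff_has_vector_derivative)
qed

text \<open>Near \<open>a\<close> positivity of \<open>r\<close> implies that of \<open>s\<close>,
  so \<open>E\<close> is nonnegative wherever \<open>D\<close> is positive. A nonzero linear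
  functional with this property cannot vanish at \<open>n\<close>, since a small change of
  \<open>n\<close> would make it negative. Thus all defining functions of the same side have
  derivatives that are positive in a common direction.\<close>

lemma proportional_derivatives:
  fixes r s :: "'a::real_normed_vector \<Rightarrow> real"
  assumes r: "(r has_derivative D) (at a)" "r a = 0" and s: "(s has_derivative E) (at a)" "s a = 0"
    and Q: "open Q" "a \<in> Q" "\<And>y. y \<in> Q \<Longrightarrow> r y > 0 \<Longrightarrow> s y > 0"
    and n: "D n > 0" and w: "E w \<noteq> 0"
  shows "E n > 0"
proof -
  interpret D: linear D using r(1) by (rule has_derivative_linear)
  interpret E: linear E using s(1) by (rule has_derivative_linear)
  have nonneg: "E v \<ge> 0" if v: "D v > 0" for v
  proof (rule ccontr)
    assume "\<not> E v \<ge> 0"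
    then have "E v < 0" by simp
    obtain d1 where d1: "d1 > 0" "\<And>h. h > 0 \<Longrightarrow> h < d1 \<Longrightarrow> r (a + h *\<^sub>R v) > 0"
      using DERIV_pos_inc_right[OF directional_derivative[OF r(1)] v] r(2) by auto
    obtain d2 where d2: "d2 > 0" "\<And>h. h > 0 \<Longrightarrow> h < d2 \<Longrightarrow> s (a + h *\<^sub>R v) < 0"
      using DERIV_neg_dec_right[OF directional_derivative[OF s(1)] \<open>E v < 0\<close>] s(2) by auto
    have "continuous (at 0) (\<lambda>h::real. a + h *\<^sub>R v)" by (intro continuous_intros)
    then have "\<forall>\<^sub>F h in at 0. a + h *\<^sub>R v \<in> Q"
      using topological_tendstoD[of "\<lambda>h. a + h *\<^sub>R v" a "at 0" Q] Q by (simp add: continuous_at)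
    then obtain d3 where d3: "d3 > 0" "\<And>h. h \<noteq> 0 \<Longrightarrow> \<bar>h\<bar> < d3 \<Longrightarrow> a + h *\<^sub>R v \<in> Q"
      unfolding eventually_at by (auto simp: dist_norm)
    define h where "h = min d1 (min d2 d3) / 2"
    have "h > 0" "h < d1" "h < d2" "h < d3" using d1 d2 d3 by (auto simp: h_def min_def)
    then show False using d1(2)[of h] d2(2)[of h] d3(2)[of h] Q(3)[of "a + h *\<^sub>R v"] by simp
  qed
  have "E n \<noteq> 0"
  proof
    assume En: "E n = 0"
    define w' where "w' = (if E w < 0 then w else - w)"
    have Ew': "E w' < 0" using w by (auto simp: w'_def E.neg)
    \<comment> \<open>Small enough for \<open>D\<close> to stay positive at
      \<open>n + e *\<^sub>R w'\<close>, where \<open>E\<close> is already negative.\<close>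
    define e where "e = D n / (2 * (\<bar>D w'\<bar> + 1))"
    have e: "e > 0" using n by (simp add: e_def)
    have "e * \<bar>D w'\<bar> \<le> e * (\<bar>D w'\<bar> + 1)" using e by simp
    also have "\<dots> = D n / 2" using n by (simp add: e_def field_simps)
    finally have "D n + e * D w' > 0" using n abs_le_D2[of "e * D w'" "D n / 2"] e
      by (simp add: abs_mult)
    then have "D (n + e *\<^sub>R w') > 0" by (simp add: D.add D.scale)
    then have "E (n + e *\<^sub>R w') \<ge> 0" by (rule nonneg)
    then have "e * E w' \<ge> 0" using En by (simp add: E.add E.scale)
    then show False using mult_pos_neg[OF e Ew'] by simp
  qed
  then show ?thesis using nonneg[OF n] by simp
qed

text \<open>The quotient of \<open>bump (d + t)\<close> by
  \<open>bump (d + t) + bump (d - t)\<close>, which rises from 0 to 1. Since \<open>bump\<close> has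
  positive slope on the positive axis, the slope of the quotient is positive on the entire open
  interval, in particular wherever a large multiple has to dominate.\<close>

lemma smooth_step:
  assumes d: "d > (0::real)"
  obtains \<psi> \<psi>' :: "real \<Rightarrow> real" where "csmooth UNIV \<psi>" "\<And>t. (\<psi> has_real_derivative \<psi>' t) (at t)"
    "\<And>t. \<bar>t\<bar> < d \<Longrightarrow> \<psi>' t > 0" "\<And>t. \<bar>t\<bar> \<ge> d \<Longrightarrow> \<psi>' t = 0" "continuous_on UNIV \<psi>'"
proof -
  obtain b' where b': "\<And>t. (bump has_real_derivative b' t) (at t)" "\<And>t. t > 0 \<Longrightarrow> b' t > 0" "\<And>t. t \<le> 0 \<Longrightarrow> b' t = 0"
    using bump_has_derivative by blast
  define S where "S t = bump (d + t) + bump (d - t)" for t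
  have S: "S t > 0" for t
  proof (cases "d + t > 0")
    case True
    then show ?thesis using bump_pos[of "d + t"] bump_nonneg[of "d - t"] by (simp add: S_def)
  next
    case False
    then show ?thesis using d bump_pos[of "d - t"] bump_nonneg[of "d + t"] by (simp add: S_def)
  qed
  define \<psi> where "\<psi> t = bump (d + t) * inverse (S t)" for t
  define \<psi>' where "\<psi>' t = (b' (d + t) * bump (d - t) + bump (d + t) * b' (d - t)) / (S t)\<^sup>2" for t
  have b1: "((\<lambda>t. bump (d + t)) has_real_derivative b' (d + t)) (at t)" for t
  proof -
    have "((\<lambda>t. d + t) has_real_derivative 1) (at t)" by (auto intro!: derivative_eq_intros)
    from DERIV_chain2[where f=bump and g="\<lambda>t. d + t", OF b'(1) this] show ?thesis by simp
  qed
  have b2: "((\<lambda>t. bump (d - t)) has_real_derivative - b' (d - t)) (at t)" for t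
  proof -
    have "((\<lambda>t. d - t) has_real_derivative -1) (at t)" by (auto intro!: derivative_eq_intros)
    from DERIV_chain2[where f=bump and g="\<lambda>t. d - t", OF b'(1) this] show ?thesis by simp
  qed
  have dS: "(S has_real_derivative b' (d + t) + - b' (d - t)) (at t)" for t
    unfolding S_def by (rule DERIV_add[OF b1 b2])
  have der: "(\<psi> has_real_derivative \<psi>' t) (at t)" for t
  proof -
    have "((\<lambda>t. bump (d + t) / S t) has_real_derivative
        (b' (d + t) * S t - bump (d + t) * (b' (d + t) + - b' (d - t))) / (S t * S t)) (at t)"
      by (rule DERIV_divide[OF b1 dS]) (use S[of t] in simp)
    moreover have "b' (d + t) * S t - bump (d + t) * (b' (d + t) + - b' (d - t)) =
        b' (d + t) * bump (d - t) + bump (d + t) * b' (d - t)" by (simp add: S_def algebra_simps)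
    ultimately show ?thesis unfolding \<psi>_def \<psi>'_def by (simp add: power2_eq_square divide_inverse)
  qed
  have c1: "csmooth UNIV (\<lambda>t. bump (d + t))"
    by (rule csmooth_compose[OF open_UNIV open_UNIV _ csmooth_bump])
       (auto intro!: csmooth_add csmooth_const csmooth_ident)
  have c2: "csmooth UNIV (\<lambda>t. bump (d - t))"
    by (rule csmooth_compose[OF open_UNIV open_UNIV _ csmooth_bump])
       (auto intro!: csmooth_diff csmooth_const csmooth_ident)
  have o: "open {x::real. x \<noteq> 0}" using open_Compl[of "{0::real}"] by (simp add: Compl_eq)
  have "csmooth UNIV S" unfolding S_def[abs_def] by (rule csmooth_add[OF open_UNIV c1 c2])
  then have "csmooth UNIV (\<lambda>t. inverse (S t))"
    by (rule csmooth_compose[OF open_UNIV o _ csmooth_inverse_real]) (use S in \<open>auto simp: less_imp_neq[symmetric]\<close>)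
  then have c\<psi>: "csmooth UNIV \<psi>" unfolding \<psi>_def[abs_def] by (rule csmooth_mult[OF open_UNIV c1])
  have "frechet_derivative \<psi> (at t) 1 = \<psi>' t" for t
    using frechet_derivative_at[OF der[of t, unfolded has_field_derivative_def]] by (metis mult.right_neutral)
  then have cont: "continuous_on UNIV \<psi>'"
    using csmooth_continuous[OF csmooth_derivative[OF c\<psi>, of 1]] by simp
  show thesis
  proof (rule that[OF c\<psi> der _ _ cont])
    fix t :: real
    show "\<psi>' t > 0" if "\<bar>t\<bar> < d"
    proof -
      have "d + t > 0" "d - t > 0" using that by auto
      then show ?thesis unfolding \<psi>'_def
        using b'(2)[of "d + t"] b'(2)[of "d - t"] bump_pos[of "d + t"] bump_pos[of "d - t"] S[of t]
        by (intro divide_pos_pos add_pos_pos mult_pos_pos) auto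
    qed
    show "\<psi>' t = 0" if "\<bar>t\<bar> \<ge> d"
    proof -
      have "d + t \<le> 0 \<or> d - t \<le> 0" using that by auto
      then show ?thesis unfolding \<psi>'_def using b'(3) bump_zero by auto
    qed
  qed
qed

text \<open>The sets \<open>A1\<close> and \<open>A2\<close> stand for the embedded pieces and
  \<open>T\<close> for the torus between them; \<open>g1\<close> and \<open>g2\<close> are the
  chosen products of powers of the circle-valued maps. No collar is part of the data: near
  \<open>T\<close> there are just the local defining functions of \<open>patch\<close>, and
  \<open>u\<close> is merely continuous.\<close>

locale glued = cmfd X for X :: "('x, 'e::euclidean_space) mfd" +
  fixes A1 A2 T :: "'x set" and g1 g2 :: "'x \<Rightarrow> complex" and u :: "'x \<Rightarrow> real"
  assumes closed: "closedin (mtop X) A1" "closedin (mtop X) A2"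
    and union: "A1 \<union> A2 = pts X" and inter: "A1 \<inter> A2 = T"
    and patch: "\<And>x. x \<in> T \<Longrightarrow> \<exists>G r. openin (mtop X) G \<and> x \<in> G \<and> smooth_map_on X G euclid (r :: 'x \<Rightarrow> real) \<and>
      (\<forall>y\<in>G. (y \<in> A1 \<longleftrightarrow> r y \<le> 0) \<and> (y \<in> T \<longleftrightarrow> r y = 0) \<and>
        (\<forall>U \<phi>. (U, \<phi>) \<in> atlas X \<longrightarrow> y \<in> U \<longrightarrow> (\<exists>v. cder r U \<phi> y v \<noteq> 0)))"
    and norm_g: "\<And>x. x \<in> A1 \<Longrightarrow> norm (g1 x) = 1" "\<And>x. x \<in> A2 \<Longrightarrow> norm (g2 x) = 1"
    and smooth_g: "smooth_map_on X A1 euclid g1" "smooth_map_on X A2 euclid g2"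
    and curves: "\<And>x. x \<in> A1 \<Longrightarrow> \<exists>\<gamma> c. c \<noteq> (0::real) \<and> smooth_map_on euclid UNIV X \<gamma> \<and> \<gamma> (0::real) = x \<and>
        (\<forall>s. \<gamma> s \<in> A1) \<and> (x \<in> T \<longrightarrow> (\<forall>s. \<gamma> s \<in> T)) \<and> (\<forall>s. g1 (\<gamma> s) = g1 x * cis (c * s))"
      "\<And>x. x \<in> A2 \<Longrightarrow> \<exists>\<gamma> c. c \<noteq> (0::real) \<and> smooth_map_on euclid UNIV X \<gamma> \<and> \<gamma> (0::real) = x \<and>
        (\<forall>s. \<gamma> s \<in> A2) \<and> (x \<in> T \<longrightarrow> (\<forall>s. \<gamma> s \<in> T)) \<and> (\<forall>s. g2 (\<gamma> s) = g2 x * cis (c * s))"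
    and u: "continuous_map (subtopology (mtop X) T) euclideanreal u"
    and match: "\<And>x. x \<in> T \<Longrightarrow> g1 x = g2 x * cis (u x)"
begin

lemma closed_T: "closedin (mtop X) T"
  using closed inter by (metis closedin_Int)

lemma open_A: "openin (mtop X) (A1 - T)" "openin (mtop X) (A2 - T)"
proof -
  have "A1 - T = pts X - A2" "A2 - T = pts X - A1" using union inter by auto
  then show "openin (mtop X) (A1 - T)" "openin (mtop X) (A2 - T)" using closed by auto
qed

text \<open>A nonzero derivative is demanded only on \<open>T\<close>, so that away from
  \<open>T\<close> the constants -1 and 1 qualify as local defining functions.\<close>

definition defining :: "('x \<Rightarrow> real) \<Rightarrow> 'x set \<Rightarrow> bool" where
  "defining r G \<longleftrightarrow> smooth_map_on X G euclid r \<and>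
     (\<forall>y\<in>G. (y \<in> A1 \<longleftrightarrow> r y \<le> 0) \<and> (y \<in> T \<longleftrightarrow> r y = 0) \<and>
       (y \<in> T \<longrightarrow> (\<forall>U \<phi>. (U, \<phi>) \<in> atlas X \<longrightarrow> y \<in> U \<longrightarrow> (\<exists>v. cder r U \<phi> y v \<noteq> 0))))"

lemma local_defining:
  assumes x: "x \<in> pts X"
  shows "\<exists>G. openin (mtop X) G \<and> x \<in> G \<and> (\<exists>r. defining r G)"
proof -
  consider "x \<in> T" | "x \<in> A1 - T" | "x \<in> A2 - T" using x union by blast
  then show ?thesis
  proof cases
    case 1
    then show ?thesis using patch[OF 1] unfolding defining_def by blast
  next
    case 2
    have "smooth_map_on X (A1 - T) euclid (\<lambda>_. -1::real)"
      by (rule smooth_map_on_const[OF pX]) (use union in auto)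
    then have "defining (\<lambda>_. -1) (A1 - T)" unfolding defining_def by auto
    then show ?thesis using 2 open_A(1) by blast
  next
    case 3
    have "smooth_map_on X (A2 - T) euclid (\<lambda>_. 1::real)"
      by (rule smooth_map_on_const[OF pX]) (use union in auto)
    then have "defining (\<lambda>_. 1) (A2 - T)" unfolding defining_def using inter by auto
    then show ?thesis using 3 open_A(2) by blast
  qed
qed

text \<open>All local functions have the same sign at a point, and a weighted mean keeps it. On
  \<open>T\<close> the derivative of the mean is the mean of the derivatives, because the functions
  themselves vanish there, and by \<open>proportional_derivatives\<close> these are all positive on
  one vector \<open>n\<close>.\<close>

lemma global_defining: "\<exists>R. defining R (pts X)"
proof (rule partition_of_unity[OF local_defining])
  fix K G Z and \<rho> :: "'x \<Rightarrow> 'x \<Rightarrow> real"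
  assume K: "finite K" "\<And>k. k \<in> K \<Longrightarrow> openin (mtop X) (G k)" "\<And>k. k \<in> K \<Longrightarrow> \<exists>r. defining r (G k)"
    "\<And>k. k \<in> K \<Longrightarrow> smooth_map_on X (pts X) euclid (\<rho> k)" "\<And>k y. k \<in> K \<Longrightarrow> y \<in> pts X \<Longrightarrow> \<rho> k y \<ge> 0"
    "\<And>k. k \<in> K \<Longrightarrow> closedin (mtop X) (Z k)" "\<And>k. k \<in> K \<Longrightarrow> Z k \<subseteq> G k"
    "\<And>k y. k \<in> K \<Longrightarrow> y \<in> pts X \<Longrightarrow> y \<notin> Z k \<Longrightarrow> \<rho> k y = 0" "\<And>y. y \<in> pts X \<Longrightarrow> (\<Sum>k\<in>K. \<rho> k y) = 1"
  obtain r where r: "\<And>k. k \<in> K \<Longrightarrow> defining (r k) (G k)" using K(3) by metis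
  define f where "f k y = \<rho> k y *\<^sub>R r k y" for k y
  define R where "R y = (\<Sum>k\<in>K. f k y)" for y
  have sf: "smooth_map_on X (pts X) euclid (f k)" if k: "k \<in> K" for k
    unfolding f_def
    by (rule smooth_localized[OF K(4)[OF k] _ K(2)[OF k] K(6)[OF k] K(7)[OF k] K(8)[OF k]])
       (use r[OF k] in \<open>auto simp: defining_def\<close>)
  have sR: "smooth_map_on X (pts X) euclid R"
    unfolding R_def by (rule smooth_map_on_sum[OF sf pX order_refl])
  have rk: "(y \<in> A1 \<longleftrightarrow> r k y \<le> 0) \<and> (y \<in> T \<longleftrightarrow> r k y = 0)" if "k \<in> K" "y \<in> G k" for k y
    using r[OF that(1)] that(2) unfolding defining_def by blast
  have G0: "\<rho> k y = 0" if "k \<in> K" "y \<in> pts X" "y \<notin> G k" for k y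
    using K(7,8) that by blast
  have ex: "\<exists>k\<in>K. \<rho> k y > 0 \<and> y \<in> G k" if y: "y \<in> pts X" for y
  proof (rule ccontr)
    assume n: "\<not> ?thesis"
    have "\<rho> k y = 0" if k: "k \<in> K" for k
    proof (cases "y \<in> G k")
      case True
      then have "\<not> \<rho> k y > 0" using n k by blast
      then show ?thesis using K(5)[OF k y] by simp
    qed (rule G0[OF k y])
    then show False using K(9)[OF y] by simp
  qed
  have pos: "R y > 0" if y: "y \<in> pts X" "y \<notin> A1" for y
  proof -
    obtain k where k: "k \<in> K" "\<rho> k y > 0" "y \<in> G k" using ex[OF y(1)] by blast
    have "f k y > 0" using rk[OF k(1,3)] k(2) y(2) by (simp add: f_def)
    moreover have "f k y \<ge> 0" if "k \<in> K" for k
      using rk[OF that] G0[OF that y(1)] K(5)[OF that y(1)] y(2) by (cases "y \<in> G k") (auto simp: f_def)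
    ultimately show ?thesis unfolding R_def by (intro sum_pos2[OF K(1) k(1)])
  qed
  have neg: "R y < 0" if y: "y \<in> A1" "y \<notin> T" for y
  proof -
    have yX: "y \<in> pts X" using y union by blast
    obtain k where k: "k \<in> K" "\<rho> k y > 0" "y \<in> G k" using ex[OF yX] by blast
    have "- f k y > 0" using rk[OF k(1,3)] k(2) y by (auto simp: f_def mult_less_0_iff)
    moreover have "- f k y \<ge> 0" if "k \<in> K" for k
      using rk[OF that] G0[OF that yX] K(5)[OF that yX] y
      by (cases "y \<in> G k") (auto simp: f_def mult_le_0_iff)
    ultimately have "(\<Sum>k\<in>K. - f k y) > 0" by (intro sum_pos2[OF K(1) k(1)])
    then show ?thesis unfolding R_def by (simp add: sum_negf)
  qed
  have zero: "R y = 0" if y: "y \<in> T" for y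
  proof -
    have yX: "y \<in> pts X" using y union inter by blast
    have "f k y = 0" if "k \<in> K" for k
      using rk[OF that, of y] G0[OF that yX] y by (cases "y \<in> G k") (auto simp: f_def)
    then show ?thesis unfolding R_def by simp
  qed
  have nondeg: "\<exists>v. cder R U \<phi> y v \<noteq> 0" if y: "y \<in> T" and U: "(U, \<phi>) \<in> atlas X" "y \<in> U" for y U \<phi>
  proof -
    have yX: "y \<in> pts X" using y union inter by blast
    obtain l where l: "l \<in> K" "\<rho> l y > 0" "y \<in> G l" using ex[OF yX] by blast
    have dr: "((\<lambda>z. r k (inv_into U \<phi> z)) has_derivative cder (r k) U \<phi> y) (at (\<phi> y))" if "k \<in> K" "y \<in> G k" for k
      by (rule cder_has_derivative[OF _ K(2)[OF that(1)] U that(2)]) (use r[OF that(1)] in \<open>simp add: defining_def\<close>)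
    have ndr: "\<exists>w. cder (r k) U \<phi> y w \<noteq> 0" if "k \<in> K" "y \<in> G k" for k
      using r[OF that(1)] that(2) y U unfolding defining_def by blast
    obtain n0 where n0: "cder (r l) U \<phi> y n0 \<noteq> 0" using ndr[OF l(1,3)] by blast
    define n where "n = (if cder (r l) U \<phi> y n0 > 0 then n0 else - n0)"
    have n: "cder (r l) U \<phi> y n > 0"
      using n0 linear_neg[OF has_derivative_linear[OF dr[OF l(1,3)]]] by (auto simp: n_def)
    have inv: "inv_into U \<phi> (\<phi> y) = y" using chart_inv[OF pX U] .
    have posk: "cder (r k) U \<phi> y n > 0" if k: "k \<in> K" "y \<in> G k" for k
    proof -
      obtain w where w: "cder (r k) U \<phi> y w \<noteq> 0" using ndr[OF k] by blast
      have o: "open (\<phi> ` (U \<inter> (G l \<inter> G k)))" using chart_img[OF U(1)] K(2) l(1) k(1) by blast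
      show ?thesis
      proof (rule proportional_derivatives[OF dr[OF l(1,3)] _ dr[OF k] _ o _ _ n w])
        show "r l (inv_into U \<phi> (\<phi> y)) = 0" "r k (inv_into U \<phi> (\<phi> y)) = 0"
          unfolding inv using rk l k y by blast+
        show "\<phi> y \<in> \<phi> ` (U \<inter> (G l \<inter> G k))" using U l k by blast
        fix z assume z: "z \<in> \<phi> ` (U \<inter> (G l \<inter> G k))" "r l (inv_into U \<phi> z) > 0"
        then obtain z' where z': "z' \<in> U" "z' \<in> G l" "z' \<in> G k" "z = \<phi> z'" by blast
        then have "inv_into U \<phi> z = z'" using chart_inv[OF pX U(1)] by simp
        then show "r k (inv_into U \<phi> z) > 0" using z(2) z' rk[OF l(1)] rk[OF k(1)] by (metis not_le)
      qed
    qed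
    \<comment> \<open>In the product rule the term with the derivative of \<open>\<rho> k\<close>
      drops out, since \<open>r k\<close> is 0 at \<open>y\<close>; if \<open>y\<close> lies outside
      \<open>G k\<close>, the product vanishes near \<open>y\<close>.\<close>
    have df: "((\<lambda>z. f k (inv_into U \<phi> z)) has_derivative
        (\<lambda>h. if y \<in> G k then \<rho> k y * cder (r k) U \<phi> y h else 0)) (at (\<phi> y))" if k: "k \<in> K" for k
    proof (cases "y \<in> G k")
      case True
      have ry: "r k y = 0" using rk[OF k True] y by blast
      have "((\<lambda>z. \<rho> k (inv_into U \<phi> z) *\<^sub>R r k (inv_into U \<phi> z)) has_derivative
          (\<lambda>h. \<rho> k (inv_into U \<phi> (\<phi> y)) *\<^sub>R cder (r k) U \<phi> y h + cder (\<rho> k) U \<phi> y h *\<^sub>R r k (inv_into U \<phi> (\<phi> y)))) (at (\<phi> y))"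
        by (rule has_derivative_scaleR[OF cder_has_derivative[OF K(4)[OF k] openin_topspace U yX] dr[OF k True]])
      then show ?thesis unfolding inv ry f_def using True by simp
    next
      case False
      then have yZ: "y \<in> pts X - Z k" using K(7)[OF k] yX by blast
      have o: "openin (mtop X) (pts X - Z k)" using K(6)[OF k] by blast
      have "((\<lambda>z. f k (inv_into U \<phi> z)) has_derivative (\<lambda>h. 0)) (at (\<phi> y))"
      proof (rule has_derivative_transform_within_open[OF has_derivative_const[of 0] chart_img[OF U(1) o]])
        show "\<phi> y \<in> \<phi> ` (U \<inter> (pts X - Z k))" using U yZ by blast
        fix z assume "z \<in> \<phi> ` (U \<inter> (pts X - Z k))"
        then obtain z' where "z' \<in> U" "z' \<in> pts X - Z k" "z = \<phi> z'" by blast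
        then show "0 = f k (inv_into U \<phi> z)" using chart_inv[OF pX U(1)] K(8)[OF k] by (simp add: f_def)
      qed
      then show ?thesis using False by simp
    qed
    have "((\<lambda>z. R (inv_into U \<phi> z)) has_derivative
        (\<lambda>h. \<Sum>k\<in>K. if y \<in> G k then \<rho> k y * cder (r k) U \<phi> y h else 0)) (at (\<phi> y))"
      unfolding R_def by (rule has_derivative_sum[OF df])
    from cder_eq[OF this] have "cder R U \<phi> y n = (\<Sum>k\<in>K. if y \<in> G k then \<rho> k y * cder (r k) U \<phi> y n else 0)" by simp
    also have "\<dots> > 0"
    proof (rule sum_pos2[OF K(1) l(1)])
      show "0 < (if y \<in> G l then \<rho> l y * cder (r l) U \<phi> y n else 0)" using l n by simp
      show "0 \<le> (if y \<in> G k then \<rho> k y * cder (r k) U \<phi> y n else 0)" if "k \<in> K" for k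
        using posk[OF that] K(5)[OF that yX] by (cases "y \<in> G k") (auto intro!: mult_nonneg_nonneg less_imp_le)
    qed
    finally show ?thesis by (intro exI[of _ n]) simp
  qed
  have "defining R (pts X)"
    unfolding defining_def
  proof (intro conjI ballI impI allI)
    fix y assume y: "y \<in> pts X"
    show "y \<in> A1 \<longleftrightarrow> R y \<le> 0" using pos[OF y] neg[of y] zero[of y] by (metis not_le order_less_imp_le order_refl)
    show "y \<in> T \<longleftrightarrow> R y = 0" using pos[OF y] neg[of y] zero[of y] by (metis less_irrefl)
  qed (use sR nondeg in auto)
  then show ?thesis by blast
qed

text \<open>At \<open>x\<close> the velocity \<open>v\<close> of a curve inside \<open>T\<close> is
  annihilated by the derivative of \<open>R\<close> but not by that of \<open>g\<close>. Off
  \<open>T\<close> it is corrected by a multiple of \<open>n\<close> so as to stay in the kernel.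
  The derivative of \<open>g\<close> in the corrected direction depends continuously on the point up
  to \<open>T\<close>, because \<open>g\<close> extends smoothly across it, and so remains nonzero
  nearby.\<close>

lemma transverse_near_T:
  assumes R: "defining R (pts X)" and x: "x \<in> T" and AT: "openin (mtop X) (A - T)" "T \<subseteq> A"
    and g: "smooth_map_on X A euclid (g :: 'x \<Rightarrow> complex)" "norm (g x) = 1"
    and \<gamma>: "c \<noteq> (0::real)" "smooth_map_on euclid UNIV X \<gamma>" "\<gamma> (0::real) = x" "\<And>s. \<gamma> s \<in> T"
      "\<And>s. g (\<gamma> s) = g x * cis (c * s)"
  obtains H where "openin (mtop X) H" "x \<in> H"
    "\<And>y. y \<in> H \<Longrightarrow> \<exists>U \<phi> v. (U, \<phi>) \<in> atlas X \<and> y \<in> U \<and> cder R U \<phi> y v \<noteq> 0"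
    "\<And>y. y \<in> H \<Longrightarrow> y \<in> A - T \<Longrightarrow> \<exists>U \<phi> v. (U, \<phi>) \<in> atlas X \<and> y \<in> U \<and> cder R U \<phi> y v = 0 \<and> cder g U \<phi> y v \<noteq> 0"
proof -
  have xX: "x \<in> pts X" using x inter union by blast
  obtain U \<phi> where U: "(U, \<phi>) \<in> atlas X" "x \<in> U" using chart_at[OF pX xX] by blast
  have inv: "inv_into U \<phi> (\<phi> y) = y" if "y \<in> U" for y using chart_inv[OF pX U(1) that] .
  have "\<phi> x \<in> \<phi> ` (A \<inter> U)" using x AT(2) U(2) by blast
  then obtain Q g' where Q: "open Q" "\<phi> x \<in> Q" "csmooth Q g'"
    "\<And>z. z \<in> \<phi> ` (A \<inter> U) \<Longrightarrow> z \<in> Q \<Longrightarrow> g' z = g (inv_into U \<phi> z)"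
    using smooth_onE[OF smooth_map_on_euclid_pts[OF g(1) U(1)]] by blast
  have g': "g' (\<phi> y) = g y" if "y \<in> A" "y \<in> U" "\<phi> y \<in> Q" for y
    using Q(4)[of "\<phi> y"] that inv by auto
  have sR: "smooth_map_on X (pts X) euclid R" using R unfolding defining_def by blast
  obtain v B where vB: "((\<lambda>s. \<phi> (\<gamma> s)) has_vector_derivative v) (at 0)" "open B" "0 \<in> B"
    "\<And>s. s \<in> B \<Longrightarrow> \<gamma> s \<in> U" "continuous_on B (\<lambda>s. \<phi> (\<gamma> s))"
    using chart_curve[OF U \<gamma>(2,3)] by blast
  let ?B = "B \<inter> (\<lambda>s. \<phi> (\<gamma> s)) -` Q"
  have oB: "open ?B" using continuous_open_preimage[OF vB(5,2) Q(1)] .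
  have B0: "0 \<in> ?B" using vB(3) \<gamma>(3) Q(2) by simp
  have dR: "((\<lambda>z. R (inv_into U \<phi> z)) has_derivative cder R U \<phi> x) (at (\<phi> (\<gamma> 0)))"
    unfolding \<gamma>(3) by (rule cder_has_derivative[OF sR openin_topspace U xX])
  have "((\<lambda>s. R (inv_into U \<phi> (\<phi> (\<gamma> s)))) has_vector_derivative cder R U \<phi> x v) (at 0)"
    by (rule vector_derivative_chain[OF vB(1) dR])
  then have "((\<lambda>s::real. 0::real) has_vector_derivative cder R U \<phi> x v) (at 0)"
  proof (rule has_vector_derivative_transform_within_open[OF _ vB(2,3)])
    fix s assume "s \<in> B"
    then show "R (inv_into U \<phi> (\<phi> (\<gamma> s))) = 0"
      using inv[OF vB(4)] \<gamma>(4)[of s] R union inter unfolding defining_def by auto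
  qed
  then have Rv: "cder R U \<phi> x v = 0"
    using vector_derivative_unique_at has_vector_derivative_const by metis
  let ?Dg = "frechet_derivative g'"
  have dg: "(g' has_derivative ?Dg (at (\<phi> (\<gamma> 0)))) (at (\<phi> (\<gamma> 0)))"
    unfolding \<gamma>(3) by (rule csmooth_has_derivative[OF Q(3,2)])
  have "((\<lambda>s. g' (\<phi> (\<gamma> s))) has_vector_derivative ?Dg (at (\<phi> x)) v) (at 0)"
    using vector_derivative_chain[OF vB(1) dg] unfolding \<gamma>(3) .
  then have "((\<lambda>s. g x * cis (c * s)) has_vector_derivative ?Dg (at (\<phi> x)) v) (at 0)"
  proof (rule has_vector_derivative_transform_within_open[OF _ oB B0])
    fix s assume s: "s \<in> ?B"
    show "g' (\<phi> (\<gamma> s)) = g x * cis (c * s)"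
      using g'[of "\<gamma> s"] vB(4)[of s] \<gamma>(4)[of s] AT(2) s \<gamma>(5) by auto
  qed
  moreover have "((\<lambda>s. g x * cis (c * s)) has_vector_derivative g x * (\<i> * of_real c)) (at 0)"
  proof -
    have "((\<lambda>s. exp (\<i> * (of_real c * of_real s))) has_vector_derivative \<i> * of_real c) (at 0)"
      by (auto intro!: derivative_eq_intros has_vector_derivative_real_field)
    from has_vector_derivative_mult_right[OF this, of "g x"] show ?thesis by (simp add: cis_conv_exp)
  qed
  ultimately have "?Dg (at (\<phi> x)) v = g x * (\<i> * of_real c)" by (rule vector_derivative_unique_at)
  then have gv: "?Dg (at (\<phi> x)) v \<noteq> 0" using \<gamma>(1) g(2) by auto
  obtain n where n: "cder R U \<phi> x n \<noteq> 0" using R x U xX unfolding defining_def by blast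
  \<comment> \<open>The derivative of the extension \<open>g'\<close> in the direction
    \<open>dR(n) v - dR(v) n\<close>, which lies in the kernel of \<open>dR\<close>. The extension
    gives it a meaning on \<open>T\<close> as well.\<close>
  define F where "F y = cder R U \<phi> y n *\<^sub>R ?Dg (at (\<phi> y)) v - cder R U \<phi> y v *\<^sub>R ?Dg (at (\<phi> y)) n" for y
  define V where "V = {y \<in> U. \<phi> y \<in> Q}"
  obtain G1 where G1: "openin (mtop X) G1" "{y \<in> U. \<phi> y \<in> Q} = U \<inter> G1"
    using smooth_map_on_nbhd[OF chart_smooth[OF pX U(1)], of Q] Q(1) by auto
  have oV: "openin (mtop X) V" unfolding V_def G1(2) using chart_open[OF pX U(1)] G1(1) by blast
  have VU: "V \<subseteq> U" by (auto simp: V_def)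
  have c\<phi>: "continuous_map (subtopology (mtop X) V) (top_of_set Q) \<phi>"
    using smooth_map_on_continuous[OF smooth_map_on_subset[OF chart_smooth[OF pX U(1)] VU]]
    by (auto simp: continuous_map_in_subtopology V_def)
  have cg: "continuous_map (subtopology (mtop X) V) euclidean (\<lambda>y. ?Dg (at (\<phi> y)) w)" for w
    using continuous_map_compose[OF c\<phi>, of euclidean "\<lambda>z. ?Dg (at z) w"]
      csmooth_continuous[OF csmooth_derivative[OF Q(3)]] by (simp add: comp_def)
  have cR: "continuous_map (subtopology (mtop X) V) euclidean (\<lambda>y. cder R U \<phi> y w)" for w
    by (rule continuous_map_from_subtopology_mono[OF continuous_cder[OF sR openin_topspace U(1)]])
       (use VU chart_subset[OF pX U(1)] in blast)
  have scale: "continuous_map (subtopology (mtop X) V) euclidean (\<lambda>y. a y *\<^sub>R (b y :: complex))"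
    if "continuous_map (subtopology (mtop X) V) euclidean a" "continuous_map (subtopology (mtop X) V) euclidean b"
    for a :: "'x \<Rightarrow> real" and b
  proof -
    have "continuous_map (subtopology (mtop X) V) euclidean (\<lambda>y. (a y, b y))"
      using continuous_map_pairedI[OF that] by simp
    from continuous_map_compose[OF this, of euclidean "\<lambda>p. fst p *\<^sub>R snd p"] show ?thesis
      by (simp add: comp_def continuous_intros)
  qed
  have cF: "continuous_map (subtopology (mtop X) V) euclidean F"
    unfolding F_def by (intro continuous_map_diff scale cR cg)
  define H where "H = {y \<in> V. F y \<in> - {0}} \<inter> {y \<in> V. cder R U \<phi> y n \<in> - {0}}"
  have tV: "topspace (subtopology (mtop X) V) = V" using openin_subset[OF oV] by auto
  have "openin (subtopology (mtop X) V) {y \<in> V. F y \<in> - {0}}"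
    "openin (subtopology (mtop X) V) {y \<in> V. cder R U \<phi> y n \<in> - {0}}"
    using openin_continuous_map_preimage[OF cF, of "- {0}"] openin_continuous_map_preimage[OF cR[of n], of "- {0}"]
    unfolding tV by auto
  then have oH: "openin (mtop X) H" unfolding H_def using oV openin_open_subtopology by blast
  have xH: "x \<in> H" using U Q(2) n gv Rv by (simp add: H_def V_def F_def)
  show thesis
  proof (rule that[OF oH xH])
    fix y assume y: "y \<in> H"
    then have yU: "y \<in> U" "\<phi> y \<in> Q" by (auto simp: H_def V_def)
    show "\<exists>U \<phi> v. (U, \<phi>) \<in> atlas X \<and> y \<in> U \<and> cder R U \<phi> y v \<noteq> 0"
      using U(1) yU y by (auto simp: H_def)
    assume yA: "y \<in> A - T"
    have yX: "y \<in> pts X" using yU(1) chart_subset[OF pX U(1)] by blast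
    have dgy: "(g' has_derivative ?Dg (at (\<phi> y))) (at (\<phi> y))" by (rule csmooth_has_derivative[OF Q(3) yU(2)])
    have o: "open (\<phi> ` (U \<inter> (A - T)) \<inter> Q)" using chart_img[OF U(1) AT(1)] Q(1) by blast
    have "((\<lambda>z. g (inv_into U \<phi> z)) has_derivative ?Dg (at (\<phi> y))) (at (\<phi> y))"
      by (rule has_derivative_transform_within_open[OF dgy o]) (use yA yU g' inv in auto)
    then have cg: "cder g U \<phi> y = ?Dg (at (\<phi> y))" by (rule cder_eq)
    have lR: "linear (cder R U \<phi> y)"
      using has_derivative_linear[OF cder_has_derivative[OF sR openin_topspace U(1) yU(1) yX]] .
    let ?w = "cder R U \<phi> y n *\<^sub>R v - cder R U \<phi> y v *\<^sub>R n"
    have "cder R U \<phi> y ?w = 0" by (simp add: linear_diff[OF lR] linear_scale[OF lR] mult.commute)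
    moreover have "cder g U \<phi> y ?w = F y"
      unfolding cg F_def using has_derivative_linear[OF dgy] by (simp add: linear_diff linear_scale)
    moreover have "F y \<noteq> 0" using y by (simp add: H_def)
    ultimately show "\<exists>U \<phi> v. (U, \<phi>) \<in> atlas X \<and> y \<in> U \<and> cder R U \<phi> y v = 0 \<and> cder g U \<phi> y v \<noteq> 0"
      using U(1) yU(1) by metis
  qed
qed

end

section \<open>Smoothing a continuous map to the circle\<close>

lemma continuous_map_binop:
  fixes h :: "'b::topological_space \<Rightarrow> 'c::topological_space \<Rightarrow> 'd::topological_space"
  assumes "continuous_map Z euclidean a" "continuous_map Z euclidean b" "continuous_on UNIV (\<lambda>p. h (fst p) (snd p))"
  shows "continuous_map Z euclidean (\<lambda>y. h (a y) (b y))"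
proof -
  have "continuous_map Z euclidean (\<lambda>y. (a y, b y))" using continuous_map_pairedI[OF assms(1,2)] by simp
  from continuous_map_compose[OF this, of euclidean "\<lambda>p. h (fst p) (snd p)"] assms(3) show ?thesis
    by (simp add: comp_def)
qed

lemma continuous_map_unop:
  assumes "continuous_map Z euclidean a" "continuous_on UNIV h"
  shows "continuous_map Z euclidean (\<lambda>y. h (a y))"
  using continuous_map_compose[OF assms(1), of euclidean h] assms(2) by (simp add: comp_def)

text \<open>This is the radial retraction \<open>w / |w|\<close>. The factor \<open>1 / |w|\<close>
  is written as \<open>exp (- ln (w \<bullet> w) / 2)\<close>, a composite of maps already known to
  be smooth.\<close>

lemma normalize_complex:
  obtains h :: "complex \<Rightarrow> complex" where "csmooth {w. w \<noteq> 0} h" "\<And>w. w \<noteq> 0 \<Longrightarrow> norm (h w) = 1"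
    "\<And>w. norm w = 1 \<Longrightarrow> h w = w"
proof
  let ?h = "\<lambda>w::complex. exp ((- 1/2) * ln (w \<bullet> w)) *\<^sub>R w"
  have o: "open {w::complex. w \<noteq> 0}" using open_Compl[of "{0::complex}"] by (simp add: Compl_eq)
  have o': "open {x::real. x > 0}" by (rule open_Collect_less) (auto intro: continuous_intros)
  have "csmooth {w::complex. w \<noteq> 0} (\<lambda>w. w \<bullet> w)"
    by (intro csmooth_bilinear[OF bounded_bilinear_inner] csmooth_ident o)
  then have "csmooth {w::complex. w \<noteq> 0} (\<lambda>w. ln (w \<bullet> w))"
    by (rule csmooth_compose[OF o o' _ csmooth_ln]) auto
  then have "csmooth {w::complex. w \<noteq> 0} (\<lambda>w. (- 1/2) * ln (w \<bullet> w))"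
    by (rule csmooth_mult[OF o csmooth_const[OF o]])
  then have "csmooth {w::complex. w \<noteq> 0} (\<lambda>w. exp ((- 1/2) * ln (w \<bullet> w)))"
    by (rule csmooth_compose[OF o open_UNIV _ csmooth_exp_real]) simp
  then show "csmooth {w. w \<noteq> 0} ?h"
    by (rule csmooth_bilinear[OF bounded_bilinear_scaleR o _ csmooth_ident[OF o]])
  show "norm (?h w) = 1" if "w \<noteq> 0" for w
  proof -
    have "exp ((- 1/2) * ln (w \<bullet> w)) = inverse (norm w)"
      using that by (simp add: dot_square_norm ln_realpow exp_minus)
    then show ?thesis using that by simp
  qed
  show "?h w = w" if "norm w = 1" for w using that by (simp add: dot_square_norm)
qed

context cmfd
begin

text \<open>A partition of unity blends the map itself, used on \<open>D\<close>, with constants,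
  used on sets where the map differs from them by less than \<open>e / 2\<close>. The sets carrying
  constants avoid \<open>C\<close>, so nothing changes there.\<close>

lemma smooth_approximation:
  fixes P :: "'x \<Rightarrow> complex"
  assumes P: "continuous_map (mtop X) euclidean P" and D: "openin (mtop X) D" "smooth_map_on X D euclid P"
    and C: "closedin (mtop X) C" "C \<subseteq> D" and e: "e > 0"
  obtains P1 where "smooth_map_on X (pts X) euclid P1" "\<And>y. y \<in> pts X \<Longrightarrow> norm (P1 y - P y) < e"
    "\<And>y. y \<in> C \<Longrightarrow> P1 y = P y"
proof -
  define Q where "Q G \<longleftrightarrow> G = D \<or> (G \<inter> C = {} \<and> (\<exists>c. \<forall>y\<in>G. norm (P y - c) < e / 2))" for G
  have "\<exists>G. openin (mtop X) G \<and> x \<in> G \<and> Q G" if x: "x \<in> pts X" for x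
  proof (cases "x \<in> D")
    case True
    then show ?thesis using D(1) by (intro exI[of _ D]) (auto simp: Q_def)
  next
    case False
    let ?G = "{y \<in> pts X. P y \<in> ball (P x) (e / 2)} - C"
    have "openin (mtop X) ?G" using open_preimage[OF P open_ball] C(1) by (rule openin_diff)
    moreover have "x \<in> ?G" using x e False C(2) by auto
    moreover have "Q ?G" unfolding Q_def by (intro disjI2 conjI exI[of _ "P x"]) (auto simp: dist_norm norm_minus_commute)
    ultimately show ?thesis by blast
  qed
  then show thesis
  proof (rule partition_of_unity)
    fix K G Z and \<rho> :: "'x \<Rightarrow> 'x \<Rightarrow> real"
    assume K: "finite K" "\<And>k. k \<in> K \<Longrightarrow> openin (mtop X) (G k)" "\<And>k. k \<in> K \<Longrightarrow> Q (G k)"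
      "\<And>k. k \<in> K \<Longrightarrow> smooth_map_on X (pts X) euclid (\<rho> k)" "\<And>k y. k \<in> K \<Longrightarrow> y \<in> pts X \<Longrightarrow> \<rho> k y \<ge> 0"
      "\<And>k. k \<in> K \<Longrightarrow> closedin (mtop X) (Z k)" "\<And>k. k \<in> K \<Longrightarrow> Z k \<subseteq> G k"
      "\<And>k y. k \<in> K \<Longrightarrow> y \<in> pts X \<Longrightarrow> y \<notin> Z k \<Longrightarrow> \<rho> k y = 0" "\<And>y. y \<in> pts X \<Longrightarrow> (\<Sum>k\<in>K. \<rho> k y) = 1"
    have "\<exists>q. smooth_map_on X (G k) euclid q \<and> (\<forall>y\<in>G k. norm (q y - P y) \<le> e / 2 \<and> (y \<in> C \<longrightarrow> q y = P y))"
      if k: "k \<in> K" for k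
    proof (cases "G k = D")
      case True
      then show ?thesis using D(2) e by (intro exI[of _ P]) auto
    next
      case False
      then obtain c where c: "G k \<inter> C = {}" "\<forall>y\<in>G k. norm (P y - c) < e / 2" using K(3)[OF k] unfolding Q_def by blast
      have "smooth_map_on X (G k) euclid (\<lambda>_. c)"
        by (rule smooth_map_on_const[OF pX]) (use openin_subset[OF K(2)[OF k]] in auto)
      moreover have "norm (c - P y) \<le> e / 2" if "y \<in> G k" for y
        using c(2) that by (metis norm_minus_commute less_imp_le)
      ultimately show ?thesis using c(1) by (intro exI[of _ "\<lambda>_. c"]) auto
    qed
    then obtain q where q: "\<And>k. k \<in> K \<Longrightarrow> smooth_map_on X (G k) euclid (q k)"
      "\<And>k y. k \<in> K \<Longrightarrow> y \<in> G k \<Longrightarrow> norm (q k y - P y) \<le> e / 2"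
      "\<And>k y. k \<in> K \<Longrightarrow> y \<in> G k \<Longrightarrow> y \<in> C \<Longrightarrow> q k y = P y" by metis
    define P1 where "P1 y = (\<Sum>k\<in>K. \<rho> k y *\<^sub>R q k y)" for y
    have sP1: "smooth_map_on X (pts X) euclid P1"
      unfolding P1_def
      by (rule smooth_map_on_sum[OF smooth_localized[OF K(4) q(1) K(2) K(6) K(7) K(8)] pX order_refl])
    have diff: "P1 y - P y = (\<Sum>k\<in>K. \<rho> k y *\<^sub>R (q k y - P y))" if y: "y \<in> pts X" for y
    proof -
      have "P y = (\<Sum>k\<in>K. \<rho> k y *\<^sub>R P y)" using K(9)[OF y] by (simp flip: scaleR_left.sum)
      then show ?thesis by (simp add: P1_def scaleR_diff_right sum_subtractf)
    qed
    have 0: "\<rho> k y = 0" if "k \<in> K" "y \<in> pts X" "y \<notin> G k" for k y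
      using K(7,8) that by blast
    show thesis
    proof (rule that[OF sP1])
      fix y assume y: "y \<in> pts X"
      have "norm (\<rho> k y *\<^sub>R (q k y - P y)) \<le> \<rho> k y * (e / 2)" if k: "k \<in> K" for k
      proof (cases "y \<in> G k")
        case True
        then show ?thesis using mult_left_mono[OF q(2)[OF k True] K(5)[OF k y]] K(5)[OF k y] by simp
      qed (use 0[OF k y] in simp)
      then have "norm (P1 y - P y) \<le> (\<Sum>k\<in>K. \<rho> k y * (e / 2))"
        unfolding diff[OF y] by (rule sum_norm_le)
      also have "\<dots> = (\<Sum>k\<in>K. \<rho> k y) * (e / 2)" by (rule sum_distrib_right[symmetric])
      also have "\<dots> = e / 2" using K(9)[OF y] by simp
      finally show "norm (P1 y - P y) < e" using e by simp
    next
      fix y assume y: "y \<in> C"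
      then have yX: "y \<in> pts X" using C(1) closedin_subset by blast
      have "\<rho> k y *\<^sub>R (q k y - P y) = 0" if k: "k \<in> K" for k
        using 0[OF k yX] q(3)[OF k _ y] by (cases "y \<in> G k") auto
      then have "(\<Sum>k\<in>K. \<rho> k y *\<^sub>R (q k y - P y)) = 0" by (rule sum.neutral[OF ballI])
      then show "P1 y = P y" using diff[OF yX] by simp
    qed
  qed
qed

lemma cis_curve_derivative: "((\<lambda>s. a * cis (c * s)) has_vector_derivative a * (\<i> * of_real c)) (at 0)"
proof -
  have "((\<lambda>s. exp (\<i> * (of_real c * of_real s))) has_vector_derivative \<i> * of_real c) (at 0)"
    by (auto intro!: derivative_eq_intros has_vector_derivative_real_field)
  from has_vector_derivative_mult_right[OF this, of a] show ?thesis by (simp add: cis_conv_exp)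
qed

text \<open>The velocity of the curve is a direction in which the derivative has the value
  \<open>f x * (\<i> * c)\<close>.\<close>

lemma curve_nondegenerate:
  fixes f :: "'x \<Rightarrow> complex"
  assumes f: "smooth_map_on X G euclid f" "openin (mtop X) G" "x \<in> G" and U: "(U, \<phi>) \<in> atlas X" "x \<in> U"
    and \<gamma>: "c \<noteq> (0::real)" "smooth_map_on euclid UNIV X \<gamma>" "\<gamma> (0::real) = x" "\<And>s. f (\<gamma> s) = f x * cis (c * s)"
    and "norm (f x) = 1"
  shows "\<exists>v. cder f U \<phi> x v \<noteq> 0"
proof -
  obtain v B where vB: "((\<lambda>s. \<phi> (\<gamma> s)) has_vector_derivative v) (at 0)" "open B" "0 \<in> B"
    "\<And>s. s \<in> B \<Longrightarrow> \<gamma> s \<in> U" "continuous_on B (\<lambda>s. \<phi> (\<gamma> s))"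
    using chart_curve[OF U \<gamma>(2,3)] by blast
  have d: "((\<lambda>z. f (inv_into U \<phi> z)) has_derivative cder f U \<phi> x) (at (\<phi> (\<gamma> 0)))"
    unfolding \<gamma>(3) by (rule cder_has_derivative[OF f(1,2) U f(3)])
  have "((\<lambda>s. f (inv_into U \<phi> (\<phi> (\<gamma> s)))) has_vector_derivative cder f U \<phi> x v) (at 0)"
    by (rule vector_derivative_chain[OF vB(1) d])
  then have "((\<lambda>s. f x * cis (c * s)) has_vector_derivative cder f U \<phi> x v) (at 0)"
    by (rule has_vector_derivative_transform_within_open[OF _ vB(2,3)])
       (use chart_inv[OF pX U(1) vB(4)] \<gamma>(4) in auto)
  then have "cder f U \<phi> x v = f x * (\<i> * of_real c)"
    using cis_curve_derivative by (rule vector_derivative_unique_at)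
  then show ?thesis using \<gamma>(1) assms(10) by (intro exI[of _ v]) auto
qed

end

context glued
begin

text \<open>Each point of \<open>T\<close> has an open neighbourhood with all three properties. On
  the compact complement of their union \<open>R\<close> has no zero, so
  \<open>\<bar>R\<bar>\<close> is bounded away from 0 there, and \<open>d\<close> is such a
  bound.\<close>

lemma transverse_collar:
  assumes R: "defining R (pts X)"
  obtains d where "d > 0"
    "\<And>y. y \<in> pts X \<Longrightarrow> \<bar>R y\<bar> < d \<Longrightarrow> \<exists>U \<phi> v. (U, \<phi>) \<in> atlas X \<and> y \<in> U \<and> cder R U \<phi> y v \<noteq> 0"
    "\<And>y. y \<in> A1 - T \<Longrightarrow> \<bar>R y\<bar> < d \<Longrightarrow> \<exists>U \<phi> v. (U, \<phi>) \<in> atlas X \<and> y \<in> U \<and> cder R U \<phi> y v = 0 \<and> cder g1 U \<phi> y v \<noteq> 0"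
    "\<And>y. y \<in> A2 - T \<Longrightarrow> \<bar>R y\<bar> < d \<Longrightarrow> \<exists>U \<phi> v. (U, \<phi>) \<in> atlas X \<and> y \<in> U \<and> cder R U \<phi> y v = 0 \<and> cder g2 U \<phi> y v \<noteq> 0"
proof -
  define nd where "nd y \<longleftrightarrow> (\<exists>U \<phi> v. (U, \<phi>) \<in> atlas X \<and> y \<in> U \<and> cder R U \<phi> y v \<noteq> 0)" for y
  define tr where "tr g y \<longleftrightarrow> (\<exists>U \<phi> v. (U, \<phi>) \<in> atlas X \<and> y \<in> U \<and> cder R U \<phi> y v = 0 \<and> cder g U \<phi> y v \<noteq> 0)" for g :: "'x \<Rightarrow> complex" and y
  define good where "good H \<longleftrightarrow> openin (mtop X) H \<and> (\<forall>y\<in>H. nd y \<and> (y \<in> A1 - T \<longrightarrow> tr g1 y) \<and> (y \<in> A2 - T \<longrightarrow> tr g2 y))" for H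
  have "\<exists>H. x \<in> H \<and> good H" if x: "x \<in> T" for x
  proof -
    have TA: "T \<subseteq> A1" "T \<subseteq> A2" using inter by auto
    have xA: "x \<in> A1" "x \<in> A2" using x TA by auto
    obtain \<gamma> c where c: "c \<noteq> (0::real)" "smooth_map_on euclid UNIV X \<gamma>" "\<gamma> (0::real) = x" "\<And>s. \<gamma> s \<in> T"
      "\<And>s. g1 (\<gamma> s) = g1 x * cis (c * s)" using curves(1)[OF xA(1)] x by blast
    have "\<exists>H. openin (mtop X) H \<and> x \<in> H \<and> (\<forall>y\<in>H. nd y \<and> (y \<in> A1 - T \<longrightarrow> tr g1 y))"
    proof (rule transverse_near_T[OF R x open_A(1) TA(1) smooth_g(1) norm_g(1)[OF xA(1)] c])
      fix H
      assume "openin (mtop X) H" "x \<in> H"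
        "\<And>y. y \<in> H \<Longrightarrow> \<exists>U \<phi> v. (U, \<phi>) \<in> atlas X \<and> y \<in> U \<and> cder R U \<phi> y v \<noteq> 0"
        "\<And>y. y \<in> H \<Longrightarrow> y \<in> A1 - T \<Longrightarrow> \<exists>U \<phi> v. (U, \<phi>) \<in> atlas X \<and> y \<in> U \<and> cder R U \<phi> y v = 0 \<and> cder g1 U \<phi> y v \<noteq> 0"
      then show ?thesis unfolding nd_def tr_def by (intro exI[of _ H]) simp
    qed
    then obtain H1 where H1: "openin (mtop X) H1" "x \<in> H1" "\<forall>y\<in>H1. nd y \<and> (y \<in> A1 - T \<longrightarrow> tr g1 y)" by blast
    obtain \<gamma> c where c: "c \<noteq> (0::real)" "smooth_map_on euclid UNIV X \<gamma>" "\<gamma> (0::real) = x" "\<And>s. \<gamma> s \<in> T"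
      "\<And>s. g2 (\<gamma> s) = g2 x * cis (c * s)" using curves(2)[OF xA(2)] x by blast
    have "\<exists>H. openin (mtop X) H \<and> x \<in> H \<and> (\<forall>y\<in>H. nd y \<and> (y \<in> A2 - T \<longrightarrow> tr g2 y))"
    proof (rule transverse_near_T[OF R x open_A(2) TA(2) smooth_g(2) norm_g(2)[OF xA(2)] c])
      fix H
      assume "openin (mtop X) H" "x \<in> H"
        "\<And>y. y \<in> H \<Longrightarrow> \<exists>U \<phi> v. (U, \<phi>) \<in> atlas X \<and> y \<in> U \<and> cder R U \<phi> y v \<noteq> 0"
        "\<And>y. y \<in> H \<Longrightarrow> y \<in> A2 - T \<Longrightarrow> \<exists>U \<phi> v. (U, \<phi>) \<in> atlas X \<and> y \<in> U \<and> cder R U \<phi> y v = 0 \<and> cder g2 U \<phi> y v \<noteq> 0"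
      then show ?thesis unfolding nd_def tr_def by (intro exI[of _ H]) simp
    qed
    then obtain H2 where H2: "openin (mtop X) H2" "x \<in> H2" "\<forall>y\<in>H2. nd y \<and> (y \<in> A2 - T \<longrightarrow> tr g2 y)" by blast
    show ?thesis unfolding good_def using H1 H2 by (intro exI[of _ "H1 \<inter> H2"]) auto
  qed
  then obtain H where H: "\<And>x. x \<in> T \<Longrightarrow> x \<in> H x" "\<And>x. x \<in> T \<Longrightarrow> good (H x)" by metis
  have sR: "smooth_map_on X (pts X) euclid R" using R unfolding defining_def by blast
  define Z where "Z = pts X - (\<Union>x\<in>T. H x)"
  have "openin (mtop X) (\<Union>x\<in>T. H x)" using H(2) unfolding good_def by blast
  then have "closedin (mtop X) Z" unfolding Z_def by blast
  then have "compactin (mtop X) Z" using closedin_compact_space[OF compact_X] by blast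
  then have "compact (R ` Z)" using image_compactin[OF _ continuous_real[OF sR]] by simp
  then have "open (- (R ` Z))" by (simp add: compact_imp_closed open_Compl)
  moreover have "R y \<noteq> 0" if "y \<in> Z" for y
  proof
    assume "R y = 0"
    then have "y \<in> T" using R that unfolding defining_def Z_def by blast
    then show False using that H(1) unfolding Z_def by blast
  qed
  then have "0 \<in> - (R ` Z)" by auto
  ultimately obtain d where d: "d > 0" "ball 0 d \<subseteq> - (R ` Z)" using open_contains_ball by blast
  have "y \<in> (\<Union>x\<in>T. H x)" if "y \<in> pts X" "\<bar>R y\<bar> < d" for y
  proof (rule ccontr)
    assume "y \<notin> (\<Union>x\<in>T. H x)"
    then have "R y \<in> R ` Z" using that(1) unfolding Z_def by blast
    moreover have "R y \<in> ball 0 d" using that(2) by simp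
    ultimately show False using d(2) by blast
  qed
  then have *: "nd y \<and> (y \<in> A1 - T \<longrightarrow> tr g1 y) \<and> (y \<in> A2 - T \<longrightarrow> tr g2 y)" if "y \<in> pts X" "\<bar>R y\<bar> < d" for y
    using H(2) that unfolding good_def by blast
  show thesis
  proof (rule that[OF d(1)], goal_cases)
    case (1 y) then show ?case using * unfolding nd_def by blast
  next
    case (2 y) then show ?case using *[of y] union unfolding tr_def by blast
  next
    case (3 y) then show ?case using *[of y] union unfolding tr_def by blast
  qed
qed

text \<open>The zones are nested: the correction by \<open>u\<close> is confined to
  \<open>\<bar>R\<bar> < d / 4\<close>, the smoothing to \<open>\<bar>R\<bar> < d / 2\<close>, and
  the step has positive slope exactly for \<open>\<bar>R\<bar> < d\<close>. Up to
  \<open>d / 2\<close> a large coefficient of the step wins by compactness. Between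
  \<open>d / 2\<close> and \<open>d\<close> the map is still \<open>g1\<close> or \<open>g2\<close>
  times the step, and a direction in the kernel of the derivative of \<open>R\<close> works for any
  coefficient. From \<open>d\<close> on the step is constant.\<close>

theorem submersion_to_circle:
  obtains p :: "'x \<Rightarrow> complex" where "smooth_map_on X (pts X) euclid p" "\<And>x. x \<in> pts X \<Longrightarrow> norm (p x) = 1"
    "\<And>x. x \<in> pts X \<Longrightarrow> \<exists>U \<phi> v. (U, \<phi>) \<in> atlas X \<and> x \<in> U \<and> cder p U \<phi> x v \<noteq> 0"
proof -
  obtain R where R: "defining R (pts X)" using global_defining by blast
  have sR: "smooth_map_on X (pts X) euclid R" using R unfolding defining_def by blast
  note cR = continuous_real[OF sR]
  have RA: "y \<in> A1 \<longleftrightarrow> R y \<le> 0" "y \<in> T \<longleftrightarrow> R y = 0" "y \<in> A2 \<longleftrightarrow> R y \<ge> 0" if "y \<in> pts X" for y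
  proof -
    show 1: "y \<in> A1 \<longleftrightarrow> R y \<le> 0" and 2: "y \<in> T \<longleftrightarrow> R y = 0" using R that unfolding defining_def by blast+
    show "y \<in> A2 \<longleftrightarrow> R y \<ge> 0" using 1 2 that union inter by force
  qed
  obtain d where d: "d > 0"
    "\<And>y. y \<in> pts X \<Longrightarrow> \<bar>R y\<bar> < d \<Longrightarrow> \<exists>U \<phi> v. (U, \<phi>) \<in> atlas X \<and> y \<in> U \<and> cder R U \<phi> y v \<noteq> 0"
    "\<And>y. y \<in> A1 - T \<Longrightarrow> \<bar>R y\<bar> < d \<Longrightarrow> \<exists>U \<phi> v. (U, \<phi>) \<in> atlas X \<and> y \<in> U \<and> cder R U \<phi> y v = 0 \<and> cder g1 U \<phi> y v \<noteq> 0"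
    "\<And>y. y \<in> A2 - T \<Longrightarrow> \<bar>R y\<bar> < d \<Longrightarrow> \<exists>U \<phi> v. (U, \<phi>) \<in> atlas X \<and> y \<in> U \<and> cder R U \<phi> y v = 0 \<and> cder g2 U \<phi> y v \<noteq> 0"
    using transverse_collar[OF R] by blast
  have "normal_space (mtop X)" using compact_Hausdorff_or_regular_imp_normal_space compact_X Hausdorff_X by blast
  then obtain u' where u': "continuous_map (mtop X) euclideanreal u'" "\<And>x. x \<in> T \<Longrightarrow> u' x = u x"
    using Tietze_extension_realinterval[OF _ closed_T is_interval_univ _ u] by (metis UNIV_not_empty subset_UNIV)
  \<comment> \<open>A tent function; continuity is enough because the map is smoothed
    afterwards.\<close>
  define \<eta> where "\<eta> t = max 0 (1 - \<bar>t\<bar> / (d / 4))" for t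
  have \<eta>: "\<eta> 0 = 1" "\<And>t. \<bar>t\<bar> \<ge> d / 4 \<Longrightarrow> \<eta> t = 0" 
  proof -
    show "\<eta> 0 = 1" by (simp add: \<eta>_def)
    fix t assume "\<bar>t\<bar> \<ge> d / 4"
    then have "\<bar>t\<bar> / (d / 4) \<ge> 1" using d(1) by (simp add: field_simps)
    then show "\<eta> t = 0" by (simp add: \<eta>_def)
  qed
  define k where "k y = u' y * \<eta> (R y)" for y
  have ck: "continuous_map (mtop X) euclideanreal k"
    unfolding k_def
    by (rule continuous_map_binop[OF u'(1) continuous_map_unop[OF cR]])
       (use d(1) in \<open>auto simp: \<eta>_def intro!: continuous_intros\<close>)
  \<comment> \<open>The branches agree on \<open>T\<close>, where \<open>\<eta> 0 = 1\<close> turns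
    \<open>k\<close> into \<open>u\<close>.\<close>
  define P where "P y = (if R y \<le> 0 then g1 y else g2 y * cis (k y))" for y
  have cP: "continuous_map (mtop X) euclidean P"
    unfolding P_def
  proof (rule continuous_map_cases_le[OF cR])
    have "{x. x \<in> pts X \<and> R x \<le> 0} = A1" using RA(1) union by auto
    then show "continuous_map (subtopology (mtop X) {x. x \<in> pts X \<and> R x \<le> 0}) euclidean g1"
      using smooth_map_on_continuous[OF smooth_g(1)] by simp
    have A2: "{x. x \<in> pts X \<and> 0 \<le> R x} = A2" using RA(3) union by auto
    show "continuous_map (subtopology (mtop X) {x. x \<in> pts X \<and> 0 \<le> R x}) euclidean (\<lambda>y. g2 y * cis (k y))"
      unfolding A2
    proof (rule continuous_map_binop[where h="(*)" and a=g2 and b="\<lambda>y. cis (k y)"])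
      show "continuous_map (subtopology (mtop X) A2) euclidean g2"
        using smooth_map_on_continuous[OF smooth_g(2)] by simp
      show "continuous_map (subtopology (mtop X) A2) euclidean (\<lambda>y. cis (k y))"
        by (rule continuous_map_unop[OF continuous_map_from_subtopology[OF ck]]) (intro continuous_intros)
    qed (intro continuous_intros)
    show "g1 x = g2 x * cis (k x)" if "x \<in> pts X" "R x = 0" for x
      using match[of x] RA(2)[OF that(1)] that(2) u'(2) \<eta>(1) by (simp add: k_def)
  qed simp
  have nP: "norm (P y) = 1" if "y \<in> pts X" for y
    using norm_g RA[OF that] by (auto simp: P_def norm_mult)
  define D where "D = {y \<in> pts X. R y \<in> - cball 0 (d / 4)}"
  define D1 where "D1 e = {y \<in> pts X. R y \<in> {..< - e}}" for e
  define D2 where "D2 e = {y \<in> pts X. R y \<in> {e <..}}" for e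
  have oD: "openin (mtop X) D" unfolding D_def by (rule open_preimage[OF cR]) auto
  have oD12: "openin (mtop X) (D1 e)" "openin (mtop X) (D2 e)" for e
    unfolding D1_def D2_def by (rule open_preimage[OF cR], simp)+
  have D1A: "D1 e \<subseteq> A1 - T" if "e > 0" for e using RA that unfolding D1_def by force
  have D2A: "D2 e \<subseteq> A2 - T" if "e > 0" for e using RA that unfolding D2_def by force
  have P1: "P y = g1 y" if "y \<in> D1 e" "e > 0" for y e using that by (auto simp: P_def D1_def)
  have P2: "P y = g2 y" if "y \<in> D2 (d / 4)" for y
    using that d(1) \<eta>(2)[of "R y"] by (auto simp: P_def D2_def k_def)
  have d4: "d / 4 > 0" "d / 2 > 0" using d(1) by auto
  have sP: "smooth_map_on X (D1 (d / 4)) euclid P" "smooth_map_on X (D2 (d / 4)) euclid P"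
  proof -
    have "smooth_map_on X (D1 (d / 4)) euclid g1" "smooth_map_on X (D2 (d / 4)) euclid g2"
      using smooth_map_on_subset[OF smooth_g(1)] smooth_map_on_subset[OF smooth_g(2)]
        D1A[OF d4(1)] D2A[OF d4(1)] by blast+
    then show "smooth_map_on X (D1 (d / 4)) euclid P" "smooth_map_on X (D2 (d / 4)) euclid P"
      using P1[OF _ d4(1)] P2 by (auto intro: smooth_map_on_cong[OF _ pX])
  qed
  have D12: "D = D1 (d / 4) \<union> D2 (d / 4)" unfolding D_def D1_def D2_def by auto
  have sPD: "smooth_map_on X D euclid P"
  proof (rule smooth_map_on_local[OF pX])
    show "D \<subseteq> pts X" by (auto simp: D_def)
    fix y assume "y \<in> D"
    then consider "y \<in> D1 (d / 4)" | "y \<in> D2 (d / 4)" using D12 by blast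
    then show "\<exists>G. openin (mtop X) G \<and> y \<in> G \<and> smooth_map_on X (D \<inter> G) euclid P"
    proof cases
      case 1
      have "smooth_map_on X (D \<inter> D1 (d / 4)) euclid P" by (rule smooth_map_on_subset[OF sP(1)]) auto
      then show ?thesis using 1 oD12 by blast
    next
      case 2
      have "smooth_map_on X (D \<inter> D2 (d / 4)) euclid P" by (rule smooth_map_on_subset[OF sP(2)]) auto
      then show ?thesis using 2 oD12 by blast
    qed
  qed
  define C where "C = {y \<in> pts X. R y \<in> - ball 0 (d / 2)}"
  have "closedin (mtop X) C" unfolding C_def by (rule closed_preimage[OF cR]) auto
  moreover have "C \<subseteq> D" using d(1) unfolding C_def D_def by auto
  \<comment> \<open>An error below 1 keeps \<open>Q\<close> away from 0, as \<open>P\<close> has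
    absolute value 1; so \<open>Q\<close> can be normalized.\<close>
  ultimately obtain Q where Q: "smooth_map_on X (pts X) euclid Q" "\<And>y. y \<in> pts X \<Longrightarrow> norm (Q y - P y) < 1"
    "\<And>y. y \<in> C \<Longrightarrow> Q y = P y"
    using smooth_approximation[OF cP oD sPD, of C 1] by auto
  obtain h :: "complex \<Rightarrow> complex" where h: "csmooth {w. w \<noteq> 0} h" "\<And>w. w \<noteq> 0 \<Longrightarrow> norm (h w) = 1"
    "\<And>w. norm w = 1 \<Longrightarrow> h w = w" using normalize_complex by blast
  have Q0: "Q y \<noteq> 0" if "y \<in> pts X" for y using Q(2)[OF that] nP[OF that] by auto
  define P' where "P' y = h (Q y)" for y
  have o: "open {w::complex. w \<noteq> 0}" using open_Compl[of "{0::complex}"] by (simp add: Compl_eq)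
  have sP': "smooth_map_on X (pts X) euclid P'"
    unfolding P'_def by (rule smooth_map_on_csmooth[OF Q(1) h(1) o _ pX]) (use Q0 in simp)
  have nP': "norm (P' y) = 1" if "y \<in> pts X" for y unfolding P'_def by (rule h(2)[OF Q0[OF that]])
  have P'C: "P' y = P y" if "y \<in> C" for y
    using that Q(3)[OF that] h(3)[OF nP] unfolding P'_def C_def by simp
  obtain \<psi> \<psi>' :: "real \<Rightarrow> real" where \<psi>: "csmooth UNIV \<psi>" "\<And>t. (\<psi> has_real_derivative \<psi>' t) (at t)"
    "\<And>t. \<bar>t\<bar> < d \<Longrightarrow> \<psi>' t > 0" "\<And>t. \<bar>t\<bar> \<ge> d \<Longrightarrow> \<psi>' t = 0" "continuous_on UNIV \<psi>'"
    using smooth_step[OF d(1)] by blast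
  define p where "p c y = P' y * cis (c * \<psi> (R y))" for c y
  have sp: "smooth_map_on X (pts X) euclid (p c)" for c
  proof -
    have c1: "csmooth UNIV (\<lambda>t. c * \<psi> t)" by (intro csmooth_mult csmooth_const open_UNIV \<psi>(1))
    have "csmooth UNIV (\<lambda>t. cis (c * \<psi> t))" by (rule csmooth_compose[OF open_UNIV open_UNIV c1 csmooth_cis]) simp
    then have "smooth_map_on X (pts X) euclid (\<lambda>y. cis (c * \<psi> (R y)))"
      by (rule smooth_map_on_csmooth[OF sR _ open_UNIV _ pX]) simp
    then show ?thesis unfolding p_def by (rule smooth_map_on_mult[OF sP' _ pX])
  qed
  have np: "norm (p c y) = 1" if "y \<in> pts X" for c y using nP'[OF that] by (simp add: p_def norm_mult)
  have cp: "cder (p c) U \<phi> y v = cis (c * \<psi> (R y)) * (cder P' U \<phi> y v + \<i> * of_real (c * \<psi>' (R y) * cder R U \<phi> y v) * P' y)"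
    if U: "(U, \<phi>) \<in> atlas X" "y \<in> U" for c U \<phi> y v
  proof -
    have yX: "y \<in> pts X" using U chart_subset[OF pX U(1)] by blast
    have inv: "inv_into U \<phi> (\<phi> y) = y" using chart_inv[OF pX U] .
    note dR = cder_has_derivative[OF sR openin_topspace U yX]
    note dP = cder_has_derivative[OF sP' openin_topspace U yX]
    have d\<psi>: "((\<lambda>t. c * \<psi> t) has_derivative (\<lambda>h. h * (c * \<psi>' (R y)))) (at (R (inv_into U \<phi> (\<phi> y))))"
      using DERIV_cmult[OF \<psi>(2)[of "R y"], of c] unfolding inv has_field_derivative_def
      by (simp add: mult.commute[of _ "c * \<psi>' (R y)"])
    have d1: "((\<lambda>z. c * \<psi> (R (inv_into U \<phi> z))) has_derivative (\<lambda>h. cder R U \<phi> y h * (c * \<psi>' (R y)))) (at (\<phi> y))"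
      using has_derivative_compose[OF dR d\<psi>] .
    have "((\<lambda>s. exp (\<i> * of_real s)) has_vector_derivative \<i> * exp (\<i> * of_real t)) (at t)" for t
      by (auto intro!: derivative_eq_intros has_vector_derivative_real_field)
    then have dcis: "(cis has_derivative (\<lambda>h. h *\<^sub>R (\<i> * cis t))) (at t)" for t
      unfolding has_vector_derivative_def by (simp add: cis_conv_exp[abs_def])
    have d2: "((\<lambda>z. cis (c * \<psi> (R (inv_into U \<phi> z)))) has_derivative
        (\<lambda>h. (cder R U \<phi> y h * (c * \<psi>' (R y))) *\<^sub>R (\<i> * cis (c * \<psi> (R (inv_into U \<phi> (\<phi> y))))))) (at (\<phi> y))"
      by (rule has_derivative_compose[OF d1 dcis])
    have "((\<lambda>z. p c (inv_into U \<phi> z)) has_derivative (\<lambda>h. P' (inv_into U \<phi> (\<phi> y)) *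
        ((cder R U \<phi> y h * (c * \<psi>' (R y))) *\<^sub>R (\<i> * cis (c * \<psi> (R (inv_into U \<phi> (\<phi> y))))))
        + cder P' U \<phi> y h * cis (c * \<psi> (R (inv_into U \<phi> (\<phi> y)))))) (at (\<phi> y))"
      unfolding p_def by (rule has_derivative_mult[OF dP d2])
    from cder_eq[OF this] show ?thesis unfolding inv by (simp add: algebra_simps scaleR_conv_of_real)
  qed
  define Z where "Z = {y \<in> pts X. R y \<in> cball 0 (d / 2)}"
  have Z: "closedin (mtop X) Z" unfolding Z_def by (rule closed_preimage[OF cR]) auto
  define sub where "sub c y \<longleftrightarrow> (\<exists>U \<phi> v. (U, \<phi>) \<in> atlas X \<and> y \<in> U \<and> cder (p c) U \<phi> y v \<noteq> 0)" for c y
  have "\<exists>H c. (openin (mtop X) H \<and> x \<in> H) \<and> c > 0 \<and> (\<forall>y\<in>H. \<forall>c'\<ge>c. sub c' y)" if x: "x \<in> Z" for x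
  proof -
    have xX: "x \<in> pts X" "\<bar>R x\<bar> < d" using x d(1) by (auto simp: Z_def)
    obtain U \<phi> n where U: "(U, \<phi>) \<in> atlas X" "x \<in> U" "cder R U \<phi> x n \<noteq> 0" using d(2)[OF xX] by blast
    define a where "a y = \<bar>\<psi>' (R y) * cder R U \<phi> y n\<bar>" for y
    define b where "b y = norm (cder P' U \<phi> y n)" for y
    have UX: "U \<inter> pts X = U" using chart_subset[OF pX U(1)] by blast
    have "continuous_map (subtopology (mtop X) U) euclideanreal (\<lambda>y. \<psi>' (R y))"
      by (rule continuous_map_unop[OF continuous_map_from_subtopology[OF cR] \<psi>(5)])
    moreover have "continuous_map (subtopology (mtop X) U) euclideanreal (\<lambda>y. cder R U \<phi> y n)"
      using continuous_cder[OF sR openin_topspace U(1)] unfolding UX .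
    ultimately have "continuous_map (subtopology (mtop X) U) euclideanreal (\<lambda>y. \<psi>' (R y) * cder R U \<phi> y n)"
      by (rule continuous_map_real_mult)
    then have ca: "continuous_map (subtopology (mtop X) U) euclideanreal a"
      unfolding a_def by (rule continuous_map_real_abs)
    have "continuous_map (subtopology (mtop X) U) euclidean (\<lambda>y. cder P' U \<phi> y n)"
      using continuous_cder[OF sP' openin_topspace U(1)] unfolding UX .
    then have cb: "continuous_map (subtopology (mtop X) U) euclideanreal b"
      unfolding b_def by (rule continuous_map_unop) (intro continuous_intros)
    have ax: "a x > 0" using \<psi>(3)[OF xX(2)] U(3) by (simp add: a_def)
    define H where "H = {y \<in> U. a y \<in> {a x / 2 <..}} \<inter> {y \<in> U. b y \<in> {..< b x + 1}}"
    have tU: "topspace (subtopology (mtop X) U) = U" using chart_subset[OF pX U(1)] by auto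
    have "openin (subtopology (mtop X) U) {y \<in> U. a y \<in> {a x / 2 <..}}"
      "openin (subtopology (mtop X) U) {y \<in> U. b y \<in> {..< b x + 1}}"
      using openin_continuous_map_preimage[OF ca, of "{a x / 2 <..}"] openin_continuous_map_preimage[OF cb, of "{..< b x + 1}"]
      unfolding tU by auto
    then have oH: "openin (mtop X) H"
      unfolding H_def using chart_open[OF pX U(1)] openin_open_subtopology by blast
    have xH: "x \<in> H" using U(2) ax by (simp add: H_def)
    \<comment> \<open>Near \<open>x\<close> the step contributes more than
      \<open>c' * a x / 2\<close> to the derivative and the smoothed map less than
      \<open>b x + 1\<close>; this threshold makes the two bounds equal.\<close>
    define c where "c = 2 * (b x + 1) / a x"
    have c: "c > 0" using ax by (simp add: c_def b_def add_nonneg_pos)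
    have "sub c' y" if y: "y \<in> H" and c': "c' \<ge> c" for y c'
    proof -
      have yU: "y \<in> U" "a y > a x / 2" "b y < b x + 1" using y by (auto simp: H_def)
      have yX: "y \<in> pts X" using yU(1) UX by blast
      have "b x + 1 = c * (a x / 2)" using ax by (simp add: c_def)
      also have "\<dots> \<le> c' * a y" using c c' yU(2) ax by (intro mult_mono) auto
      finally have "b y < c' * a y" using yU(3) by simp
      also have "\<dots> = norm (\<i> * of_real (c' * \<psi>' (R y) * cder R U \<phi> y n) * P' y)"
        using c c' nP'[OF yX] by (simp add: a_def norm_mult abs_mult)
      finally have "cder P' U \<phi> y n + \<i> * of_real (c' * \<psi>' (R y) * cder R U \<phi> y n) * P' y \<noteq> 0"
        unfolding b_def by (metis add_eq_0_iff less_irrefl norm_minus_cancel)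
      then have "cder (p c') U \<phi> y n \<noteq> 0" unfolding cp[OF U(1) yU(1)] by (metis cis_neq_zero mult_eq_0_iff)
      then show ?thesis unfolding sub_def using U(1) yU(1) by blast
    qed
    then show ?thesis using oH xH c by blast
  qed
  then obtain H c where Hc: "\<And>x. x \<in> Z \<Longrightarrow> openin (mtop X) (H x) \<and> x \<in> H x" "\<And>x. x \<in> Z \<Longrightarrow> c x > 0"
    "\<And>x y c'. x \<in> Z \<Longrightarrow> y \<in> H x \<Longrightarrow> c' \<ge> c x \<Longrightarrow> sub c' y" by metis
  obtain K where K: "finite K" "K \<subseteq> Z" "Z \<subseteq> (\<Union>x\<in>K. H x)" using compact_cover[OF Z Hc(1)] by blast
  define M where "M = (\<Sum>k\<in>K. c k)"
  have "c k \<le> M" if "k \<in> K" for k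
    unfolding M_def using that K Hc(2) by (intro member_le_sum) (auto intro: less_imp_le)
  then have subZ: "sub M y" if "y \<in> Z" for y using that K Hc(3) by blast
  \<comment> \<open>Away from the central zone the smoothed map is \<open>g\<close> itself. While
    \<open>\<bar>R\<bar> < d\<close>, the direction from \<open>tr\<close> annihilates the
    contribution of the step; beyond that the step has slope 0 and any direction from
    \<open>nd\<close> serves.\<close>
  have far: "sub M y" if y: "y \<in> Di" and Di: "openin (mtop X) Di" "Di \<subseteq> A - T" and g: "smooth_map_on X A euclid g"
      and Pg: "\<And>y. y \<in> Di \<Longrightarrow> P' y = g y"
      and nd: "\<And>U \<phi>. (U, \<phi>) \<in> atlas X \<Longrightarrow> y \<in> U \<Longrightarrow> \<exists>v. cder g U \<phi> y v \<noteq> 0"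
      and tr: "\<bar>R y\<bar> < d \<Longrightarrow> \<exists>U \<phi> v. (U, \<phi>) \<in> atlas X \<and> y \<in> U \<and> cder R U \<phi> y v = 0 \<and> cder g U \<phi> y v \<noteq> 0"
    for y Di A g
  proof -
    have yX: "y \<in> pts X" using y openin_subset[OF Di(1)] by blast
    have sg: "smooth_map_on X Di euclid g" by (rule smooth_map_on_subset[OF g]) (use Di(2) in blast)
    have Pg': "cder P' U \<phi> y = cder g U \<phi> y" if "(U, \<phi>) \<in> atlas X" "y \<in> U" for U \<phi>
      by (rule cder_cong[OF Di(1) that y _ sg]) (use Pg in simp)
    obtain U \<phi> where U: "(U, \<phi>) \<in> atlas X" "y \<in> U" using chart_at[OF pX yX] by blast
    show ?thesis
    proof (cases "\<bar>R y\<bar> < d")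
      case True
      then obtain U \<phi> v where U: "(U, \<phi>) \<in> atlas X" "y \<in> U" "cder R U \<phi> y v = 0" "cder g U \<phi> y v \<noteq> 0" using tr by blast
      have "cder (p M) U \<phi> y v \<noteq> 0"
        unfolding cp[OF U(1,2)] Pg'[OF U(1,2)] U(3) using U(4) by simp
      then show ?thesis unfolding sub_def using U by blast
    next
      case False
      obtain v where v: "cder g U \<phi> y v \<noteq> 0" using nd[OF U] by blast
      have "\<psi>' (R y) = 0" using \<psi>(4) False by simp
      then have "cder (p M) U \<phi> y v \<noteq> 0"
        unfolding cp[OF U] Pg'[OF U] using v by simp
      then show ?thesis unfolding sub_def using U by blast
    qed
  qed
  have "sub M y" if yX: "y \<in> pts X" for y
  proof -
    consider "y \<in> Z" | "y \<in> D1 (d / 2)" | "y \<in> D2 (d / 2)" using yX unfolding Z_def D1_def D2_def by force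
    then show ?thesis
    proof cases
      case 1
      then show ?thesis by (rule subZ)
    next
      case 2
      have yA: "y \<in> A1 - T" using 2 D1A[OF d4(2)] by blast
      show ?thesis
      proof (rule far[OF 2 oD12(1) D1A[OF d4(2)] smooth_g(1)])
        show "P' z = g1 z" if "z \<in> D1 (d / 2)" for z
        proof -
          have "z \<in> C" using that by (auto simp: C_def D1_def)
          then show ?thesis using P'C P1[OF that d4(2)] by simp
        qed
        show "\<exists>v. cder g1 U \<phi> y v \<noteq> 0" if U: "(U, \<phi>) \<in> atlas X" "y \<in> U" for U \<phi>
        proof -
          obtain \<gamma> c where c: "c \<noteq> (0::real)" "smooth_map_on euclid UNIV X \<gamma>" "\<gamma> (0::real) = y"
            "\<And>s. g1 (\<gamma> s) = g1 y * cis (c * s)" using curves(1)[of y] yA by blast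
          show ?thesis
            by (rule curve_nondegenerate[OF smooth_map_on_subset[OF smooth_g(1)] open_A(1) yA U c]) (use yA norm_g in auto)
        qed
      qed (use d(3) yA in blast)
    next
      case 3
      have yA: "y \<in> A2 - T" using 3 D2A[OF d4(2)] by blast
      show ?thesis
      proof (rule far[OF 3 oD12(2) D2A[OF d4(2)] smooth_g(2)])
        show "P' z = g2 z" if "z \<in> D2 (d / 2)" for z
        proof -
          have "z \<in> C" "z \<in> D2 (d / 4)" using that d(1) by (auto simp: C_def D2_def)
          then show ?thesis using P'C P2 by simp
        qed
        show "\<exists>v. cder g2 U \<phi> y v \<noteq> 0" if U: "(U, \<phi>) \<in> atlas X" "y \<in> U" for U \<phi>
        proof -
          obtain \<gamma> c where c: "c \<noteq> (0::real)" "smooth_map_on euclid UNIV X \<gamma>" "\<gamma> (0::real) = y"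
            "\<And>s. g2 (\<gamma> s) = g2 y * cis (c * s)" using curves(2)[of y] yA by blast
          show ?thesis
            by (rule curve_nondegenerate[OF smooth_map_on_subset[OF smooth_g(2)] open_A(2) yA U c]) (use yA norm_g in auto)
        qed
      qed (use d(4) yA in blast)
    qed
  qed
  then show thesis using that[of "p M"] sp np unfolding sub_def by blast
qed

end

section \<open>The two pieces inside the glued manifold\<close>

lemma unit_powi_smooth:
  assumes f: "smooth_map_on M A euclid (f :: 'a \<Rightarrow> complex)" and n: "\<And>x. x \<in> A \<Longrightarrow> norm (f x) = 1" and M: "premfd M"
  shows "smooth_map_on M A euclid (\<lambda>x. f x powi k)"
proof -
  have o: "open {w::complex. w \<noteq> 0}" using open_Compl[of "{0::complex}"] by (simp add: Compl_eq)
  have "csmooth {w::complex. w \<noteq> 0} (\<lambda>w. w powi k)"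
    by (rule csmooth_holomorphic[OF _ o]) (auto intro!: holomorphic_intros)
  then show ?thesis
    by (rule smooth_map_on_csmooth[OF f _ o _ M]) (use n in force)
qed

context piece
begin

lemma boundary_chart:
  assumes w: "w \<in> bd W"
  obtains U \<phi> Q b where "(U, \<phi>) \<in> atlas W" "w \<in> U" "open Q" "\<phi> ` U = half_space b \<inter> Q" "b \<noteq> 0"
    "\<And>w'. w' \<in> U \<Longrightarrow> w' \<in> bd W \<longleftrightarrow> \<phi> w' \<bullet> b = 0"
proof -
  have "w \<in> pts W" using w bd_subset by blast
  then obtain U \<phi> where U: "(U, \<phi>) \<in> atlas W" "w \<in> U" using chart_at[OF premfd_W] by blast
  obtain b Q where Q: "open Q" "\<phi> ` U = half_space b \<inter> Q"
    using chart_image_W[OF U(1)] unfolding chart_image_def by (auto simp: openin_open)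
  have bdU: "w' \<in> bd W \<longleftrightarrow> \<phi> w' \<notin> interior (\<phi> ` U)" if "w' \<in> U" for w'
    using bd_iff_chart[OF premfd_W U(1) that] .
  have b: "b \<noteq> 0"
  proof
    assume "b = 0"
    then have "interior (\<phi> ` U) = \<phi> ` U" using Q by (simp add: interior_open)
    then show False using bdU[OF U(2)] w U(2) by blast
  qed
  have "w' \<in> bd W \<longleftrightarrow> \<phi> w' \<bullet> b = 0" if w': "w' \<in> U" for w'
  proof
    assume "w' \<in> bd W"
    then have n: "\<phi> w' \<notin> interior (\<phi> ` U)" using bdU[OF w'] by blast
    have "\<phi> w' \<in> half_space b \<inter> Q" using w' Q(2) by blast
    then have m: "\<phi> w' \<in> Q" "\<phi> w' \<bullet> b \<ge> 0" by (auto simp: half_space_def)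
    have "open ({y. y \<bullet> b > 0} \<inter> Q)"
      by (intro open_Int Q(1) open_Collect_less continuous_intros)
    moreover have "{y. y \<bullet> b > 0} \<inter> Q \<subseteq> \<phi> ` U" unfolding Q(2) by (auto simp: half_space_def)
    ultimately have "{y. y \<bullet> b > 0} \<inter> Q \<subseteq> interior (\<phi> ` U)" by (metis interior_maximal)
    then show "\<phi> w' \<bullet> b = 0" using n m by force
  next
    assume "\<phi> w' \<bullet> b = 0"
    then show "w' \<in> bd W" unfolding bdU[OF w'] using not_interior_half_space[OF b] Q(2) by blast
  qed
  then show thesis using that[OF U Q b] by blast
qed

text \<open>The embedding composed with an inverse boundary chart presents the piece as a half-space
  patch. In the straightened coordinates \<open>\<beta>\<close> the function \<open>r\<close> is
  minus the inner product with the normal vector \<open>b\<close>; being a nonzero linear function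
  of \<open>\<beta>\<close>, it has nonzero derivative in every chart by the chain rule.\<close>

lemma embedded_patch:
  fixes X :: "('x, 'd::euclidean_space) mfd"
  assumes X: "cmfd X" and dim: "DIM('e) = DIM('d)" and j: "smooth_embedding W X j" and x: "x \<in> j ` bd W"
  shows "\<exists>G r. openin (mtop X) G \<and> x \<in> G \<and> smooth_map_on X G euclid (r :: 'x \<Rightarrow> real) \<and>
      (\<forall>y\<in>G. (y \<in> j ` pts W \<longleftrightarrow> r y \<le> 0) \<and> (y \<in> j ` bd W \<longleftrightarrow> r y = 0) \<and>
        (\<forall>U \<phi>. (U, \<phi>) \<in> atlas X \<longrightarrow> y \<in> U \<longrightarrow> (\<exists>v. cmfd.cder r U \<phi> y v \<noteq> 0)))"
proof -
  interpret X: cmfd X by (rule X)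
  define i where "i = inv_into (pts W) j"
  have j: "inj_on j (pts W)" "smooth_map_on W (pts W) X j" "smooth_map_on X (j ` pts W) W i"
    using j unfolding smooth_embedding_def diffeo_on_def bij_betw_def i_def by blast+
  have ij: "i (j w) = w" if "w \<in> pts W" for w using j(1) that by (simp add: i_def)
  obtain w where w: "w \<in> bd W" "x = j w" using x by blast
  have wW: "w \<in> pts W" using w(1) bd_subset by blast
  have "\<exists>U \<phi> Q b. (U, \<phi>) \<in> atlas W \<and> w \<in> U \<and> open Q \<and> \<phi> ` U = half_space b \<inter> Q \<and> b \<noteq> 0 \<and>
      (\<forall>w'\<in>U. w' \<in> bd W \<longleftrightarrow> \<phi> w' \<bullet> b = 0)"
    by (rule boundary_chart[OF w(1)]) (intro exI conjI ballI)
  then obtain U \<phi> Q b where U: "(U, \<phi>) \<in> atlas W" "w \<in> U" "open Q" "\<phi> ` U = half_space b \<inter> Q" "b \<noteq> 0"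
    "\<And>w'. w' \<in> U \<Longrightarrow> w' \<in> bd W \<longleftrightarrow> \<phi> w' \<bullet> b = 0" by blast
  have UW: "U \<subseteq> pts W" by (rule chart_subset[OF premfd_W U(1)])
  have inv: "inv_into U \<phi> (\<phi> w) = w" if "w \<in> U" for w using chart_inv[OF premfd_W U(1) that] .
  have x0: "\<phi> w \<in> Q" "\<phi> w \<in> half_space b" using U(2,4) by blast+
  have sh: "smooth_map_on euclid (half_space b \<inter> Q) X (\<lambda>y. j (inv_into U \<phi> y))"
    unfolding U(4)[symmetric]
    by (rule smooth_map_on_compose[OF chart_inverse_smooth[OF premfd_W U(1)] j(2) _ premfd_euclid premfd_W])
       (use inv UW in auto)
  have him: "(\<lambda>y. j (inv_into U \<phi> y)) ` (half_space b \<inter> Q) = j ` U"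
    unfolding U(4)[symmetric] by (simp add: image_image inv)
  have sk: "smooth_map_on X ((\<lambda>y. j (inv_into U \<phi> y)) ` (half_space b \<inter> Q)) euclid (\<lambda>x. \<phi> (i x))"
    unfolding him
    by (rule smooth_map_on_compose[OF smooth_map_on_subset[OF j(3)] chart_smooth[OF premfd_W U(1)] _ X.pX premfd_W])
       (use ij UW in auto)
  have kh: "\<phi> (i (j (inv_into U \<phi> y))) = y" if y: "y \<in> half_space b \<inter> Q" for y
  proof -
    obtain w where "w \<in> U" "y = \<phi> w" using y unfolding U(4)[symmetric] by blast
    then show ?thesis using inv ij UW by auto
  qed
  obtain G0 where G0: "openin (mtop X) G0" "{x \<in> j ` pts W. i x \<in> U} = j ` pts W \<inter> G0"
    using smooth_map_on_nbhd[OF j(3) chart_open[OF premfd_W U(1)]] by blast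
  have "{x \<in> j ` pts W. i x \<in> U} = j ` U" using ij UW by auto
  then have jU: "j ` U = j ` pts W \<inter> G0" using G0(2) by simp
  show ?thesis
  proof (rule mfd_half_space_patch[OF X.pX X.bd_X dim U(3) x0 sh sk kh G0(1) him[unfolded jU]])
    fix G \<beta> g
    assume *: "openin (mtop X) G" "j (inv_into U \<phi> (\<phi> w)) \<in> G" "open (\<beta> ` G)" "smooth_map_on X G euclid \<beta>"
      "smooth_map_on euclid (\<beta> ` G) X g" "\<And>y. y \<in> G \<Longrightarrow> g (\<beta> y) = y"
      "\<And>y. y \<in> G \<Longrightarrow> (y \<in> j ` pts W) = (\<beta> y \<in> half_space b)"
      "\<And>y. y \<in> G \<Longrightarrow> y \<in> j ` pts W \<Longrightarrow> \<beta> y = \<phi> (i y)"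
    define r where "r y = \<beta> y \<bullet> (- b)" for y
    have "csmooth UNIV (\<lambda>z. z \<bullet> (- b))"
      by (intro csmooth_bilinear[OF bounded_bilinear_inner] csmooth_ident csmooth_const open_UNIV)
    then have sr: "smooth_map_on X G euclid r"
      unfolding r_def by (rule smooth_map_on_csmooth[OF *(4) _ open_UNIV _ X.pX]) simp
    have "\<exists>v. X.cder r V \<psi> y v \<noteq> 0" if y: "y \<in> G" and V: "(V, \<psi>) \<in> atlas X" "y \<in> V" for y V \<psi>
    proof -
      have o: "open (\<beta> ` (G \<inter> V))" by (rule smooth_map_on_open_image[OF *(5,3,6) chart_open[OF X.pX V(1)]])
      have "smooth_map_on euclid (\<beta> ` (G \<inter> V)) euclid (\<lambda>z. \<psi> (g z))"
        by (rule smooth_map_on_compose[OF smooth_map_on_subset[OF *(5)] chart_smooth[OF X.pX V(1)] _ premfd_euclid X.pX])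
           (use *(6) in auto)
      then have c: "csmooth (\<beta> ` (G \<inter> V)) (\<lambda>z. \<psi> (g z))" by (simp add: smooth_map_on_euclid smooth_on_open[OF o])
      let ?D = "frechet_derivative (\<lambda>z. \<psi> (g z)) (at (\<beta> y))"
      have by': "\<beta> y \<in> \<beta> ` (G \<inter> V)" using y V(2) by blast
      have d1: "((\<lambda>z. \<psi> (g z)) has_derivative ?D) (at (\<beta> y))" by (rule csmooth_has_derivative[OF c by'])
      have d2: "((\<lambda>z. r (inv_into V \<psi> z)) has_derivative X.cder r V \<psi> y) (at (\<psi> (g (\<beta> y))))"
        unfolding *(6)[OF y] by (rule X.cder_has_derivative[OF sr *(1) V y])
      have "((\<lambda>z. r (inv_into V \<psi> (\<psi> (g z)))) has_derivative (\<lambda>h. X.cder r V \<psi> y (?D h))) (at (\<beta> y))"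
        by (rule has_derivative_compose[OF d1 d2])
      then have "((\<lambda>z. z \<bullet> (- b)) has_derivative (\<lambda>h. X.cder r V \<psi> y (?D h))) (at (\<beta> y))"
      proof (rule has_derivative_transform_within_open[OF _ o by'])
        fix z assume "z \<in> \<beta> ` (G \<inter> V)"
        then obtain y' where "y' \<in> G" "y' \<in> V" "z = \<beta> y'" by blast
        then show "r (inv_into V \<psi> (\<psi> (g z))) = z \<bullet> (- b)"
          using *(6) chart_inv[OF X.pX V(1)] by (simp add: r_def)
      qed
      moreover have "((\<lambda>z. z \<bullet> (- b)) has_derivative (\<lambda>h. h \<bullet> (- b))) (at (\<beta> y))"
        by (auto intro!: derivative_eq_intros)
      ultimately have "(\<lambda>h. X.cder r V \<psi> y (?D h)) = (\<lambda>h. h \<bullet> (- b))" by (rule has_derivative_unique)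
      then have "X.cder r V \<psi> y (?D b) = - (b \<bullet> b)" by (metis inner_minus_right)
      then show ?thesis using U(5) by (intro exI[of _ "?D b"]) simp
    qed
    \<comment> \<open>Inside \<open>G0\<close> the points of the embedded piece come from the chart
      domain \<open>U\<close>, where the boundary is known to be the zero set of the inner product
      with \<open>b\<close>.\<close>
    moreover have "(y \<in> j ` pts W \<longleftrightarrow> r y \<le> 0) \<and> (y \<in> j ` bd W \<longleftrightarrow> r y = 0)" if y: "y \<in> G" "y \<in> G0" for y
    proof (cases "y \<in> j ` pts W")
      case True
      then have "y \<in> j ` U" using y(2) jU by blast
      then obtain w' where w': "w' \<in> U" "y = j w'" by blast
      have "r y = - (\<phi> w' \<bullet> b)" using *(8)[OF y(1) True] w' ij UW by (auto simp: r_def)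
      moreover have "y \<in> j ` bd W \<longleftrightarrow> w' \<in> bd W"
        unfolding w'(2) by (rule inj_on_image_mem_iff[OF j(1)]) (use w' UW bd_subset in auto)
      moreover have "r y \<le> 0" using *(7)[OF y(1)] True by (simp add: r_def half_space_def)
      ultimately show ?thesis using True U(6)[OF w'(1)] by simp
    next
      case False
      then have "r y > 0" using *(7)[OF y(1)] by (simp add: r_def half_space_def)
      moreover have "y \<notin> j ` bd W" using False bd_subset by blast
      ultimately show ?thesis using False by simp
    qed
    moreover have "x \<in> G \<inter> G0" using *(2) inv[OF U(2)] w(2) jU U(2) by auto
    moreover have "openin (mtop X) (G \<inter> G0)" using *(1) G0(1) by blast
    moreover have "smooth_map_on X (G \<inter> G0) euclid r" by (rule smooth_map_on_subset[OF sr]) auto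
    ultimately show ?thesis by (intro exI[of _ "G \<inter> G0"] exI[of _ r]) blast
  qed
qed

lemma embedded_curve:
  assumes j: "smooth_map_on W (pts W) X j" "inj_on j (pts W)" and ab: "a \<noteq> 0 \<or> b \<noteq> 0" and x: "x \<in> j ` pts W"
    and g: "\<And>w. w \<in> pts W \<Longrightarrow> g (j w) = z w powi a * P w powi b"
  shows "\<exists>\<gamma> c. c \<noteq> (0::real) \<and> smooth_map_on euclid UNIV X \<gamma> \<and> \<gamma> (0::real) = x \<and>
        (\<forall>s. \<gamma> s \<in> j ` pts W) \<and> (x \<in> j ` bd W \<longrightarrow> (\<forall>s. \<gamma> s \<in> j ` bd W)) \<and> (\<forall>s. g (\<gamma> s) = g x * cis (c * s))"
proof -
  obtain w where w: "w \<in> pts W" "x = j w" using x by blast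
  obtain \<gamma> c where \<gamma>: "c \<noteq> (0::real)" "smooth_map_on euclid UNIV W \<gamma>" "\<gamma> (0::real) = w"
    "w \<in> bd W \<longrightarrow> (\<forall>s. \<gamma> s \<in> bd W)"
    "\<And>s. z (\<gamma> s) powi a * P (\<gamma> s) powi b = z w powi a * P w powi b * cis (c * s)"
    using curve[OF w(1) ab] by blast
  have \<gamma>W: "\<gamma> s \<in> pts W" for s using smooth_map_on_image[OF \<gamma>(2)] by simp
  have "smooth_map_on euclid UNIV X (\<lambda>s. j (\<gamma> s))"
    by (rule smooth_map_on_compose[OF \<gamma>(2) j(1) \<gamma>W premfd_euclid premfd_W])
  moreover have "x \<in> j ` bd W \<longleftrightarrow> w \<in> bd W"
    unfolding w(2) by (rule inj_on_image_mem_iff[OF j(2) w(1) bd_subset])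
  ultimately show ?thesis
    using \<gamma> \<gamma>W w by (intro exI[of _ "\<lambda>s. j (\<gamma> s)"] exI[of _ c]) (auto simp: g)
qed

end

text \<open>The dependence is worked out on the boundary of \<open>W2\<close>, to which
  \<open>f\<close> pulls back the maps of \<open>W1\<close>. If the exponents of \<open>z2\<close>
  and \<open>P2\<close> both vanish, the contradiction arises on the boundary of \<open>W1\<close>,
  to which \<open>u\<close> is carried by the inverse of \<open>f\<close>.\<close>

theorem gluing_submersion:
  fixes W1 :: "('v, 'e::euclidean_space) mfd" and W2 :: "('w, 'e) mfd" and X :: "('x, 'd::euclidean_space) mfd"
  assumes W1: "piece W1 z1 P1" and W2: "piece W2 z2 P2" and dim: "DIM('e) = DIM('d)"
    and f: "diffeo_on W2 (bd W2) W1 (bd W1) f" and glue: "boundary_gluing W1 W2 f X j1 j2"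
  obtains p :: "'x \<Rightarrow> complex" where "cmfd X" "pts X \<noteq> {}" "smooth_map_on X (pts X) euclid p" "\<And>x. x \<in> pts X \<Longrightarrow> norm (p x) = 1"
    "\<And>x. x \<in> pts X \<Longrightarrow> \<exists>U \<phi> v. (U, \<phi>) \<in> atlas X \<and> x \<in> U \<and> cmfd.cder p U \<phi> x v \<noteq> 0"
proof -
  interpret W1: piece W1 z1 P1 by (rule W1)
  interpret W2: piece W2 z2 P2 by (rule W2)
  have X: "smooth_mfd X" "bd X = {}" "smooth_embedding W1 X j1" "smooth_embedding W2 X j2"
    "pts X = j1 ` pts W1 \<union> j2 ` pts W2"
    "\<And>x y. x \<in> pts W1 \<Longrightarrow> y \<in> pts W2 \<Longrightarrow> j1 x = j2 y \<longleftrightarrow> y \<in> bd W2 \<and> x = f y"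
    using glue unfolding boundary_gluing_def by blast+
  define i1 where "i1 = inv_into (pts W1) j1"
  define i2 where "i2 = inv_into (pts W2) j2"
  have j1: "inj_on j1 (pts W1)" "smooth_map_on W1 (pts W1) X j1" "smooth_map_on X (j1 ` pts W1) W1 i1"
    using X(3) unfolding smooth_embedding_def diffeo_on_def bij_betw_def i1_def by blast+
  have j2: "inj_on j2 (pts W2)" "smooth_map_on W2 (pts W2) X j2" "smooth_map_on X (j2 ` pts W2) W2 i2"
    using X(4) unfolding smooth_embedding_def diffeo_on_def bij_betw_def i2_def by blast+
  have ij1: "i1 (j1 w) = w" if "w \<in> pts W1" for w using j1(1) that by (simp add: i1_def)
  have ij2: "i2 (j2 w) = w" if "w \<in> pts W2" for w using j2(1) that by (simp add: i2_def)
  have fbij: "bij_betw f (bd W2) (bd W1)" and sf: "smooth_map_on W2 (bd W2) W1 f"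
    and sf': "smooth_map_on W1 (bd W1) W2 (inv_into (bd W2) f)"
    using f unfolding diffeo_on_def by blast+
  have f1: "f y \<in> bd W1" if "y \<in> bd W2" for y using fbij that by (auto simp: bij_betw_def)
  have comp: "compactin (mtop X) (j ` pts W)"
    if "compact_space (mtop W)" "smooth_map_on W (pts W) X j" for W :: "('a, 'e) mfd" and j
    using image_compactin[of "mtop W" "pts W" "mtop X" j] that smooth_map_on_continuous[OF that(2)]
    by (simp add: compact_space_def subtopology_topspace)
  have compA: "compactin (mtop X) (j1 ` pts W1)" "compactin (mtop X) (j2 ` pts W2)"
    using comp[OF W1.compact_W j1(2)] comp[OF W2.compact_W j2(2)] by blast+
  have "compact_space (mtop X)" unfolding compact_space_def X(5) using compA by (rule compactin_Un)
  then have cX: "cmfd X" using X(1,2) by (simp add: cmfd_def)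
  interpret X: cmfd X by (rule cX)
  have T1: "j2 ` bd W2 = j1 ` bd W1"
  proof -
    have "j2 y = j1 (f y)" if "y \<in> bd W2" for y
      using X(6)[of "f y" y] that f1[OF that] W1.bd_subset W2.bd_subset by force
    then have "j2 ` bd W2 = j1 ` f ` bd W2" by (simp add: image_image cong: image_cong)
    then show ?thesis using fbij by (simp add: bij_betw_def)
  qed
  have j2f: "j2 y = j1 (f y)" if "y \<in> bd W2" for y
    using X(6)[of "f y" y] that f1[OF that] W1.bd_subset W2.bd_subset by force
  define h :: "nat \<Rightarrow> 'w \<Rightarrow> complex" where
    "h k = (if k = 0 then (\<lambda>y. z1 (f y)) else if k = 1 then (\<lambda>y. P1 (f y)) else if k = 2 then z2 else P2)" for k
  have cf: "continuous_map W2.bdW (mtop W1) f" using smooth_map_on_continuous[OF sf] .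
  have c1: "continuous_map (mtop W1) euclidean z1" "continuous_map (mtop W1) euclidean P1"
    using smooth_map_on_continuous[OF W1.smooth_z] smooth_map_on_continuous[OF W1.smooth_P]
    by (simp_all add: subtopology_topspace)
  have c2: "continuous_map (mtop W2) euclidean z2" "continuous_map (mtop W2) euclidean P2"
    using smooth_map_on_continuous[OF W2.smooth_z] smooth_map_on_continuous[OF W2.smooth_P]
    by (simp_all add: subtopology_topspace)
  have ch: "continuous_map W2.bdW euclidean (h k)" for k
    using continuous_map_compose[OF cf c1(1)] continuous_map_compose[OF cf c1(2)]
      continuous_map_from_subtopology[OF c2(1)] continuous_map_from_subtopology[OF c2(2)]
    by (simp add: h_def comp_def)
  have nh: "norm (h k w) = 1" if "w \<in> bd W2" for k w
  proof -
    have "f w \<in> pts W1" "w \<in> pts W2" using f1[OF that] W1.bd_subset that W2.bd_subset by blast+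
    then show ?thesis using W1.norm_z W1.norm_P W2.norm_z W2.norm_P by (simp add: h_def)
  qed
  have "\<exists>l (c :: nat \<Rightarrow> int) u. l \<in> {..<4} \<and> c l \<noteq> 0 \<and> continuous_map W2.bdW euclideanreal u \<and>
      (\<forall>w\<in>bd W2. (\<Prod>k\<in>{..<4}. h k w powi c k) = cis (u w))"
    by (rule W2.null_combination[where h = h, OF finite_lessThan[of 4] _ ch nh]) (simp, assumption, intro exI conjI ballI)
  then obtain l and c :: "nat \<Rightarrow> int" and u where c: "l \<in> {..<4}" "c l \<noteq> 0" "continuous_map W2.bdW euclideanreal u"
    "\<And>w. w \<in> bd W2 \<Longrightarrow> (\<Prod>k\<in>{..<4}. h k w powi c k) = cis (u w)"
    by blast
  have eq: "z1 (f y) powi c 0 * P1 (f y) powi c 1 * z2 y powi c 2 * P2 y powi c 3 = cis (u y)" if "y \<in> bd W2" for y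
  proof -
    have "{..<4::nat} = {0, 1, 2, 3}" by auto
    then show ?thesis using c(4)[OF that] by (simp add: h_def mult.assoc)
  qed
  have c01: "c 0 \<noteq> 0 \<or> c 1 \<noteq> 0"
  proof (rule ccontr)
    assume n: "\<not> (c 0 \<noteq> 0 \<or> c 1 \<noteq> 0)"
    have "l = 0 \<or> l = 1 \<or> l = 2 \<or> l = 3" using c(1) by auto
    then have "c 2 \<noteq> 0 \<or> c 3 \<noteq> 0" using n c(2) by auto
    then show False
    proof (rule W2.not_null[OF _ c(3)])
      show "z2 w powi c 2 * P2 w powi c 3 = cis (u w)" if "w \<in> bd W2" for w using eq[OF that] n by simp
    qed
  qed
  have c23: "- c 2 \<noteq> 0 \<or> - c 3 \<noteq> 0"
  proof (rule ccontr)
    assume n: "\<not> (- c 2 \<noteq> 0 \<or> - c 3 \<noteq> 0)"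
    let ?f' = "inv_into (bd W2) f"
    have f': "?f' w \<in> bd W2" "f (?f' w) = w" if "w \<in> bd W1" for w
      using fbij that by (auto simp: bij_betw_def inv_into_into f_inv_into_f)
    have "continuous_map W1.bdW W2.bdW ?f'"
      using smooth_map_on_continuous[OF sf'] f'(1) by (auto simp: continuous_map_in_subtopology)
    from continuous_map_compose[OF this c(3)]
    have "continuous_map W1.bdW euclideanreal (\<lambda>w. u (?f' w))" by (simp add: comp_def)
    then show False
    proof (rule W1.not_null[OF c01])
      show "z1 w powi c 0 * P1 w powi c 1 = cis (u (?f' w))" if "w \<in> bd W1" for w
        using eq[OF f'(1)[OF that]] f'(2)[OF that] n by simp
    qed
  qed
  define g1 where "g1 x = z1 (i1 x) powi c 0 * P1 (i1 x) powi c 1" for x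
  \<comment> \<open>The factors from the second piece move to the other side of the relation, which
    turns their exponents negative.\<close>
  define g2 where "g2 x = z2 (i2 x) powi (- c 2) * P2 (i2 x) powi (- c 3)" for x
  have i1: "i1 x \<in> pts W1" if "x \<in> j1 ` pts W1" for x using ij1 that by auto
  have i2: "i2 x \<in> pts W2" if "x \<in> j2 ` pts W2" for x using ij2 that by auto
  have "glued X (j1 ` pts W1) (j2 ` pts W2) (j2 ` bd W2) g1 g2 (\<lambda>x. u (i2 x))"
  proof
    show "closedin (mtop X) (j1 ` pts W1)" "closedin (mtop X) (j2 ` pts W2)"
      using compactin_imp_closedin[OF X.Hausdorff_X] compA by blast+
    show "j1 ` pts W1 \<union> j2 ` pts W2 = pts X" using X(5) by simp
    show "j1 ` pts W1 \<inter> j2 ` pts W2 = j2 ` bd W2"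
    proof (intro equalityI subsetI)
      fix x assume "x \<in> j1 ` pts W1 \<inter> j2 ` pts W2"
      then obtain w y where "w \<in> pts W1" "y \<in> pts W2" "x = j1 w" "x = j2 y" by blast
      then show "x \<in> j2 ` bd W2" using X(6)[of w y] by blast
    next
      fix x assume "x \<in> j2 ` bd W2"
      then show "x \<in> j1 ` pts W1 \<inter> j2 ` pts W2" using T1 W1.bd_subset W2.bd_subset by blast
    qed
    show "\<exists>G r. openin (mtop X) G \<and> x \<in> G \<and> smooth_map_on X G euclid (r :: 'x \<Rightarrow> real) \<and>
      (\<forall>y\<in>G. (y \<in> j1 ` pts W1 \<longleftrightarrow> r y \<le> 0) \<and> (y \<in> j2 ` bd W2 \<longleftrightarrow> r y = 0) \<and>
        (\<forall>U \<phi>. (U, \<phi>) \<in> atlas X \<longrightarrow> y \<in> U \<longrightarrow> (\<exists>v. X.cder r U \<phi> y v \<noteq> 0)))" if "x \<in> j2 ` bd W2" for x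
      using W1.embedded_patch[OF cX dim X(3), of x] that unfolding T1 by blast
    show "norm (g1 x) = 1" if "x \<in> j1 ` pts W1" for x
      using W1.norm_z[OF i1[OF that]] W1.norm_P[OF i1[OF that]] by (simp add: g1_def norm_mult norm_power_int)
    show "norm (g2 x) = 1" if "x \<in> j2 ` pts W2" for x
      using W2.norm_z[OF i2[OF that]] W2.norm_P[OF i2[OF that]] by (simp add: g2_def norm_mult norm_power_int)
    have s1: "smooth_map_on X (j1 ` pts W1) euclid (\<lambda>x. z1 (i1 x))" "smooth_map_on X (j1 ` pts W1) euclid (\<lambda>x. P1 (i1 x))"
      by (rule smooth_map_on_compose[OF j1(3) W1.smooth_z i1 X.pX W1.premfd_W], assumption)
         (rule smooth_map_on_compose[OF j1(3) W1.smooth_P i1 X.pX W1.premfd_W])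
    have s2: "smooth_map_on X (j2 ` pts W2) euclid (\<lambda>x. z2 (i2 x))" "smooth_map_on X (j2 ` pts W2) euclid (\<lambda>x. P2 (i2 x))"
      by (rule smooth_map_on_compose[OF j2(3) W2.smooth_z i2 X.pX W2.premfd_W], assumption)
         (rule smooth_map_on_compose[OF j2(3) W2.smooth_P i2 X.pX W2.premfd_W])
    show "smooth_map_on X (j1 ` pts W1) euclid g1"
      unfolding g1_def
      by (rule smooth_map_on_mult[OF unit_powi_smooth[OF s1(1) W1.norm_z[OF i1] X.pX]
            unit_powi_smooth[OF s1(2) W1.norm_P[OF i1] X.pX] X.pX])
    show "smooth_map_on X (j2 ` pts W2) euclid g2"
      unfolding g2_def
      by (rule smooth_map_on_mult[OF unit_powi_smooth[OF s2(1) W2.norm_z[OF i2] X.pX]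
            unit_powi_smooth[OF s2(2) W2.norm_P[OF i2] X.pX] X.pX])
    show "\<exists>\<gamma> c. c \<noteq> (0::real) \<and> smooth_map_on euclid UNIV X \<gamma> \<and> \<gamma> (0::real) = x \<and>
        (\<forall>s. \<gamma> s \<in> j1 ` pts W1) \<and> (x \<in> j2 ` bd W2 \<longrightarrow> (\<forall>s. \<gamma> s \<in> j2 ` bd W2)) \<and> (\<forall>s. g1 (\<gamma> s) = g1 x * cis (c * s))"
      if "x \<in> j1 ` pts W1" for x
      unfolding T1 by (rule W1.embedded_curve[OF j1(2,1) c01 that]) (simp add: g1_def ij1)
    show "\<exists>\<gamma> c. c \<noteq> (0::real) \<and> smooth_map_on euclid UNIV X \<gamma> \<and> \<gamma> (0::real) = x \<and>
        (\<forall>s. \<gamma> s \<in> j2 ` pts W2) \<and> (x \<in> j2 ` bd W2 \<longrightarrow> (\<forall>s. \<gamma> s \<in> j2 ` bd W2)) \<and> (\<forall>s. g2 (\<gamma> s) = g2 x * cis (c * s))"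
      if "x \<in> j2 ` pts W2" for x
      by (rule W2.embedded_curve[OF j2(2,1) c23 that]) (simp add: g2_def ij2)
    have "continuous_map (subtopology (mtop X) (j2 ` bd W2)) W2.bdW i2"
    proof -
      have "continuous_map (subtopology (mtop X) (j2 ` bd W2)) (mtop W2) i2"
        by (rule continuous_map_from_subtopology_mono[OF smooth_map_on_continuous[OF j2(3)]]) (use W2.bd_subset in blast)
      then show ?thesis using ij2 W2.bd_subset by (auto simp: continuous_map_in_subtopology)
    qed
    from continuous_map_compose[OF this c(3)]
    show "continuous_map (subtopology (mtop X) (j2 ` bd W2)) euclideanreal (\<lambda>x. u (i2 x))" by (simp add: comp_def)
    show "g1 x = g2 x * cis (u (i2 x))" if x: "x \<in> j2 ` bd W2" for x
    proof -
      obtain y where y: "y \<in> bd W2" "x = j2 y" using x by blast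
      have pts: "y \<in> pts W2" "f y \<in> pts W1" using y(1) f1 W1.bd_subset W2.bd_subset by blast+
      have i: "i2 x = y" "i1 x = f y" using ij2[OF pts(1)] ij1[OF pts(2)] j2f[OF y(1)] y(2) by auto
      have nz: "z2 y \<noteq> 0" "P2 y \<noteq> 0" using W2.norm_z[OF pts(1)] W2.norm_P[OF pts(1)] by auto
      show ?thesis
        unfolding g1_def g2_def i eq[OF y(1), symmetric]
        using nz by (simp add: power_int_minus field_simps)
    qed
  qed
  then interpret G: glued X "j1 ` pts W1" "j2 ` pts W2" "j2 ` bd W2" g1 g2 "\<lambda>x. u (i2 x)" .
  have "pts X \<noteq> {}" using X(5) W1.bd_nonempty W1.bd_subset by blast
  then show thesis
    using G.submersion_to_circle that cX by metis
qed

section \<open>Submersions onto the circle are fiber bundles\<close>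

text \<open>The inverse function theorem applies to \<open>(z, t) \<mapsto> (z, G (z, t))\<close>,
  whose derivative is injective since \<open>G\<close> has nonzero derivative in \<open>t\<close>.
  Uniqueness of the zero within \<open>O'\<close> identifies \<open>T\<close> with the last
  component of the inverse at \<open>(z, 0)\<close>, so that continuity of \<open>T\<close> need not
  be known beforehand.\<close>

lemma csmooth_implicit:
  fixes G :: "'b::euclidean_space \<times> real \<Rightarrow> real"
  assumes O: "open O'" "csmooth O' G" and S: "open S"
    and T: "\<And>z. z \<in> S \<Longrightarrow> (z, T z) \<in> O'" "\<And>z. z \<in> S \<Longrightarrow> G (z, T z) = 0"
    and uniq: "\<And>z t. (z, t) \<in> O' \<Longrightarrow> G (z, t) = 0 \<Longrightarrow> t = T z"
    and nz: "\<And>z. z \<in> S \<Longrightarrow> frechet_derivative G (at (z, T z)) (0, 1) \<noteq> 0"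
  shows "csmooth S T"
proof (rule csmooth_local)
  fix z0 assume z0: "z0 \<in> S"
  define H where "H w = (fst w, G w)" for w
  let ?D = "frechet_derivative G (at (z0, T z0))"
  have sH: "csmooth O' H" unfolding H_def
    by (intro csmooth_Pair O csmooth_linear bounded_linear_fst)
  have dG: "(G has_derivative ?D) (at (z0, T z0))" by (rule csmooth_has_derivative[OF O(2) T(1)[OF z0]])
  then have "(H has_derivative (\<lambda>h. (fst h, ?D h))) (at (z0, T z0))"
    unfolding H_def by (intro derivative_eq_intros) auto
  then have fd: "frechet_derivative H (at (z0, T z0)) = (\<lambda>h. (fst h, ?D h))" by (rule frechet_derivative_at[symmetric])
  have lin: "linear ?D" using dG by (rule has_derivative_linear)
  have "h = 0" if h: "fst h = 0" "?D h = 0" for h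
  proof -
    have "h = snd h *\<^sub>R (0, 1)" using h(1) by (simp add: prod_eq_iff)
    then have "?D h = snd h *\<^sub>R ?D (0, 1)" using linear_scale[OF lin] by metis
    then show ?thesis using h nz[OF z0] by (simp add: prod_eq_iff)
  qed
  moreover have "linear (\<lambda>h. (fst h, ?D h))" by (rule linearI) (simp_all add: linear_add[OF lin] linear_scale[OF lin])
  ultimately have inj: "inj (frechet_derivative H (at (z0, T z0)))"
    unfolding fd by (auto simp: linear_injective_0 prod_eq_iff)
  show "\<exists>V. open V \<and> z0 \<in> V \<and> csmooth (S \<inter> V) T"
  proof (rule csmooth_inverse_function[OF refl O(1) sH T(1)[OF z0] inj])
    fix U V g assume *: "open U" "(z0, T z0) \<in> U" "U \<subseteq> O'" "open V" "homeomorphism U V H g" "csmooth V g"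
    have o: "open {z. (z, 0::real) \<in> V}"
      using open_vimage[OF *(4), of "\<lambda>z. (z, 0::real)"] by (simp add: vimage_def continuous_on_Pair)
    have "H (z0, T z0) \<in> V" using *(2,5) by (auto simp: homeomorphism_def)
    then have "z0 \<in> {z. (z, 0) \<in> V}" using T(2)[OF z0] by (simp add: H_def)
    moreover have "csmooth (S \<inter> {z. (z, 0::real) \<in> V}) (\<lambda>z. snd (g (z, 0)))"
    proof (rule csmooth_linear_compose[OF bounded_linear_snd])
      show "open (S \<inter> {z. (z, 0::real) \<in> V})" using S o by blast
      then show "csmooth (S \<inter> {z. (z, 0::real) \<in> V}) (\<lambda>z. g (z, 0))"
        by (intro csmooth_compose[OF _ *(4) _ *(6)] csmooth_Pair csmooth_ident csmooth_const) auto
    qed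
    then have "csmooth (S \<inter> {z. (z, 0::real) \<in> V}) T"
    proof (rule csmooth_cong[rotated 2])
      show "open (S \<inter> {z. (z, 0::real) \<in> V})" using S o by blast
      fix z assume z: "z \<in> S \<inter> {z. (z, 0::real) \<in> V}"
      then have V: "(z, 0) \<in> V" by blast
      have "H (g (z, 0)) = (z, 0)" using *(5) V by (rule homeomorphism_apply2)
      moreover have "g (z, 0) \<in> O'" using homeomorphism_image2[OF *(5)] V *(3) by blast
      moreover obtain a b where "g (z, 0) = (a, b)" by (cases "g (z, 0)")
      ultimately show "snd (g (z, 0)) = T z" using uniq[of a b] by (auto simp: H_def)
    qed
    ultimately show ?thesis using o by blast
  qed
qed

section \<open>Pushing points along a coordinate axis\<close>

lemma line_lipschitz:
  fixes \<sigma> :: "'e::euclidean_space \<Rightarrow> real"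
  assumes \<sigma>: "csmooth (ball 0 R) \<sigma>" and C: "C < R"
    and B: "\<And>y. norm y \<le> C \<Longrightarrow> \<bar>frechet_derivative \<sigma> (at y) e\<bar> \<le> B"
    and y: "norm (y + a *\<^sub>R e) \<le> C" "norm (y + b *\<^sub>R e) \<le> C"
  shows "\<bar>\<sigma> (y + a *\<^sub>R e) - \<sigma> (y + b *\<^sub>R e)\<bar> \<le> B * \<bar>a - b\<bar>"
proof -
  have seg: "norm (y + t *\<^sub>R e) \<le> C" if "t \<in> closed_segment a b" for t
  proof -
    obtain u where u: "0 \<le> u" "u \<le> 1" "t = (1 - u) * a + u * b" using \<open>t \<in> closed_segment a b\<close> by (auto simp: in_segment)
    have "y + t *\<^sub>R e = (1 - u) *\<^sub>R (y + a *\<^sub>R e) + u *\<^sub>R (y + b *\<^sub>R e)" unfolding u(3) by (simp add: algebra_simps)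
    also have "norm \<dots> \<le> (1 - u) * norm (y + a *\<^sub>R e) + u * norm (y + b *\<^sub>R e)"
      by (rule order_trans[OF norm_triangle_ineq]) (use u in simp)
    also have "\<dots> \<le> C" by (rule convex_bound_le) (use u y in auto)
    finally show ?thesis .
  qed
  have d: "((\<lambda>t. \<sigma> (y + t *\<^sub>R e)) has_real_derivative frechet_derivative \<sigma> (at (y + t *\<^sub>R e)) e) (at t)"
    if t: "t \<in> closed_segment a b" for t
  proof -
    have "(\<sigma> has_derivative frechet_derivative \<sigma> (at (y + t *\<^sub>R e))) (at (y + t *\<^sub>R e))"
      by (rule csmooth_has_derivative[OF \<sigma>]) (use seg[OF t] C in simp)
    moreover have "((\<lambda>t. y + t *\<^sub>R e) has_vector_derivative e) (at t)"
      unfolding has_vector_derivative_def by (auto intro!: derivative_eq_intros)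
    ultimately show ?thesis
      unfolding has_real_derivative_iff_has_vector_derivative by (rule vector_derivative_chain[rotated])
  qed
  have "norm (\<sigma> (y + a *\<^sub>R e) - \<sigma> (y + b *\<^sub>R e)) \<le> B * norm (a - b)"
  proof (rule field_differentiable_bound[of "closed_segment a b"])
    show "((\<lambda>t. \<sigma> (y + t *\<^sub>R e)) has_real_derivative frechet_derivative \<sigma> (at (y + t *\<^sub>R e)) e)
        (at t within closed_segment a b)" if "t \<in> closed_segment a b" for t
      using d[OF that] by (rule DERIV_subset) simp
  qed (use B seg in auto)
  then show ?thesis by simp
qed

lemma contraction_unique:
  fixes t :: real
  assumes "t = s * c" "\<bar>c\<bar> \<le> B * \<bar>t\<bar>" "\<bar>s\<bar> * B < 1"
  shows "t = 0"
proof (rule ccontr)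
  assume "t \<noteq> 0"
  have "\<bar>t\<bar> = \<bar>s\<bar> * \<bar>c\<bar>" using assms(1) by (simp add: abs_mult)
  also have "\<dots> \<le> \<bar>s\<bar> * (B * \<bar>t\<bar>)" by (intro mult_left_mono assms(2)) simp
  also have "\<dots> = (\<bar>s\<bar> * B) * \<bar>t\<bar>" by simp
  also have "\<dots> < 1 * \<bar>t\<bar>" by (rule mult_strict_right_mono) (use assms(3) \<open>t \<noteq> 0\<close> in auto)
  finally show False by simp
qed

text \<open>In straightened coordinates a shift by \<open>t\<close> along \<open>e\<close>
  multiplies the circle-valued map by \<open>cis t\<close>, so the relation required of a push
  becomes the equation for \<open>T\<close>. A solution exists by the intermediate value theorem, is
  unique by contraction and smooth by the implicit function theorem. The functions agree beyond
  radius \<open>C\<close>, shifts are smaller than \<open>r\<close>, and radius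
  \<open>C + 2 * r\<close> still lies inside the ball.\<close>

lemma line_push:
  fixes \<sigma> \<sigma>' :: "'e::euclidean_space \<Rightarrow> real"
  assumes e: "norm e = 1" and r: "0 < r" "C + 2 * r < R"
    and \<sigma>: "csmooth (ball 0 R) \<sigma>" "csmooth (ball 0 R) \<sigma>'"
    and B: "\<And>y. norm y \<le> C + 2 * r \<Longrightarrow> \<bar>\<sigma> y\<bar> \<le> B" "\<And>y. norm y \<le> C + 2 * r \<Longrightarrow> \<bar>\<sigma>' y\<bar> \<le> B"
      "\<And>y. norm y \<le> C + 2 * r \<Longrightarrow> \<bar>frechet_derivative \<sigma>' (at y) e\<bar> \<le> B" "0 \<le> B"
    and eq: "\<And>y. C < norm y \<Longrightarrow> norm y < R \<Longrightarrow> \<sigma>' y = \<sigma> y"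
    and \<epsilon>: "\<epsilon> * (2 * B + 1) \<le> 1" "\<epsilon> * (2 * B + 1) \<le> r"
  obtains T :: "'e \<times> real \<Rightarrow> real" where "csmooth (ball 0 (C + r) \<times> {-\<epsilon><..<\<epsilon>}) T"
    "\<And>y s. norm y < C + r \<Longrightarrow> \<bar>s\<bar> < \<epsilon> \<Longrightarrow> \<bar>T (y, s)\<bar> < r"
    "\<And>y s. norm y < C + r \<Longrightarrow> \<bar>s\<bar> < \<epsilon> \<Longrightarrow> T (y, s) = s * (\<sigma>' (y + T (y, s) *\<^sub>R e) - \<sigma> y)"
    "\<And>y s. C < norm y \<Longrightarrow> norm y < C + r \<Longrightarrow> \<bar>s\<bar> < \<epsilon> \<Longrightarrow> T (y, s) = 0"
proof -
  \<comment> \<open>The first bound makes the equation for the shift a contraction. The second keeps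
    the shift below \<open>r\<close>, because \<open>2 * B\<close> bounds the difference of the two
    functions.\<close>
  have sB: "\<bar>s\<bar> * B < 1" "\<bar>s\<bar> * (2 * B) < r" if "\<bar>s\<bar> < \<epsilon>" for s
  proof -
    have "\<bar>s\<bar> * (2 * B + 1) < \<epsilon> * (2 * B + 1)" using that B(4) by (intro mult_strict_right_mono) auto
    moreover have "\<bar>s\<bar> * (2 * B + 1) = 2 * (\<bar>s\<bar> * B) + \<bar>s\<bar>" by (simp add: algebra_simps)
    moreover have "\<bar>s\<bar> * B \<ge> 0" using B(4) by simp
    ultimately show "\<bar>s\<bar> * B < 1" "\<bar>s\<bar> * (2 * B) < r" using \<epsilon> by linarith+
  qed
  have nb: "norm (y + t *\<^sub>R e) \<le> C + 2 * r" if "norm y < C + r" "\<bar>t\<bar> \<le> r" for y t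
    using norm_triangle_ineq[of y "t *\<^sub>R e"] that e by simp
  define O' where "O' = (ball (0::'e) (C + r) \<times> {-\<epsilon><..<\<epsilon>}) \<times> {-r<..<r}"
  define G where "G w = snd w - snd (fst w) * (\<sigma>' (fst (fst w) + snd w *\<^sub>R e) - \<sigma> (fst (fst w)))" for w :: "('e \<times> real) \<times> real"
  have uniq: "t = t'" if "((y, s), t) \<in> O'" "((y, s), t') \<in> O'" "G ((y, s), t) = 0" "G ((y, s), t') = 0" for y :: 'e and s t t'
  proof -
    have o: "norm y < C + r" "\<bar>s\<bar> < \<epsilon>" "\<bar>t\<bar> \<le> r" "\<bar>t'\<bar> \<le> r" using that(1,2) by (auto simp: O'_def)
    have "t - t' = s * (\<sigma>' (y + t *\<^sub>R e) - \<sigma>' (y + t' *\<^sub>R e))" using that(3,4) by (simp add: G_def algebra_simps)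
    then have "t - t' = 0"
      by (rule contraction_unique[OF _ line_lipschitz[OF \<sigma>(2) r(2) B(3) nb nb] sB(1)]) (use o in auto)
    then show ?thesis by simp
  qed
  have ex: "\<exists>t. \<bar>t\<bar> < r \<and> G ((y, s), t) = 0" if y: "norm y < C + r" and s: "\<bar>s\<bar> < \<epsilon>" for y s
  proof -
    have b: "\<bar>s * (\<sigma>' (y + t *\<^sub>R e) - \<sigma> y)\<bar> < r" if "\<bar>t\<bar> \<le> r" for t
    proof -
      have "\<bar>\<sigma>' (y + t *\<^sub>R e)\<bar> \<le> B" by (rule B(2)[OF nb[OF y that]])
      moreover have "\<bar>\<sigma> y\<bar> \<le> B" by (rule B(1)) (use y r in simp)
      ultimately have "\<bar>\<sigma>' (y + t *\<^sub>R e) - \<sigma> y\<bar> \<le> 2 * B" by linarith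
      then have "\<bar>s\<bar> * \<bar>\<sigma>' (y + t *\<^sub>R e) - \<sigma> y\<bar> \<le> \<bar>s\<bar> * (2 * B)" by (intro mult_left_mono) auto
      then show ?thesis using sB(2)[OF s] by (simp add: abs_mult)
    qed
    have "continuous_on {-r..r} (\<lambda>t. \<sigma>' (y + t *\<^sub>R e))"
    proof (rule continuous_on_compose2[OF csmooth_continuous[OF \<sigma>(2)]])
      show "continuous_on {-r..r} (\<lambda>t. y + t *\<^sub>R e)" by (intro continuous_intros)
      have "norm (y + t *\<^sub>R e) < R" if "t \<in> {-r..r}" for t
        using nb[OF y, of t] that r(2) by (simp add: abs_le_iff)
      then show "(\<lambda>t. y + t *\<^sub>R e) ` {-r..r} \<subseteq> ball 0 R" by auto
    qed
    then have c: "continuous_on {-r..r} (\<lambda>t. G ((y, s), t))" unfolding G_def by (auto intro!: continuous_intros)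
    have "G ((y, s), -r) \<le> 0" "0 \<le> G ((y, s), r)" using b[of "-r"] b[of r] r by (auto simp: G_def abs_less_iff)
    then obtain t where t: "-r \<le> t" "t \<le> r" "G ((y, s), t) = 0" using IVT'[of "\<lambda>t. G ((y, s), t)" "-r" 0 r, OF _ _ _ c] r by auto
    then have "\<bar>t\<bar> < r" using b[of t] by (simp add: G_def abs_le_iff)
    then show ?thesis using t by blast
  qed
  define T where "T z = (SOME t. \<bar>t\<bar> < r \<and> G (z, t) = 0)" for z
  have T: "\<bar>T (y, s)\<bar> < r" "G ((y, s), T (y, s)) = 0" if "norm y < C + r" "\<bar>s\<bar> < \<epsilon>" for y s
    using someI_ex[OF ex[OF that]] by (simp_all add: T_def)
  have TO: "((y, s), T (y, s)) \<in> O'" if "norm y < C + r" "\<bar>s\<bar> < \<epsilon>" for y s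
    using T(1)[OF that] that by (auto simp: O'_def abs_less_iff)
  show thesis
  proof
    have oO: "open O'" unfolding O'_def by (intro open_Times) auto
    have ob: "open (ball (0::'e) R)" by simp
    have l1: "csmooth O' (\<lambda>w. fst (fst w))" "csmooth O' (\<lambda>w. snd (fst w))" "csmooth O' (\<lambda>w. snd w)"
      by (intro csmooth_linear oO bounded_linear_compose[OF bounded_linear_fst bounded_linear_fst]
          bounded_linear_compose[OF bounded_linear_snd bounded_linear_fst] bounded_linear_snd)+
    have l2: "csmooth O' (\<lambda>w. fst (fst w) + snd w *\<^sub>R e)"
      by (intro csmooth_add oO l1 csmooth_bilinear[OF bounded_bilinear_scaleR] csmooth_const)
    have im: "(\<lambda>w. fst (fst w) + snd w *\<^sub>R e) ` O' \<subseteq> ball 0 R" "(\<lambda>w. fst (fst w)) ` O' \<subseteq> ball 0 R"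
    proof -
      have "norm (y + t *\<^sub>R e) < R" if "norm y < C + r" "\<bar>t\<bar> < r" for y t
        using nb[of y t] that r by auto
      moreover have "norm y < R" if "norm y < C + r" for y using that r by auto
      ultimately show "(\<lambda>w. fst (fst w) + snd w *\<^sub>R e) ` O' \<subseteq> ball 0 R" "(\<lambda>w. fst (fst w)) ` O' \<subseteq> ball 0 R"
        by (auto simp: O'_def abs_less_iff)
    qed
    have sG: "csmooth O' G" unfolding G_def
      by (intro csmooth_diff csmooth_mult oO l1 csmooth_compose[OF oO ob l2 \<sigma>(2) im(1)] csmooth_compose[OF oO ob l1(1) \<sigma>(1) im(2)])
    show "csmooth (ball 0 (C + r) \<times> {-\<epsilon><..<\<epsilon>}) T"
    proof (rule csmooth_implicit[OF oO sG])
      show "open (ball (0::'e) (C + r) \<times> {-\<epsilon><..<\<epsilon>})" by (intro open_Times) auto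
      fix z assume "z \<in> ball (0::'e) (C + r) \<times> {-\<epsilon><..<\<epsilon>}"
      then obtain y s where z: "z = (y, s)" "norm y < C + r" "\<bar>s\<bar> < \<epsilon>" by (auto simp: abs_less_iff)
      show "(z, T z) \<in> O'" "G (z, T z) = 0" using TO[OF z(2,3)] T(2)[OF z(2,3)] z(1) by simp_all
      let ?y = "y + T (y, s) *\<^sub>R e"
      have ny: "norm ?y \<le> C + 2 * r" using nb[OF z(2)] T(1)[OF z(2,3)] by simp
      have d: "(\<sigma>' has_derivative frechet_derivative \<sigma>' (at ?y)) (at ?y)"
        by (rule csmooth_has_derivative[OF \<sigma>(2)]) (use ny r in simp)
      have "((\<lambda>t. y + t *\<^sub>R e) has_vector_derivative e) (at (T (y, s)))"
        unfolding has_vector_derivative_def by (auto intro!: derivative_eq_intros)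
      from vector_derivative_chain[OF this d]
      have "((\<lambda>t. \<sigma>' (y + t *\<^sub>R e)) has_real_derivative frechet_derivative \<sigma>' (at ?y) e) (at (T (y, s)))"
        unfolding has_real_derivative_iff_has_vector_derivative .
      then have d1: "((\<lambda>t. G ((y, s), t)) has_real_derivative 1 - s * frechet_derivative \<sigma>' (at ?y) e) (at (T (y, s)))"
        unfolding G_def by (auto intro!: derivative_eq_intros)
      have "((\<lambda>t. ((y, s), t)) has_vector_derivative ((0, 0), 1)) (at (T (y, s)))"
        unfolding has_vector_derivative_def by (auto intro!: derivative_eq_intros simp: zero_prod_def)
      from vector_derivative_chain[OF this csmooth_has_derivative[OF sG TO[OF z(2,3)]]]
      have "((\<lambda>t. G ((y, s), t)) has_real_derivative frechet_derivative G (at ((y, s), T (y, s))) ((0, 0), 1)) (at (T (y, s)))"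
        unfolding has_real_derivative_iff_has_vector_derivative .
      then have "frechet_derivative G (at ((y, s), T (y, s))) ((0, 0), 1) = 1 - s * frechet_derivative \<sigma>' (at ?y) e"
        by (rule DERIV_unique[OF _ d1])
      moreover have "\<bar>s * frechet_derivative \<sigma>' (at ?y) e\<bar> < 1"
      proof -
        have "\<bar>s\<bar> * \<bar>frechet_derivative \<sigma>' (at ?y) e\<bar> \<le> \<bar>s\<bar> * B" by (intro mult_left_mono B(3) ny) simp
        then show ?thesis using sB(1)[OF z(3)] by (simp add: abs_mult)
      qed
      ultimately show "frechet_derivative G (at (z, T z)) (0, 1) \<noteq> 0" by (auto simp: z(1) zero_prod_def)
    next
      fix z t assume z: "(z, t) \<in> O'" "G (z, t) = 0"
      obtain y s where ys: "z = (y, s)" by (cases z)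
      then have "norm y < C + r" "\<bar>s\<bar> < \<epsilon>" using z by (auto simp: O'_def)
      then show "t = T z" using uniq[of y s t "T z"] z TO T ys by blast
    qed
    fix y :: 'e and s assume y: "norm y < C + r" and s: "\<bar>s\<bar> < \<epsilon>"
    show "\<bar>T (y, s)\<bar> < r" by (rule T(1)[OF y s])
    show "T (y, s) = s * (\<sigma>' (y + T (y, s) *\<^sub>R e) - \<sigma> y)" using T(2)[OF y s] by (simp add: G_def)
    assume "C < norm y"
    then have "\<sigma>' y = \<sigma> y" using eq y r by simp
    then have "G ((y, s), 0) = 0" by (simp add: G_def)
    moreover have "((y, s), 0) \<in> O'" using y s r by (auto simp: O'_def abs_less_iff)
    ultimately show "T (y, s) = 0" using uniq[OF TO[OF y s] _ T(2)[OF y s]] by blast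
  qed
qed

section \<open>Straightened charts and pushes on the manifold\<close>

context cmfd
begin

text \<open>The local normal form of a submersion to the circle: in suitable coordinates its angle
  is a linear function, up to a constant. The range is a full ball, so that shifts along
  \<open>e\<close> can be controlled by norms alone.\<close>

definition straight where
  "straight (p :: 'x \<Rightarrow> complex) G (\<psi> :: 'x \<Rightarrow> 'e) g e R w \<longleftrightarrow> openin (mtop X) G \<and> R > 0 \<and> norm e = 1 \<and>
     smooth_map_on X G euclid \<psi> \<and> smooth_map_on euclid (ball 0 R) X g \<and>
     (\<forall>x\<in>G. norm (\<psi> x) < R \<and> g (\<psi> x) = x \<and> p x = w * cis (\<psi> x \<bullet> e)) \<and>
     (\<forall>y. norm y < R \<longrightarrow> g y \<in> G \<and> \<psi> (g y) = y)"

text \<open>With \<open>\<theta>\<close> a local angle of \<open>p\<close>, the component of the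
  chart coordinate along \<open>e\<close> is replaced by \<open>\<theta>\<close>. Here
  \<open>e\<close> is the normalized direction in which the derivative of \<open>\<theta>\<close> is
  nonzero, which makes this change of coordinates invertible near the point.\<close>

lemma straight_chart:
  assumes p: "smooth_map_on X (pts X) euclid p" "\<And>x. x \<in> pts X \<Longrightarrow> norm (p x) = 1"
    and U: "(U, \<phi>) \<in> atlas X" "x0 \<in> U" "cder p U \<phi> x0 v \<noteq> 0"
  shows "\<exists>G \<psi> g e R w. x0 \<in> G \<and> straight p G \<psi> g e R w"
proof -
  define w where "w = p x0"
  define a where "a = \<phi> x0"
  define f where "f y = p (inv_into U \<phi> y)" for y
  have UX: "U \<subseteq> pts X" by (rule chart_subset[OF pX U(1)])
  have w: "norm w = 1" using p(2) U(2) UX by (auto simp: w_def)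
  define G1 where "G1 = {x \<in> pts X. p x \<in> {z. Re (z * cnj w) > 0}}"
  have G1: "openin (mtop X) G1" unfolding G1_def
    by (rule open_preimage[OF continuous_real[OF p(1)] open_Re_pos[OF w]])
  define Q where "Q = \<phi> ` (U \<inter> G1)"
  have oQ: "open Q" unfolding Q_def by (rule chart_img[OF U(1) G1])
  have inv: "inv_into U \<phi> (\<phi> x) = x" if "x \<in> U" for x by (rule chart_inv[OF pX U(1) that])
  have "Re (w * cnj w) = 1" using w by (simp add: complex_mult_cnj cmod_def power2_eq_square)
  then have "x0 \<in> G1" using U(2) UX by (auto simp: G1_def w_def)
  then have aQ: "a \<in> Q" using U(2) by (auto simp: Q_def a_def)
  have sf: "csmooth Q f" unfolding Q_def f_def
    by (rule chart_csmooth[OF smooth_map_on_subset[OF p(1)] G1 U(1)]) (auto simp: G1_def)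
  have fQ: "f y \<in> {z. Re (z * cnj w) > 0}" "norm (f y) = 1" if "y \<in> Q" for y
    using that inv p(2) by (auto simp: Q_def f_def G1_def)
  define \<theta> where "\<theta> y = angle_from w (f y)" for y
  have s\<theta>: "csmooth Q \<theta>" unfolding \<theta>_def
    by (rule csmooth_compose[OF oQ open_Re_pos[OF w] sf csmooth_angle_from[OF w]]) (use fQ in auto)
  have f\<theta>: "f y = w * cis (\<theta> y)" if "y \<in> Q" for y
    unfolding \<theta>_def by (rule cis_angle_from[OF w fQ(2)[OF that], symmetric])
  have \<theta>a: "\<theta> a = 0"
    using angle_from_cis[OF w, of 0] inv[OF U(2)] by (simp add: \<theta>_def f_def a_def w_def)
  let ?T = "frechet_derivative \<theta> (at a)"
  have d\<theta>: "(\<theta> has_derivative ?T) (at a)" by (rule csmooth_has_derivative[OF s\<theta> aQ])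
  have linT: "linear ?T" using d\<theta> by (rule has_derivative_linear)
  have Tv: "?T v \<noteq> 0"
  proof
    assume 0: "?T v = 0"
    let ?C = "frechet_derivative (\<lambda>t. w * cis t) (at (\<theta> a))"
    have dC: "((\<lambda>t. w * cis t) has_derivative ?C) (at (\<theta> a))"
      by (rule csmooth_has_derivative[OF csmooth_cis_from[OF w] UNIV_I])
    have "((\<lambda>y. w * cis (\<theta> y)) has_derivative (\<lambda>h. ?C (?T h))) (at a)"
      by (rule has_derivative_compose[OF d\<theta> dC])
    then have "(f has_derivative (\<lambda>h. ?C (?T h))) (at a)"
      by (rule has_derivative_transform_within_open[OF _ oQ aQ]) (simp add: f\<theta>)
    then have "cder p U \<phi> x0 = (\<lambda>h. ?C (?T h))" unfolding f_def a_def by (rule cder_eq)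
    then have "cder p U \<phi> x0 v = 0" using 0 linear_0[OF has_derivative_linear[OF dC]] by simp
    then show False using U(3) by blast
  qed
  have "v \<noteq> 0" using Tv linear_0[OF linT] by auto
  define e where "e = v /\<^sub>R norm v"
  have e: "norm e = 1" using \<open>v \<noteq> 0\<close> by (simp add: e_def)
  have Te: "?T e \<noteq> 0" using Tv \<open>v \<noteq> 0\<close> by (simp add: e_def linear_scale[OF linT])
  have ee: "e \<bullet> e = 1" using e by (simp add: norm_eq_1)
  define H where "H y = (y - a) + (\<theta> y - (y - a) \<bullet> e) *\<^sub>R e" for y
  have sH: "csmooth Q H" unfolding H_def
    by (intro csmooth_add csmooth_diff csmooth_bilinear[OF bounded_bilinear_scaleR] csmooth_bilinear[OF bounded_bilinear_inner]
        csmooth_ident csmooth_const oQ s\<theta>)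
  have He: "H y \<bullet> e = \<theta> y" for y by (simp add: H_def inner_add_left ee)
  have Ha: "H a = 0" by (simp add: H_def \<theta>a)
  have "(H has_derivative (\<lambda>h. h + (?T h - h \<bullet> e) *\<^sub>R e)) (at a)"
    unfolding H_def by (rule derivative_eq_intros d\<theta> refl | simp)+
  then have fd: "frechet_derivative H (at a) = (\<lambda>h. h + (?T h - h \<bullet> e) *\<^sub>R e)" by (rule frechet_derivative_at[symmetric])
  have "linear (\<lambda>h. h + (?T h - h \<bullet> e) *\<^sub>R e)"
    by (rule linearI) (simp_all add: linear_add[OF linT] linear_scale[OF linT] algebra_simps)
  \<comment> \<open>A vector in the kernel is a multiple of \<open>e\<close> annihilated by
    \<open>?T\<close>, but \<open>?T\<close> is nonzero on \<open>e\<close>.\<close>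
  moreover have "h = 0" if h: "h + (?T h - h \<bullet> e) *\<^sub>R e = 0" for h
  proof -
    define c where "c = h \<bullet> e - ?T h"
    have hc: "h = c *\<^sub>R e" using h by (simp add: c_def algebra_simps add_eq_0_iff)
    have "h \<bullet> e = c" unfolding hc by (simp add: ee)
    then have "?T h = 0" by (simp add: c_def)
    then have "c = 0" using Te unfolding hc by (simp add: linear_scale[OF linT])
    then show ?thesis using hc by simp
  qed
  ultimately have inj: "inj (frechet_derivative H (at a))" unfolding fd by (subst linear_injective_0) blast+
  show ?thesis
  proof (rule csmooth_inverse_function[OF refl oQ sH aQ inj])
    fix U' V k assume *: "open U'" "a \<in> U'" "U' \<subseteq> Q" "open V" "homeomorphism U' V H k" "csmooth V k"
    have k: "k z \<in> U'" "H (k z) = z" if "z \<in> V" for z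
      using homeomorphism_image2[OF *(5)] homeomorphism_apply2[OF *(5) that] that by auto
    have Hk: "H y \<in> V" "k (H y) = y" if "y \<in> U'" for y
      using homeomorphism_image1[OF *(5)] homeomorphism_apply1[OF *(5) that] that by auto
    have "0 \<in> V" using Hk(1)[OF *(2)] Ha by simp
    then obtain R where R: "R > 0" "ball 0 R \<subseteq> V" using *(4) openE by blast
    define G where "G = {x \<in> U. \<phi> x \<in> U' \<and> norm (H (\<phi> x)) < R}"
    have "open (U' \<inter> H -` ball 0 R)"
      by (rule continuous_open_preimage[OF continuous_on_subset[OF csmooth_continuous[OF sH] *(3)] *(1) open_ball])
    then have "openin (mtop euclid) (U' \<inter> H -` ball 0 R)" by (simp add: open_openin[symmetric])
    then have "\<exists>G'. openin (mtop X) G' \<and> {x \<in> U. \<phi> x \<in> U' \<inter> H -` ball 0 R} = U \<inter> G'"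
      by (rule smooth_map_on_nbhd[OF chart_smooth[OF pX U(1)]]) blast
    moreover have "{x \<in> U. \<phi> x \<in> U' \<inter> H -` ball 0 R} = G" by (auto simp: G_def)
    ultimately have oG: "openin (mtop X) G" using chart_open[OF pX U(1)] by auto
    define \<psi> where "\<psi> x = H (\<phi> x)" for x
    define g where "g y = inv_into U \<phi> (k y)" for y
    have GU: "G \<subseteq> U" by (auto simp: G_def)
    have "smooth_map_on X G euclid \<psi>" unfolding \<psi>_def
      by (rule smooth_map_on_csmooth[OF smooth_map_on_subset[OF chart_smooth[OF pX U(1)] GU] sH oQ _ pX])
         (use *(3) in \<open>auto simp: G_def\<close>)
    moreover have kb: "k y \<in> U'" "H (k y) = y" if "norm y < R" for y using k R(2) that by auto
    have kU: "k y \<in> \<phi> ` U" if "y \<in> ball 0 R" for y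
    proof -
      have "norm y < R" using that by simp
      then have "k y \<in> Q" using kb(1) *(3) by blast
      then show ?thesis unfolding Q_def by blast
    qed
    have "smooth_map_on euclid (ball 0 R) euclid k"
      unfolding smooth_map_on_euclid smooth_on_open[OF open_ball] by (rule csmooth_subset[OF *(6) R(2)])
    then have "smooth_map_on euclid (ball 0 R) X g" unfolding g_def
      by (rule smooth_map_on_compose[OF _ chart_inverse_smooth[OF pX U(1)] _ premfd_euclid premfd_euclid])
         (rule kU)
    moreover have "norm (\<psi> x) < R \<and> g (\<psi> x) = x \<and> p x = w * cis (\<psi> x \<bullet> e)" if x: "x \<in> G" for x
    proof -
      have x: "x \<in> U" "\<phi> x \<in> U'" "norm (\<psi> x) < R" using x by (auto simp: G_def \<psi>_def)
      have "p x = w * cis (\<theta> (\<phi> x))" using f\<theta>[of "\<phi> x"] x(2) *(3) by (auto simp: f_def inv[OF x(1)])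
      then show ?thesis using x Hk inv by (simp add: \<psi>_def g_def He)
    qed
    moreover have "g y \<in> G \<and> \<psi> (g y) = y" if y: "norm y < R" for y
    proof -
      have "k y \<in> \<phi> ` U" using kb(1)[OF y] *(3) by (auto simp: Q_def)
      then obtain x where x: "x \<in> U" "k y = \<phi> x" by blast
      then have "g y = x" by (simp add: g_def inv)
      then show ?thesis using x kb[OF y] y by (auto simp: G_def \<psi>_def)
    qed
    ultimately have "straight p G \<psi> g e R w" using oG R(1) e by (simp add: straight_def)
    moreover have "x0 \<in> G" using U(2) *(2) Ha R(1) by (simp add: G_def a_def)
    ultimately show ?thesis by blast
  qed
qed

lemma straightD:
  assumes "straight p G \<psi> g e R w"
  shows "openin (mtop X) G" "R > 0" "norm e = 1" "smooth_map_on X G euclid \<psi>" "smooth_map_on euclid (ball 0 R) X g"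
    "\<And>x. x \<in> G \<Longrightarrow> norm (\<psi> x) < R" "\<And>x. x \<in> G \<Longrightarrow> g (\<psi> x) = x" "\<And>x. x \<in> G \<Longrightarrow> p x = w * cis (\<psi> x \<bullet> e)"
    "\<And>y. norm y < R \<Longrightarrow> g y \<in> G" "\<And>y. norm y < R \<Longrightarrow> \<psi> (g y) = y" "G \<subseteq> pts X"
  using assms openin_subset[of "mtop X" G] unfolding straight_def by auto

lemma straight_open:
  assumes s: "straight p G \<psi> g e R w" and Q: "open Q"
  shows "openin (mtop X) {x \<in> G. \<psi> x \<in> Q}"
proof -
  note S = straightD[OF s]
  obtain G' where "openin (mtop X) G'" "{x \<in> G. \<psi> x \<in> Q} = G \<inter> G'"
    using smooth_map_on_nbhd[OF S(4), of Q] Q by (metis mtop_euclid open_openin)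
  then show ?thesis using S(1) by auto
qed

text \<open>The shift of \<open>line_push\<close> is carried to the manifold and continued by the
  identity. Both definitions agree where the norm of \<open>\<psi> x\<close> lies strictly between
  \<open>C\<close> and \<open>C + r\<close>; all points actually moved lie in the compact image of a
  closed ball, whose complement is open.\<close>

lemma push_along:
  fixes \<sigma> \<sigma>' :: "'x \<Rightarrow> real"
  assumes s: "straight p G \<psi> g e R w" and \<sigma>: "smooth_map_on X (pts X) euclid \<sigma>" "smooth_map_on X (pts X) euclid \<sigma>'"
    and r: "0 < r" "0 < C" "C + 2 * r < R"
    and B: "\<And>y. norm y \<le> C + 2 * r \<Longrightarrow> \<bar>\<sigma> (g y)\<bar> \<le> B" "\<And>y. norm y \<le> C + 2 * r \<Longrightarrow> \<bar>\<sigma>' (g y)\<bar> \<le> B"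
      "\<And>y. norm y \<le> C + 2 * r \<Longrightarrow> \<bar>frechet_derivative (\<lambda>y. \<sigma>' (g y)) (at y) e\<bar> \<le> B" "0 \<le> B"
    and eq: "\<And>x. x \<in> G \<Longrightarrow> C < norm (\<psi> x) \<Longrightarrow> \<sigma>' x = \<sigma> x"
    and \<epsilon>: "\<epsilon> * (2 * B + 1) \<le> 1" "\<epsilon> * (2 * B + 1) \<le> r"
  shows "\<exists>D. smooth_map_on (prod_mfd X euclid) (pts X \<times> {-\<epsilon><..<\<epsilon>}) X D \<and>
      (\<forall>x\<in>pts X. \<forall>s\<in>{-\<epsilon><..<\<epsilon>}. \<not> (x \<in> G \<and> norm (\<psi> x) \<le> C) \<longrightarrow> D (x, s) = x) \<and>
      (\<forall>x\<in>G. \<forall>s\<in>{-\<epsilon><..<\<epsilon>}. norm (\<psi> x) \<le> C \<longrightarrow> (\<exists>t. \<bar>t\<bar> < r \<and> D (x, s) = g (\<psi> x + t *\<^sub>R e) \<and>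
        t = s * (\<sigma>' (D (x, s)) - \<sigma> x)))"
proof -
  note S = straightD[OF s]
  have sc: "csmooth (ball 0 R) (\<lambda>y. \<tau> (g y))" if "smooth_map_on X (pts X) euclid \<tau>" for \<tau> :: "'x \<Rightarrow> real"
    using smooth_map_on_compose[OF S(5) that _ premfd_euclid pX] S(9,11)
    unfolding smooth_map_on_euclid smooth_on_open[OF open_ball] by auto
  have eq': "\<sigma>' (g y) = \<sigma> (g y)" if "C < norm y" "norm y < R" for y
    using eq[OF S(9)[OF that(2)]] S(10)[OF that(2)] that(1) by simp
  show ?thesis
  proof (rule line_push[OF S(3) r(1,3) sc[OF \<sigma>(1)] sc[OF \<sigma>(2)] B eq' \<epsilon>])
    fix T :: "'e \<times> real \<Rightarrow> real"
    assume T: "csmooth (ball 0 (C + r) \<times> {-\<epsilon><..<\<epsilon>}) T"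
      "\<And>y s. norm y < C + r \<Longrightarrow> \<bar>s\<bar> < \<epsilon> \<Longrightarrow> \<bar>T (y, s)\<bar> < r"
      "\<And>y s. norm y < C + r \<Longrightarrow> \<bar>s\<bar> < \<epsilon> \<Longrightarrow> T (y, s) = s * (\<sigma>' (g (y + T (y, s) *\<^sub>R e)) - \<sigma> (g y))"
      "\<And>y s. C < norm y \<Longrightarrow> norm y < C + r \<Longrightarrow> \<bar>s\<bar> < \<epsilon> \<Longrightarrow> T (y, s) = 0"
    define D where "D z = (if fst z \<in> G \<and> norm (\<psi> (fst z)) < C + r then g (\<psi> (fst z) + T (\<psi> (fst z), snd z) *\<^sub>R e) else fst z)" for z
    define G' where "G' = {x \<in> G. norm (\<psi> x) < C + r}"
    define K where "K = {x \<in> G. norm (\<psi> x) \<le> C}"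
    have pXr: "premfd (prod_mfd X (euclid :: (real, real) mfd))" by (rule premfd_prod[OF pX premfd_euclid])
    have oG': "openin (mtop X) G'"
      using straight_open[OF s open_ball[of 0 "C + r"]] by (simp add: G'_def)
    have "K = g ` cball 0 C"
    proof (intro equalityI subsetI)
      fix x assume "x \<in> K"
      then have "\<psi> x \<in> cball 0 C" "x = g (\<psi> x)" using S(7) by (auto simp: K_def)
      then show "x \<in> g ` cball 0 C" by blast
    next
      fix x assume "x \<in> g ` cball 0 C"
      then show "x \<in> K" using S(9,10) r by (auto simp: K_def)
    qed
    moreover have "continuous_map (top_of_set (cball 0 C)) (mtop X) g"
      using smooth_map_on_continuous[OF smooth_map_on_subset[OF S(5), of "cball 0 C"]] r by (simp add: subset_eq)
    ultimately have "compactin (mtop X) K"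
      using image_compactin[of "top_of_set (cball 0 C)" "cball 0 C" "mtop X" g] by (simp add: compactin_subtopology)
    then have cK: "closedin (mtop X) K" by (rule compactin_imp_closedin[OF Hausdorff_X])
    have out: "D (x, s) = x" if "\<not> (x \<in> G \<and> norm (\<psi> x) \<le> C)" "s \<in> {-\<epsilon><..<\<epsilon>}" for x s
      using that T(4)[of "\<psi> x" s] S(7)[of x] by (auto simp: D_def abs_less_iff)
    have inn: "\<exists>t. \<bar>t\<bar> < r \<and> D (x, s) = g (\<psi> x + t *\<^sub>R e) \<and> t = s * (\<sigma>' (D (x, s)) - \<sigma> x)"
      if x: "x \<in> G" "s \<in> {-\<epsilon><..<\<epsilon>}" "norm (\<psi> x) \<le> C" for x s
    proof -
      have h: "norm (\<psi> x) < C + r" "\<bar>s\<bar> < \<epsilon>" using x r by auto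
      have D: "D (x, s) = g (\<psi> x + T (\<psi> x, s) *\<^sub>R e)" using h x by (simp add: D_def)
      show ?thesis using T(2)[OF h] T(3)[OF h] S(7)[OF x(1)] by (intro exI[of _ "T (\<psi> x, s)"]) (simp add: D)
    qed
    have "smooth_map_on (prod_mfd X euclid) (pts X \<times> {-\<epsilon><..<\<epsilon>}) X D"
    proof (rule smooth_map_on_local[OF pXr])
      show "pts X \<times> {-\<epsilon><..<\<epsilon>} \<subseteq> pts (prod_mfd X (euclid :: (real, real) mfd))" by auto
      fix z assume z: "z \<in> pts X \<times> {-\<epsilon><..<\<epsilon>}"
      show "\<exists>H. openin (mtop (prod_mfd X (euclid :: (real, real) mfd))) H \<and> z \<in> H \<and>
          smooth_map_on (prod_mfd X euclid) (pts X \<times> {-\<epsilon><..<\<epsilon>} \<inter> H) X D"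
      proof (cases "fst z \<in> G'")
        case True
        let ?A = "G' \<times> {-\<epsilon><..<\<epsilon>}"
        have A: "?A \<subseteq> pts X \<times> pts (euclid :: (real, real) mfd)" using S(11) by (auto simp: G'_def)
        have p1: "smooth_map_on (prod_mfd X euclid) ?A X fst" "smooth_map_on (prod_mfd X euclid) ?A (euclid :: (real, real) mfd) snd"
          by (rule smooth_map_on_fst_snd[OF pX premfd_euclid A])+
        have p2: "smooth_map_on (prod_mfd X euclid) ?A euclid (\<lambda>z. \<psi> (fst z))"
          by (rule smooth_map_on_compose[OF p1(1) S(4) _ pXr pX]) (auto simp: G'_def)
        have p3: "smooth_map_on (prod_mfd X euclid) ?A euclid (\<lambda>z. (\<psi> (fst z), snd z))"
          using smooth_map_on_Pair[OF p2 p1(2)] by (simp add: prod_euclid)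
        have "smooth_map_on (prod_mfd X euclid) ?A euclid (\<lambda>z. T (\<psi> (fst z), snd z))"
          by (rule smooth_map_on_csmooth[OF p3 T(1) open_Times[OF open_ball open_greaterThanLessThan] _ pXr]) (auto simp: G'_def)
        then have p4: "smooth_map_on (prod_mfd X euclid) ?A euclid (\<lambda>z. T (\<psi> (fst z), snd z) *\<^sub>R e)"
          by (rule smooth_map_on_csmooth[OF _ csmooth_linear[OF bounded_linear_scaleR_left open_UNIV] open_UNIV _ pXr]) simp
        have "smooth_map_on (prod_mfd X euclid) ?A X (\<lambda>z. g (\<psi> (fst z) + T (\<psi> (fst z), snd z) *\<^sub>R e))"
        proof (rule smooth_map_on_compose[OF smooth_map_on_add[OF p2 p4 pXr] S(5) _ pXr premfd_euclid])
          fix z assume "z \<in> ?A"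
          then have h: "norm (\<psi> (fst z)) < C + r" "\<bar>snd z\<bar> < \<epsilon>" by (auto simp: G'_def abs_less_iff)
          show "\<psi> (fst z) + T (\<psi> (fst z), snd z) *\<^sub>R e \<in> ball 0 R"
            using norm_triangle_ineq[of "\<psi> (fst z)" "T (\<psi> (fst z), snd z) *\<^sub>R e"] T(2)[OF h] h(1) r S(3) by simp
        qed
        then have "smooth_map_on (prod_mfd X euclid) ?A X D"
          by (rule smooth_map_on_cong[OF _ pXr]) (auto simp: D_def G'_def)
        moreover have "pts X \<times> {-\<epsilon><..<\<epsilon>} \<inter> G' \<times> UNIV = ?A" using openin_subset[OF oG'] by blast
        moreover have "openin (mtop (prod_mfd X (euclid :: (real, real) mfd))) (G' \<times> UNIV)"
          using oG' by (simp add: openin_prod_Times_iff)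
        ultimately show ?thesis using True z by (intro exI[of _ "G' \<times> UNIV"]) (auto simp: mem_Times_iff)
      next
        case False
        have "smooth_map_on (prod_mfd X euclid) (pts X \<times> {-\<epsilon><..<\<epsilon>} \<inter> (pts X - K) \<times> UNIV) X D"
        proof (rule smooth_map_on_cong[OF _ pXr])
          show "smooth_map_on (prod_mfd X euclid) (pts X \<times> {-\<epsilon><..<\<epsilon>} \<inter> (pts X - K) \<times> (UNIV :: real set)) X fst"
            by (rule smooth_map_on_fst_snd[OF pX premfd_euclid]) auto
          show "fst z = D z" if "z \<in> pts X \<times> {-\<epsilon><..<\<epsilon>} \<inter> (pts X - K) \<times> UNIV" for z
          proof -
            obtain x t where "z = (x, t)" by (cases z)
            then show ?thesis using that out[of x t] by (simp add: K_def)
          qed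
        qed
        moreover have "openin (mtop (prod_mfd X (euclid :: (real, real) mfd))) ((pts X - K) \<times> UNIV)"
          using cK by (simp add: openin_prod_Times_iff openin_diff)
        moreover have "fst z \<notin> K" using False r by (auto simp: G'_def K_def)
        ultimately show ?thesis using z by (intro exI[of _ "(pts X - K) \<times> UNIV"]) (auto simp: mem_Times_iff)
      qed
    qed
    then show ?thesis using out inn by (intro exI[of _ D]) blast
  qed
qed

end

lemma compact_in_smaller_ball:
  assumes "compact S" "S \<subseteq> ball (0::'a::real_normed_vector) R" "R > 0"
  obtains C where "0 < C" "C < R" "\<And>y. y \<in> S \<Longrightarrow> norm y \<le> C"
proof (cases "S = {}")
  case True
  then show thesis using that[of "R / 2"] assms(3) by simp
next
  case False
  obtain x where x: "x \<in> S" "\<And>y. y \<in> S \<Longrightarrow> norm y \<le> norm x"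
    using continuous_attains_sup[OF assms(1) False, of norm] by (auto intro: continuous_on_norm_id)
  have "norm y \<le> max (norm x) (R / 2)" if "y \<in> S" for y using x(2)[OF that] by simp
  moreover have "norm x < R" using x(1) assms(2) by auto
  ultimately show thesis using that[of "max (norm x) (R / 2)"] assms(3) by simp
qed

lemma bounded_on_cball:
  fixes f :: "'a::euclidean_space \<Rightarrow> real"
  assumes "csmooth (ball 0 R) f" "c < R"
  obtains b where "0 \<le> b" "\<And>y. norm y \<le> c \<Longrightarrow> \<bar>f y\<bar> \<le> b"
proof -
  have "continuous_on (cball 0 c) f"
    by (rule continuous_on_subset[OF csmooth_continuous[OF assms(1)]]) (use assms(2) in auto)
  then have "compact (f ` cball 0 c)" by (rule compact_continuous_image) simp
  then obtain b where "\<And>z. z \<in> f ` cball 0 c \<Longrightarrow> norm z \<le> b" using compact_imp_bounded bounded_iff by metis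
  then show thesis using that[of "max b 0"] by fastforce
qed

text \<open>Linear coordinates on the orthogonal complement of \<open>e\<close>, in which the fibers
  of a straightened submersion will receive their charts.\<close>

lemma hyperplane_split:
  fixes e :: "'e::euclidean_space"
  assumes e: "norm e = 1" and dim: "DIM('e) = Suc DIM('d::euclidean_space)"
  obtains \<pi> :: "'e \<Rightarrow> 'd::euclidean_space" and \<iota> where "linear \<pi>" "linear \<iota>" "\<And>y. \<pi> (\<iota> y) = y" "\<And>z. \<iota> (\<pi> z) = z - (z \<bullet> e) *\<^sub>R e"
    "\<pi> e = 0" "\<And>y. \<iota> y \<bullet> e = 0"
proof -
  let ?S = "{y. e \<bullet> y = 0}"
  have ee: "e \<bullet> e = 1" using e by (simp add: norm_eq_1)
  have "e \<noteq> 0" using e by auto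
  have "dim ?S = dim (UNIV :: 'd set)" using dim_hyperplane[OF \<open>e \<noteq> 0\<close>] dim by simp
  then obtain f :: "'e \<Rightarrow> 'd" and g where fg: "linear f" "linear g" "g ` UNIV = ?S" "\<And>x. x \<in> ?S \<Longrightarrow> g (f x) = x" "\<And>y. f (g y) = y"
    by (rule isometries_subspaces[OF subspace_hyperplane subspace_UNIV]) simp_all
  define \<pi> where "\<pi> z = f (z - (z \<bullet> e) *\<^sub>R e)" for z
  have ge: "g y \<bullet> e = 0" for y using fg(3) by (auto simp: inner_commute)
  show thesis
  proof
    show "linear \<pi>" unfolding \<pi>_def
      by (rule linearI) (simp_all add: linear_add[OF fg(1)] linear_diff[OF fg(1)] linear_scale[OF fg(1)] algebra_simps)
    show "linear g" by (rule fg(2))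
    show "\<pi> (g y) = y" for y by (simp add: \<pi>_def ge fg(5))
    show "g (\<pi> z) = z - (z \<bullet> e) *\<^sub>R e" for z
      unfolding \<pi>_def by (rule fg(4)) (simp add: inner_diff_right ee inner_commute)
    show "\<pi> e = 0" by (simp add: \<pi>_def ee linear_0[OF fg(1)])
    show "g y \<bullet> e = 0" for y by (rule ge)
  qed
qed

context cmfd
begin

text \<open>The map \<open>f\<close> is the push with the roles of \<open>\<sigma>\<close> and
  \<open>\<sigma>'\<close> exchanged. The two shifts add up to a solution of
  \<open>t = s * (\<sigma> (g (\<psi> x + t e)) - \<sigma> x)\<close>, whose only solution is 0 by
  contraction. If \<open>d\<close> moves the point out of the region where the functions differ, its
  shift already satisfies this equation.\<close>

lemma push_inverse:
  fixes \<sigma> \<sigma>' :: "'x \<Rightarrow> real"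
  assumes st: "straight p G \<psi> g e R w" and \<sigma>: "csmooth (ball 0 R) (\<lambda>y. \<sigma> (g y))"
    and r: "0 < r" "C + 2 * r < R"
    and B: "\<And>y. norm y \<le> C + 2 * r \<Longrightarrow> \<bar>frechet_derivative (\<lambda>y. \<sigma> (g y)) (at y) e\<bar> \<le> B" and sB: "\<bar>s\<bar> * B < 1"
    and eq: "\<And>x. x \<in> G \<Longrightarrow> C < norm (\<psi> x) \<Longrightarrow> \<sigma>' x = \<sigma> x"
    and d: "\<And>x. x \<in> pts X \<Longrightarrow> \<not> (x \<in> G \<and> norm (\<psi> x) \<le> C) \<Longrightarrow> d x = x"
      "\<And>x. x \<in> G \<Longrightarrow> norm (\<psi> x) \<le> C \<Longrightarrow> \<exists>t. \<bar>t\<bar> < r \<and> d x = g (\<psi> x + t *\<^sub>R e) \<and> t = s * (\<sigma>' (d x) - \<sigma> x)"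
    and f: "\<And>x. x \<in> pts X \<Longrightarrow> \<not> (x \<in> G \<and> norm (\<psi> x) \<le> C) \<Longrightarrow> f x = x"
      "\<And>x. x \<in> G \<Longrightarrow> norm (\<psi> x) \<le> C \<Longrightarrow> \<exists>t. \<bar>t\<bar> < r \<and> f x = g (\<psi> x + t *\<^sub>R e) \<and> t = s * (\<sigma> (f x) - \<sigma>' x)"
    and x: "x \<in> pts X"
  shows "f (d x) = x"
proof (cases "x \<in> G \<and> norm (\<psi> x) \<le> C")
  case False
  then show ?thesis using d(1)[OF x] f(1)[OF x] by simp
next
  case True
  note S = straightD[OF st]
  have nb: "norm (y + t *\<^sub>R e) \<le> C + r" if "norm y \<le> C" "\<bar>t\<bar> < r" for y t
    using norm_triangle_ineq[of y "t *\<^sub>R e"] that S(3) by simp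
  have zero: "t = 0" if "t = s * (\<sigma> (g (\<psi> x + t *\<^sub>R e)) - \<sigma> x)" "norm (\<psi> x + t *\<^sub>R e) \<le> C + r" for t
  proof -
    have "\<bar>\<sigma> (g (\<psi> x + t *\<^sub>R e)) - \<sigma> (g (\<psi> x + 0 *\<^sub>R e))\<bar> \<le> B * \<bar>t - 0\<bar>"
      by (rule line_lipschitz[OF \<sigma> r(2) B]) (use that(2) True r in auto)
    then show ?thesis using contraction_unique[OF that(1) _ sB] S(7) True by simp
  qed
  obtain t where t: "\<bar>t\<bar> < r" "d x = g (\<psi> x + t *\<^sub>R e)" "t = s * (\<sigma>' (d x) - \<sigma> x)" using d(2)[of x] True by blast
  have n: "norm (\<psi> x + t *\<^sub>R e) \<le> C + r" "norm (\<psi> x + t *\<^sub>R e) < R" using nb[OF _ t(1), of "\<psi> x"] True r by auto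
  have dx: "d x \<in> G" "\<psi> (d x) = \<psi> x + t *\<^sub>R e" using S(9,10)[OF n(2)] t(2) by auto
  have gx: "g (\<psi> x) = x" using S(7) True by blast
  show ?thesis
  proof (cases "norm (\<psi> (d x)) \<le> C")
    case inner: True
    obtain t' where t': "\<bar>t'\<bar> < r" "f (d x) = g (\<psi> (d x) + t' *\<^sub>R e)" "t' = s * (\<sigma> (f (d x)) - \<sigma>' (d x))"
      using f(2)[OF dx(1) inner] by blast
    have fd: "f (d x) = g (\<psi> x + (t + t') *\<^sub>R e)" using t'(2) by (simp add: dx(2) algebra_simps)
    have "t + t' = s * (\<sigma> (f (d x)) - \<sigma> x)" using t(3) t'(3) by (simp only: right_diff_distrib)
    moreover have "norm (\<psi> x + (t + t') *\<^sub>R e) \<le> C + r" using nb[OF inner t'(1)] by (simp add: dx(2) algebra_simps)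
    ultimately have "t + t' = 0" using zero[of "t + t'"] fd by simp
    then show ?thesis using fd gx by simp
  next
    case outer: False
    then have "\<sigma>' (d x) = \<sigma> (d x)" using eq[OF dx(1)] by simp
    then have "t = s * (\<sigma> (d x) - \<sigma> x)" using t(3) by metis
    then have "t = s * (\<sigma> (g (\<psi> x + t *\<^sub>R e)) - \<sigma> x)" unfolding t(2)[symmetric] .
    then have "t = 0" using zero n(1) by blast
    then have "d x = x" using t(2) gx by simp
    then show ?thesis using f(1)[OF x] outer by auto
  qed
qed

text \<open>Takes the place of the flow of a vector field: \<open>D\<close> carries the map \<open>p \<cdot> cis (- s \<sigma>')\<close> back to
  \<open>p \<cdot> cis (- s \<sigma>)\<close>. If \<open>\<sigma>'\<close> and \<open>\<sigma>\<close> differ only in one chart, it moves points along one coordinate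
  axis, and such pushes compose to the case \<open>\<sigma> = 0\<close>, \<open>\<sigma>' = 1\<close> by a partition of unity.\<close>

definition push where
  "push (p :: 'x \<Rightarrow> complex) \<epsilon> (\<sigma> :: 'x \<Rightarrow> real) \<sigma>' \<longleftrightarrow> (\<exists>D E.
     smooth_map_on (prod_mfd X (euclid :: (real, real) mfd)) (pts X \<times> {-\<epsilon><..<\<epsilon>}) X D \<and>
     smooth_map_on (prod_mfd X (euclid :: (real, real) mfd)) (pts X \<times> {-\<epsilon><..<\<epsilon>}) X E \<and>
     (\<forall>x\<in>pts X. \<forall>s\<in>{-\<epsilon><..<\<epsilon>}. E (D (x, s), s) = x \<and> D (E (x, s), s) = x \<and>
        p (D (x, s)) * cis (- s * \<sigma>' (D (x, s))) = p x * cis (- s * \<sigma> x)))"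

lemma pXr: "premfd (prod_mfd X (euclid :: (real, real) mfd))"
  by (rule premfd_prod[OF pX premfd_euclid])

text \<open>A compact \<open>Z\<close> inside a straightened chart lies within a ball of radius
  \<open>C\<close> smaller than the full one, which leaves room for shifts. \<open>D\<close> and its
  inverse \<open>E\<close> both come from \<open>push_along\<close>, with the two functions
  exchanged, so \<open>B\<close> has to bound both of them and both derivatives along
  \<open>e\<close>.\<close>

lemma push_step:
  fixes \<sigma> \<sigma>' :: "'x \<Rightarrow> real"
  assumes s: "straight p G \<psi> g e R w" and \<sigma>: "smooth_map_on X (pts X) euclid \<sigma>" "smooth_map_on X (pts X) euclid \<sigma>'"
    and Z: "closedin (mtop X) Z" "Z \<subseteq> G" "\<And>x. x \<in> pts X \<Longrightarrow> x \<notin> Z \<Longrightarrow> \<sigma>' x = \<sigma> x"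
  shows "\<exists>\<epsilon>>0. push p \<epsilon> \<sigma> \<sigma>'"
proof -
  note S = straightD[OF s]
  have sc: "csmooth (ball 0 R) (\<lambda>y. \<tau> (g y))" if "smooth_map_on X (pts X) euclid \<tau>" for \<tau> :: "'x \<Rightarrow> real"
    using smooth_map_on_compose[OF S(5) that _ premfd_euclid pX] S(9,11)
    unfolding smooth_map_on_euclid smooth_on_open[OF open_ball] by auto
  have "compactin (mtop X) Z" using compact_X Z(1) by (rule closedin_compact_space)
  then have "compactin (subtopology (mtop X) G) Z" using Z(2) by (simp add: compactin_subtopology)
  from image_compactin[OF this smooth_map_on_continuous[OF S(4)]] have "compact (\<psi> ` Z)" by simp
  then obtain C where C: "0 < C" "C < R" "\<And>y. y \<in> \<psi> ` Z \<Longrightarrow> norm y \<le> C"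
    by (rule compact_in_smaller_ball[OF _ _ S(2)]) (use S(6) Z(2) in \<open>auto simp: subset_eq\<close>)
  \<comment> \<open>Two shifts of size up to \<open>r\<close> still fit between the radii
    \<open>C\<close> and \<open>R\<close>.\<close>
  define r where "r = (R - C) / 4"
  have r: "0 < r" "C + 2 * r < R" using C(2) by (auto simp: r_def field_simps)
  obtain b1 where b1: "0 \<le> b1" "\<And>y. norm y \<le> C + 2 * r \<Longrightarrow> \<bar>\<sigma> (g y)\<bar> \<le> b1"
    using bounded_on_cball[OF sc[OF \<sigma>(1)] r(2)] by metis
  obtain b2 where b2: "0 \<le> b2" "\<And>y. norm y \<le> C + 2 * r \<Longrightarrow> \<bar>\<sigma>' (g y)\<bar> \<le> b2"
    using bounded_on_cball[OF sc[OF \<sigma>(2)] r(2)] by metis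
  obtain b3 where b3: "0 \<le> b3" "\<And>y. norm y \<le> C + 2 * r \<Longrightarrow> \<bar>frechet_derivative (\<lambda>y. \<sigma> (g y)) (at y) e\<bar> \<le> b3"
    using bounded_on_cball[OF csmooth_derivative[OF sc[OF \<sigma>(1)]] r(2)] by metis
  obtain b4 where b4: "0 \<le> b4" "\<And>y. norm y \<le> C + 2 * r \<Longrightarrow> \<bar>frechet_derivative (\<lambda>y. \<sigma>' (g y)) (at y) e\<bar> \<le> b4"
    using bounded_on_cball[OF csmooth_derivative[OF sc[OF \<sigma>(2)]] r(2)] by metis
  define B where "B = b1 + b2 + b3 + b4"
  have B: "0 \<le> B" "\<And>y. norm y \<le> C + 2 * r \<Longrightarrow> \<bar>\<sigma> (g y)\<bar> \<le> B" "\<And>y. norm y \<le> C + 2 * r \<Longrightarrow> \<bar>\<sigma>' (g y)\<bar> \<le> B"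
    "\<And>y. norm y \<le> C + 2 * r \<Longrightarrow> \<bar>frechet_derivative (\<lambda>y. \<sigma> (g y)) (at y) e\<bar> \<le> B"
    "\<And>y. norm y \<le> C + 2 * r \<Longrightarrow> \<bar>frechet_derivative (\<lambda>y. \<sigma>' (g y)) (at y) e\<bar> \<le> B"
    using b1(1) b2(1) b3(1) b4(1) by (auto simp: B_def dest: b1(2) b2(2) b3(2) b4(2))
  \<comment> \<open>The largest value for which the shift equation is a contraction with shifts
    below \<open>r\<close>; the summand 1 keeps the denominator positive when \<open>B\<close> is
    0.\<close>
  define \<epsilon> where "\<epsilon> = min 1 r / (2 * B + 1)"
  have \<epsilon>: "0 < \<epsilon>" "\<epsilon> * (2 * B + 1) \<le> 1" "\<epsilon> * (2 * B + 1) \<le> r" using r(1) B(1) by (simp_all add: \<epsilon>_def)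
  have sB: "\<bar>t\<bar> * B < 1" if "t \<in> {-\<epsilon><..<\<epsilon>}" for t
  proof -
    have "\<bar>t\<bar> * (2 * B + 1) < \<epsilon> * (2 * B + 1)" using that B(1) by (intro mult_strict_right_mono) auto
    moreover have "\<bar>t\<bar> * B \<ge> 0" using B(1) by simp
    ultimately show ?thesis using \<epsilon>(2) by (simp add: algebra_simps)
  qed
  have ZK: "\<not> (x \<in> G \<and> norm (\<psi> x) \<le> C) \<Longrightarrow> x \<notin> Z" for x using Z(2) C(3) by blast
  have eq: "\<sigma>' x = \<sigma> x" "\<sigma> x = \<sigma>' x" if "x \<in> G" "C < norm (\<psi> x)" for x
    using Z(3)[of x] ZK[of x] S(11) that by auto
  obtain D where D: "smooth_map_on (prod_mfd X euclid) (pts X \<times> {-\<epsilon><..<\<epsilon>}) X D"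
      "\<And>x s. x\<in>pts X \<Longrightarrow> s\<in>{-\<epsilon><..<\<epsilon>} \<Longrightarrow> \<not> (x \<in> G \<and> norm (\<psi> x) \<le> C) \<Longrightarrow> D (x, s) = x"
      "\<And>x s. x\<in>G \<Longrightarrow> s\<in>{-\<epsilon><..<\<epsilon>} \<Longrightarrow> norm (\<psi> x) \<le> C \<Longrightarrow> \<exists>t. \<bar>t\<bar> < r \<and> D (x, s) = g (\<psi> x + t *\<^sub>R e) \<and>
        t = s * (\<sigma>' (D (x, s)) - \<sigma> x)"
    using push_along[OF s \<sigma> r(1) C(1) r(2) B(2,3,5,1) eq(1) \<epsilon>(2,3)] by blast
  obtain E where E: "smooth_map_on (prod_mfd X euclid) (pts X \<times> {-\<epsilon><..<\<epsilon>}) X E"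
      "\<And>x s. x\<in>pts X \<Longrightarrow> s\<in>{-\<epsilon><..<\<epsilon>} \<Longrightarrow> \<not> (x \<in> G \<and> norm (\<psi> x) \<le> C) \<Longrightarrow> E (x, s) = x"
      "\<And>x s. x\<in>G \<Longrightarrow> s\<in>{-\<epsilon><..<\<epsilon>} \<Longrightarrow> norm (\<psi> x) \<le> C \<Longrightarrow> \<exists>t. \<bar>t\<bar> < r \<and> E (x, s) = g (\<psi> x + t *\<^sub>R e) \<and>
        t = s * (\<sigma> (E (x, s)) - \<sigma>' x)"
    using push_along[OF s \<sigma>(2,1) r(1) C(1) r(2) B(3,2,4,1) eq(2) \<epsilon>(2,3)] by blast
  have ED: "E (D (x, t), t) = x" if x: "x \<in> pts X" and t: "t \<in> {-\<epsilon><..<\<epsilon>}" for x t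
    by (rule push_inverse[where d = "\<lambda>x. D (x, t)" and f = "\<lambda>x. E (x, t)" and s = t, OF s sc[OF \<sigma>(1)] r B(4) sB[OF t] eq(1)
          D(2)[OF _ t] D(3)[OF _ t] E(2)[OF _ t] E(3)[OF _ t] x])
  have DE: "D (E (x, t), t) = x" if x: "x \<in> pts X" and t: "t \<in> {-\<epsilon><..<\<epsilon>}" for x t
    by (rule push_inverse[where f = "\<lambda>x. D (x, t)" and d = "\<lambda>x. E (x, t)" and s = t, OF s sc[OF \<sigma>(2)] r B(5) sB[OF t] eq(2)
          E(2)[OF _ t] E(3)[OF _ t] D(2)[OF _ t] D(3)[OF _ t] x])
  \<comment> \<open>The shift \<open>a\<close> multiplies \<open>p\<close> by \<open>cis a\<close>,
    and the equation satisfied by \<open>a\<close> is precisely the relation between the two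
    exponents.\<close>
  have pD: "p (D (x, t)) * cis (- t * \<sigma>' (D (x, t))) = p x * cis (- t * \<sigma> x)" if x: "x \<in> pts X" and t: "t \<in> {-\<epsilon><..<\<epsilon>}" for x t
  proof (cases "x \<in> G \<and> norm (\<psi> x) \<le> C")
    case False
    then show ?thesis using D(2)[OF x t False] Z(3)[OF x ZK[OF False]] by simp
  next
    case True
    obtain a where a: "\<bar>a\<bar> < r" "D (x, t) = g (\<psi> x + a *\<^sub>R e)" "a = t * (\<sigma>' (D (x, t)) - \<sigma> x)"
      using D(3)[OF _ t] True by blast
    have "norm (\<psi> x + a *\<^sub>R e) < R" using norm_triangle_ineq[of "\<psi> x" "a *\<^sub>R e"] a(1) True r S(3) by simp
    from S(8)[OF S(9)[OF this]] S(10)[OF this] have "p (D (x, t)) = w * cis (\<psi> x \<bullet> e + a)"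
      using S(3) by (simp add: a(2) inner_add_left norm_eq_1)
    then have "p (D (x, t)) * cis (- t * \<sigma>' (D (x, t))) = w * cis (\<psi> x \<bullet> e + a + - t * \<sigma>' (D (x, t)))"
      by (simp add: mult.assoc cis_mult)
    also have "\<psi> x \<bullet> e + a + - t * \<sigma>' (D (x, t)) = \<psi> x \<bullet> e + - t * \<sigma> x" using a(3) by (simp add: algebra_simps)
    also have "w * cis \<dots> = p x * cis (- t * \<sigma> x)" using S(8) True by (simp add: cis_mult mult.assoc)
    finally show ?thesis .
  qed
  have "push p \<epsilon> \<sigma> \<sigma>'" unfolding push_def
    by (rule exI[of _ D], rule exI[of _ E]) (intro conjI ballI D(1) E(1) ED DE pD)
  then show ?thesis using \<epsilon>(1) by blast
qed

section \<open>Composing pushes into a lift of the rotation\<close>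

lemma push_mono:
  assumes "push p \<epsilon> \<sigma> \<sigma>'" "\<delta> \<le> \<epsilon>"
  shows "push p \<delta> \<sigma> \<sigma>'"
proof -
  have sub: "{-\<delta><..<\<delta>} \<subseteq> {-\<epsilon><..<\<epsilon>}" using assms(2) by auto
  then have sub': "pts X \<times> {-\<delta><..<\<delta>} \<subseteq> pts X \<times> {-\<epsilon><..<\<epsilon>}" by blast
  show ?thesis using assms(1) sub smooth_map_on_subset[OF _ sub'] unfolding push_def by blast
qed

text \<open>The factor \<open>c\<close> is 1 when pushes are composed and \<open>1/2\<close> when
  the range of times is doubled.\<close>

lemma smooth_map_on_two_stage:
  assumes D: "smooth_map_on (prod_mfd X (euclid :: (real, real) mfd)) (pts X \<times> J) X D"
    and D': "smooth_map_on (prod_mfd X (euclid :: (real, real) mfd)) (pts X \<times> J) X D'"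
    and c: "\<And>s. s \<in> J' \<Longrightarrow> c * s \<in> J"
  shows "smooth_map_on (prod_mfd X (euclid :: (real, real) mfd)) (pts X \<times> J') X (\<lambda>z. D' (D (fst z, c * snd z), c * snd z))"
proof -
  let ?P = "prod_mfd X (euclid :: (real, real) mfd)"
  have A: "pts X \<times> J' \<subseteq> pts X \<times> pts (euclid :: (real, real) mfd)" by auto
  note fs = smooth_map_on_fst_snd[OF pX premfd_euclid A]
  have c': "smooth_map_on ?P (pts X \<times> J') euclid (\<lambda>z. c * snd z)"
    by (rule smooth_map_on_csmooth[OF fs(2) csmooth_linear[OF bounded_linear_mult_right open_UNIV] open_UNIV _ pXr]) simp
  have 1: "smooth_map_on ?P (pts X \<times> J') X (\<lambda>z. D (fst z, c * snd z))"
    by (rule smooth_map_on_compose[OF smooth_map_on_Pair[OF fs(1) c'] D _ pXr pXr]) (use c in auto)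
  show ?thesis
    by (rule smooth_map_on_compose[OF smooth_map_on_Pair[OF 1 c'] D' _ pXr pXr])
       (use c smooth_map_on_image[OF 1] in auto)
qed

lemma push_trans:
  assumes "push p \<epsilon> \<sigma> \<sigma>'" "push p \<epsilon> \<sigma>' \<sigma>''"
  shows "push p \<epsilon> \<sigma> \<sigma>''"
proof -
  let ?P = "prod_mfd X (euclid :: (real, real) mfd)"
  let ?J = "{-\<epsilon><..<\<epsilon>}"
  obtain D E where D: "smooth_map_on ?P (pts X \<times> ?J) X D" "smooth_map_on ?P (pts X \<times> ?J) X E"
    "\<And>x s. x \<in> pts X \<Longrightarrow> s \<in> ?J \<Longrightarrow> E (D (x, s), s) = x \<and> D (E (x, s), s) = x \<and>
        p (D (x, s)) * cis (- s * \<sigma>' (D (x, s))) = p x * cis (- s * \<sigma> x)"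
    using assms(1) unfolding push_def by blast
  obtain D' E' where D': "smooth_map_on ?P (pts X \<times> ?J) X D'" "smooth_map_on ?P (pts X \<times> ?J) X E'"
    "\<And>x s. x \<in> pts X \<Longrightarrow> s \<in> ?J \<Longrightarrow> E' (D' (x, s), s) = x \<and> D' (E' (x, s), s) = x \<and>
        p (D' (x, s)) * cis (- s * \<sigma>'' (D' (x, s))) = p x * cis (- s * \<sigma>' x)"
    using assms(2) unfolding push_def by blast
  have m: "D (x, s) \<in> pts X" "E (x, s) \<in> pts X" "D' (x, s) \<in> pts X" "E' (x, s) \<in> pts X" if "x \<in> pts X" "s \<in> ?J" for x s
    using that smooth_map_on_image[OF D(1), of "(x, s)"] smooth_map_on_image[OF D(2), of "(x, s)"]
      smooth_map_on_image[OF D'(1), of "(x, s)"] smooth_map_on_image[OF D'(2), of "(x, s)"] by auto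
  let ?F = "\<lambda>z. D' (D (fst z, 1 * snd z), 1 * snd z)"
  let ?G = "\<lambda>z. E (E' (fst z, 1 * snd z), 1 * snd z)"
  show ?thesis unfolding push_def
  proof (rule exI[of _ ?F], rule exI[of _ ?G], intro conjI ballI)
    show "smooth_map_on ?P (pts X \<times> ?J) X ?F" by (rule smooth_map_on_two_stage[OF D(1) D'(1)]) simp
    show "smooth_map_on ?P (pts X \<times> ?J) X ?G" by (rule smooth_map_on_two_stage[OF D'(2) D(2)]) simp
    fix x s assume xs: "x \<in> pts X" "s \<in> ?J"
    show "?G (?F (x, s), s) = x" using D(3)[OF xs] D'(3)[OF m(1)[OF xs] xs(2)] by simp
    show "?F (?G (x, s), s) = x" using D'(3)[OF xs] D(3)[OF m(4)[OF xs] xs(2)] by simp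
    show "p (?F (x, s)) * cis (- s * \<sigma>'' (?F (x, s))) = p x * cis (- s * \<sigma> x)"
      using D(3)[OF xs] D'(3)[OF m(1)[OF xs] xs(2)] by simp
  qed
qed

text \<open>The partial sums form a chain from 0 to the full sum in which neighbours differ by one
  \<open>\<rho> k\<close>, supported in one straightened chart. Finitely many pushes have a common
  positive range of times.\<close>

lemma push_sum:
  fixes \<rho> :: "'k \<Rightarrow> 'x \<Rightarrow> real"
  assumes "finite K" "\<And>k. k \<in> K \<Longrightarrow> \<exists>\<psi> g e R w. straight p (G k) \<psi> g e R w"
    "\<And>k. k \<in> K \<Longrightarrow> smooth_map_on X (pts X) euclid (\<rho> k)"
    "\<And>k. k \<in> K \<Longrightarrow> closedin (mtop X) (Z k)" "\<And>k. k \<in> K \<Longrightarrow> Z k \<subseteq> G k"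
    "\<And>k y. k \<in> K \<Longrightarrow> y \<in> pts X \<Longrightarrow> y \<notin> Z k \<Longrightarrow> \<rho> k y = 0"
  shows "\<exists>\<epsilon>>0. push p \<epsilon> (\<lambda>x. 0) (\<lambda>x. \<Sum>k\<in>K. \<rho> k x)"
  using assms
proof (induction K rule: finite_induct)
  case empty
  have "smooth_map_on (prod_mfd X (euclid :: (real, real) mfd)) (pts X \<times> {-1<..<1}) X fst"
    by (rule smooth_map_on_fst_snd[OF pX premfd_euclid]) auto
  then have "push p 1 (\<lambda>x. 0) (\<lambda>x. \<Sum>k\<in>{}. \<rho> k x)" unfolding push_def by (intro exI[of _ fst]) auto
  then show ?case using zero_less_one by blast
next
  case (insert k K)
  have "\<exists>\<epsilon>>0. push p \<epsilon> (\<lambda>x. 0) (\<lambda>x. \<Sum>k\<in>K. \<rho> k x)"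
    by (rule insert.IH; rule insert.prems; simp)
  then obtain \<epsilon>1 where e1: "\<epsilon>1 > 0" "push p \<epsilon>1 (\<lambda>x. 0) (\<lambda>x. \<Sum>k\<in>K. \<rho> k x)" by blast
  obtain \<psi> g e R w where st: "straight p (G k) \<psi> g e R w" using insert(4) by blast
  have sm: "smooth_map_on X (pts X) euclid (\<lambda>x. \<Sum>k\<in>K. \<rho> k x)" "smooth_map_on X (pts X) euclid (\<lambda>x. \<Sum>k\<in>insert k K. \<rho> k x)"
    by (rule smooth_map_on_sum[OF _ pX order_refl], use insert(5) in blast)+
  have "\<exists>\<epsilon>>0. push p \<epsilon> (\<lambda>x. \<Sum>k\<in>K. \<rho> k x) (\<lambda>x. \<Sum>k\<in>insert k K. \<rho> k x)"
    by (rule push_step[OF st sm, of "Z k"]) (use insert in auto)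
  then obtain \<epsilon>2 where e2: "\<epsilon>2 > 0" "push p \<epsilon>2 (\<lambda>x. \<Sum>k\<in>K. \<rho> k x) (\<lambda>x. \<Sum>k\<in>insert k K. \<rho> k x)" by blast
  have "push p (min \<epsilon>1 \<epsilon>2) (\<lambda>x. 0) (\<lambda>x. \<Sum>k\<in>insert k K. \<rho> k x)"
    by (rule push_trans[OF push_mono[OF e1(2)] push_mono[OF e2(2)]]) auto
  then show ?case using e1(1) e2(1) by (intro exI[of _ "min \<epsilon>1 \<epsilon>2"]) simp
qed

text \<open>No group law in the time variable is asked for: \<open>D\<close> just lifts the rotation
  by \<open>s\<close> to a diffeomorphism for each small \<open>s\<close>, smoothly in
  \<open>s\<close>, and \<open>E\<close> is its inverse.\<close>

definition flow where
  "flow (p :: 'x \<Rightarrow> complex) \<epsilon> D E \<longleftrightarrow>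
     smooth_map_on (prod_mfd X (euclid :: (real, real) mfd)) (pts X \<times> {-\<epsilon><..<\<epsilon>}) X D \<and>
     smooth_map_on (prod_mfd X (euclid :: (real, real) mfd)) (pts X \<times> {-\<epsilon><..<\<epsilon>}) X E \<and>
     (\<forall>x\<in>pts X. \<forall>s\<in>{-\<epsilon><..<\<epsilon>}. E (D (x, s), s) = x \<and> D (E (x, s), s) = x \<and> p (D (x, s)) = p x * cis s)"

text \<open>Applying the lift of the rotation by \<open>s / 2\<close> twice lifts the rotation by
  \<open>s\<close>. Since the initial range is uniform on the compact manifold, repeated doubling
  reaches any prescribed range of times.\<close>

lemma flow_double:
  assumes "flow p \<epsilon> D E"
  shows "flow p (2 * \<epsilon>) (\<lambda>z. D (D (fst z, (1/2) * snd z), (1/2) * snd z)) (\<lambda>z. E (E (fst z, (1/2) * snd z), (1/2) * snd z))"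
proof -
  have D: "smooth_map_on (prod_mfd X (euclid :: (real, real) mfd)) (pts X \<times> {-\<epsilon><..<\<epsilon>}) X D"
     "smooth_map_on (prod_mfd X (euclid :: (real, real) mfd)) (pts X \<times> {-\<epsilon><..<\<epsilon>}) X E"
     "\<And>x s. x \<in> pts X \<Longrightarrow> s \<in> {-\<epsilon><..<\<epsilon>} \<Longrightarrow> E (D (x, s), s) = x \<and> D (E (x, s), s) = x \<and> p (D (x, s)) = p x * cis s"
    using assms unfolding flow_def by blast+
  have m: "D (x, s) \<in> pts X" "E (x, s) \<in> pts X" if "x \<in> pts X" "s \<in> {-\<epsilon><..<\<epsilon>}" for x s
    using that smooth_map_on_image[OF D(1), of "(x, s)"] smooth_map_on_image[OF D(2), of "(x, s)"] by auto
  have h: "(1/2) * s \<in> {-\<epsilon><..<\<epsilon>}" if "s \<in> {-(2 * \<epsilon>)<..<2 * \<epsilon>}" for s using that by auto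
  show ?thesis unfolding flow_def
  proof (intro conjI ballI smooth_map_on_two_stage[OF D(1,1) h] smooth_map_on_two_stage[OF D(2,2) h]; (assumption)?)
    fix x s assume x: "x \<in> pts X" and "s \<in> {-(2 * \<epsilon>)<..<2 * \<epsilon>}"
    from h[OF this(2)] have s: "s / 2 \<in> {-\<epsilon><..<\<epsilon>}" by simp
    show "E (E (fst (D (D (fst (x, s), 1 / 2 * snd (x, s)), 1 / 2 * snd (x, s)), s), 1 / 2 * snd (D (D (fst (x, s), 1 / 2 * snd (x, s)), 1 / 2 * snd (x, s)), s)),
        1 / 2 * snd (D (D (fst (x, s), 1 / 2 * snd (x, s)), 1 / 2 * snd (x, s)), s)) = x"
      using D(3)[OF x s] D(3)[OF m(1)[OF x s] s] by simp
    show "D (D (fst (E (E (fst (x, s), 1 / 2 * snd (x, s)), 1 / 2 * snd (x, s)), s), 1 / 2 * snd (E (E (fst (x, s), 1 / 2 * snd (x, s)), 1 / 2 * snd (x, s)), s)),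
        1 / 2 * snd (E (E (fst (x, s), 1 / 2 * snd (x, s)), 1 / 2 * snd (x, s)), s)) = x"
      using D(3)[OF x s] D(3)[OF m(2)[OF x s] s] by simp
    show "p (D (D (fst (x, s), 1 / 2 * snd (x, s)), 1 / 2 * snd (x, s))) = p x * cis s"
      using D(3)[OF x s] D(3)[OF m(1)[OF x s] s] by (simp add: mult.assoc cis_mult)
  qed
qed

lemma flow_exists:
  assumes p: "smooth_map_on X (pts X) euclid p" "\<And>x. x \<in> pts X \<Longrightarrow> norm (p x) = 1"
    and sub: "\<And>x. x \<in> pts X \<Longrightarrow> \<exists>U \<phi> v. (U, \<phi>) \<in> atlas X \<and> x \<in> U \<and> cder p U \<phi> x v \<noteq> 0"
  obtains D E where "flow p c D E"
proof -
  have "\<exists>G. openin (mtop X) G \<and> x \<in> G \<and> (\<exists>\<psi> g e R w. straight p G \<psi> g e R w)" if x: "x \<in> pts X" for x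
  proof -
    obtain U \<phi> v where "(U, \<phi>) \<in> atlas X" "x \<in> U" "cder p U \<phi> x v \<noteq> 0" using sub[OF x] by blast
    from straight_chart[OF p this] obtain G \<psi> g e R w where "x \<in> G" "straight p G \<psi> g e R w" by blast
    then show ?thesis using straightD(1) by metis
  qed
  then have "\<exists>\<epsilon>>0. push p \<epsilon> (\<lambda>x. 0) (\<lambda>x. 1)"
  proof (rule partition_of_unity)
    fix K :: "'x set" and G Z and \<rho> :: "'x \<Rightarrow> 'x \<Rightarrow> real"
    assume *: "finite K"
      "\<And>k. k \<in> K \<Longrightarrow> \<exists>\<psi> g e R w. straight p (G k) \<psi> g e R w"
      "\<And>k. k \<in> K \<Longrightarrow> smooth_map_on X (pts X) euclid (\<rho> k)"
      "\<And>k. k \<in> K \<Longrightarrow> closedin (mtop X) (Z k)" "\<And>k. k \<in> K \<Longrightarrow> Z k \<subseteq> G k"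
      "\<And>k y. k \<in> K \<Longrightarrow> y \<in> pts X \<Longrightarrow> y \<notin> Z k \<Longrightarrow> \<rho> k y = 0" and 1: "\<And>y. y \<in> pts X \<Longrightarrow> (\<Sum>k\<in>K. \<rho> k y) = 1"
    obtain \<epsilon> where \<epsilon>: "\<epsilon> > 0" "push p \<epsilon> (\<lambda>x. 0) (\<lambda>x. \<Sum>k\<in>K. \<rho> k x)" using push_sum[where K = K and G = G and Z = Z and \<rho> = \<rho> and p = p, OF *] by blast
    then obtain D E where D: "smooth_map_on (prod_mfd X (euclid :: (real, real) mfd)) (pts X \<times> {-\<epsilon><..<\<epsilon>}) X D"
     "smooth_map_on (prod_mfd X (euclid :: (real, real) mfd)) (pts X \<times> {-\<epsilon><..<\<epsilon>}) X E"
     "\<And>x s. x \<in> pts X \<Longrightarrow> s \<in> {-\<epsilon><..<\<epsilon>} \<Longrightarrow> E (D (x, s), s) = x \<and> D (E (x, s), s) = x \<and>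
        p (D (x, s)) * cis (- s * (\<Sum>k\<in>K. \<rho> k (D (x, s)))) = p x * cis (- s * 0)"
      unfolding push_def by blast
    have "p (D (x, s)) * cis (- s * 1) = p x * cis (- s * 0)" if "x \<in> pts X" "s \<in> {-\<epsilon><..<\<epsilon>}" for x s
      using D(3)[OF that] 1[of "D (x, s)"] smooth_map_on_image[OF D(1), of "(x, s)"] that by simp
    then have "push p \<epsilon> (\<lambda>x. 0) (\<lambda>x. 1)" unfolding push_def using D by blast
    then show ?thesis using \<epsilon>(1) by blast
  qed
  then obtain \<epsilon> D E where \<epsilon>: "\<epsilon> > 0" and D: "smooth_map_on (prod_mfd X (euclid :: (real, real) mfd)) (pts X \<times> {-\<epsilon><..<\<epsilon>}) X D"
     "smooth_map_on (prod_mfd X (euclid :: (real, real) mfd)) (pts X \<times> {-\<epsilon><..<\<epsilon>}) X E"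
     "\<And>x s. x \<in> pts X \<Longrightarrow> s \<in> {-\<epsilon><..<\<epsilon>} \<Longrightarrow> E (D (x, s), s) = x \<and> D (E (x, s), s) = x \<and>
        p (D (x, s)) * cis (- s * 1) = p x * cis (- s * 0)"
    unfolding push_def by blast
  have "p (D (x, s)) = p x * cis s" if "x \<in> pts X" "s \<in> {-\<epsilon><..<\<epsilon>}" for x s
  proof -
    have "p (D (x, s)) * cis (- s) * cis s = p x * cis s" using D(3)[OF that] by simp
    then show ?thesis by (simp add: mult.assoc cis_mult)
  qed
  then have "flow p \<epsilon> D E" using D unfolding flow_def by blast
  then have "\<exists>D E. flow p (2 ^ n * \<epsilon>) D E" for n
  proof (induction n)
    case (Suc n)
    then obtain D E where "flow p (2 ^ n * \<epsilon>) D E" by auto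
    from flow_double[OF this] show ?case by (auto simp: mult.assoc)
  qed auto
  moreover obtain n where n: "c / \<epsilon> < 2 ^ n" using real_arch_pow[of 2 "c / \<epsilon>"] by auto
  ultimately obtain D E where DE: "flow p (2 ^ n * \<epsilon>) D E" by blast
  have "c \<le> 2 ^ n * \<epsilon>" using n \<epsilon> by (simp add: field_simps)
  then have sub: "{-c<..<c} \<subseteq> {-(2 ^ n * \<epsilon>)<..<2 ^ n * \<epsilon>}" by auto
  then have "pts X \<times> {-c<..<c} \<subseteq> pts X \<times> {-(2 ^ n * \<epsilon>)<..<2 ^ n * \<epsilon>}" by blast
  from smooth_map_on_subset[OF _ this] DE sub have "flow p c D E" unfolding flow_def by blast
  then show thesis by (rule that)
qed

end

section \<open>Charts of the fiber and local triviality\<close>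

context cmfd
begin

text \<open>In a straightened chart the fiber consists of slices of parallel hyperplanes whose
  heights along \<open>e\<close> differ by multiples of \<open>2 * pi\<close>. The slice through
  \<open>x0\<close> is therefore open in the fiber, and the linear coordinates of its hyperplane
  form a chart.\<close>

lemma fiber_chart:
  fixes p :: "'x \<Rightarrow> complex"
  assumes st: "straight p G \<psi> g e R w" and dim: "DIM('e) = Suc DIM('d::euclidean_space)" and x0: "x0 \<in> G" "p x0 = 1"
  shows "\<exists>U \<phi>. (U, \<phi>) \<in> atlas (submfd X {x \<in> pts X. p x = 1} :: ('x, 'd) mfd) \<and> x0 \<in> U"
proof -
  note S = straightD[OF st]
  define c where "c = \<psi> x0 \<bullet> e"
  have wc: "w * cis c = 1" using S(8)[OF x0(1)] x0(2) by (simp add: c_def)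
  then have "w \<noteq> 0" by auto
  show ?thesis
  proof (rule hyperplane_split[OF S(3) dim])
    fix \<pi> :: "'e \<Rightarrow> 'd" and \<iota>
    assume *: "linear \<pi>" "linear \<iota>" "\<And>y. \<pi> (\<iota> y) = y" "\<And>z. \<iota> (\<pi> z) = z - (z \<bullet> e) *\<^sub>R e" "\<pi> e = 0" "\<And>y. \<iota> y \<bullet> e = 0"
    have ee: "e \<bullet> e = 1" using S(3) by (simp add: norm_eq_1)
    have bl: "bounded_linear \<pi>" "bounded_linear \<iota>" using *(1,2) by (simp_all add: linear_conv_bounded_linear)
    define F where "F = {x \<in> pts X. p x = 1}"
    define U where "U = {x \<in> G. \<psi> x \<bullet> e = c}"
    define \<phi> where "\<phi> x = \<pi> (\<psi> x)" for x
    define k where "k y = g (\<iota> y + c *\<^sub>R e)" for y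
    \<comment> \<open>The bound 1 is below \<open>pi\<close>, which excludes the other
      slices.\<close>
    have "U = F \<inter> {x \<in> G. \<psi> x \<in> {y. \<bar>y \<bullet> e - c\<bar> < 1}}"
    proof (intro equalityI subsetI)
      fix x assume "x \<in> U"
      then have "x \<in> G" "\<psi> x \<bullet> e = c" by (auto simp: U_def)
      then show "x \<in> F \<inter> {x \<in> G. \<psi> x \<in> {y. \<bar>y \<bullet> e - c\<bar> < 1}}" using S(8,11) wc by (auto simp: F_def)
    next
      fix x assume "x \<in> F \<inter> {x \<in> G. \<psi> x \<in> {y. \<bar>y \<bullet> e - c\<bar> < 1}}"
      then have x: "x \<in> G" "\<bar>\<psi> x \<bullet> e - c\<bar> < 1" "p x = 1" by (auto simp: F_def)
      have "w * cis (\<psi> x \<bullet> e) = w * cis c" using S(8)[OF x(1)] x(3) wc by simp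
      then have "cis (\<psi> x \<bullet> e) = cis c" using \<open>w \<noteq> 0\<close> by simp
      moreover have "cis (\<psi> x \<bullet> e - c) = cis (\<psi> x \<bullet> e) / cis c" by (simp add: cis_divide)
      ultimately have "cis (\<psi> x \<bullet> e - c) = 1" by simp
      moreover have "Im (Ln (cis (\<psi> x \<bullet> e - c))) = \<psi> x \<bullet> e - c" by (rule Im_Ln_cis) (use x(2) pi_gt3 in linarith)
      ultimately have "\<psi> x \<bullet> e - c = 0" by simp
      then show "x \<in> U" using x(1) by (simp add: U_def)
    qed
    moreover have "openin (mtop X) {x \<in> G. \<psi> x \<in> {y. \<bar>y \<bullet> e - c\<bar> < 1}}"
      by (rule straight_open[OF st]) (intro open_Collect_less continuous_intros)
    ultimately have oU: "openin (subtopology (mtop X) F) U"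
      unfolding openin_subtopology by blast
    have kU: "k y \<in> U" "\<phi> (k y) = y" if "norm (\<iota> y + c *\<^sub>R e) < R" for y
      using S(9,10)[OF that] by (auto simp: U_def k_def \<phi>_def inner_add_left ee *(3,5,6) linear_add[OF *(1)] linear_scale[OF *(1)])
    have \<phi>U: "\<iota> (\<phi> x) + c *\<^sub>R e = \<psi> x" if "x \<in> U" for x using that by (simp add: U_def \<phi>_def *(4))
    have im: "\<phi> ` U = {y. norm (\<iota> y + c *\<^sub>R e) < R}"
    proof (intro equalityI subsetI)
      fix y assume "y \<in> \<phi> ` U"
      then show "y \<in> {y. norm (\<iota> y + c *\<^sub>R e) < R}" using \<phi>U S(6) by (auto simp: U_def)
    next
      fix y assume "y \<in> {y. norm (\<iota> y + c *\<^sub>R e) < R}"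
      then show "y \<in> \<phi> ` U" using kU[of y] by force
    qed
    have oim: "open (\<phi> ` U)"
      unfolding im by (intro open_Collect_less continuous_intros linear_continuous_on[OF bl(2)])
    have "(U, \<phi>) \<in> atlas (submfd X F)"
    proof (rule premfd_open_chart[OF oU oim])
      show "smooth_map_on X U euclid \<phi>" unfolding \<phi>_def
        by (rule smooth_map_on_csmooth[OF smooth_map_on_subset[OF S(4)] csmooth_linear[OF bl(1) open_UNIV] open_UNIV _ pX])
           (auto simp: U_def)
      have "csmooth (\<phi> ` U) (\<lambda>y. \<iota> y + c *\<^sub>R e)"
        by (rule csmooth_add[OF oim csmooth_linear[OF bl(2) oim] csmooth_const[OF oim]])
      then have "smooth_map_on euclid (\<phi> ` U) euclid (\<lambda>y. \<iota> y + c *\<^sub>R e)"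
        by (simp add: smooth_map_on_euclid smooth_on_open[OF oim])
      then show "smooth_map_on euclid (\<phi> ` U) X k" unfolding k_def
        by (rule smooth_map_on_compose[OF _ S(5) _ premfd_euclid premfd_euclid]) (simp add: im)
      show "k (\<phi> x) = x" if "x \<in> U" for x using \<phi>U[OF that] S(7) that by (simp add: k_def U_def)
    qed
    moreover have "x0 \<in> U" using x0 by (simp add: U_def c_def)
    ultimately show ?thesis unfolding F_def by blast
  qed
qed

text \<open>Over an open half-circle there is a smooth branch of the argument. Turning each point
  back by the argument of its value moves it into the fiber over 1, and turning forward again is the
  inverse, so the lifted rotation gives the local trivializations.\<close>

theorem submersion_fiber_bundle:
  fixes p :: "'x \<Rightarrow> complex"
  assumes p: "smooth_map_on X (pts X) euclid p" "\<And>x. x \<in> pts X \<Longrightarrow> norm (p x) = 1"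
    and sub: "\<And>x. x \<in> pts X \<Longrightarrow> \<exists>U \<phi> v. (U, \<phi>) \<in> atlas X \<and> x \<in> U \<and> cder p U \<phi> x v \<noteq> 0"
    and ne: "pts X \<noteq> {}" and dim: "DIM('e) = Suc DIM('d::euclidean_space)"
  shows "smooth_fiber_bundle X circle (submfd X {x \<in> pts X. p x = 1} :: ('x, 'd) mfd) p"
proof -
  let ?F = "submfd X {x \<in> pts X. p x = 1} :: ('x, 'd) mfd"
  let ?P = "prod_mfd X (euclid :: (real, real) mfd)"
  have cover: "\<exists>U \<phi>. (U, \<phi>) \<in> atlas ?F \<and> x \<in> U" if "x \<in> {x \<in> pts X. p x = 1}" for x
  proof -
    have x: "x \<in> pts X" "p x = 1" using that by auto
    obtain U \<phi> v where U: "(U, \<phi>) \<in> atlas X" "x \<in> U" "cder p U \<phi> x v \<noteq> 0" using sub[OF x(1)] by blast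
    obtain G \<psi> g e R w where G: "x \<in> G" "straight p G \<psi> g e R w" using straight_chart[OF p U] by blast
    show ?thesis by (rule fiber_chart[OF G(2) dim G(1) x(2)])
  qed
  have pF: "premfd ?F" by (rule premfd_submfd[OF pX cover])
  have ptsF: "pts ?F = {x \<in> pts X. p x = 1}" by auto
  have "Hausdorff_space (mtop ?F)" "second_countable (mtop ?F)"
    using smooth_X by (simp_all add: smooth_mfd_def Hausdorff_space_subtopology second_countable_subtopology)
  then have mF: "smooth_mfd ?F"
    using pF unfolding smooth_mfd_def premfd_def by (auto simp: submfd_atlas)
  have pc: "smooth_map_on X (pts X) circle p" unfolding smooth_map_on_circle[OF pX] using p by blast
  \<comment> \<open>Times of size below \<open>3 * pi / 2\<close> occur, an argument of size at most
    \<open>pi\<close> plus an angle below \<open>pi / 2\<close>; the number 7 exceeds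
    \<open>2 * pi\<close> and so leaves ample room.\<close>
  obtain D E where fl: "flow p 7 D E" using flow_exists[OF p sub] by blast
  have D: "smooth_map_on ?P (pts X \<times> {-7<..<7}) X D" "smooth_map_on ?P (pts X \<times> {-7<..<7}) X E"
     "\<And>x s. x \<in> pts X \<Longrightarrow> s \<in> {-7<..<7} \<Longrightarrow> E (D (x, s), s) = x"
     "\<And>x s. x \<in> pts X \<Longrightarrow> s \<in> {-7<..<7} \<Longrightarrow> D (E (x, s), s) = x"
     "\<And>x s. x \<in> pts X \<Longrightarrow> s \<in> {-7<..<7} \<Longrightarrow> p (D (x, s)) = p x * cis s"
    using fl unfolding flow_def by blast+
  have m: "D (x, s) \<in> pts X" "E (x, s) \<in> pts X" if "x \<in> pts X" "s \<in> {-7<..<7}" for x s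
    using that smooth_map_on_image[OF D(1), of "(x, s)"] smooth_map_on_image[OF D(2), of "(x, s)"] by auto
  have pE: "p (E (x, s)) * cis s = p x" if "x \<in> pts X" "s \<in> {-7<..<7}" for x s
    using D(4)[OF that] D(5)[OF m(2)[OF that] that(2)] by simp
  have arg: "\<exists>\<beta>. \<bar>\<beta>\<bar> \<le> pi \<and> b = cis \<beta>" if "norm b = 1" for b
  proof -
    have "b \<noteq> 0" using that by auto
    then show ?thesis using cis_Im_Ln[OF that] mpi_less_Im_Ln[of b] Im_Ln_le_pi[of b] by (intro exI[of _ "Im (Ln b)"]) (auto simp: abs_le_iff)
  qed
  have p7: "2 * pi < 7" using pi_less_4 pi_approx by simp
  show ?thesis unfolding smooth_fiber_bundle_def
  proof (intro conjI ballI mF pc)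
    \<comment> \<open>The lifted rotation carries the value of \<open>p\<close> at one point of
      \<open>X\<close> to any other value on the circle.\<close>
    show "p ` pts X = pts circle"
    proof (intro equalityI subsetI)
      fix b assume "b \<in> pts circle"
      then have b: "norm b = 1" by simp
      obtain x where x: "x \<in> pts X" using ne by blast
      have "norm (b * cnj (p x)) = 1" using b p(2)[OF x] by (simp add: norm_mult)
      then obtain \<beta> where \<beta>: "\<bar>\<beta>\<bar> \<le> pi" "b * cnj (p x) = cis \<beta>" using arg by blast
      have "\<beta> \<in> {-7<..<7}" using \<beta>(1) p7 pi_gt_zero by auto
      then have "p (D (x, \<beta>)) = b" "D (x, \<beta>) \<in> pts X"
        using D(5)[OF x] m(1)[OF x] unit_cancel(1)[OF p(2)[OF x], of b] by (auto simp: \<beta>(2)[symmetric])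
      then show "b \<in> p ` pts X" by blast
    qed (use p(2) in auto)
    fix b assume "b \<in> pts circle"
    then have b: "norm b = 1" by simp
    obtain \<beta> where \<beta>: "\<bar>\<beta>\<bar> \<le> pi" "b = cis \<beta>" using arg[OF b] by blast
    define V where "V = {z. Re (z * cnj b) > 0}"
    define U where "U = sphere 0 1 \<inter> V"
    define s where "s c = \<beta> + angle_from b c" for c
    have oV: "open V" unfolding V_def by (rule open_Re_pos[OF b])
    have s7: "s c \<in> {-7<..<7}" if "c \<in> V" for c
    proof -
      have "\<bar>angle_from b c\<bar> < pi / 2" by (rule angle_from_bound[OF b]) (use that in \<open>simp only: V_def mem_Collect_eq\<close>)
      then show ?thesis using \<beta>(1) p7 pi_gt_zero by (auto simp: s_def)
    qed
    have cs: "cis (s c) = c" if "c \<in> U" for c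
      using cis_angle_from[OF b, of c] that by (simp add: s_def U_def cis_mult[symmetric] \<beta>(2)[symmetric])
    have ss: "csmooth V s" unfolding s_def V_def
      by (intro csmooth_add csmooth_const csmooth_angle_from b open_Re_pos)
    \<comment> \<open>For \<open>p x\<close> in \<open>U\<close> the number \<open>s (p x)\<close>
      is an argument of \<open>p x\<close>, so turning back by it leads to the fiber over 1.\<close>
    define \<Psi> where "\<Psi> x = (p x, E (x, s (p x)))" for x
    define \<Phi> where "\<Phi> z = D (snd z, s (fst z))" for z
    let ?A = "{x \<in> pts X. p x \<in> U}"
    have pA: "smooth_map_on X ?A euclid p" by (rule smooth_map_on_subset[OF p(1)]) auto
    have "smooth_map_on X ?A X (\<lambda>x. E (x, s (p x)))"
      by (rule smooth_map_on_compose[OF smooth_map_on_Pair[OF smooth_map_on_id[OF pX]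
              smooth_map_on_csmooth[OF pA ss oV _ pX]] D(2) _ pX pXr])
         (use s7 U_def in blast)+
    then have sE: "smooth_map_on X ?A ?F (\<lambda>x. E (x, s (p x)))"
    proof (rule smooth_map_on_submfd_cod[OF _ _ pX pX])
      fix x assume x: "x \<in> ?A"
      then have "s (p x) \<in> {-7<..<7}" using s7 by (auto simp: U_def)
      then have "p (E (x, s (p x))) * p x = 1 * p x" "E (x, s (p x)) \<in> pts X"
        using pE m(2) cs x by force+
      moreover have "p x \<noteq> 0" using p(2) x by force
      ultimately show "E (x, s (p x)) \<in> {x \<in> pts X. p x = 1}" by simp
    qed
    have S\<Psi>: "smooth_map_on X ?A (prod_mfd circle ?F) \<Psi>" unfolding \<Psi>_def
      by (rule smooth_map_on_Pair[OF smooth_map_on_subset[OF pc] sE]) auto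
    let ?Q = "prod_mfd circle ?F"
    have pQ: "premfd ?Q" by (rule premfd_prod[OF premfd_circle pF])
    have B: "U \<times> pts ?F \<subseteq> pts circle \<times> pts ?F" by (auto simp: U_def)
    note fs = smooth_map_on_fst_snd[OF premfd_circle pF B]
    have f1: "smooth_map_on ?Q (U \<times> pts ?F) euclid fst" using fs(1) unfolding smooth_map_on_circle[OF pQ] by blast
    have f2: "smooth_map_on ?Q (U \<times> pts ?F) X snd"
      by (rule smooth_map_on_compose[OF fs(2) smooth_map_on_submfd_dom[OF smooth_map_on_id[OF pX, of "{x \<in> pts X. p x = 1}"] order_refl pX] _ pQ pF])
         auto
    have S\<Phi>: "smooth_map_on ?Q (U \<times> pts ?F) X \<Phi>" unfolding \<Phi>_def
      by (rule smooth_map_on_compose[OF smooth_map_on_Pair[OF f2 smooth_map_on_csmooth[OF f1 ss oV _ pQ]] D(1) _ pQ pXr])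
         (use s7 in \<open>auto simp: U_def\<close>)
    have "diffeo_on X ?A ?Q (U \<times> pts ?F) \<Psi>"
    proof (rule diffeo_onI[OF S\<Psi> S\<Phi> pQ])
      show "\<Psi> x \<in> U \<times> pts ?F" if "x \<in> ?A" for x
        using that smooth_map_on_image[OF sE that] by (simp add: \<Psi>_def)
      show "\<Phi> (\<Psi> x) = x" if "x \<in> ?A" for x
        using that D(4)[of x "s (p x)"] s7[of "p x"] by (simp add: \<Psi>_def \<Phi>_def U_def)
      fix z assume "z \<in> U \<times> pts ?F"
      then obtain c y where z: "z = (c, y)" "c \<in> U" "y \<in> pts X" "p y = 1" by auto
      have sc: "s c \<in> {-7<..<7}" using s7 z(2) by (auto simp: U_def)
      have pD: "p (\<Phi> z) = c" using D(5)[OF z(3) sc] cs[OF z(2)] z(4) by (simp add: \<Phi>_def z(1))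
      show "\<Phi> z \<in> ?A" using pD z(2) m(1)[OF z(3) sc] by (simp add: \<Phi>_def z(1))
      show "\<Psi> (\<Phi> z) = z" unfolding \<Psi>_def pD using D(3)[OF z(3) sc] by (simp add: \<Phi>_def z(1))
    qed
    moreover have "openin (mtop circle) U" using oV by (auto simp: U_def openin_open)
    moreover have "b \<in> U"
    proof -
      have "Re (b * cnj b) > 0" using b by (simp add: complex_mult_cnj cmod_def power2_eq_square)
      then show ?thesis using b by (simp only: U_def V_def) simp
    qed
    moreover have "fst (\<Psi> x) = p x" for x by (simp add: \<Psi>_def)
    ultimately show "\<exists>U \<Psi>. openin (mtop circle) U \<and> b \<in> U \<and>
        diffeo_on X {x \<in> pts X. p x \<in> U} ?Q (U \<times> pts ?F) \<Psi> \<and> (\<forall>x\<in>pts X. p x \<in> U \<longrightarrow> fst (\<Psi> x) = p x)"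
      by blast
  qed
qed

end

theorem theorem3p2:
  fixes Y1 :: "('a, real^3) mfd" and Y2 :: "('b, real^3) mfd"
    and K1 N1 F1 :: "'a set" and K2 N2 F2 :: "'b set"
    and \<phi>1 :: "'a \<Rightarrow> 'a" and \<phi>2 :: "'b \<Rightarrow> 'b"
    and W1 :: "(complex \<times> 'a, real \<times> (real^3)) mfd"
    and W2 :: "(complex \<times> 'b, real \<times> (real^3)) mfd"
    and f :: "complex \<times> 'b \<Rightarrow> complex \<times> 'a"
    and X :: "('x, real^4) mfd"
    and j1 :: "complex \<times> 'a \<Rightarrow> 'x" and j2 :: "complex \<times> 'b \<Rightarrow> 'x"
  assumes "closed_mfd Y1" "connected_space (mtop Y1)" "orientable Y1"
    and "closed_mfd Y2" "connected_space (mtop Y2)" "orientable Y2"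
    and "fibered_knot Y1 K1 N1 F1 \<phi>1"
    and "fibered_knot Y2 K2 N2 F2 \<phi>2"
    and "W1 = prod_mfd circle (exterior Y1 N1)"
    and "W2 = prod_mfd circle (exterior Y2 N2)"
    and "diffeo_on W2 (bd W2) W1 (bd W1) f"
    and "boundary_gluing W1 W2 f X j1 j2"
  shows "fibers_over_circle X"
proof -
  obtain P1 where P1: "piece W1 fst P1" using fibered_knot_piece[OF assms(1,7)] assms(9) by blast
  obtain P2 where P2: "piece W2 fst P2" using fibered_knot_piece[OF assms(4,8)] assms(10) by blast
  have "DIM(real \<times> (real^3)) = DIM(real^4)" by simp
  from gluing_submersion[OF P1 P2 this assms(11,12)]
  obtain p :: "'x \<Rightarrow> complex" where p: "cmfd X" "pts X \<noteq> {}" "smooth_map_on X (pts X) euclid p" "\<And>x. x \<in> pts X \<Longrightarrow> norm (p x) = 1"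
    "\<And>x. x \<in> pts X \<Longrightarrow> \<exists>U \<phi> v. (U, \<phi>) \<in> atlas X \<and> x \<in> U \<and> cmfd.cder p U \<phi> x v \<noteq> 0"
    by metis
  have "smooth_fiber_bundle X circle (submfd X {x \<in> pts X. p x = 1} :: ('x, real^3) mfd) p"
    by (rule cmfd.submersion_fiber_bundle[OF p(1,3,4,5,2)]) simp_all
  then show ?thesis unfolding fibers_over_circle_def by blast
qed

end
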